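(* Let $d=2$ and $\lambda\in\{-1,1\}$. There exists $\varepsilon_0>0$ such that, given $\mu_\infty\in W^{2,\infty}(\mathbb{R}^2_x\times\mathbb{R}^2_v)$ and $E_\infty=E[\mu_\infty]\in W^{3,\infty}(\mathbb{R}^2)$ satisfying $$\|\langle v\rangle\mu_\infty\|_{L^2_{x,v}}+\|\langle v\rangle^4\mu_\infty\|_{L^\infty_{x,v}}+\|\langle v\rangle\nabla_{x,v}\mu_\infty\|_{L^\infty_{x,v}}+\|\langle v\rangle^2\nabla^2_{x,v}\mu_\infty\|_{L^\infty_{x,v}}+\|E_\infty\|_{W^{3,\infty}}\le\varepsilon_0,$$ there exists a unique global strong solution $\mu$ of $$\partial_t\mu+v\cdot\nabla_x\mu+x\cdot\nabla_v\mu+\lambda E[\mu]\cdot\nabla_v\mu=0$$ such that $$\mu\big(t,\mathcal{X}(t,x-v,v),\mathcal{V}(t,x-v,v)\big)\to\mu_\infty(x,v)\quad\text{as }t\to\infty,$$ locally uniformly in $(x,v)$, where $$\mathcal{X}(t,x,v)=x\cosh t+v\sinh t-\lambda te^{-t}E_\infty(x+v),\qquad \mathcal{V}(t,x,v)=v\cosh t+x\sinh t+\lambda te^{-t}E_\infty(x+v).$$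
   Context: $\langle y\rangle=(1+|y|^2)^{1/2}$. For $g:\mathbb{R}^2_x\times\mathbb{R}^2_v\to\mathbb{R}$ the electric field generated by $g$ is $$E[g](x)=\frac1{2\pi}\iint_{\mathbb{R}^2_y\times\mathbb{R}^2_v}\frac{x-y}{|x-y|^2}\,g^2(y,v)\,dy\,dv,$$ and for a time-dependent $\mu(t,x,v)$, $E[\mu](t,x)=E[\mu(t,\cdot,\cdot)](x)$. The equation is the Vlasov--Poisson system with repulsive harmonic potential $-|x|^2/2$ written for $\mu$, where the particle distribution function is $\mu^2$.
   Formalization: Existence and uniqueness are in the class where μ(t,𝒳(t,x−v,v),𝒱(t,x−v,v)) stays bounded for t≥0 in the ⟨v⟩-weighted L² and ⟨v⟩⁴-weighted L^∞ norms; with no such class uniqueness fails, e.g. for μ_∞=0. *)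

theory Defs
  imports "HOL-Analysis.Analysis" "HOL-Probability.Essential_Supremum"
begin

type_synonym plane = "real ^ 2"

definition jbracket :: "'a::real_normed_vector \<Rightarrow> real" where
  "jbracket y = sqrt (1 + (norm y)\<^sup>2)"

section \<open>Weak derivatives and the spaces \<open>W\<^sup>k\<^sup>,\<^sup>\<infinity>\<close>\<close>

fun cont_diff :: "nat \<Rightarrow> ('a::euclidean_space \<Rightarrow> real) \<Rightarrow> bool" where
  "cont_diff 0 \<phi> \<longleftrightarrow> continuous_on UNIV \<phi>"
| "cont_diff (Suc k) \<phi> \<longleftrightarrow> \<phi> differentiable_on UNIV \<and>
     (\<forall>b\<in>Basis. cont_diff k (\<lambda>x. frechet_derivative \<phi> (at x) b))"

definition test_function :: "('a::euclidean_space \<Rightarrow> real) \<Rightarrow> bool" where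
  "test_function \<phi> \<longleftrightarrow> (\<forall>k. cont_diff k \<phi>) \<and> compact (closure {x. \<phi> x \<noteq> 0})"

definition locally_integrable :: "('a::euclidean_space \<Rightarrow> 'b::euclidean_space) \<Rightarrow> bool" where
  "locally_integrable f \<longleftrightarrow>
     f \<in> borel_measurable lborel \<and> (\<forall>K. compact K \<longrightarrow> set_integrable lborel K f)"

definition has_weak_deriv ::
  "('a::euclidean_space \<Rightarrow> 'b::euclidean_space) \<Rightarrow> 'a \<Rightarrow> ('a \<Rightarrow> 'b) \<Rightarrow> bool" where
  "has_weak_deriv f b g \<longleftrightarrow> locally_integrable f \<and> locally_integrable g \<and>
     (\<forall>\<phi>. test_function \<phi> \<longrightarrow>
        (\<integral>x. frechet_derivative \<phi> (at x) b *\<^sub>R f x \<partial>lborel) = - (\<integral>x. \<phi> x *\<^sub>R g x \<partial>lborel))"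

text \<open>Iterated weak partial derivatives along a list of coordinate directions. A weak derivative
  is determined only almost everywhere; one representative is chosen, and everything below depends
  only on its class. The value is meaningful only when the weak derivative exists, which is
  part of membership in \<open>W_inf\<close>.\<close>

fun weak_deriv :: "'a list \<Rightarrow> ('a::euclidean_space \<Rightarrow> 'b::euclidean_space) \<Rightarrow> 'a \<Rightarrow> 'b" where
  "weak_deriv [] f = f"
| "weak_deriv (b # bs) f = (SOME g. has_weak_deriv (weak_deriv bs f) b g)"

text \<open>Euclidean (Frobenius) norm \<open>|\<nabla>\<^sup>k f(x)|\<close> of the tensor of weak derivatives of order \<open>k\<close>.\<close>

definition grad_norm :: "nat \<Rightarrow> ('a::euclidean_space \<Rightarrow> 'b::euclidean_space) \<Rightarrow> 'a \<Rightarrow> real" where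
  "grad_norm k f x =
     sqrt (\<Sum>bs \<in> {bs. set bs \<subseteq> Basis \<and> length bs = k}. (norm (weak_deriv bs f x))\<^sup>2)"

text \<open>Norms take the value \<open>\<infinity>\<close> on functions outside the space (non-measurable ones included),
  so an upper bound by a real number contains membership.\<close>

definition Linf_norm :: "('a::euclidean_space \<Rightarrow> real) \<Rightarrow> ereal" where
  "Linf_norm f = esssup lborel (\<lambda>x. ereal \<bar>f x\<bar>)"

definition L2_norm :: "('a::euclidean_space \<Rightarrow> real) \<Rightarrow> ereal" where
  "L2_norm f =
     (if f \<in> borel_measurable lborel \<and> integrable lborel (\<lambda>x. (f x)\<^sup>2)
      then ereal (sqrt (\<integral>x. (f x)\<^sup>2 \<partial>lborel)) else \<infinity>)"

definition W_inf :: "nat \<Rightarrow> ('a::euclidean_space \<Rightarrow> 'b::euclidean_space) \<Rightarrow> bool" where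
  "W_inf k f \<longleftrightarrow> f \<in> borel_measurable lborel \<and>
     (\<forall>b bs. set (b # bs) \<subseteq> Basis \<and> length (b # bs) \<le> k \<longrightarrow>
        has_weak_deriv (weak_deriv bs f) b (weak_deriv (b # bs) f)) \<and>
     (\<forall>j\<le>k. Linf_norm (grad_norm j f) < \<infinity>)"

definition W_inf_norm :: "nat \<Rightarrow> ('a::euclidean_space \<Rightarrow> 'b::euclidean_space) \<Rightarrow> ereal" where
  "W_inf_norm k f = (\<Sum>j\<le>k. Linf_norm (grad_norm j f))"

section \<open>The Vlasov--Poisson system with repulsive harmonic potential\<close>

text \<open>Phase space is \<open>plane \<times> plane\<close>, with points \<open>(x, v)\<close>.\<close>

definition efield_kernel :: "(plane \<times> plane \<Rightarrow> real) \<Rightarrow> plane \<Rightarrow> plane \<times> plane \<Rightarrow> plane" where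
  "efield_kernel g x = (\<lambda>(y, v). ((g (y, v))\<^sup>2 / (norm (x - y))\<^sup>2) *\<^sub>R (x - y))"

definition efield :: "(plane \<times> plane \<Rightarrow> real) \<Rightarrow> plane \<Rightarrow> plane" where
  "efield g x = (1 / (2 * pi)) *\<^sub>R (\<integral>p. efield_kernel g x p \<partial>lborel)"

text \<open>A global strong solution is defined for \<open>t \<ge> 0\<close>, locally Lipschitz in \<open>(t, x, v)\<close> (that is,
  locally in \<open>W\<^sup>1\<^sup>,\<^sup>\<infinity>\<close>), of finite mass \<open>\<integral>\<integral>\<mu>\<^sup>2\<close> and with a well-defined electric field at
  each time, and satisfies the equation almost everywhere. In the last clause \<open>D\<close> is the total derivative
  of \<open>\<mu>\<close>, so its four terms are \<open>\<partial>\<^sub>t \<mu>\<close>, \<open>v \<cdot> \<nabla>\<^sub>x \<mu>\<close>, \<open>x \<cdot> \<nabla>\<^sub>v \<mu>\<close> and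
  \<open>\<lambda> E[\<mu>] \<cdot> \<nabla>\<^sub>v \<mu>\<close>. Integrability is required explicitly because the integral of a
  non-integrable function is \<open>0\<close> by convention.\<close>

definition global_strong_solution :: "real \<Rightarrow> (real \<Rightarrow> plane \<times> plane \<Rightarrow> real) \<Rightarrow> bool" where
  "global_strong_solution lam \<mu> \<longleftrightarrow>
     (\<forall>K. compact K \<and> K \<subseteq> {0..} \<times> UNIV \<longrightarrow> (\<exists>L. L-lipschitz_on K (\<lambda>(t, p). \<mu> t p))) \<and>
     (\<forall>t\<ge>0. integrable lborel (\<lambda>p. (\<mu> t p)\<^sup>2)) \<and>
     (\<forall>t\<ge>0. \<forall>x. integrable lborel (efield_kernel (\<mu> t) x)) \<and>
     (AE q in lborel. case q of (t, x, v) \<Rightarrow> t > 0 \<longrightarrow>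
        (\<exists>D. ((\<lambda>(t, p). \<mu> t p) has_derivative D) (at (t, x, v)) \<and>
           D (1, 0, 0) + D (0, v, 0) + D (0, 0, x) + lam * D (0, 0, efield (\<mu> t) x) = 0))"

definition curve_X :: "real \<Rightarrow> (plane \<Rightarrow> plane) \<Rightarrow> real \<Rightarrow> plane \<Rightarrow> plane \<Rightarrow> plane" where
  "curve_X lam Einf t x v =
     cosh t *\<^sub>R x + sinh t *\<^sub>R v - (lam * t * exp (- t)) *\<^sub>R Einf (x + v)"

definition curve_V :: "real \<Rightarrow> (plane \<Rightarrow> plane) \<Rightarrow> real \<Rightarrow> plane \<Rightarrow> plane \<Rightarrow> plane" where
  "curve_V lam Einf t x v =
     cosh t *\<^sub>R v + sinh t *\<^sub>R x + (lam * t * exp (- t)) *\<^sub>R Einf (x + v)"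

definition profile ::
  "real \<Rightarrow> (plane \<Rightarrow> plane) \<Rightarrow> (real \<Rightarrow> plane \<times> plane \<Rightarrow> real) \<Rightarrow> real \<Rightarrow> plane \<times> plane \<Rightarrow> real" where
  "profile lam Einf \<mu> t =
     (\<lambda>(x, v). \<mu> t (curve_X lam Einf t (x - v) v, curve_V lam Einf t (x - v) v))"

text \<open>The class in which solutions are sought, and in which uniqueness is asserted: the profile stays,
  uniformly in time, in the two weighted spaces (of order zero) that contain the asymptotic state.
  Uniqueness needs such a condition, because locally uniform convergence alone does not
  prevent mass of the profile from escaping to \<open>|v| = \<infinity>\<close>. For instance, let \<open>\<eta> \<noteq> 0\<close> be small,
  smooth and compactly supported, with \<open>\<integral>\<eta>\<^sup>2 dv\<close> radial in \<open>x\<close> and \<open>\<eta> = 0\<close> wherever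
  \<open>E[\<eta>] = 0\<close>. The solution scattering to \<open>\<eta>\<close> along the curves built from \<open>E[\<eta>]\<close> tends to \<open>0\<close>
  locally uniformly along the curves built from \<open>Einf = 0\<close>, its profile being asymptotic to
  \<open>\<eta>(x, v - \<lambda> t E[\<eta>](x))\<close>; but so does the zero solution.
  Nothing is assumed on the size of the constant \<open>C\<close>.\<close>

definition bounded_profile :: "real \<Rightarrow> (plane \<Rightarrow> plane) \<Rightarrow> (real \<Rightarrow> plane \<times> plane \<Rightarrow> real) \<Rightarrow> bool" where
  "bounded_profile lam Einf \<mu> \<longleftrightarrow>
     (\<exists>C::real. \<forall>t\<ge>0.
        L2_norm (\<lambda>(x, v). jbracket v * profile lam Einf \<mu> t (x, v)) \<le> ereal C \<and>
        Linf_norm (\<lambda>(x, v). jbracket v ^ 4 * profile lam Einf \<mu> t (x, v)) \<le> ereal C)"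

definition scatters_to ::
  "real \<Rightarrow> (plane \<Rightarrow> plane) \<Rightarrow> (real \<Rightarrow> plane \<times> plane \<Rightarrow> real) \<Rightarrow> (plane \<times> plane \<Rightarrow> real) \<Rightarrow> bool" where
  "scatters_to lam Einf \<mu> \<mu>inf \<longleftrightarrow>
     (\<forall>K. compact K \<longrightarrow> uniform_limit K (profile lam Einf \<mu>) \<mu>inf at_top)"

end

theory Submission
  imports Defs
begin

text \<open>
In the coordinates \<open>a = exp (-t) (X + V)\<close>, \<open>c = cosh t V - sinh t X\<close> free transport is trivial, and
with \<open>X / cosh t = a - kap t c\<close>, \<open>kap t = 1 - tanh t\<close>, the characteristics become
\<open>a' = lam kap F(t, a - kap c)\<close>, \<open>c' = lam F(t, a - kap c)\<close>, where \<open>F\<close> is the rescaled self-consistent field.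
Prescribing \<open>mu\<close> along \<open>c = v + lam t E(a)\<close> at infinity is a final value problem: for a field tending
to \<open>E\<close> like \<open>exp (-t/2)\<close>, the flow from infinity gives the solution \<open>mu o Phi\<close>, and the weights in the
velocity absorb the growth of \<open>Phi\<close>.

One Euler step of the characteristics is a composition of shears, hence preserves Lebesgue measure
exactly; transport estimates follow from it by Fatou's lemma. The difference of two fields is
split at radius \<open>exp (-t/2)\<close>: near the singularity by comparing the densities pointwise, away from
it by transporting the truncated kernel as a test function. This bounds the difference at time \<open>t\<close>
by \<open>C exp (-t/2)\<close> times its integral over \<open>[t, \<infinity>)\<close>, so the fixed point map is a contraction in a
weighted space, and iterating the bound, with constants \<open>C^n / n!\<close>, yields uniqueness.

The profile is only Lipschitz; Rademacher's theorem provides total derivatives almost everywhere,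
and mollification turns the weak derivative bounds into Lipschitz bounds.
\<close>

text \<open>Uniqueness is claimed in a class that controls no derivative of the competitor uniformly
  in time and allows constants of any size. Its field comes with a bound but with no Lipschitz
  estimate, hence with no flow; so a competitor enters only through first order statements along
  Euler steps, and all differentiation falls on the constructed solution or on test functions pulled
  back by its flow. The radius exp (-t/2) balances the two parts of the field difference: the near
  part costs the radius itself, the far part \<open>kap t\<close> divided by its square, because a
  late kick of the characteristics moves positions at time t only by O(kap t). Lipschitz bounds of
  the flow from infinity may lose one power of the velocity, the power carried by the weight of the
  gradient. The loss comes from a rate e min (kap t |v|, 1), whose time integral is of order e log
  (1 + |v|); for small e its exponential is at most of order 1 + |v|. The threshold 10^-9 absorbs
  numerical constants, and the strongest demand on it comes from the contraction.\<close>

type_synonym phase = "plane * plane"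

notation scaleR (infixr "*R" 75)

abbreviation lims (infixr "--->" 60) where "X ---> L == X \<longlonglongrightarrow> L"

abbreviation "bmeas == borel_measurable borel"

abbreviation nn_lborel (binder "NN " 10) where "nn_lborel f == integral\<^sup>N lborel f"

abbreviation evs (binder "EV " 10) where "evs P == eventually P sequentially"

section \<open>Rademacher's theorem\<close>

text \<open>A non-integrable \<open>f\<close> has integral 0 by convention, and \<open>g\<close>
  dominates a norm, so the bound survives and callers need not check integrability of
  \<open>f\<close>.\<close>

lemma norm_integral_le_integral:
 fixes f :: "'a => 'b::{banach, second_countable_topology}"
 assumes g: "integrable M g" and le: "AE x in M. norm (f x) <= g x"
 shows "norm (\<integral>x. f x \<partial>M) <= (\<integral>x. g x \<partial>M)"
proof (cases "integrable M f")
 case True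
 have "norm (\<integral>x. f x \<partial>M) <= (\<integral>x. norm (f x) \<partial>M)" by (rule integral_norm_bound)
 also have "... <= (\<integral>x. g x \<partial>M)" using True g le by (intro integral_mono_AE) auto
 finally show ?thesis .
next
 case False
 have "AE x in M. 0 <= g x" using le by eventually_elim (meson norm_ge_zero order_trans)
 then show ?thesis using False by (simp add: not_integrable_integral_eq integral_nonneg_AE)
qed

lemma integrable_indicator_cball:
 "integrable lborel (%x::'a::euclidean_space. c * indicator (cball 0 r) x :: real)"
 using emeasure_bounded_finite[OF bounded_cball, of "0::'a" r]
 by (intro integrable_mult_right integrable_real_indicator) auto

text \<open>Adding \<open>2 * c * x\<close> makes \<open>f\<close> strictly increasing and
  bi-Lipschitz. The image of Lebesgue measure under the inverse of the sum gives a set the length of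
  its image, so it is absolutely continuous; its Radon-Nikodym density minus \<open>2 * c\<close> is
  the density of \<open>f\<close>. Lebesgue differentiation identifies that density with the limit
  of the difference quotients.\<close>

lemma lipschitz_real_density:
 fixes f :: "real => real"
 assumes lip: "!!x y. abs (f x - f y) <= L * abs (x - y)"
 obtains w where "!!a b. a <= b ==> (w has_integral f b - f a) {a..b}"
  "AE x in lborel. (%n. (f (x + 1 / Suc n) - f x) * Suc n) ---> w x"
proof -
 define c where "c = abs L + 1"
 have c: "c > 0" by (simp add: c_def)
 have lipc: "abs (f x - f y) <= c * abs (x - y)" for x y
  using order_trans[OF lip mult_right_mono[of L c]] by (simp add: c_def)
 define g where "g = (%x. f x + 2 * c * x)"
 have low: "c * (y - x) <= g y - g x" and up: "g y - g x <= 3 * c * (y - x)" if "x <= y" for x y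
  using lipc[of x y] that by (simp_all add: g_def algebra_simps abs_le_iff)
 have g_mono: "g x < g y" if "x < y" for x y
  using low[of x y] mult_pos_pos[OF c, of "y - x"] that by linarith
 have glip: "abs (g x - g y) <= 3 * c * abs (x - y)" for x y
  using up[of x y] up[of y x] g_mono[of x y] g_mono[of y x] by (cases x y rule: linorder_cases) auto
 have "(3 * c)-lipschitz_on UNIV g" using glip c by (intro lipschitz_onI) (auto simp: dist_real_def)
 then have gc: "continuous_on A g" for A by (metis lipschitz_on_continuous_on continuous_on_subset subset_UNIV)
 have g_le: "g x <= g y \<longleftrightarrow> x <= y" for x y using g_mono by (metis linorder_not_le less_le)
 have "EX x. g x = y" for y
 proof -
  define r where "r = abs (y - g 0) / c"
  have r: "r >= 0" "c * r = abs (y - g 0)" using c by (simp_all add: r_def)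
  then have "g (-r) <= y" "y <= g r" using low[of "-r" 0] low[of 0 r] by auto
  then show ?thesis using IVT'[of g "-r" y r] r gc by auto
 qed
 then obtain h where gh: "!!y. g (h y) = y" by metis
 have hg: "h (g x) = x" for x using g_le by (metis gh order_antisym order_refl)
 have "mono h" by (rule monoI) (metis gh g_le)
 then have [measurable]: "h : bmeas" by (rule borel_measurable_mono)
 define M where "M = distr lborel borel h"
 have "absolutely_continuous lborel M"
  unfolding absolutely_continuous_def
 proof
  fix N :: "real set" assume N: "N : null_sets lborel"
  have "negligible (g ` N)"
   by (rule negligible_locally_Lipschitz_image)
    (use N glip in \<open>auto intro!: exI[of _ UNIV] exI[of _ "3 * c"] simp: negligible_iff_null_sets null_sets_completionI\<close>)
  moreover have "g ` N = h -` N" by (auto simp: hg) (metis gh image_eqI)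
  moreover have "h -` N : sets borel" using N by (auto intro!: measurable_sets_borel[of h borel])
  ultimately show "N : null_sets M"
   using N by (auto simp: M_def null_sets_def emeasure_distr negligible_iff_emeasure0)
 qed
 then obtain W where W [measurable]: "W : bmeas" and WM: "density lborel W = M"
  using sigma_finite_measure.Radon_Nikodym[OF sigma_finite_lborel, of M] by (auto simp: M_def)
 have W_int: "(NN x. W x * indicator {a..b} x) = ennreal (g b - g a)" if "a <= b" for a b
 proof -
  have "h -` {a..b} = {g a..g b}" using g_le by (auto simp: gh) (metis gh g_le)+
  then have "emeasure M {a..b} = ennreal (g b - g a)" using that g_le by (simp add: M_def emeasure_distr)
  then show ?thesis by (simp add: WM[symmetric] emeasure_density)
 qed
 \<comment> \<open>Finite integrals over bounded intervals make the density finite a.e.;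
   \<open>enn2real\<close> below would turn an infinite value into 0.\<close>
 have "AE x in lborel. x : {- real n..real n} --> W x ~= \<infinity>" for n
  using nn_integral_PInf_AE[of "%x. W x * indicator {- real n..real n} x" lborel] W_int[of "- real n" "real n"]
  by (auto elim!: eventually_mono simp: indicator_def)
 then have fin: "AE x in lborel. ALL n. x : {- real n..real n} --> W x ~= \<infinity>" unfolding AE_all_countable by blast
 define w where "w = (%x. enn2real (W x) - 2 * c)"
 have wI: "(w has_integral f b - f a) {a..b}" if ab: "a <= b" for a b
 proof -
  have "(NN x. ennreal (enn2real (W x) * indicator {a..b} x)) = (NN x. W x * indicator {a..b} x)"
  proof (rule nn_integral_cong_AE, use fin in eventually_elim)
   case (elim x)
   obtain n :: nat where "abs x <= real n" using real_arch_simple by blast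
   then have "W x < top" using elim[rule_format, of n] by (simp add: abs_le_iff less_top)
   then show ?case by (simp split: split_indicator)
  qed
  then have "((%x. enn2real (W x) * indicator {a..b} x) has_integral g b - g a) UNIV"
   using g_le ab by (intro nn_integral_has_integral) (auto simp: W_int)
  then have "((%x. enn2real (W x)) has_integral g b - g a) {a..b}"
   using has_integral_restrict_UNIV[of "{a..b}" "%x. enn2real (W x)"] by (simp add: indicator_def of_bool_def if_distrib cong: if_cong)
  then show ?thesis using has_integral_diff[OF _ has_integral_const_real[of "2 * c" a b]] ab
   by (fastforce simp: w_def g_def algebra_simps)
 qed
 have w_on: "w integrable_on cbox a b" for a b
 proof (cases "a <= b")
  case True then show ?thesis using wI[OF True] by auto
 qed auto
 obtain N where N: "negligible N" "!!x e. x ~: N ==> 0 < e ==>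
   EX d>0. ALL h. 0 < h & h < d --> norm (integral (cbox x (x + h *R One)) w /\<^sub>R h ^ DIM(real) - w x) < e"
  using integrable_ccontinuous_explicit[OF w_on] by blast
 have conv: "(%n. (f (x + 1 / Suc n) - f x) * Suc n) ---> w x" if x: "x ~: N" for x
 proof (rule LIMSEQ_I)
  fix e :: real assume "e > 0"
  from N(2)[OF x this] obtain d where d: "d > 0"
   "!!h. 0 < h ==> h < d ==> abs (integral {x..x + h} w / h - w x) < e" by (auto simp: divide_inverse mult.commute)
  obtain k :: nat where k: "1 / Suc k < d" using d(1) by (metis inverse_eq_divide reals_Archimedean)
  show "EX k. ALL n>=k. norm ((f (x + 1 / Suc n) - f x) * Suc n - w x) < e"
  proof (intro exI allI impI)
   fix n assume "n >= k"
   then have "1 / Suc n <= 1 / Suc k" by (intro divide_left_mono) auto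
   then show "norm ((f (x + 1 / Suc n) - f x) * Suc n - w x) < e"
    using d(2)[of "1 / Suc n"] k integral_unique[OF wI[of x "x + 1 / Suc n"]] by simp
  qed
 qed
 have "AE x in lborel. (%n. (f (x + 1 / Suc n) - f x) * Suc n) ---> w x"
 proof -
  obtain N' where "N' : null_sets lborel" "N <= N'"
   using N(1) unfolding negligible_iff_null_sets null_sets_completion_iff2 by blast
  then show ?thesis by (intro AE_I') (use conv in auto)
 qed
 with wI show ?thesis using that by blast
qed

section \<open>One-sided rates along the step sizes 1/(n+1)\<close>

text \<open>This says limsup (n+1) X n <= a: a one-sided derivative bound sampled along a sequence
  of steps, the setting in which Fatou's lemma applies.\<close>

definition rate_le :: "real => (nat => real) => bool" where
 "rate_le a X \<longleftrightarrow> (ALL ep>0. EV n. X n <= (a + ep) / Suc n)"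

lemma rate_leI: "(!!ep. ep > 0 ==> EV n. X n <= (a + ep) / Suc n) ==> rate_le a X"
 by (simp add: rate_le_def)

lemma rate_leD: "rate_le a X ==> ep > 0 ==> EV n. X n <= (a + ep) / Suc n"
 by (simp add: rate_le_def)

lemma rate_le_const: "(!!n. X n <= a / Suc n) ==> rate_le a X"
proof (rule rate_leI, rule always_eventually, rule allI)
 fix ep :: real and n assume "!!n. X n <= a / Suc n" "ep > 0"
 then show "X n <= (a + ep) / Suc n" using order_trans[OF _ divide_right_mono[of a "a + ep" "real (Suc n)"]] by simp
qed

lemma rate_le_mono:
 assumes X: "rate_le a X" and le: "!!n. Y n <= X n" and ab: "a <= b"
 shows "rate_le b Y"
proof (rule rate_leI)
 fix ep :: real assume "ep > 0"
 from rate_leD[OF X this] show "EV n. Y n <= (b + ep) / Suc n"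
 proof eventually_elim
  case (elim n)
  have "(a + ep) / Suc n <= (b + ep) / Suc n" using ab by (intro divide_right_mono) auto
  then show ?case using elim le[of n] by linarith
 qed
qed

lemma rate_le_add:
 assumes X: "rate_le a X" and Y: "rate_le b Y"
 shows "rate_le (a + b) (%n. X n + Y n)"
proof (rule rate_leI)
 fix ep :: real assume "ep > 0"
 then have "ep / 2 > 0" by simp
 from rate_leD[OF X this] rate_leD[OF Y this] show "EV n. X n + Y n <= (a + b + ep) / Suc n"
 proof eventually_elim
  case (elim n)
  have "(a + ep / 2) / Suc n + (b + ep / 2) / Suc n = (a + b + ep) / Suc n" unfolding add_divide_distrib[symmetric] by (simp add: algebra_simps)
  then show ?case using elim by linarith
 qed
qed

lemma rate_le_cmult:
 assumes X: "rate_le a X" and c: "0 <= c"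
 shows "rate_le (c * a) (%n. c * X n)"
proof (rule rate_leI)
 fix ep :: real assume ep: "ep > 0"
 \<comment> \<open>Dividing by \<open>c + 1\<close> rather than \<open>c\<close> covers
   \<open>c = 0\<close>.\<close>
 then have "ep / (c + 1) > 0" using c by simp
 from rate_leD[OF X this] show "EV n. c * X n <= (c * a + ep) / Suc n"
 proof eventually_elim
  case (elim n)
  have "c * (ep / (c + 1)) <= ep" using c ep by (simp add: pos_divide_le_eq distrib_left)
  then have "c * (a + ep / (c + 1)) / Suc n <= (c * a + ep) / Suc n" by (intro divide_right_mono) (simp_all add: distrib_left)
  then show ?case using mult_left_mono[OF elim c] by simp
 qed
qed

lemma rate_0_iff: "rate_le 0 (%n. abs (X n)) \<longleftrightarrow> (%n. real (Suc n) * X n) ---> 0"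
proof
 have eq: "abs (X n) <= (0 + ep) / Suc n \<longleftrightarrow> abs (real (Suc n) * X n) <= ep" for n and ep :: real
  by (simp add: pos_le_divide_eq abs_mult mult.commute del: of_nat_Suc)
 show "(%n. real (Suc n) * X n) ---> 0" if r: "rate_le 0 (%n. abs (X n))"
 proof (rule tendstoI)
  fix ep :: real assume ep: "ep > 0"
  have "EV n. abs (real (Suc n) * X n) <= ep / 2" using rate_leD[OF r, of "ep / 2"] ep unfolding eq by simp
  then show "EV n. dist (real (Suc n) * X n) 0 < ep"
   by eventually_elim (use ep in \<open>simp add: dist_real_def\<close>)
 qed
 show "rate_le 0 (%n. abs (X n))" if l: "(%n. real (Suc n) * X n) ---> 0"
 proof (rule rate_leI, unfold eq)
  fix ep :: real assume "ep > 0"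
  from tendstoD[OF l this] show "EV n. abs (real (Suc n) * X n) <= ep"
   by eventually_elim (simp add: dist_real_def)
 qed
qed

lemma rate_le_bounded_mult:
 assumes X: "rate_le 0 (%n. abs (X n))" and Y: "!!n. abs (Y n) <= B"
 shows "rate_le 0 (%n. abs (X n * Y n))"
proof -
 have "0 <= B" using Y[of 0] by linarith
 from rate_le_cmult[OF X this] show ?thesis
  by (rule rate_le_mono) (use Y in "auto simp: abs_mult mult.commute[of B] intro: mult_left_mono")
qed

text \<open>The a.e. bound on right quotients passes to the density of \<open>I\<close>, and
  integrating the density recovers the increment. The Lipschitz hypothesis excludes a singular
  part.\<close>

lemma lipschitz_dini_le:
 fixes I B :: "real => real"
 assumes lip: "!!s t. abs (I s - I t) <= L * abs (s - t)" and t01: "t0 <= t1"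
  and B: "continuous_on {t0..t1} B"
  and dini: "AE t in lborel. t0 < t --> t < t1 --> rate_le (B t) (%n. I (t + 1 / Suc n) - I t)"
 shows "I t1 - I t0 <= integral {t0..t1} B"
proof -
 obtain w where w: "!!a b. a <= b ==> (w has_integral I b - I a) {a..b}"
  "AE x in lborel. (%n. (I (x + 1 / Suc n) - I x) * Suc n) ---> w x"
  using lipschitz_real_density[OF lip] by blast
 have "AE t in lborel. t0 < t --> t < t1 --> w t <= B t"
  using w(2) dini
 proof eventually_elim
  case (elim t)
  show ?case
  proof (intro impI, rule field_le_epsilon)
   fix ep :: real assume "t0 < t" "t < t1" "ep > 0"
   then have "EV n. I (t + 1 / Suc n) - I t <= (B t + ep) / Suc n" using elim(2) rate_leD by blast
   then have "EV n. (I (t + 1 / Suc n) - I t) * Suc n <= B t + ep"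
    by eventually_elim (simp add: pos_le_divide_eq del: of_nat_Suc)
   then show "w t <= B t + ep" by (rule tendsto_upperbound[OF elim(1)]) simp
  qed
 qed
 then obtain N where N: "N : null_sets lborel" "!!t. t0 < t ==> t < t1 ==> t ~: N ==> w t <= B t"
  by (auto elim!: AE_E3)
 have "negligible (N \<union> {t0, t1})" using N(1) by (simp add: negligible_iff_null_sets null_sets_completionI)
 then have "((%t. if t : N \<union> {t0, t1} then B t else w t) has_integral I t1 - I t0) {t0..t1}"
  by (rule has_integral_spike[OF _ _ w(1)[OF t01]]) auto
 then show ?thesis
  by (rule has_integral_le[OF _ integrable_integral[OF integrable_continuous_interval[OF B]]])
   (use N(2) in "auto simp: less_le")
qed

section \<open>Directional derivatives of a Lipschitz function\<close>

definition dquot :: "('a::real_normed_vector => real) => 'a => real => 'a => real" where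
 "dquot f e s x = (f (x + s *R e) - f x) / s"

text \<open>\<open>lim\<close> has an unspecified value where the quotients diverge; convergence
  a.e. is established below, and measurability holds regardless.\<close>

definition dlim :: "('a::real_normed_vector => real) => 'a => 'a => real" where
 "dlim f e x = lim (%n. dquot f e (1 / Suc n) x)"

context
 fixes f :: "'a::euclidean_space => real" and L :: real
 assumes lip: "!!x y. abs (f x - f y) <= L * norm (x - y)"
begin

lemma lip_abs: "abs (f x - f y) <= abs L * norm (x - y)"
 using lip[of x y] mult_right_mono[OF abs_ge_self norm_ge_zero, of L "x - y"] by linarith

lemma lipf_meas [measurable]: "f : bmeas"
proof -
 have "(abs L)-lipschitz_on UNIV f" using lip_abs by (intro lipschitz_onI) (auto simp: dist_real_def dist_norm)
 then show ?thesis by (intro borel_measurable_continuous_onI lipschitz_on_continuous_on)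
qed

lemma dquot_meas [measurable]: "dquot f e s : bmeas" unfolding dquot_def[abs_def] by measurable

lemma dlim_meas [measurable]: "dlim f e : bmeas" unfolding dlim_def[abs_def] by measurable

lemma dquot_bound: "abs (dquot f e s x) <= abs L * norm e"
proof (cases "s = 0")
 case False
 then show ?thesis using lip_abs[of "x + s *R e" x] by (simp add: dquot_def field_simps)
qed (simp add: dquot_def)

text \<open>On every line parallel to \<open>e\<close> the exceptional set \<open>N\<close> is null
  by the one-dimensional result. Averaging the measure of the translates of \<open>N\<close> along
  \<open>e\<close> over a unit interval and exchanging the integrals turns this into nullity of
  \<open>N\<close>, without coordinates adapted to \<open>e\<close>.\<close>

lemma dlim_AE: "AE x in lborel. (%n. dquot f e (1 / Suc n) x) ---> dlim f e x"
proof -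
 define N where "N = {x. ~ convergent (%n. dquot f e (1 / Suc n) x)}"
 have [measurable]: "N : sets borel" unfolding N_def Cauchy_convergent_iff[symmetric] by measurable
 have line: "AE s in lborel. x + s *R e ~: N" for x
 proof -
  have "abs (f (x + s *R e) - f (x + t *R e)) <= (L * norm e) * abs (s - t)" for s t
   using lip[of "x + s *R e" "x + t *R e"] by (simp add: scaleR_diff_left[symmetric] mult_ac)
  then obtain w where "AE s in lborel. (%n. (f (x + (s + 1 / Suc n) *R e) - f (x + s *R e)) * Suc n) ---> w s"
   by (rule lipschitz_real_density)
  then show ?thesis
   by eventually_elim (auto simp: N_def convergent_def dquot_def scaleR_add_left add_ac simp del: of_nat_Suc)
 qed
 have "emeasure lborel N = (NN s. indicator {0..1::real} s * emeasure lborel N)"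
  by (subst nn_integral_multc) auto
 also have "... = (NN s. (NN x. indicator {0..1} s * indicator N (x + s *R e)))"
 proof (rule nn_integral_cong)
  fix s :: real
  have "emeasure lborel N = (\<integral>\<^sup>+x. indicator N x \<partial>distr lborel borel ((+) (s *R e)))" by (simp add: lborel_distr_plus)
  also have "... = (NN x. indicator N (x + s *R e))" by (subst nn_integral_distr) (auto simp: add.commute)
  finally show "indicator {0..1} s * emeasure lborel N = (NN x. indicator {0..1} s * indicator N (x + s *R e))"
   by (subst nn_integral_cmult) auto
 qed
 also have "... = (NN x. (NN s. indicator {0..1} s * indicator N (x + s *R e)))"
  by (rule lborel_pair.Fubini') measurable
 also have "... = (NN (x::'a). 0)"
 proof (rule nn_integral_cong)
  fix x
  have "(NN s. indicator {0..1} s * indicator N (x + s *R e)) = (NN (s::real). 0)"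
   by (rule nn_integral_cong_AE) (use line[of x] in auto)
  then show "(NN s. indicator {0..1} s * indicator N (x + s *R e)) = 0" by simp
 qed
 finally have "N : null_sets lborel" by (intro null_setsI) auto
 then show ?thesis by (rule AE_I') (auto simp: N_def dlim_def convergent_LIMSEQ_iff)
qed

lemma dlim_bound: "AE x in lborel. abs (dlim f e x) <= abs L * norm e"
 using dlim_AE[of e] by eventually_elim (rule tendsto_upperbound[OF tendsto_rabs], auto intro: always_eventually dquot_bound)

text \<open>Both sides have the same integral over every box, because translating a box by \<open>e / n\<close> changes its
 indicator only near the boundary in the limit.\<close>

lemma dlim_add: "AE x in lborel. dlim f (e + e') x = dlim f e x + dlim f e' x"
proof -
 define w where "w = (%x. dlim f (e + e') x - dlim f e x - dlim f e' x)"
 define h where "h = (%n::nat. 1 / real (Suc n))"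
 have h: "h n > 0" "h n <= 1" for n by (auto simp: h_def)
 have h0: "h ---> 0" unfolding h_def by (rule LIMSEQ_Suc[OF lim_1_over_n])
 have w0: "integral (cbox a b) w = 0" "w integrable_on cbox a b" for a b
 proof -
  define Q where "Q = cbox a b"
  have [measurable]: "Q : sets borel" by (simp add: Q_def)
  obtain R where R: "!!y. y : Q ==> norm y <= R" unfolding Q_def by (metis bounded_cbox bounded_iff)
  have Qi: "indicator Q (y - s *R e) <= (indicator (cball 0 (R + norm e)) y :: real)" if "0 <= s" "s <= 1" for y s
  proof (cases "y - s *R e : Q")
   case True
   then have "norm (y - s *R e) <= R" using R by auto
   moreover have "norm (s *R e) <= norm e" using that by (simp add: mult_left_le_one_le)
   ultimately have "norm y <= R + norm e" using norm_triangle_ineq[of "y - s *R e" "s *R e"] by simp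
   then show ?thesis by simp
  qed simp
  have bi: "integrable lborel (%y::'a. C * indicator (cball 0 r) y :: real)" for C r
   using emeasure_bounded_finite[OF bounded_cball, of "0::'a" r] by (intro integrable_mult_right integrable_real_indicator) auto
  have i: "integrable lborel (%y. indicator Q (y - s *R e) * u y)"
   if [measurable]: "u : bmeas" and u: "AE y in lborel. abs (u y) <= C" and s: "0 <= s" "s <= 1" for u :: "'a => real" and s C
  proof (rule Bochner_Integration.integrable_bound[OF bi[of C "R + norm e"]])
   show "AE y in lborel. norm (indicator Q (y - s *R e) * u y) <= norm (C * indicator (cball 0 (R + norm e)) y)"
    using u
   proof eventually_elim
    case (elim y)
    have "norm (indicator Q (y - s *R e) * u y) <= C * indicator (cball 0 (R + norm e)) y"
     using mult_mono[OF Qi[OF s, of y] elim] by (simp add: abs_mult mult.commute)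
    then show ?case using abs_ge_self order_trans by fastforce
   qed
  qed measurable
  have lim: "(%n. LBINT y. indicator Q (y - (k * h n) *R e) * dquot f d (h n) y) ---> (LBINT y. indicator Q y * dlim f d y)"
   if k: "k : {0, 1}" for k d
  proof (rule integral_dominated_convergence[OF _ _ bi[of "abs L * norm d" "R + norm e"]])
   have "negligible (frontier Q)" unfolding Q_def by (intro negligible_convex_frontier convex_box)
   then have "AE y in lborel. y ~: frontier Q"
    by (intro AE_I'[of "frontier Q"]) (auto simp: negligible_iff_emeasure0 intro: null_setsI)
   then show "AE y in lborel. (%n. indicator Q (y - (k * h n) *R e) * dquot f d (h n) y) ---> indicator Q y * dlim f d y"
    using dlim_AE[of d]
   proof eventually_elim
    case (elim y)
    have "(%n. y - (k * h n) *R e) ---> y - (k * 0) *R e" by (intro tendsto_intros h0)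
    then have "(%n. indicator Q (y - (k * h n) *R e) :: real) ---> indicator Q y"
     using isCont_tendsto_compose[OF isCont_indicator[THEN iffD2, OF elim(1)]] by simp
    then show ?case using elim(2) by (auto simp: h_def intro: tendsto_mult)
   qed
   show "AE y in lborel. norm (indicator Q (y - (k * h n) *R e) * dquot f d (h n) y) <= abs L * norm d * indicator (cball 0 (R + norm e)) y" for n
    using Qi[of "k * h n"] dquot_bound[of d "h n"] h[of n] k
    by (auto simp: abs_mult mult.commute[of "abs L * norm d"] intro!: AE_I2 mult_mono)
  qed measurable
  have "(LBINT y. indicator Q y * dquot f (e + e') (h n) y)
   = (LBINT y. indicator Q (y - h n *R e) * dquot f e' (h n) y) + (LBINT y. indicator Q y * dquot f e (h n) y)" (is "?A n = ?B n") for n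
  proof -
   have 1: "integrable lborel (%y. indicator Q y * dquot f e (h n) y)" using i[OF _ AE_I2[OF dquot_bound], where s=0] by simp
   have 2: "integrable lborel (%y. indicator Q (y - h n *R e) * dquot f e' (h n) y)"
    by (rule i[OF _ AE_I2[OF dquot_bound]]) (use h in "auto intro: less_imp_le")
   \<comment> \<open>The increment along e + e' is the increment along e' at the point shifted by h
     e, plus the increment along e. The shift is moved onto the box by translation
     invariance.\<close>
   have eq: "indicator Q y * dquot f (e + e') (h n) y = indicator Q y * dquot f e' (h n) (y + h n *R e) + indicator Q y * dquot f e (h n) y" for y
    by (simp add: dquot_def scaleR_add_right add_ac add_divide_distrib[symmetric] distrib_left[symmetric])
   have 3: "integrable lborel (%y. indicator Q y * dquot f e' (h n) (y + h n *R e))"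
    and 4: "(LBINT y. indicator Q y * dquot f e' (h n) (y + h n *R e)) = (LBINT y. indicator Q (y - h n *R e) * dquot f e' (h n) y)"
    using 2 by (subst (asm) lborel_distr_plus[of "h n *R e", symmetric], simp add: integrable_distr_eq add.commute)
     (subst lborel_distr_plus[of "h n *R e", symmetric], simp add: integral_distr add.commute)
   show ?thesis unfolding eq by (simp add: 1 3 4)
  qed
  then have sum: "(LBINT y. indicator Q y * dlim f (e + e') y) = (LBINT y. indicator Q y * dlim f e' y) + (LBINT y. indicator Q y * dlim f e y)"
   using LIMSEQ_unique[OF lim[of 0 "e + e'"]] tendsto_add[OF lim[of 1 e'] lim[of 0 e]] by simp
  have di: "integrable lborel (%y. indicator Q y * dlim f d y)" for d using i[OF _ dlim_bound, where s=0] by simp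
  have "set_integrable lborel Q w" unfolding set_integrable_def w_def by (simp add: right_diff_distrib di)
  moreover have "(LINT y:Q|lborel. w y) = 0"
   unfolding set_lebesgue_integral_def w_def by (simp add: right_diff_distrib di sum)
  ultimately show "integral (cbox a b) w = 0" "w integrable_on cbox a b"
   using set_borel_integral_eq_integral[of Q w] by (simp_all add: Q_def)
 qed
 \<comment> \<open>All box integrals of \<open>w\<close> vanish, so Lebesgue differentiation over
   boxes with corner x gives \<open>w x = 0\<close> off a negligible set.\<close>
 obtain N where N: "negligible N" "!!x e. x ~: N ==> 0 < e ==>
   EX d>0. ALL h. 0 < h & h < d --> norm (integral (cbox x (x + h *R One)) w /\<^sub>R h ^ DIM('a) - w x) < e"
  using integrable_ccontinuous_explicit[OF w0(2)] by blast
 have "dlim f (e + e') x = dlim f e x + dlim f e' x" if "x ~: N" for x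
 proof (rule ccontr)
  assume "~ ?thesis"
  then have "abs (w x) > 0" by (simp add: w_def)
  from N(2)[OF that this] show False by (auto simp: w0(1)) (meson dense)
 qed
 moreover obtain N' where "N' : null_sets lborel" "N <= N'"
  using N(1) unfolding negligible_iff_null_sets null_sets_completion_iff2 by blast
 ultimately show ?thesis by (intro AE_I'[of N']) (auto simp: subset_iff)
qed

text \<open>A step s is compared with 1/(m+1), where m = floor (1/s). The two differ by a factor of
  at most 1 + s, so by the Lipschitz bound the quotients differ by O(s).\<close>

lemma dquot_at_right:
 assumes D: "(%n. dquot f e (1 / Suc n) x) ---> D"
 shows "((%s. dquot f e s x) \<longlongrightarrow> D) (at_right 0)"
proof -
 define m where "m = (%s::real. nat \<lfloor>inverse s\<rfloor>)"
 have "filterlim m sequentially (at_right 0)" unfolding m_def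
  by (intro filterlim_compose[OF filterlim_nat_sequentially] filterlim_compose[OF filterlim_floor_sequentially] filterlim_inverse_at_top_right)
 from filterlim_compose[OF D this] have lim: "((%s. dquot f e (1 / Suc (m s)) x) \<longlongrightarrow> D) (at_right 0)" .
 have "((%s. dquot f e s x - dquot f e (1 / Suc (m s)) x) \<longlongrightarrow> 0) (at_right 0)"
 proof (rule Lim_null_comparison)
  have "((%s. 2 * (abs L * norm e) * s) \<longlongrightarrow> 2 * (abs L * norm e) * 0) (at_right 0)" by (intro tendsto_intros)
  then show "((%s. 2 * (abs L * norm e) * s) \<longlongrightarrow> 0) (at_right 0)" by simp
  show "\<forall>\<^sub>F s in at_right 0. norm (dquot f e s x - dquot f e (1 / Suc (m s)) x) <= 2 * (abs L * norm e) * s"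
   using eventually_at_right_less[of 0]
  proof eventually_elim
   case (elim s)
   define sg where "sg = 1 / real (Suc (m s))"
   define K where "K = abs L * norm e"
   define M where "M = real (Suc (m s))"
   have "M <= 1 / s + 1" "1 / s < M" using elim by (simp_all add: M_def m_def divide_inverse) linarith+
   then have "s * M <= 1 + s" "1 < s * M" "M > 0" using elim by (auto simp: M_def field_simps)
   moreover have "s - 1 / M = (s * M - 1) / M" using \<open>M > 0\<close> by (simp add: field_simps)
   ultimately have sg: "sg > 0" "sg < s" "s - sg <= sg * s"
    unfolding sg_def M_def[symmetric] by (auto simp: divide_le_cancel pos_divide_less_eq)
   have a: "abs (f (x + s *R e) - f (x + sg *R e)) <= K * (s - sg)"
    using lip_abs[of "x + s *R e" "x + sg *R e"] sg by (simp add: K_def scaleR_diff_left[symmetric] mult_ac)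
   have b: "abs (dquot f e sg x) <= K" unfolding K_def by (rule dquot_bound)
   have "s * (dquot f e s x - dquot f e sg x) = (f (x + s *R e) - f (x + sg *R e)) - (s - sg) * dquot f e sg x"
    using elim sg by (simp add: dquot_def field_simps)
   also have "abs ... <= K * (s - sg) + (s - sg) * K"
    using a mult_left_mono[OF b, of "s - sg"] sg by (intro order_trans[OF abs_triangle_ineq4 add_mono]) (auto simp: abs_mult)
   also have "... <= s * (2 * K * s)"
   proof -
    have "sg * s <= s * s" using sg by (intro mult_right_mono) auto
    then have "s - sg <= s * s" using sg(3) by linarith
    then have "(s - sg) * K <= (s * s) * K" by (intro mult_right_mono) (auto simp: K_def)
    then show ?thesis by (simp add: algebra_simps)
   qed
   finally show ?case using elim by (simp add: abs_mult sg_def K_def)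
  qed
 qed
 from tendsto_add[OF this lim] show ?thesis by simp
qed

text \<open>For positive \<open>r\<close> the steps r/(n+1) need not have the form 1/(m+1), hence
  the recourse to the limit over all positive steps. Negative \<open>r\<close> follows from
  additivity, since opposite directions add up to 0.\<close>

lemma dlim_scale: "AE x in lborel. dlim f (r *R e) x = r * dlim f e x"
proof -
 have pos: "AE x in lborel. dlim f (r *R e) x = r * dlim f e x" if r: "r > 0" for r
  using dlim_AE[of e] dlim_AE[of "r *R e"]
 proof eventually_elim
  case (elim x)
  have "filterlim (%n. r * (1 / real (Suc n))) (at_right 0) sequentially" unfolding filterlim_at
   using tendsto_mult_right_zero[OF LIMSEQ_Suc[OF lim_1_over_n], of r] r by (auto simp del: of_nat_Suc)
  from tendsto_mult_left[OF filterlim_compose[OF dquot_at_right[OF elim(1)] this], of r] elim(2)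
  show ?case using r by (intro LIMSEQ_unique[OF elim(2)]) (simp add: dquot_def mult.commute)
 qed
 have zero: "dlim f 0 x = 0" for x by (simp add: dlim_def dquot_def)
 consider "r > 0" | "r = 0" | "- r > 0" by linarith
 then show ?thesis
 proof cases
  case 3
  show ?thesis using pos[OF 3] dlim_add[of "r *R e" "(- r) *R e"] by eventually_elim (simp add: zero)
 qed (simp_all add: pos zero)
qed

lemma dlim_linear: "AE x in lborel. dlim f q x = (\<Sum>i\<in>Basis. (q \<bullet> i) * dlim f i x)"
proof -
 have "AE x in lborel. dlim f (\<Sum>i\<in>S. (q \<bullet> i) *R i) x = (\<Sum>i\<in>S. (q \<bullet> i) * dlim f i x)" if "finite S" for S
  using that
 proof induction
  case empty
  show ?case using dlim_scale[of 0 q] by simp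
 next
  case (insert i S)
  show ?case using insert.IH dlim_scale[of "q \<bullet> i" i] dlim_add[of "(q \<bullet> i) *R i" "\<Sum>i\<in>S. (q \<bullet> i) *R i"]
   by eventually_elim (simp add: insert)
 qed
 from this[OF finite_Basis] show ?thesis by (simp add: euclidean_representation)
qed

text \<open>Compactness of the unit sphere gives a finite net of directions from \<open>C\<close>,
  along which convergence is uniform; the Lipschitz bound of \<open>f\<close> and the boundedness of
  \<open>A\<close> carry it to all directions. The net width \<open>ep / (2 * (abs L + B))\<close>
  makes the transfer cost half of \<open>ep\<close>, and the quotients cost the other half.\<close>

lemma has_derivative_of_directional:
 assumes A: "linear (A :: 'a => real)" and dense: "!!X::'a set. open X ==> X ~= {} ==> EX q:C. q : X"
  and dir: "!!q::'a. q : C ==> ((%s. dquot f q s x) \<longlongrightarrow> A q) (at_right 0)"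
 shows "(f has_derivative A) (at x)"
proof -
 have bl: "bounded_linear A" using A by (simp add: linear_linear)
 obtain B where B: "B > 0" "!!h. norm (A h) <= norm h * B" using bounded_linear.pos_bounded[OF bl] by blast
 show ?thesis unfolding has_derivative_at_alt
 proof (intro conjI bl allI impI)
  fix ep :: real assume ep: "0 < ep"
  define et where "et = ep / (2 * (abs L + B))"
  have LB: "abs L + B > 0" using B by auto
  have et: "et > 0" using ep LB by (simp add: et_def)
  have "sphere (0::'a) 1 <= (\<Union>q\<in>C. ball q et)"
   using dense[OF open_ball] et by (fastforce simp: dist_commute)
  then obtain Q :: "'a set" where Q: "Q <= C" "finite Q" "sphere 0 1 <= (\<Union>q\<in>Q. ball q et)"
   by (rule compactE_image[OF compact_sphere, where f="%q. ball q et" and C=C, rotated]) auto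
  have "\<forall>\<^sub>F s in at_right 0. ALL q:Q. dist (dquot f q s x) (A q) < ep / 2"
   by (intro eventually_ball_finite Q(2) ballI tendstoD[OF dir]) (use Q(1) ep in auto)
  then obtain d where d: "d > 0" "!!s q. 0 < s ==> s < d ==> q : Q ==> abs (dquot f q s x - A q) < ep / 2"
   unfolding eventually_at_right_field dist_real_def by auto
  show "EX d>0. ALL y. norm (y - x) < d --> norm (f y - f x - A (y - x)) <= ep * norm (y - x)"
  proof (intro exI[of _ d] conjI d(1) allI impI)
   fix y assume y: "norm (y - x) < d"
   show "norm (f y - f x - A (y - x)) <= ep * norm (y - x)"
   proof (cases "y = x")
    case True then show ?thesis by (simp add: linear_0[OF A])
   next
    case False
    define s where "s = norm (y - x)"
    have s: "s > 0" using False by (simp add: s_def)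
    define u where "u = (1 / s) *R (y - x)"
    have "norm u = 1" and yx: "y = x + s *R u" using s by (simp_all add: u_def s_def)
    then obtain q where q: "q : Q" "norm (q - u) < et" using Q(3) by (auto simp: dist_norm subset_iff)
    have qs: "norm (s *R (q - u)) <= s * et" using q s by simp
    have "abs (f (x + s *R q) - f y) <= abs L * (s * et)"
     using lip_abs[of "x + s *R q" y] mult_left_mono[OF qs, of "abs L"] by (simp add: yx scaleR_diff_right[symmetric] del: norm_scaleR)
    moreover have "abs (A (s *R (q - u))) <= (s * et) * B"
     using order_trans[OF B(2) mult_right_mono[OF qs]] B(1) by simp
    moreover have "abs (s * (dquot f q s x - A q)) <= s * (ep / 2)"
     using d(2)[OF s _ q(1)] y s by (simp add: abs_mult s_def)
    moreover have "f y - f x - A (y - x) = A (s *R (q - u)) + s * (dquot f q s x - A q) - (f (x + s *R q) - f y)"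
    proof -
     have "s * dquot f q s x = f (x + s *R q) - f x" using s by (simp add: dquot_def)
     then show ?thesis by (simp add: yx linear_scale[OF A] linear_diff[OF A] right_diff_distrib)
    qed
    ultimately have "abs (f y - f x - A (y - x)) <= abs L * (s * et) + (s * et) * B + s * (ep / 2)" by linarith
    also have "... = s * (et * (abs L + B)) + s * (ep / 2)" by (simp add: algebra_simps)
    also have "et * (abs L + B) = ep / 2" using LB by (simp add: et_def divide_simps)
    finally show ?thesis by (simp add: s_def algebra_simps)
   qed
  qed
 qed
qed

text \<open>Each fixed direction has its own null set on which linearity may fail, so only countably
  many dense directions are used, and \<open>has_derivative_of_directional\<close> supplies the
  others.\<close>

theorem rademacher: "AE x in lborel. f differentiable (at x)"
proof -
 obtain C :: "'a set" where C: "countable C" "!!X. open X ==> X ~= {} ==> EX q:C. q : X"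
  using countable_dense_exists by blast
 have "AE x in lborel. ALL q:C. (%n. dquot f q (1 / Suc n) x) ---> (\<Sum>i\<in>Basis. (q \<bullet> i) * dlim f i x)"
  unfolding AE_ball_countable[OF C(1)]
 proof
  fix q
  show "AE x in lborel. (%n. dquot f q (1 / Suc n) x) ---> (\<Sum>i\<in>Basis. (q \<bullet> i) * dlim f i x)"
   using dlim_AE[of q] dlim_linear[of q] by eventually_elim simp
 qed
 then show ?thesis
 proof eventually_elim
  case (elim x)
  have "linear (%q. \<Sum>i\<in>Basis. (q \<bullet> i) * dlim f i x)"
   by (intro linearI) (auto simp: inner_add_left algebra_simps sum.distrib sum_distrib_left)
  from has_derivative_of_directional[OF this C(2) dquot_at_right] elim show ?case unfolding differentiable_def by blast
 qed
qed

end

declare lipf_meas [measurable del] dquot_meas [measurable del] dlim_meas [measurable del]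

text \<open>Composing with the projection onto a box reduces the local statement to the global one.\<close>

theorem rademacher_local:
 fixes f :: "'a::euclidean_space => real"
 assumes lip: "!!R. EX L. ALL x y. norm x <= R --> norm y <= R --> abs (f x - f y) <= L * norm (x - y)"
 shows "AE x in lborel. f differentiable (at x)"
proof -
 have "AE x in lborel. norm x < real n --> f differentiable (at x)" for n
 proof -
  define a where "a = (\<Sum>i\<in>Basis. real n *R i :: 'a)"
  have ai: "a \<bullet> i = real n" if "i : Basis" for i using that by (simp add: a_def)
  have "bounded (cbox (-a) a)" by simp
  then obtain R where R: "!!x. x : cbox (-a) a ==> norm x <= R" by (auto simp: bounded_iff)
  obtain L where L: "!!x y. norm x <= R ==> norm y <= R ==> abs (f x - f y) <= L * norm (x - y)" using lip by blast
  define g where "g = f \<circ> clamp (-a) a"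
  have cl: "clamp (-a) a x : cbox (-a) a" for x by (rule clamp_in_interval) (simp add: ai)
  have "abs (g x - g y) <= abs L * norm (x - y)" for x y
  proof -
   have "abs (g x - g y) <= L * norm (clamp (-a) a x - clamp (-a) a y)" unfolding g_def o_def by (intro L R cl)
   also have "... <= abs L * norm (clamp (-a) a x - clamp (-a) a y)" by (intro mult_right_mono) auto
   also have "... <= abs L * norm (x - y)"
    using dist_clamps_le_dist_args[of "-a" a x y] by (intro mult_left_mono) (auto simp: dist_norm ai)
   finally show ?thesis .
  qed
  from rademacher[OF this] show ?thesis
  proof eventually_elim
   case (elim x)
   show ?case
   proof
    assume x: "norm x < real n"
    then have "x : ball 0 (real n)" by simp
    moreover have "g y = f y" if "y : ball 0 (real n)" for y
    proof -
     have "y : cbox (-a) a" unfolding mem_box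
     proof
      fix i :: 'a assume i: "i : Basis"
      have "abs (y \<bullet> i) <= norm y" using i by (rule Basis_le_norm)
      then show "- a \<bullet> i <= y \<bullet> i & y \<bullet> i <= a \<bullet> i" using that by (auto simp: ai[OF i])
     qed
     then show ?thesis by (simp add: g_def)
    qed
    ultimately show "f differentiable at x"
     using elim unfolding differentiable_def
     by (metis has_derivative_transform_within_open open_ball)
   qed
  qed
 qed
 then have "AE x in lborel. ALL n::nat. norm x < real n --> f differentiable (at x)" unfolding AE_all_countable by blast
 then show ?thesis by eventually_elim (metis reals_Archimedean2)
qed

section \<open>Measure-preserving shears and the Coulomb kernel\<close>

definition lborel_pres :: "('a::euclidean_space => 'a) => bool" where
 "lborel_pres T \<longleftrightarrow> T : bmeas & distr lborel borel T = lborel"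

lemma lborel_pres_measurable: "lborel_pres T ==> T : bmeas"
 by (simp add: lborel_pres_def)

lemma lborel_pres_nn_integral:
 assumes "lborel_pres T" "f : bmeas"
 shows "(NN x. f (T x)) = (NN x. f x)"
proof -
 have "(NN x. f x) = (\<integral>\<^sup>+x. f x \<partial>distr lborel borel T)" using assms by (simp add: lborel_pres_def)
 also have "... = (NN x. f (T x))" using assms by (intro nn_integral_distr) (auto simp: lborel_pres_def)
 finally show ?thesis by simp
qed

lemma lborel_pres_integral:
 fixes f :: "'a::euclidean_space => 'b::{banach, second_countable_topology}"
 assumes "lborel_pres T" "f : bmeas"
 shows "(LBINT x. f (T x)) = (LBINT x. f x)"
proof -
 have "(LBINT x. f x) = (\<integral>x. f x \<partial>distr lborel borel T)" using assms by (simp add: lborel_pres_def)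
 also have "... = (LBINT x. f (T x))" using assms by (intro integral_distr) (auto simp: lborel_pres_def)
 finally show ?thesis by simp
qed

lemma lborel_pres_integrable:
 fixes f :: "'a::euclidean_space => 'b::{banach, second_countable_topology}"
 assumes "lborel_pres T" "f : bmeas"
 shows "integrable lborel (%x. f (T x)) \<longleftrightarrow> integrable lborel f"
proof -
 have "integrable lborel f \<longleftrightarrow> integrable (distr lborel borel T) f" using assms by (simp add: lborel_pres_def)
 also have "... \<longleftrightarrow> integrable lborel (%x. f (T x))" using assms by (intro integrable_distr_eq) (auto simp: lborel_pres_def)
 finally show ?thesis by simp
qed

lemma lborel_pres_AE:
 assumes "lborel_pres T" "AE x in lborel. P x"
 shows "AE x in lborel. P (T x)"
proof (rule AE_distrD[where M'=borel and f=T])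
 show "T : lborel \<rightarrow>\<^sub>M borel" using assms by (simp add: lborel_pres_def)
 have "distr lborel borel T = lborel" using assms by (simp add: lborel_pres_def)
 then show "AE x in distr lborel borel T. P x" using assms(2) by (simp only:)
qed

lemma lborel_pres_comp:
 assumes "lborel_pres T" "lborel_pres S" shows "lborel_pres (%x. T (S x))"
proof -
 have m: "T : bmeas" "S : bmeas" using assms by (auto simp: lborel_pres_def)
 have "distr lborel borel (%x. T (S x)) = distr (distr lborel borel S) borel T"
  using m by (subst distr_distr) (auto simp: o_def)
 then show ?thesis using assms m by (auto simp: lborel_pres_def)
qed

lemma lborel_presI:
 assumes [measurable]: "T : bmeas"
  and "!!A. A : sets borel ==> (NN x. indicator A (T x)) = emeasure lborel A"
 shows "lborel_pres T"
 unfolding lborel_pres_def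
proof (intro conjI measure_eqI)
 fix A assume "A : sets (distr lborel borel T)"
 then have A [measurable]: "A : sets borel" by simp
 have "emeasure (distr lborel borel T) A = (\<integral>\<^sup>+x. indicator A x \<partial>distr lborel borel T)" by simp
 also have "... = (NN x. indicator A (T x))" by (rule nn_integral_distr) auto
 finally show "emeasure (distr lborel borel T) A = emeasure lborel A" using assms(2)[OF A] by simp
qed auto

lemma nn_integral_lborel_plus:
 fixes c :: "'a::euclidean_space"
 assumes "f : bmeas"
 shows "(NN x. f (x + c)) = (NN x. f x)"
proof -
 have "(NN x. f x) = (\<integral>\<^sup>+x. f x \<partial>distr lborel borel ((+) c))" by (simp add: lborel_distr_plus)
 also have "... = (NN x. f (x + c))" using assms by (subst nn_integral_distr) (auto simp: add.commute)
 finally show ?thesis by simp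
qed

lemma nn_integral_lborel_prod:
 fixes f :: "'a::euclidean_space \<times> 'b::euclidean_space => ennreal"
 assumes [measurable]: "f : bmeas"
 shows "(NN p. f p) = (NN x. NN y. f (x, y))"
  and "(NN p. f p) = (NN y. NN x. f (x, y))"
proof -
 have m: "f : borel_measurable (lborel \<Otimes>\<^sub>M lborel)" by (simp add: lborel_prod)
 show "(NN p. f p) = (NN x. NN y. f (x, y))"
  unfolding lborel_prod[symmetric] using m by (rule lborel.nn_integral_fst[symmetric])
 show "(NN p. f p) = (NN y. NN x. f (x, y))"
  unfolding lborel_prod[symmetric] using m by (rule lborel_pair.nn_integral_snd[symmetric])
qed

text \<open>By Fubini, since the map is a translation for each fixed first component.
  \<open>f\<close> is only required to be measurable, which is what admits rough fields
  later.\<close>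

lemma lborel_pres_shear_snd:
 fixes f :: "'a::euclidean_space => 'b::euclidean_space"
 assumes [measurable]: "f : bmeas"
 shows "lborel_pres (%p::'a \<times> 'b. (fst p, snd p + f (fst p)))"
proof (rule lborel_presI)
 have m: "(%p::'a \<times> 'b. (fst p, snd p + f (fst p))) : borel \<Otimes>\<^sub>M borel \<rightarrow>\<^sub>M borel \<Otimes>\<^sub>M borel"
  by measurable
 then show m': "(%p::'a \<times> 'b. (fst p, snd p + f (fst p))) : borel \<rightarrow>\<^sub>M borel" by (simp add: borel_prod)
 fix A :: "('a \<times> 'b) set" assume A [measurable]: "A : sets borel"
 have A' [measurable]: "A : sets (borel \<Otimes>\<^sub>M borel)" using A by (subst borel_prod)
 have "(NN p. indicator A (fst p, snd p + f (fst p)))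
   = (NN x. NN y. indicator A (x, y + f x))"
  by (subst nn_integral_lborel_prod(1)) (use measurable_compose[OF m' borel_measurable_indicator[OF A]] in simp_all)
 also have "... = (NN x. NN y. indicator A (x, y))"
 proof (rule nn_integral_cong)
  fix x :: 'a
  have "(%y. indicator A (x, y) :: ennreal) : bmeas" by measurable
  from nn_integral_lborel_plus[OF this, of "f x"]
  show "(NN y. indicator A (x, y + f x)) = (NN y. indicator A (x, y))" .
 qed
 also have "... = (NN p. indicator A p)"
  by (rule nn_integral_lborel_prod(1)[symmetric]) measurable
 finally show "(NN p. indicator A (fst p, snd p + f (fst p))) = emeasure lborel A" by simp
qed

lemma lborel_pres_shear_fst:
 fixes f :: "'b::euclidean_space => 'a::euclidean_space"
 assumes [measurable]: "f : bmeas"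
 shows "lborel_pres (%p::'a \<times> 'b. (fst p + f (snd p), snd p))"
proof (rule lborel_presI)
 have m: "(%p::'a \<times> 'b. (fst p + f (snd p), snd p)) : borel \<Otimes>\<^sub>M borel \<rightarrow>\<^sub>M borel \<Otimes>\<^sub>M borel"
  by measurable
 then show m': "(%p::'a \<times> 'b. (fst p + f (snd p), snd p)) : borel \<rightarrow>\<^sub>M borel" by (simp add: borel_prod)
 fix A :: "('a \<times> 'b) set" assume A [measurable]: "A : sets borel"
 have A' [measurable]: "A : sets (borel \<Otimes>\<^sub>M borel)" using A by (subst borel_prod)
 have "(NN p. indicator A (fst p + f (snd p), snd p))
   = (NN y. NN x. indicator A (x + f y, y))"
  by (subst nn_integral_lborel_prod(2)) (use measurable_compose[OF m' borel_measurable_indicator[OF A]] in simp_all)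
 also have "... = (NN y. NN x. indicator A (x, y))"
 proof (rule nn_integral_cong)
  fix y :: 'b
  have "(%x. indicator A (x, y) :: ennreal) : bmeas" by measurable
  from nn_integral_lborel_plus[OF this, of "f y"]
  show "(NN x. indicator A (x + f y, y)) = (NN x. indicator A (x, y))" .
 qed
 also have "... = (NN p. indicator A p)"
  by (rule nn_integral_lborel_prod(2)[symmetric]) measurable
 finally show "(NN p. indicator A (fst p + f (snd p), snd p)) = emeasure lborel A" by simp
qed

section \<open>The Coulomb kernel and its truncation\<close>

text \<open>The factor 1/(2 pi) is left out. At the origin, division by zero yields the value
  0.\<close>

definition Kn :: "plane => plane" where "Kn y = (1 / (norm y)^2) *R y"

text \<open>\<open>Kr r\<close> is the Coulomb kernel truncated at distance \<open>r\<close>; \<open>jr r\<close> dominates the error.\<close>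

definition Kr :: "real => plane => plane" where "Kr r y = (1 / (max r (norm y))^2) *R y"

definition jr :: "real => plane => real" where "jr r y = (if norm y < r then 1 / norm y else 0)"

lemma Kr_bound: "r > 0 ==> norm (Kr r y) <= 1 / r"
proof -
 assume r: "r > 0"
 have "norm y / (max r (norm y))^2 <= max r (norm y) / (max r (norm y))^2" by (intro divide_right_mono) auto
 also have "... = 1 / max r (norm y)" using r by (simp add: power2_eq_square)
 also have "... <= 1 / r" using r by (intro divide_left_mono) auto
 finally show ?thesis by (simp add: Kr_def)
qed

lemma Kn_Kr: "r > 0 ==> norm (Kn y - Kr r y) <= jr r y"
proof (cases "norm y < r")
 case True
 assume r: "r > 0"
 show ?thesis
 proof (cases "y = 0")
  case False
  have "Kn y - Kr r y = (1 / (norm y)^2 - 1 / r^2) *R y" using True by (simp add: Kn_def Kr_def scaleR_diff_left max_def)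
  moreover have "abs (1 / (norm y)^2 - 1 / r^2) <= 1 / (norm y)^2"
  proof -
   have "(norm y)^2 <= r^2" using True by (intro power_mono) auto
   then have "1 / r^2 <= 1 / (norm y)^2" using False r by (intro divide_left_mono mult_pos_pos) auto
   then show ?thesis by simp
  qed
  ultimately have "norm (Kn y - Kr r y) <= 1 / (norm y)^2 * norm y"
   using mult_right_mono[of "abs (1 / (norm y)^2 - 1 / r^2)" "1 / (norm y)^2" "norm y"] by simp
  then show ?thesis using True False by (simp add: jr_def power2_eq_square)
 qed (simp add: Kn_def Kr_def jr_def)
next
 case False
 assume "r > 0"
 then show ?thesis using False by (simp add: Kn_def Kr_def jr_def max_def)
qed

text \<open>Outside the truncation radius this is the distortion formula of inversion. In general
  the squared norm is expanded, and the factors 1/a^2 and 1/b^2 are exchanged between the two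
  diagonal terms; as |x|/a >= |y|/b while 1/a <= 1/b, the exchange can only increase the
  sum.\<close>

lemma Kr_diff:
 assumes r: "r > 0"
 shows "norm (Kr r x - Kr r y) <= norm (x - y) / (max r (norm x) * max r (norm y))"
proof -
 have wlog: "norm (Kr r x - Kr r y) <= norm (x - y) / (max r (norm x) * max r (norm y))" if le: "norm y <= norm x" for x y
 proof -
  define a where "a = max r (norm x)"
  define b where "b = max r (norm y)"
  have ab: "a > 0" "b > 0" "b <= a" using r le by (auto simp: a_def b_def)
  have m: "norm y / b <= norm x / a"
  proof (cases "norm x <= r")
   case True then show ?thesis using le r by (auto simp: a_def b_def max_def divide_right_mono)
  next
   case False
   then have "a = norm x" by (simp add: a_def max_def)
   then have "norm x / a = 1" using ab(1) by simp
   moreover have "norm y / b <= 1" using ab by (simp add: b_def)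
   ultimately show ?thesis by linarith
  qed
  then have m2: "(norm y)^2 / b^2 <= (norm x)^2 / a^2"
   using power_mono[OF m, of 2] ab by (simp add: power_divide)
  have ia: "1 / a^2 <= 1 / b^2" using ab by (intro divide_left_mono power_mono) auto
  have "(norm (Kr r x - Kr r y))^2 = (norm x)^2 / a^2 * (1 / a^2) + (norm y)^2 / b^2 * (1 / b^2) - 2 * (x \<bullet> y) * (1 / a^2 * (1 / b^2))"
   unfolding power2_norm_eq_inner Kr_def a_def[symmetric] b_def[symmetric]
   by (simp add: inner_diff_left inner_diff_right inner_commute[of y x] power2_eq_square divide_simps)
    (simp add: algebra_simps)
  also have "... <= (norm x)^2 / a^2 * (1 / b^2) + (norm y)^2 / b^2 * (1 / a^2) - 2 * (x \<bullet> y) * (1 / a^2 * (1 / b^2))"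
  proof -
   have "0 <= ((norm x)^2 / a^2 - (norm y)^2 / b^2) * (1 / b^2 - 1 / a^2)" using m2 ia by (intro mult_nonneg_nonneg) auto
   then show ?thesis by (simp add: algebra_simps)
  qed
  also have "... = (norm (x - y) / (a * b))^2"
   using ab unfolding power_divide power2_norm_eq_inner
   by (simp add: inner_diff_left inner_diff_right inner_commute[of y x] power2_eq_square field_simps)
  finally have "norm (Kr r x - Kr r y) <= norm (x - y) / (a * b)"
   by (rule power2_le_imp_le) (use ab in auto)
  then show ?thesis by (simp add: a_def b_def)
 qed
 show ?thesis
 proof (cases "norm y <= norm x")
  case True then show ?thesis by (rule wlog)
 next
  case False
  then show ?thesis using wlog[of x y] by (simp add: norm_minus_commute mult.commute)
 qed
qed

lemma Kr_lip:
 assumes r: "r > 0"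
 shows "norm (Kr r x - Kr r y) <= norm (x - y) / r^2"
proof -
 have "r * r <= max r (norm x) * max r (norm y)" using r by (intro mult_mono) auto
 then have "norm (x - y) / (max r (norm x) * max r (norm y)) <= norm (x - y) / (r * r)"
  using r by (intro divide_left_mono mult_pos_pos) (auto simp: max_def)
 then show ?thesis using Kr_diff[OF r, of x y] by (simp add: power2_eq_square)
qed

text \<open>The product in \<open>Kr_diff\<close> becomes a sum of squares, so that each summand can
  be integrated against a density around its own centre.\<close>

lemma Kr_diff_symm:
 assumes r: "r > 0"
 shows "norm (Kr r x - Kr r y) <= norm (x - y) * (1 / (max r (norm x))^2 + 1 / (max r (norm y))^2)"
proof -
 define a where "a = 1 / max r (norm x)"
 define b where "b = 1 / max r (norm y)"
 have "2 * (a * b) <= a^2 + b^2" using sum_squares_bound[of a b] by simp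
 moreover have "a * b >= 0" using r by (auto simp: a_def b_def)
 ultimately have "a * b <= a^2 + b^2" by linarith
 then have "norm (x - y) * (a * b) <= norm (x - y) * (a^2 + b^2)" by (intro mult_left_mono) auto
 then show ?thesis using Kr_diff[OF r, of x y] by (simp add: a_def b_def power_divide)
qed

lemma Kn_meas [measurable]: "Kn : bmeas"
 unfolding Kn_def by measurable
lemma Kr_meas [measurable]: "Kr r : bmeas"
 unfolding Kr_def by measurable
lemma jr_meas [measurable]: "jr r : bmeas"
 unfolding jr_def by measurable
lemma jr_nonneg: "0 <= jr r y" by (simp add: jr_def)

section \<open>Dyadic bounds for integrals over the plane\<close>

lemma emeasure_ball_plane: "r >= 0 ==> emeasure lborel (ball (y::plane) r) = ennreal (pi * r^2)"
 by (simp add: emeasure_ball unit_ball_vol_2)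

lemma suminf_geometric_half: "c >= 0 ==> (\<Sum>n. ennreal (c * (1/2)^n)) = ennreal (2 * c)"
proof -
 assume c: "c >= 0"
 have "(%n. c * (1/2)^n) sums (c * (1 / (1 - 1/2)))" by (intro sums_mult geometric_sums) auto
 then show ?thesis using c by (subst suminf_ennreal2) (auto simp: sums_iff)
qed

lemma ennreal_le_suminf: "(f :: nat => ennreal) n <= (\<Sum>n. f n)"
 using sum_le_suminf[of f "{n}"] by (simp add: summableI)

text \<open>\<open>n\<close> is the least exponent with s <= 2^(n+1). The strict bound in the second
  clause is there to place a point in an open ball.\<close>

lemma power_2_bracket:
 assumes "(1::real) <= s"
 obtains n where "2 ^ n <= s" "1 < s --> 2 ^ n < s" "s <= 2 * 2 ^ n"
proof -
 define n where "n = (LEAST n. s <= 2 * 2 ^ n)"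
 obtain k where "s < 2 ^ k" using real_arch_pow[of 2 s] by auto
 then have "s <= 2 * 2 ^ k" using zero_less_power[of "2::real" k] by linarith
 then have n: "s <= 2 * 2 ^ n" unfolding n_def by (rule LeastI)
 have "n = 0 | 2 ^ n < s"
 proof (cases n)
  case (Suc m)
  then have "~ s <= 2 * 2 ^ m" unfolding n_def using not_less_Least lessI by metis
  then show ?thesis using Suc by simp
 qed simp
 then show thesis using assms n by (intro that[of n]) auto
qed

text \<open>This replaces polar coordinates: the function is dominated by a series of ball
  indicators whose integrals are geometric with ratio 1/2, and the factor 2 is the sum of that
  series.\<close>

lemma nn_integral_dyadic_le:
 fixes y :: plane
 assumes pt: "!!z. EX n. f z <= ennreal (c n) * indicator (ball y (R n)) z"
  and c: "!!n. 0 <= c n" and R: "!!n. 0 <= R n" and C: "0 <= C"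
  and eq: "!!n. c n * (pi * (R n)^2) = C * (1/2)^n"
 shows "(NN z. f z) <= ennreal (2 * C)"
proof -
 let ?F = "%n z. ennreal (c n) * indicator (ball y (R n)) z"
 have "f z <= (\<Sum>n. ?F n z)" for z
  using pt[of z] ennreal_le_suminf[of "%n. ?F n z"] order_trans by blast
 then have "(NN z. f z) <= (NN z. (\<Sum>n. ?F n z))"
  by (rule nn_integral_mono)
 also have "... = (\<Sum>n. NN z. ?F n z)"
  by (rule nn_integral_suminf) (auto intro!: borel_measurable_times_ennreal borel_measurable_indicator)
 also have "... = (\<Sum>n. ennreal (C * (1/2)^n))"
  by (intro arg_cong[where f=suminf] ext, subst nn_integral_cmult_indicator)
    (use R c eq in "auto simp: emeasure_ball_plane ennreal_mult[symmetric]")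
 also have "... = ennreal (2 * C)" using C by (intro suminf_geometric_half) auto
 finally show ?thesis .
qed

lemma weight_ge: "x^2 <= ((1 + norm v) * x)^2" for x :: real and v :: plane
 by (simp add: power_mult_distrib mult_left_le one_le_power mult_right_mono[of 1 _ "x^2", simplified])

lemma nn_integral_jr:
 assumes r: "r > 0"
 shows "(NN z. ennreal (jr r (y - z))) <= ennreal (16 * r)"
proof -
 have "EX n. ennreal (jr r (y - z)) <= ennreal (2 * 2^n / r) * indicator (ball y (r / 2 ^ n)) z" for z
 proof (cases "0 < norm (y - z) & norm (y - z) < r")
  case True
  then obtain n where "2 ^ n < r / norm (y - z)" "r / norm (y - z) <= 2 * 2 ^ n"
   using power_2_bracket[of "r / norm (y - z)"] by auto
  then have "norm (y - z) < r / 2 ^ n" "1 / norm (y - z) <= 2 * 2 ^ n / r"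
   using True r by (auto simp: field_simps)
  then have "ennreal (jr r (y - z)) <= ennreal (2 * 2^n / r) * indicator (ball y (r / 2^n)) z"
   by (auto simp: jr_def dist_norm intro: ennreal_leI)
  then show ?thesis ..
 qed (auto simp: jr_def)
 then have "(NN z. ennreal (jr r (y - z))) <= ennreal (2 * (2 * pi * r))"
  using r by (intro nn_integral_dyadic_le[where c="%n. 2 * 2^n / r" and R="%n. r / 2^n"]) (auto simp: power2_eq_square field_simps power_one_over)
 also have "... <= ennreal (16 * r)" using r pi_less_4 by (intro ennreal_leI) (simp add: mult_right_mono)
 finally show ?thesis .
qed

text \<open>The exponent 3 exceeds the dimension, so 8^-n times the area of a ball of radius 2 * 2^n
  is summable. The centre is arbitrary because densities will concentrate around a velocity that
  depends on time and position.\<close>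

lemma nn_integral_weight3:
 "(\<integral>\<^sup>+v. ennreal (1 / (1 + norm (v - v0)) ^ 3) \<partial>(lborel :: plane measure)) <= ennreal 32"
proof -
 have "EX n. ennreal (1 / (1 + norm (v - v0)) ^ 3) <= ennreal (1 / 8^n) * indicator (ball v0 (2 * 2^n)) v" for v :: plane
 proof -
  define s where "s = 1 + norm (v - v0)"
  have s: "s >= 1" by (simp add: s_def)
  then obtain n where n: "2 ^ n <= s" "s <= 2 * 2 ^ n" by (rule power_2_bracket)
  have "(2 ^ n) ^ 3 <= s ^ 3" using n by (intro power_mono) auto
  then have "8 ^ n <= s ^ 3" by (simp add: power_mult[symmetric] mult.commute[of n]) (simp add: power_mult)
  then have "1 / s ^ 3 <= 1 / 8 ^ n" using s by (intro divide_left_mono) auto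
  moreover have "v : ball v0 (2 * 2 ^ n)" using n by (simp add: s_def dist_norm norm_minus_commute)
  ultimately show ?thesis by (intro exI[of _ n]) (simp add: ennreal_leI s_def)
 qed
 moreover have "1 / 8 ^ n * (pi * (2 * 2 ^ n)^2) = 4 * pi * (1/2)^n" for n
 proof -
  have "(8::real) ^ n = 2 ^ n * (2 ^ n * 2 ^ n)" by (simp add: power_mult_distrib[symmetric])
  then show ?thesis by (simp add: power2_eq_square field_simps power_one_over)
 qed
 ultimately have "(\<integral>\<^sup>+v. ennreal (1 / (1 + norm (v - v0)) ^ 3) \<partial>(lborel :: plane measure)) <= ennreal (2 * (4 * pi))"
  by (intro nn_integral_dyadic_le[where c="%n. 1 / 8^n" and R="%n. 2 * 2^n"]) auto
 also have "... <= ennreal 32" using pi_less_4 by (intro ennreal_leI) simp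
 finally show ?thesis .
qed

section \<open>Profile coordinates and transport\<close>

text \<open>Free motion reads X = cosh t a - exp (-t) c. Dividing by cosh t leaves the coefficient
  exp (-t) / cosh t in front of c, which equals 1 - tanh t.\<close>

definition kap :: "real => real" where "kap t = 1 - tanh t"

lemma kap_eq: "kap t = 2 * exp (- 2 * t) / (1 + exp (- 2 * t))"
proof -
 have "1 + exp (- 2 * t) > 0" by (simp add: add_pos_pos)
 then show ?thesis by (simp add: kap_def tanh_real_altdef field_simps)
qed

lemma kap_cosh: "kap t * cosh t = exp (- t)"
 by (simp add: kap_def tanh_def field_simps cosh_minus_sinh)

lemma kap_pos: "kap t > 0" unfolding kap_eq by (intro divide_pos_pos mult_pos_pos add_pos_pos) auto

lemma kap_le_exp: "kap t <= 2 * exp (- 2 * t)"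
proof -
 have "2 * exp (- 2 * t) / (1 + exp (- 2 * t)) <= 2 * exp (- 2 * t) / 1"
  by (intro divide_left_mono) (auto intro: add_pos_pos)
 then show ?thesis unfolding kap_eq by simp
qed

lemma kap_antimono: "s <= t ==> kap t <= kap s" by (simp add: kap_def)

lemma kap_le1: "t >= 0 ==> kap t <= 1" by (simp add: kap_def)

lemma kap_cont [continuous_intros]: "continuous_on A f ==> continuous_on A (%x. kap (f x))"
 unfolding kap_def by (intro continuous_intros) (auto simp: cosh_real_pos less_imp_neq[symmetric])

lemma kap_meas [measurable]: "kap : bmeas"
 by (intro borel_measurable_continuous_onI continuous_intros)

lemma tanh_lip: "abs (tanh s - tanh t) <= abs (s - (t::real))"
proof -
 have "norm (tanh s - tanh t) <= 1 * norm (s - t)"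
 proof (rule field_differentiable_bound[of UNIV tanh "%x. 1 - tanh x ^ 2"])
  show "(tanh has_field_derivative 1 - (tanh z)^2) (at z within UNIV)" for z :: real
   by (auto intro!: derivative_eq_intros simp: cosh_real_pos less_imp_neq[symmetric])
  show "norm (1 - (tanh z)^2) <= 1" for z :: real
  proof -
   have "abs (tanh z) < 1" using tanh_real_lt_1[of z] tanh_real_gt_neg1[of z] by auto
   then have "(tanh z)^2 <= 1" by (simp add: abs_square_le_1)
   then show ?thesis by simp
  qed
 qed auto
 then show ?thesis by simp
qed

lemma kap_lip: "abs (kap s - kap t) <= abs (s - t)"
 using tanh_lip[of t s] by (simp add: kap_def abs_minus_commute)

definition zc :: "real => phase => plane" where "zc t p = fst p - kap t *R snd p"

text \<open>The direction of the characteristics in (a, c). The ratio \<open>kap t\<close> of its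
  components makes \<open>zc t\<close> unchanged by the force at fixed time: along characteristics
  \<open>zc\<close> moves only through the derivative of \<open>kap\<close>.\<close>

definition Wf :: "(real => plane => plane) => real => phase => phase" where
 "Wf F t p = (kap t *R F t (zc t p), F t (zc t p))"

lemma zc_meas [measurable]: "zc t : bmeas"
 unfolding zc_def by (intro borel_measurable_continuous_onI continuous_intros)

lemma lborel_pres_zc: "lborel_pres (%p::phase. (zc t p, snd p))"
proof -
 have "(%c::plane. - kap t *R c) : bmeas" by measurable
 from lborel_pres_shear_fst[OF this] show ?thesis by (simp add: zc_def)
qed

lemma lborel_pres_unzc: "lborel_pres (%p::phase. (fst p + kap t *R snd p, snd p))"
 by (rule lborel_pres_shear_fst) measurable

text \<open>In the coordinates (\<open>zc\<close>, c) the step adds a function of \<open>zc\<close>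
  to c and leaves \<open>zc\<close> fixed, since the two terms \<open>kap t *R F\<close> cancel. It
  is a shear conjugated by a shear, for any measurable field and any step size.\<close>

lemma lborel_pres_Wf:
 assumes F: "F t : bmeas"
 shows "lborel_pres (%p. p + h *R Wf F t p)"
proof -
 have "(%z. h *R F t z) : bmeas" using F by measurable
 from lborel_pres_comp[OF lborel_pres_unzc lborel_pres_comp[OF lborel_pres_shear_snd[OF this] lborel_pres_zc[of t]], of t]
 show ?thesis by (simp add: Wf_def zc_def algebra_simps plus_prod_def scaleR_prod_def)
qed

lemma norm_Wf:
 assumes "t >= 0" "norm (F t (zc t p)) <= M"
 shows "norm (Wf F t p) <= 2 * M"
proof -
 have "norm (Wf F t p) <= norm (kap t *R F t (zc t p)) + norm (F t (zc t p))"
  unfolding Wf_def by (rule norm_Pair_le)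
 also have "... <= 1 * norm (F t (zc t p)) + norm (F t (zc t p))"
  using kap_le1[OF assms(1)] kap_pos[of t] by (auto intro!: mult_left_le_one_le)
 finally show ?thesis using assms by simp
qed

section \<open>Locally Lipschitz functions of time and position\<close>

definition loclip :: "(real => 'a::real_normed_vector => 'b::real_normed_vector) => bool" where
 "loclip u \<longleftrightarrow> (ALL K. compact K & K <= {0..} \<times> UNIV --> (EX L. L-lipschitz_on K (%(t, p). u t p)))"

lemma loclipD: "loclip u ==> compact K ==> K <= {0..} \<times> UNIV ==> EX L. L-lipschitz_on K (%q. u (fst q) (snd q))"
 by (simp add: loclip_def split_def)

lemma loclipE:
 fixes u :: "real => 'a::euclidean_space => 'b::real_normed_vector"
 assumes "loclip u"
 obtains L where "L >= 0" "!!t t' p p'. t : {0..T} ==> t' : {0..T} ==> norm p <= R ==> norm p' <= R ==>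
   norm (u t p - u t' p') <= L * (abs (t - t') + norm (p - p'))"
proof -
 have "compact ({0..T} \<times> cball (0 :: 'a) R)" by (intro compact_Times) auto
 from loclipD[OF assms this] obtain L where L: "L-lipschitz_on ({0..T} \<times> cball 0 R) (%q. u (fst q) (snd q))" by force
 have "norm (u t p - u t' p') <= L * (abs (t - t') + norm (p - p'))" if "t : {0..T}" "t' : {0..T}" "norm p <= R" "norm p' <= R" for t t' p p'
  using lipschitz_onD[OF L, of "(t, p)" "(t', p')"] that norm_Pair_le[of "t - t'" "p - p'"]
   mult_left_mono[of "norm (t - t', p - p')" "abs (t - t') + norm (p - p')" L] lipschitz_on_nonneg[OF L]
  by (simp add: dist_norm)
 then show thesis using that lipschitz_on_nonneg[OF L] by blast
qed

lemma norm_fst_snd: "norm (fst q) <= norm q" "norm (snd q) <= norm q"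
 by (metis norm_fst_le prod.collapse) (metis norm_snd_le prod.collapse)

lemma loclipI:
 assumes "!!T. EX L. ALL s:{0..T}. ALL s':{0..T}. ALL p p'. norm (u s p - u s' p') <= L * (abs (s - s') + norm (p - p'))"
 shows "loclip u"
 unfolding loclip_def
proof (intro allI impI)
 fix K :: "(real \<times> 'a) set" assume K: "compact K & K <= {0..} \<times> UNIV"
 have "bounded (fst ` K)" using K by (intro compact_imp_bounded compact_continuous_image continuous_intros) auto
 then obtain T where T: "!!q. q : K ==> abs (fst q) <= T" unfolding bounded_iff by auto
 obtain L where L: "ALL s:{0..T}. ALL s':{0..T}. ALL p p'. norm (u s p - u s' p') <= L * (abs (s - s') + norm (p - p'))" using assms by blast
 have "(2 * abs L)-lipschitz_on K (%(t, p). u t p)"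
 proof (rule lipschitz_onI)
  fix q q' assume q: "q : K" "q' : K"
  then have "fst q : {0..T}" "fst q' : {0..T}" using K T[of q] T[of q'] by force+
  then have "norm (u (fst q) (snd q) - u (fst q') (snd q')) <= L * (abs (fst q - fst q') + norm (snd q - snd q'))" using L by blast
  also have "... <= abs L * (2 * norm (q - q'))" using norm_fst_snd[of "q - q'"] by (intro mult_mono) auto
  finally show "dist (case q of (t, p) => u t p) (case q' of (t, p) => u t p) <= 2 * abs L * dist q q'" by (simp add: dist_norm split_def)
 qed simp
 then show "EX L. L-lipschitz_on K (%(t, p). u t p)" ..
qed

text \<open>The graph map sends a compact set to a compact set of the same time range, on which
  \<open>g\<close> is Lipschitz.\<close>

lemma loclip_compose:
 fixes Q :: "real => 'a::real_normed_vector => 'b::real_normed_vector"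
 assumes g: "loclip g" and Q: "loclip Q"
 shows "loclip (%t p. g t (Q t p))"
 unfolding loclip_def
proof (intro allI impI)
 fix K :: "(real \<times> 'a) set" assume K: "compact K & K <= {0..} \<times> UNIV"
 obtain L where "L-lipschitz_on K (%q. Q (fst q) (snd q))" using loclipD[OF Q] K by blast
 moreover have "1-lipschitz_on K fst" by (rule lipschitz_onI) (auto simp: dist_fst_le)
 ultimately obtain M where M: "M-lipschitz_on K (%q. (fst q, Q (fst q) (snd q)))" using lipschitz_on_Pair by blast
 have "compact ((%q. (fst q, Q (fst q) (snd q))) ` K)"
  by (rule compact_continuous_image[OF lipschitz_on_continuous_on[OF M]]) (use K in simp)
 from loclipD[OF g this] obtain L' where "L'-lipschitz_on ((%q. (fst q, Q (fst q) (snd q))) ` K) (%q. g (fst q) (snd q))"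
  using K by force
 from lipschitz_on_compose[OF M this] show "EX L. L-lipschitz_on K (%(t, p). g t (Q t p))" by (auto simp: o_def split_def)
qed

lemma loclip_const:
 fixes f :: "'a::real_normed_vector => 'b::real_normed_vector"
 assumes "!!K. compact K ==> EX L. L-lipschitz_on K f"
 shows "loclip (%t. f)"
 unfolding loclip_def
proof (intro allI impI)
 fix K :: "(real \<times> 'a) set" assume K: "compact K & K <= {0..} \<times> UNIV"
 have "compact (snd ` K)" using K by (intro compact_continuous_image continuous_intros) auto
 then obtain L where "L-lipschitz_on (snd ` K) f" using assms by blast
 moreover have "1-lipschitz_on K snd" by (rule lipschitz_onI) (auto simp: dist_snd_le)
 ultimately have "(L * 1)-lipschitz_on K (f \<circ> snd)" using lipschitz_on_compose by blast
 then show "EX L. L-lipschitz_on K (%(t, p). f p)" by (auto simp: o_def split_def)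
qed

lemma loclip_const_time:
 assumes "!!p p'. norm (f p - f p') <= C * norm (p - p')"
 shows "loclip (%t. f)"
proof (rule loclip_const, rule exI, rule lipschitz_onI)
 show "dist (f p) (f p') <= abs C * dist p p'" for p p'
  using order_trans[OF assms mult_right_mono[OF abs_ge_self norm_ge_zero]] by (simp add: dist_norm)
qed simp

lemma loclip_combine:
 assumes u: "loclip u" and v: "loclip v"
  and comb: "!!K L M. L-lipschitz_on K (%q. u (fst q) (snd q)) ==> M-lipschitz_on K (%q. v (fst q) (snd q)) ==> (h L M)-lipschitz_on K (%q. w (fst q) (snd q))"
 shows "loclip w"
 unfolding loclip_def split_def using loclipD[OF u] loclipD[OF v] comb by metis

lemma loclip_Pair: "loclip u ==> loclip v ==> loclip (%t p. (u t p, v t p))"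
 by (erule loclip_combine[where w="%t p. (u t p, v t p)"], assumption) (rule lipschitz_on_Pair)

lemma loclip_add: "loclip u ==> loclip v ==> loclip (%t p. u t p + v t p)"
 by (erule loclip_combine[where w="%t p. u t p + v t p"], assumption) (rule lipschitz_on_add)

lemma loclip_diff: "loclip u ==> loclip v ==> loclip (%t p. u t p - v t p)"
 by (erule loclip_combine[where w="%t p. u t p - v t p"], assumption) (rule lipschitz_on_diff)

lemma loclip_uminus: "loclip u ==> loclip (%t p. - u t p)"
 unfolding loclip_def split_def by (simp add: lipschitz_on_minus_iff)

lemma loclip_time:
 fixes f :: "real => real"
 assumes d: "!!t. (f has_real_derivative f' t) (at t)" and c: "continuous_on UNIV f'"
 shows "loclip (%t (p::'a::real_normed_vector). f t)"
proof (rule loclipI)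
 fix T :: real
 have "compact (f' ` {0..T})" by (rule compact_continuous_image[OF continuous_on_subset[OF c subset_UNIV] compact_Icc])
 then obtain B where B: "!!t. t : {0..T} ==> norm (f' t) <= B"
  using compact_imp_bounded[of "f' ` {0..T}"] by (metis bounded_iff imageI)
 show "EX L. ALL s:{0..T}. ALL s':{0..T}. ALL (p::'a) p'. norm (f s - f s') <= L * (abs (s - s') + norm (p - p'))"
 proof (intro exI[of _ "abs B"] ballI allI)
  fix s s' and p p' :: 'a assume s: "s : {0..T}" "s' : {0..T}"
  have "norm (f s - f s') <= B * norm (s - s')"
   by (rule field_differentiable_bound[of "{0..T}" f f']) (use s B d in "auto intro: has_field_derivative_at_within")
  also have "... <= abs B * (abs (s - s') + norm (p - p'))" by (intro mult_mono) auto
  finally show "norm (f s - f s') <= abs B * (abs (s - s') + norm (p - p'))" .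
 qed
qed

lemma (in bounded_bilinear) loclip:
 assumes u: "loclip u" and v: "loclip v"
 shows "loclip (%t p. prod (u t p) (v t p))"
proof -
 have "loclip (%t p. (%q. prod (fst q) (snd q)) (u t p, v t p))"
 proof (rule loclip_compose[OF loclip_const loclip_Pair[OF u v]])
  fix K :: "('a \<times> 'b) set" assume "compact K"
  then obtain B where B: "B > 0" "!!q. q : K ==> norm q <= B" using compact_imp_bounded bounded_pos by metis
  obtain C where C: "C > 0" "!!a b. norm (prod a b) <= norm a * norm b * C" using pos_bounded by blast
  have "(2 * B * C)-lipschitz_on K (%q. prod (fst q) (snd q))"
  proof (rule lipschitz_onI)
   fix q q' assume q: "q : K" "q' : K"
   have "prod (fst q) (snd q) - prod (fst q') (snd q') = prod (fst (q - q')) (snd q) + prod (fst q') (snd (q - q'))" by (simp add: diff_left diff_right)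
   also have "norm ... <= norm (q - q') * B * C + B * norm (q - q') * C"
    using B(1) C(1) order_trans[OF norm_fst_snd(1) B(2)[OF q(2)]] order_trans[OF norm_fst_snd(2) B(2)[OF q(1)]] norm_fst_snd[of "q - q'"]
    by (intro norm_triangle_mono order_trans[OF C(2)] mult_mono) auto
   finally show "dist (prod (fst q) (snd q)) (prod (fst q') (snd q')) <= 2 * B * C * dist q q'" by (simp add: dist_norm mult_ac)
  qed (use B C in simp)
  then show "EX L. L-lipschitz_on K (%q. prod (fst q) (snd q))" ..
 qed
 then show ?thesis by simp
qed

lemmas loclip_mult = bounded_bilinear.loclip[OF bounded_bilinear_mult]

lemma loclip_cont:
 fixes u :: "real => 'a::euclidean_space => 'b::real_normed_vector"
 assumes "loclip u" "t >= 0" shows "continuous_on UNIV (u t)"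
proof (rule continuous_at_imp_continuous_on, rule ballI)
 fix x :: 'a
 obtain L where "L >= 0" "!!s s' p p'. s : {0..t} ==> s' : {0..t} ==> norm p <= norm x + 1 ==> norm p' <= norm x + 1 ==>
   norm (u s p - u s' p') <= L * (abs (s - s') + norm (p - p'))" by (rule loclipE[OF assms(1)]) blast
 then have "L-lipschitz_on (cball 0 (norm x + 1)) (u t)" using assms(2)
  by (intro lipschitz_onI) (fastforce simp: dist_norm)+
 then show "isCont (u t) x" by (intro continuous_on_interior[OF lipschitz_on_continuous_on]) auto
qed

lemma loclip_meas: "loclip u ==> t >= 0 ==> (u t :: 'a::euclidean_space => real) : bmeas"
 by (intro borel_measurable_continuous_onI loclip_cont)

text \<open>Compact support makes the Lipschitz bound global: \<open>u\<close> does not change when its argument is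
 projected onto a ball that is larger than the support.\<close>

lemma loclip_support:
 fixes u :: "real => 'a::euclidean_space => 'b::real_normed_vector"
 assumes lip: "loclip u" and t0: "0 <= t0"
  and supp: "!!t p. t : {t0..T} ==> u t p ~= 0 ==> norm p <= R"
 obtains L where "L >= 0" "!!t t' p p'. t : {t0..T} ==> t' : {t0..T} ==> norm (u t p - u t' p') <= L * (abs (t - t') + norm (p - p'))"
proof -
 define B where "B = cball (0::'a) (max R 0 + 1)"
 define c where "c = closest_point B"
 have B: "closed B" "convex B" "B ~= {}" by (auto simp: B_def)
 have cB: "norm (c p) <= max R 0 + 1" for p using closest_point_in_set[OF B(1,3), of p] by (simp add: c_def B_def)
 have uc: "u t p = u t (c p)" if t: "t : {t0..T}" for t p
 proof (cases "p : B")
  case True then show ?thesis by (simp add: c_def closest_point_self)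
 next
  case False
  have "interior B ~= {}" by (simp add: B_def)
  then have "c p : frontier B" unfolding c_def using closest_point_in_rel_frontier[OF B(1,3), of p] False interior_subset[of B]
   by (auto simp: rel_frontier_nonempty_interior affine_hull_nonempty_interior rel_interior_nonempty_interior)
  then have "norm (c p) = max R 0 + 1" by (simp add: B_def)
  then show ?thesis using supp[OF t, of p] supp[OF t, of "c p"] False by (force simp: B_def)
 qed
 obtain L where L: "L >= 0" "!!t t' p p'. t : {0..T} ==> t' : {0..T} ==> norm p <= max R 0 + 1 ==> norm p' <= max R 0 + 1 ==>
   norm (u t p - u t' p') <= L * (abs (t - t') + norm (p - p'))" by (rule loclipE[OF lip]) blast
 have "norm (u t p - u t' p') <= L * (abs (t - t') + norm (p - p'))" if t: "t : {t0..T}" "t' : {t0..T}" for t t' p p'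
 proof -
  have "norm (u t p - u t' p') <= L * (abs (t - t') + norm (c p - c p'))" unfolding uc[OF t(1), of p] uc[OF t(2), of p']
   using L(2) t t0 cB by auto
  also have "... <= L * (abs (t - t') + norm (p - p'))"
   using closest_point_lipschitz[OF B(2,1,3), of p p'] by (intro mult_left_mono L(1)) (auto simp: c_def dist_norm)
  finally show ?thesis .
 qed
 then show thesis using that L(1) by blast
qed

lemma integrable_continuous_support:
 fixes f :: "'a::euclidean_space => real"
 assumes "continuous_on UNIV f" "!!p. f p ~= 0 ==> norm p <= R"
 shows "integrable lborel f"
proof -
 have "integrable lborel (%p. indicator (cball 0 R) p *R f p)"
  by (rule borel_integrable_compact[OF compact_cball continuous_on_subset[OF assms(1) subset_UNIV]])
 moreover have "(%p. indicator (cball 0 R) p *R f p) = f" using assms(2) by (fastforce simp: indicator_def)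
 ultimately show ?thesis by simp
qed

section \<open>Transport inequalities along Euler steps\<close>

text \<open>Increment of \<open>u\<close> over one Euler step of size 1/(n+1) for the
  characteristics driven by \<open>F\<close>. No flow is mentioned, so \<open>F\<close> need not be
  Lipschitz.\<close>

abbreviation inc :: "(real => plane => plane) => (real => phase => real) => real => phase => nat => real" where
 "inc F u t p \<equiv> %n. u (t + 1 / real (Suc n)) (p + (1 / real (Suc n)) *R Wf F t p) - u t p"

text \<open>Fatou's lemma along the Euler step \<open>p + h W\<close>, which preserves Lebesgue measure exactly.\<close>

lemma transport_step:
 fixes u :: "real => phase => real"
 assumes Fm: "F t : bmeas" and Fb: "!!y. norm (F t y) <= M" and t: "t >= 0"
  and lip: "!!t' p p'. t <= t' ==> t' <= t + 1 ==> abs (u t' p' - u t p) <= L * (abs (t' - t) + norm (p' - p))"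
  and ut: "!!t'. t <= t' ==> t' <= t + 1 ==> integrable lborel (u t')"
  and supp: "!!t' p. t <= t' ==> t' <= t + 1 ==> u t' p ~= 0 ==> norm p <= R"
  and km: "k : bmeas" and k0: "!!p. k p >= 0"
  and kint: "(NN p. ennreal (k p)) <= ennreal m" and m: "m >= 0" and b: "b >= 0"
  and ae: "AE p in lborel. rate_le (b * k p) (inc F u t p)"
  and ep: "ep > 0"
 shows "EV n. (LBINT p. u (t + 1 / Suc n) p) - (LBINT p. u t p) <= (b * m + ep) / Suc n"
proof -
 note [measurable] = Fm km
 have M: "M >= 0" using Fb[of 0] norm_ge_zero order_trans by blast
 have L: "L >= 0" using lip[of "t + 1" 0 0] by (simp add: order_trans[OF abs_ge_zero])
 define h where "h = (%n::nat. 1 / real (Suc n))"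
 have h: "h n > 0" "h n <= 1" for n by (auto simp: h_def)
 define W where "W = Wf F t"
 have Wb: "norm (W p) <= 2 * M" for p unfolding W_def by (rule norm_Wf[OF t]) (rule Fb)
 have [measurable]: "u t : bmeas" "u (t + h n) : bmeas" for n
  using ut[of t] ut[of "t + h n"] h[of n] by auto
 define q where "q = (%n p. (u (t + h n) (p + h n *R W p) - u t p) / h n)"
 define C where "C = L * (1 + 2 * M)"
 define B where "B = cball (0::phase) (R + 2 * M)"
 have C: "C >= 0" using L M by (simp add: C_def)
 have Bm [measurable]: "B : sets borel" by (simp add: B_def)
 have pres: "lborel_pres (%p. p + h n *R W p)" for n unfolding W_def by (rule lborel_pres_Wf) (rule Fm)
 have um': "(%p. u (t + h n) (p + h n *R W p)) : bmeas" for n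
  using lborel_pres_measurable[OF pres] by measurable
 note [measurable] = um'
 have qm [measurable]: "q n : bmeas" for n unfolding q_def by measurable
 \<comment> \<open>A step of size at most 1 moves a point by at most \<open>2 * M\<close>, so the
   supports stay in one ball; this provides an integrable majorant independent of n.\<close>
 have qB: "abs (q n p) <= C * indicator B p" for n p
 proof (cases "p : B")
  case True
  have "abs (u (t + h n) (p + h n *R W p) - u t p) <= L * (abs ((t + h n) - t) + norm ((p + h n *R W p) - p))"
   using h[of n] by (intro lip) auto
  also have "... <= L * (h n + h n * (2 * M))" using h[of n] Wb[of p] L by (intro mult_left_mono add_mono) auto
  also have "... = C * h n" by (simp add: C_def algebra_simps)
  finally show ?thesis using h[of n] True by (simp add: q_def field_simps)
 next
  case False
  then have np: "norm p > R + 2 * M" by (simp add: B_def)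
  have "h n * norm (W p) <= 1 * (2 * M)" using h[of n] Wb[of p] by (intro mult_mono) auto
  then have "norm (p + h n *R W p) > R" using np norm_triangle_ineq2[of p "- (h n *R W p)"] h[of n] by auto
  moreover have "norm p > R" using np M by linarith
  ultimately have "u (t + h n) (p + h n *R W p) = 0" "u t p = 0"
   using supp[of "t + h n"] supp[of t p] h[of n] by fastforce+
  then show ?thesis using False by (simp add: q_def)
 qed
 have iB: "integrable lborel (%p. C * indicator B p :: real)" unfolding B_def by (rule integrable_indicator_cball)
 have iq: "integrable lborel (q n)" for n
  by (rule Bochner_Integration.integrable_bound[OF iB]) (use qB[of n] C in auto)
 define Q where "Q = (%n. ((LBINT p. u (t + h n) p) - (LBINT p. u t p)) / h n)"
 have Qq: "(LBINT p. q n p) = Q n" for n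
 proof -
  have ui: "integrable lborel (u (t + h n))" using ut[of "t + h n"] h[of n] by auto
  have "(LBINT p. u (t + h n) (p + h n *R W p)) = (LBINT p. u (t + h n) p)"
   by (rule lborel_pres_integral[OF pres]) measurable
  moreover have "integrable lborel (%p. u (t + h n) (p + h n *R W p))"
   by (subst lborel_pres_integrable[OF pres]) (use ui in auto)
  ultimately show ?thesis unfolding q_def Q_def using ut[of t]
   by (simp add: Bochner_Integration.integral_diff)
 qed
 define V where "V = (LBINT p. C * indicator B p)"
 have nn: "(NN p. ennreal (C * indicator B p - q n p)) = ennreal (V - Q n)" for n
 proof -
  have "(NN p. ennreal (C * indicator B p - q n p)) = ennreal (LBINT p. C * indicator B p - q n p)"
  proof (rule nn_integral_eq_integral)
   show "AE p in lborel. 0 <= C * indicator B p - q n p" using qB[of n] by (auto simp: abs_le_iff intro!: AE_I2)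
  qed (intro Bochner_Integration.integrable_diff iB iq)
  also have "(LBINT p. C * indicator B p - q n p) = V - Q n"
   using Bochner_Integration.integral_diff[OF iB iq] by (simp add: V_def Qq)
  finally show ?thesis .
 qed
 have "ennreal V = (NN p. ennreal (C * indicator B p))"
  unfolding V_def using iB C by (subst nn_integral_eq_integral) auto
 \<comment> \<open>Fatou's lemma is applied to the nonnegative functions
   \<open>C * indicator B p - q n p\<close>; it turns the pointwise bound \<open>b * k p\<close> on
   the limsup of \<open>q n p\<close> into the bound \<open>b * m\<close> on the limsup of the
   integrals.\<close>
 also have "... <= (NN p. liminf (%n. ennreal (C * indicator B p - q n p)) + ennreal b * ennreal (k p))"
 proof (rule nn_integral_mono_AE)
  show "AE p in lborel. ennreal (C * indicator B p) <= liminf (%n. ennreal (C * indicator B p - q n p)) + ennreal b * ennreal (k p)"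
   using ae
  proof eventually_elim
   case (elim p)
   show ?case
   proof (rule ennreal_le_epsilon)
    fix e :: real assume e: "0 < e"
    have "EV n. q n p <= b * k p + e"
     using rate_leD[OF elim e] by eventually_elim (auto simp: q_def h_def W_def field_simps)
    then have "EV n. ennreal (C * indicator B p - (b * k p + e)) <= ennreal (C * indicator B p - q n p)"
     by eventually_elim (auto intro!: ennreal_leI)
    then have 1: "ennreal (C * indicator B p - (b * k p + e)) <= liminf (%n. ennreal (C * indicator B p - q n p))"
     by (rule Liminf_bounded)
    have "ennreal (C * indicator B p) <= ennreal ((C * indicator B p - (b * k p + e)) + (b * k p + e))"
     by simp
    also have "... <= ennreal (C * indicator B p - (b * k p + e)) + ennreal (b * k p + e)"
     using k0[of p] b e by (cases "C * indicator B p - (b * k p + e) >= 0") (auto simp: ennreal_plus[symmetric] ennreal_neg intro!: ennreal_leI simp del: ennreal_plus)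
    also have "... <= liminf (%n. ennreal (C * indicator B p - q n p)) + ennreal (b * k p + e)"
     using 1 by (rule add_right_mono)
    also have "ennreal (b * k p + e) = ennreal b * ennreal (k p) + ennreal e"
     using k0[of p] b e by (simp add: ennreal_mult)
    finally show "ennreal (C * indicator B p) <= liminf (%n. ennreal (C * indicator B p - q n p)) + ennreal b * ennreal (k p) + ennreal e"
     by (simp add: add.assoc)
   qed
  qed
 qed
 also have "... = (NN p. liminf (%n. ennreal (C * indicator B p - q n p))) + ennreal b * (NN p. ennreal (k p))"
  by (subst nn_integral_add) (auto simp: nn_integral_cmult)
 also have "... <= liminf (%n. NN p. ennreal (C * indicator B p - q n p)) + ennreal b * ennreal m"
  by (intro add_mono nn_integral_liminf mult_left_mono kint) auto
 also have "... = liminf (%n. ennreal (V - Q n)) + ennreal (b * m)"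
  unfolding nn using b m by (simp add: ennreal_mult)
 finally have main: "ennreal V <= liminf (%n. ennreal (V - Q n)) + ennreal (b * m)" .
 have V0: "V >= 0" unfolding V_def using C by (intro integral_nonneg_AE) auto
 have QV: "Q n <= V" for n
 proof -
  have "(LBINT p. q n p) <= V" unfolding V_def
   by (intro integral_mono iq iB) (use qB in "auto simp: abs_le_iff")
  then show ?thesis by (simp add: Qq)
 qed
 have "EV n. Q n <= b * m + ep"
 proof (cases "V <= b * m")
  case True
  then show ?thesis using QV ep by (intro always_eventually) (meson add_increasing2 less_imp_le order_trans)
 next
  case False
  then have "ennreal (V - b * m) <= liminf (%n. ennreal (V - Q n))"
   using main V0 b m by (simp add: ennreal_minus[symmetric] ennreal_minus_le_iff add.commute)
  moreover have "ennreal (V - b * m - ep) < ennreal (V - b * m)" using False ep by (intro ennreal_lessI) auto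
  ultimately have "ennreal (V - b * m - ep) < liminf (%n. ennreal (V - Q n))" by (rule less_le_trans[rotated])
  then have "EV n. ennreal (V - b * m - ep) < ennreal (V - Q n)" by (rule less_LiminfD)
  then show ?thesis
  proof eventually_elim
   case (elim n)
   then have "V - b * m - ep < V - Q n" using QV[of n] by (meson ennreal_leI linorder_not_less)
   then show ?case by simp
  qed
 qed
 then show ?thesis
  by eventually_elim (auto simp: Q_def h_def field_simps)
qed

text \<open>Fubini turns the a.e. hypothesis on space-time into one for almost every time, at which
  \<open>transport_step\<close> bounds the right derivative of the integral. Lipschitz continuity of
  the integral in time allows this bound to be integrated.\<close>

lemma transport_ineq:
 fixes u :: "real => phase => real"
 assumes Fm: "!!t. F t : bmeas" and Fb: "!!t y. t >= 0 ==> norm (F t y) <= M"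
  and t01: "0 <= t0" "t0 <= t1" and lip: "loclip u"
  and supp: "!!t p. t0 <= t ==> t <= t1 + 1 ==> u t p ~= 0 ==> norm p <= R"
  and km: "!!t. t0 <= t ==> t <= t1 ==> k t : bmeas" and k0: "!!t p. k t p >= 0"
  and kint: "!!t. t0 <= t ==> t <= t1 ==> (NN p. ennreal (k t p)) <= ennreal m" and m: "m >= 0"
  and b: "continuous_on {t0..t1} b" "!!t. b t >= 0"
  and ae: "AE q in lborel. case q of (t, p) => t0 < t --> t < t1 -->
   rate_le (b t * k t p) (inc F u t p)"
 shows "(LBINT p. u t1 p) - (LBINT p. u t0 p) <= m * integral {t0..t1} b"
proof -
 obtain L where L: "L >= 0" "!!t t' p p'. t : {t0..t1 + 1} ==> t' : {t0..t1 + 1} ==> norm (u t p - u t' p') <= L * (abs (t - t') + norm (p - p'))"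
  by (rule loclip_support[OF lip t01(1), of "t1 + 1" R]) (use supp in auto)
 define I where "I = (%t. LBINT p. u t p)"
 \<comment> \<open>Times are clamped to \<open>{t0..t1 + 1}\<close>: Euler steps look ahead by up to
   1, which is why the support hypothesis reaches \<open>t1 + 1\<close>.\<close>
 define c where "c = (%t. max t0 (min (t1 + 1) t))"
 have cI: "t0 <= c t" "c t <= t1 + 1" for t using t01 by (auto simp: c_def)
 define V where "V = measure lborel (cball (0::phase) R)"
 have ui: "integrable lborel (u t)" if t: "t0 <= t" "t <= t1 + 1" for t
  by (rule integrable_continuous_support[OF loclip_cont[OF lip] supp[OF t]]) (use t t01 in auto)
 have Ilip: "abs (I (c s) - I (c t)) <= (L * V) * abs (s - t)" for s t
 proof -
  have "I (c s) - I (c t) = (LBINT p. u (c s) p - u (c t) p)"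
   unfolding I_def by (rule Bochner_Integration.integral_diff[symmetric]) (intro ui cI)+
  moreover have "norm (LBINT p. u (c s) p - u (c t) p) <= (LBINT p. (L * abs (s - t)) * indicator (cball (0::phase) R) p)"
  proof (rule norm_integral_le_integral[OF integrable_indicator_cball AE_I2])
   fix p :: "phase"
   have "abs (c s - c t) <= abs (s - t)" by (auto simp: c_def)
   from order_trans[OF L(2) mult_left_mono[OF _ L(1)], of "c s" "c t" p p "abs (s - t)"] this
   have "abs (u (c s) p - u (c t) p) <= L * abs (s - t)" using cI by simp
   then show "norm (u (c s) p - u (c t) p) <= (L * abs (s - t)) * indicator (cball 0 R) p"
    using supp[OF cI, of s p] supp[OF cI, of t p] by (cases "u (c s) p = 0"; cases "u (c t) p = 0") (auto split: split_indicator)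
  qed
  moreover have "(LBINT p. (L * abs (s - t)) * indicator (cball (0::phase) R) p) = (L * V) * abs (s - t)"
   by (simp add: V_def)
  ultimately show ?thesis by (simp only: real_norm_def)
 qed
 have ae': "AE t in lborel. AE p in lborel. t0 < t --> t < t1 -->
   rate_le (b t * k t p) (inc F u t p)"
  using lborel_pair.AE_pair[of "%q. case q of (t, p) => t0 < t --> t < t1 -->
   rate_le (b t * k t p) (inc F u t p)"] ae
  unfolding lborel_prod by simp
 have "AE t in lborel. t0 < t --> t < t1 --> rate_le (b t * m) (%n. I (c (t + 1 / Suc n)) - I (c t))"
  using ae'
 proof eventually_elim
  case (elim t)
  show ?case
  proof (intro impI rate_leI)
   fix ep :: real assume t: "t0 < t" "t < t1" and ep: "ep > 0"
   have "EV n. I (t + 1 / Suc n) - I t <= (b t * m + ep) / Suc n"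
    unfolding I_def
   proof (rule transport_step[where F=F and M=M and L=L and R=R and k="k t"])
    show "abs (u t' p' - u t p) <= L * (abs (t' - t) + norm (p' - p))" if "t <= t'" "t' <= t + 1" for t' p p'
     using L(2)[of t' t p' p] that t by auto
    show "norm p <= R" if "t <= t'" "t' <= t + 1" "u t' p ~= 0" for t' p
     by (rule supp) (use that t in auto)
    show "AE p in lborel. rate_le (b t * k t p) (inc F u t p)"
     using elim t by simp
   qed (use t t01 Fm Fb ui km k0 kint m b ep in auto)
   moreover have "c (t + 1 / Suc n) = t + 1 / Suc n" for n
   proof -
    have "1 / real (Suc n) <= 1" "1 / real (Suc n) > 0" by auto
    then show ?thesis using t unfolding c_def by linarith
   qed
   moreover have "c t = t" using t by (simp add: c_def)
   ultimately show "EV n. I (c (t + 1 / Suc n)) - I (c t) <= (b t * m + ep) / Suc n" by simp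
  qed
 qed
 from lipschitz_dini_le[OF Ilip t01(2) _ this]
 have "I (c t1) - I (c t0) <= integral {t0..t1} (%t. b t * m)" using b(1) by (metis continuous_on_mult_right)
 also have "... = m * integral {t0..t1} b" by (simp add: mult.commute)
 finally show ?thesis using t01 by (simp add: I_def c_def)
qed

section \<open>Comparison of solutions\<close>

text \<open>A square with a dead zone. Where it is nonzero its argument exceeds \<open>et\<close>,
  and velocity decay of a solution then bounds the velocity. The cut in value thus replaces a cutoff
  in velocity, and as a function of the solution it is transported without error.\<close>

definition betat :: "real => real => real" where "betat et x = (max 0 (abs x - et))^2"

definition chi :: "real => plane => real" where "chi R a = max 0 (min 1 (2 - norm a / R))"

lemma betat_nonneg: "0 <= betat et x" by (simp add: betat_def)

lemma betat_le: "et >= 0 ==> betat et x <= x^2"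
 using power_mono[of "max 0 (abs x - et)" "abs x" 2] by (simp add: betat_def)

lemma betat_lip:
 assumes "et >= 0" "abs x <= A" "abs y <= A"
 shows "abs (betat et x - betat et y) <= 2 * A * abs (x - y)"
proof -
 define a where "a = max 0 (abs x - et)"
 define b where "b = max 0 (abs y - et)"
 have "abs (a - b) <= abs (x - y)" "0 <= a + b" "a + b <= 2 * A" using assms by (auto simp: a_def b_def)
 then have "(a + b) * abs (a - b) <= 2 * A * abs (x - y)" by (intro mult_mono) auto
 moreover have "betat et x - betat et y = (a + b) * (a - b)"
  by (simp add: betat_def a_def b_def power2_eq_square algebra_simps)
 ultimately show ?thesis using \<open>0 <= a + b\<close> by (simp add: abs_mult)
qed

lemma betat_loclip: "loclip g ==> loclip (%t p. betat et (g t p))"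
proof -
 assume g: "loclip g"
 have "loclip (%t x::real. max 0 (abs x - et))" by (rule loclip_const_time[where C=1]) auto
 from loclip_compose[OF this g] have "loclip (%t p. max 0 (abs (g t p) - et))" .
 from loclip_mult[OF this this] show ?thesis by (simp add: betat_def power2_eq_square)
qed

lemma betat_supp: "betat et x ~= 0 ==> et < abs x" by (auto simp: betat_def)

lemma betat_meas [measurable]: "betat et : bmeas" unfolding betat_def by measurable

lemma betat_lim: "(%n. betat (1 / Suc n) x) ---> x^2"
proof -
 have "(%n. betat (1 / Suc n) x) ---> (max 0 (abs x - 0))^2"
  unfolding betat_def by (intro tendsto_intros LIMSEQ_Suc[OF lim_1_over_n])
 then show ?thesis by simp
qed

lemma chi_bounds: "0 <= chi R a" "chi R a <= 1" by (auto simp: chi_def)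

lemma chi_supp: "R > 0 ==> chi R a ~= 0 ==> norm a <= 2 * R" by (auto simp: chi_def max_def min_def field_simps split: if_splits)

lemma chi_lip: "R > 0 ==> abs (chi R a - chi R b) <= norm (a - b) / R"
proof -
 assume R: "R > 0"
 have "abs (chi R a - chi R b) <= abs (norm a / R - norm b / R)" by (auto simp: chi_def max_def min_def)
 also have "... = abs (norm a - norm b) / R" using R by (simp add: diff_divide_distrib[symmetric])
 also have "... <= norm (a - b) / R" using R norm_triangle_ineq3[of a b] by (intro divide_right_mono) auto
 finally show ?thesis .
qed

lemma chi_meas [measurable]: "chi R : bmeas" unfolding chi_def by measurable

lemma chi_lim: "(%n. chi (Suc n) a) ---> 1"
proof -
 have "(%n. max 0 (min 1 (2 - norm a * (1 / Suc n)))) ---> max 0 (min 1 (2 - norm a * 0))"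
  by (intro tendsto_intros LIMSEQ_Suc[OF lim_1_over_n])
 then show ?thesis by (simp add: chi_def)
qed

lemma chi_fst_loclip: "R > 0 ==> loclip (%t p. chi R (fst (p :: phase)))"
proof (rule loclip_const_time[where C="1/R"])
 fix p p' :: "phase" assume R: "R > 0"
 have "norm (fst p - fst p') <= norm (p - p')" using norm_fst_snd(1)[of "p - p'"] by simp
 then have "norm (fst p - fst p') / R <= norm (p - p') / R" using R by (intro divide_right_mono) auto
 then show "norm (chi R (fst p) - chi R (fst p')) <= 1 / R * norm (p - p')"
  using chi_lip[OF R, of "fst p" "fst p'"] by simp
qed

lemma fst_meas_plane [measurable]: "(fst :: phase => plane) : bmeas"
 by (intro borel_measurable_continuous_onI continuous_intros)
lemma snd_meas_plane [measurable]: "(snd :: phase => plane) : bmeas"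
 by (intro borel_measurable_continuous_onI continuous_intros)

section \<open>Transported functions and the asymptotic frame\<close>

text \<open>Constancy along characteristics to first order, at almost every point of space-time: the
  form in which the equation is available for a solution that is merely Lipschitz.\<close>

definition transported :: "(real => plane => plane) => (real => phase => real) => bool" where
 "transported F g \<longleftrightarrow> loclip g & (AE q in lborel. case q of (t, p) => 0 < t --> rate_le 0 (%n. abs (inc F g t p n)))"

definition fieldbd :: "(real => plane => plane) => real => bool" where
 "fieldbd F M \<longleftrightarrow> (ALL t. F t : bmeas) & (ALL t>=0. ALL y. norm (F t y) <= M)"

lemma fieldbd_nonneg: "fieldbd F M ==> M >= 0"
 unfolding fieldbd_def by (meson norm_ge_zero order_refl order_trans)

text \<open>The three conditions on \<open>E\<close> are difference forms of bounds on
  \<open>E\<close> and on its derivatives of order one and two. All smallness is carried by the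
  single number \<open>e\<close>.\<close>

locale asym =
 fixes lam :: real and E :: "plane => plane" and e :: real
 assumes lam: "abs lam = 1" and e0: "0 < e" and e1: "e <= 1 / 10 ^ 9"
  and Ebd: "norm (E x) <= e"
  and Elip: "norm (E x - E y) <= e * norm (x - y)"
  and E2: "norm (E (x + h + k) - E (x + h) - E (x + k) + E x) <= e * norm h * norm k"
begin

text \<open>The prescribed asymptotic curve with labels (x, v) is a = x, c = v + lam t E(x), which
  is \<open>asy\<close>. \<open>vel\<close> recovers v from (a, c); it, and not c, is the velocity
  in which weights are bounded uniformly in time.\<close>

definition vel :: "real => phase => plane" where "vel t p = snd p - (lam * t) *R E (fst p)"

definition asy :: "real => phase => phase" where "asy t p = (fst p, snd p + (lam * t) *R E (fst p))"

abbreviation "fin g n p \<equiv> g (real n) (asy (real n) p)"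

definition pdec :: "real => (real => phase => real) => bool" where
 "pdec A g \<longleftrightarrow> A >= 0 & (ALL t>=0. ALL p. abs (g t p) <= A / (1 + norm (vel t p)) ^ 4)"

lemma E_cont: "continuous_on A E"
proof -
 have "e-lipschitz_on UNIV E" by (intro lipschitz_onI) (use Elip e0 in "auto simp: dist_norm")
 then show ?thesis using lipschitz_on_continuous_on continuous_on_subset by blast
qed

lemma E_meas [measurable]: "E : bmeas"
 using E_cont by (rule borel_measurable_continuous_onI)

lemma asy_pres: "lborel_pres (asy t)"
proof -
 have "(%x. (lam * t) *R E x) : bmeas" by measurable
 from lborel_pres_shear_snd[OF this] show ?thesis by (simp add: asy_def[abs_def])
qed

lemma asy_meas [measurable]: "asy t : bmeas" by (rule lborel_pres_measurable[OF asy_pres])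

lemma vel_asy [simp]: "vel t (asy t p) = snd p" by (simp add: vel_def asy_def)
lemma fst_asy [simp]: "fst (asy t p) = fst p" by (simp add: asy_def)
lemma asy_vel [simp]: "asy t (fst p, vel t p) = p" by (simp add: vel_def asy_def)

lemma norm_snd_le_vel: "t >= 0 ==> norm (snd p) <= norm (vel t p) + t * e"
proof -
 assume t: "t >= 0"
 have "norm (snd p) = norm (vel t p + (lam * t) *R E (fst p))" by (simp add: vel_def)
 also have "... <= norm (vel t p) + norm ((lam * t) *R E (fst p))" by (rule norm_triangle_ineq)
 also have "norm ((lam * t) *R E (fst p)) <= t * e" using Ebd[of "fst p"] lam t by (simp add: abs_mult mult_left_mono)
 finally show ?thesis by simp
qed

lemma pdec_bd: "pdec A g ==> t >= 0 ==> abs (g t p) <= A"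
proof -
 assume g: "pdec A g" and t: "t >= 0"
 have "(1 + norm (vel t p)) ^ 4 >= 1" by (intro one_le_power) simp
 moreover have "A >= 0" using g by (simp add: pdec_def)
 ultimately have "A / (1 + norm (vel t p)) ^ 4 <= A / 1" using add_pos_nonneg[OF zero_less_one norm_ge_zero[of "vel t p"]] by (intro divide_left_mono) auto
 then show ?thesis using g t unfolding pdec_def by (metis div_by_1 order_trans)
qed

lemma pdec_supp:
 assumes g: "pdec A g" and t: "t >= 0" and et: "et > 0" and gt: "et < abs (g t p)"
 shows "norm (vel t p) <= A / et"
proof -
 have "et < A / (1 + norm (vel t p)) ^ 4" using g t gt unfolding pdec_def by (meson less_le_trans)
 moreover have "(1 + norm (vel t p)) ^ 4 > 0" by (intro zero_less_power add_pos_nonneg) auto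
 ultimately have "et * (1 + norm (vel t p)) ^ 4 < A" by (simp add: pos_less_divide_eq)
 moreover have "1 + norm (vel t p) <= (1 + norm (vel t p)) ^ 4" by (rule self_le_power) auto
 ultimately have "et * (1 + norm (vel t p)) < A" using et by (meson le_less_trans mult_le_cancel_left_pos)
 then have "et * norm (vel t p) <= A" using et by (simp add: distrib_left)
 then show ?thesis using et by (simp add: field_simps)
qed

lemma norm_le_of_cut:
 assumes g: "pdec A g" and t: "t >= 0" "t <= T" and et: "et > 0" and gt: "et < abs (g t p)" and R: "R > 0" and c: "chi R (fst p) ~= 0"
 shows "norm p <= 2 * R + A / et + T * e"
proof -
 have "norm p <= norm (fst p) + norm (snd p)" using norm_Pair_le[of "fst p" "snd p"] by simp
 moreover have "norm (fst p) <= 2 * R" by (rule chi_supp[OF R c])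
 moreover have "norm (snd p) <= norm (vel t p) + t * e" by (rule norm_snd_le_vel[OF t(1)])
 moreover have "norm (vel t p) <= A / et" by (rule pdec_supp[OF g t(1) et gt])
 moreover have "t * e <= T * e" using t e0 by (intro mult_right_mono) auto
 ultimately show ?thesis by linarith
qed

text \<open>The cutoff acts on a, whose speed is \<open>kap t\<close> times the field. The error is
  therefore integrable in time and vanishes as \<open>R\<close> grows.\<close>

lemma chi_step:
 assumes R: "R > 0" and F: "fieldbd F M" and t: "t >= 0"
 shows "abs (chi R (fst (p + (1 / Suc n) *R Wf F t p)) - chi R (fst p)) <= kap t * M / R / Suc n"
proof -
 have "abs (chi R (fst (p + (1 / Suc n) *R Wf F t p)) - chi R (fst p)) <= norm (fst (p + (1 / Suc n) *R Wf F t p) - fst p) / R"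
  by (rule chi_lip[OF R])
 also have "... = kap t * norm (F t (zc t p)) / R / Suc n" using kap_pos[of t] by (simp add: Wf_def)
 also have "... <= kap t * M / R / Suc n"
  using F t kap_pos[of t] R by (intro divide_right_mono mult_left_mono) (auto simp: fieldbd_def)
 finally show ?thesis .
qed

text \<open>A product rule along an Euler step: the factor in \<open>g\<close> contributes nothing
  to first order, the spatial cutoff contributes the term with 1/R, and the test function
  contributes its own rate \<open>b\<close>.\<close>

lemma integral_cut_le:
 assumes F: "fieldbd F M" and g: "transported F g" and dec: "pdec A g"
  and mass: "!!t. t >= 0 ==> (NN p. ennreal ((g t p)^2)) <= ennreal m" and m: "m >= 0"
  and Ps: "loclip Ps" and Psb: "!!t p. t >= 0 ==> abs (Ps t p) <= m0"
  and t01: "0 <= t0" "t0 <= t1" and b: "continuous_on {t0..t1} b" "!!t. b t >= 0"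
  and dPs: "!!t p. t0 < t ==> t < t1 ==> rate_le (b t) (%n. abs (inc F Ps t p n))"
  and et: "et > 0" and R: "R > 0"
 shows "(LBINT p. betat et (g t1 p) * chi R (fst p) * Ps t1 p) - (LBINT p. betat et (g t0 p) * chi R (fst p) * Ps t0 p)
   <= m * integral {t0..t1} (%t. b t + m0 * kap t * M / R)"
proof (rule transport_ineq[where F=F and M=M and R="2 * R + A / et + (t1 + 1) * e" and k="%t p. (g t p)^2"])
 have M: "M >= 0" by (rule fieldbd_nonneg[OF F])
 have m0: "m0 >= 0" using Psb[of 0 0] by linarith
 have A: "A >= 0" using dec by (simp add: pdec_def)
 have gl: "loclip g" using g by (simp add: transported_def)
 show "loclip (%t p. betat et (g t p) * chi R (fst p) * Ps t p)"
  by (intro loclip_mult Ps chi_fst_loclip[OF R] betat_loclip[OF gl])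
 show "norm p <= 2 * R + A / et + (t1 + 1) * e" if "t0 <= t" "t <= t1 + 1" "betat et (g t p) * chi R (fst p) * Ps t p ~= 0" for t p
  by (rule norm_le_of_cut[OF dec _ that(2) et betat_supp R]) (use that t01 in auto)
 show "(%p. (g t p)^2) : bmeas" if "t0 <= t" "t <= t1" for t
  by (intro borel_measurable_power loclip_meas[OF gl]) (use that t01 in auto)
 show "continuous_on {t0..t1} (%t. b t + m0 * kap t * M / R)" using R by (intro continuous_intros b) auto
 show b0: "b t + m0 * kap t * M / R >= 0" for t using b m0 M R kap_pos[of t] by (intro add_nonneg_nonneg) auto
 have "AE q in lborel. case q of (t, p) => 0 < t --> rate_le 0 (%n. abs (inc F g t p n))" using g by (simp add: transported_def)
 then show "AE q in lborel. case q of (t, p) => t0 < t --> t < t1 -->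
   rate_le ((b t + m0 * kap t * M / R) * (g t p)^2) (inc F (%t p. betat et (g t p) * chi R (fst p) * Ps t p) t p)"
 proof (rule AE_mp, intro AE_I2 impI)
  fix q :: "real \<times> phase"
  obtain t p where tp: "q = (t, p)" by (cases q)
  assume "case q of (t, p) => 0 < t --> rate_le 0 (%n. abs (inc F g t p n))"
  then have q: "0 < t ==> rate_le 0 (%n. abs (inc F g t p n))" by (simp add: tp)
  show "case q of (t, p) => t0 < t --> t < t1 -->
   rate_le ((b t + m0 * kap t * M / R) * (g t p)^2) (inc F (%t p. betat et (g t p) * chi R (fst p) * Ps t p) t p)"
   unfolding tp prod.case
  proof (intro impI)
   assume t: "t0 < t" "t < t1"
   have tp0: "t > 0" using t t01 by simp
   have tn: "t + 1 / real (Suc n) >= 0" for n using tp0 by simp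
   define p' where "p' n = p + (1 / real (Suc n)) *R Wf F t p" for n
   define B c psi where "B = betat et (g t p)" and "c = chi R (fst p)" and "psi = Ps t p"
   define B' c' psi' where "B' n = betat et (g (t + 1 / real (Suc n)) (p' n))" and "c' n = chi R (fst (p' n))"
    and "psi' n = Ps (t + 1 / real (Suc n)) (p' n)" for n
   have B0: "0 <= B" "B <= (g t p)^2" unfolding B_def using et by (auto intro: betat_nonneg betat_le)
   have c0: "0 <= c' n" "c' n <= 1" "0 <= c" "c <= 1" for n by (auto simp: c_def c'_def chi_bounds)
   have psi0: "abs (psi' n) <= m0" for n unfolding psi'_def by (rule Psb[OF tn])
   have "rate_le (2 * A * 0) (%n. 2 * A * abs (inc F g t p n))" by (rule rate_le_cmult[OF q[OF tp0]]) (use A in simp)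
   then have "rate_le 0 (%n. abs (B' n - B))"
    unfolding B_def B'_def p'_def by (rule rate_le_mono) (use et tp0 tn in \<open>auto intro!: betat_lip pdec_bd[OF dec] simp del: of_nat_Suc\<close>)
   moreover have "abs (c' n * psi' n) <= m0" for n using mult_mono[OF c0(2)[of n] psi0[of n]] c0(1)[of n] by (simp add: abs_mult)
   ultimately have r1: "rate_le 0 (%n. abs ((B' n - B) * (c' n * psi' n)))" by (rule rate_le_bounded_mult)
   have r2: "rate_le (B * (kap t * M / R) * m0) (%n. abs (B * (c' n - c) * psi' n))"
   proof (rule rate_le_const)
    fix n
    have "abs (B * (c' n - c) * psi' n) <= B * (kap t * M / R / Suc n) * m0" unfolding abs_mult abs_of_nonneg[OF B0(1)]
     using chi_step[OF R F, of t p n] tp0 B0 m0 psi0[of n] kap_pos[of t] M R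
     by (intro mult_mono mult_left_mono) (auto simp: c'_def c_def p'_def simp del: of_nat_Suc)
    then show "abs (B * (c' n - c) * psi' n) <= B * (kap t * M / R) * m0 / Suc n" by simp
   qed
   have r3: "rate_le (B * c * b t) (%n. B * c * abs (psi' n - psi))"
    using rate_le_cmult[OF dPs[OF t], where c="B * c"] B0 c0 by (simp add: psi'_def psi_def p'_def)
   have "rate_le ((b t + m0 * kap t * M / R) * (g t p)^2) (%n. B' n * c' n * psi' n - B * c * psi)"
   proof (rule rate_le_mono[OF rate_le_add[OF rate_le_add[OF r1 r2] r3]])
    fix n
    have "B' n * c' n * psi' n - B * c * psi = (B' n - B) * (c' n * psi' n) + B * (c' n - c) * psi' n + B * c * (psi' n - psi)"
     by (simp add: algebra_simps)
    also have "B * c * (psi' n - psi) <= B * c * abs (psi' n - psi)" using B0 c0 by (intro mult_left_mono) auto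
    finally show "B' n * c' n * psi' n - B * c * psi <= abs ((B' n - B) * (c' n * psi' n)) + abs (B * (c' n - c) * psi' n) + B * c * abs (psi' n - psi)" by linarith
    have "0 + B * (kap t * M / R) * m0 + B * c * b t <= B * (kap t * M / R) * m0 + B * 1 * b t"
     by (intro add_mono mult_right_mono mult_left_mono) (use B0 c0 b(2) in auto)
    also have "... = (b t + m0 * kap t * M / R) * B" by (simp add: algebra_simps)
    also have "... <= (b t + m0 * kap t * M / R) * (g t p)^2" by (rule mult_left_mono[OF B0(2) b0])
    finally show "0 + B * (kap t * M / R) * m0 + B * c * b t <= (b t + m0 * kap t * M / R) * (g t p)^2" .
   qed
   then show "rate_le ((b t + m0 * kap t * M / R) * (g t p)^2) (inc F (%t p. betat et (g t p) * chi R (fst p) * Ps t p) t p)"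
    by (simp add: B_def B'_def c_def c'_def psi_def psi'_def p'_def)
  qed
 qed
qed (use F mass m t01 in "auto simp: fieldbd_def")

end

section \<open>Conservation of mass and strong convergence at infinity\<close>

lemma continuous_AE_zero:
 fixes f :: "'a::euclidean_space => real"
 assumes c: "continuous_on UNIV f" and ae: "AE x in lborel. f x = 0"
 shows "f x = 0"
proof -
 have o: "open {x. f x ~= 0}" using open_Collect_neq[OF c continuous_on_const] by simp
 have "{x. f x ~= 0} : null_sets lborel" using ae o by (subst (asm) AE_iff_null) auto
 then have "negligible {x. f x ~= 0}" using negligible_iff_null_sets null_sets_completionI by blast
 then have "{x. f x ~= 0} = {}" using open_not_negligible[OF o] by blast
 then show ?thesis by blast
qed

lemma integral_kap_le: "0 <= s ==> s <= t ==> integral {s..t} kap <= exp (- 2 * s)"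
proof -
 assume st: "0 <= s" "s <= t"
 have 1: "((%r. 2 * exp (- 2 * r)) has_integral (- exp (- 2 * t) - (- exp (- 2 * s)))) {s..t}"
  by (rule fundamental_theorem_of_calculus[OF st(2)])
   (auto intro!: derivative_eq_intros simp: has_real_derivative_iff_has_vector_derivative[symmetric])
 have "(kap has_integral integral {s..t} kap) {s..t}"
  by (intro integrable_integral integrable_continuous_interval continuous_intros)
 from has_integral_le[OF this 1] have "integral {s..t} kap <= - exp (- 2 * t) - (- exp (- 2 * s))"
  using kap_le_exp by auto
 then show ?thesis using exp_gt_zero[of "- 2 * t"] by linarith
qed

lemma integrable_sq_of_nn:
 fixes f :: "'a::euclidean_space => real"
 assumes f: "f : bmeas" and le: "(NN p. ennreal ((f p)^2)) <= ennreal m"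
 shows "integrable lborel (%p. (f p)^2)"
proof (rule integrableI_bounded)
 have "(NN p. ennreal (norm ((f p)^2))) <= ennreal m" using le by simp
 then show "(NN p. ennreal (norm ((f p)^2))) < \<infinity>" using ennreal_less_top le_less_trans by fastforce
qed (use f in measurable)

locale sol = asym lam E e for lam E e +
 fixes F :: "real => plane => plane" and g :: "real => phase => real"
  and M A m :: real and mu :: "phase => real"
 assumes F: "fieldbd F M" and tr: "transported F g" and dec: "pdec A g"
  and mass: "t >= 0 ==> (NN p. ennreal ((g t p)^2)) <= ennreal m" and m: "m >= 0"
  and mum: "mu : bmeas" and mumass: "(NN p. ennreal ((mu p)^2)) <= ennreal m"
  and conv: "(%n. fin g n p) ---> mu p"
begin

lemma M0: "M >= 0" by (rule fieldbd_nonneg[OF F])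
lemma A0: "A >= 0" using dec by (simp add: pdec_def)
lemma gl: "loclip g" using tr by (simp add: transported_def)
lemma gm: "t >= 0 ==> g t : bmeas"
 by (rule loclip_meas[OF gl])
lemma gint: "t >= 0 ==> integrable lborel (%p. (g t p)^2)"
 by (rule integrable_sq_of_nn[OF gm mass])
lemma muint: "integrable lborel (%p. (mu p)^2)"
 by (rule integrable_sq_of_nn[OF mum mumass])
lemma gint_le: "t >= 0 ==> (LBINT p. (g t p)^2) <= m"
 using mass[of t] m by (simp add: nn_integral_eq_integral[OF gint])

lemma cut_limit:
 assumes f: "f : bmeas" "integrable lborel (%p. (f p)^2)" and psi: "psi : bmeas" "!!p. abs (psi p) <= B"
 shows "(%n. LBINT p. betat (1 / Suc n) (f p) * chi (Suc n) (fst (p :: phase)) * psi p) ---> (LBINT p. (f p)^2 * psi p)"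
proof (rule integral_dominated_convergence[where w="%p. (f p)^2 * B"])
 note [measurable] = f(1) psi(1)
 show "(%p. (f p)^2 * psi p) : borel_measurable lborel" by measurable
 show "(%p. betat (1 / Suc n) (f p) * chi (Suc n) (fst p) * psi p) : borel_measurable lborel" for n by measurable
 show "integrable lborel (%p. (f p)^2 * B)" using f(2) by auto
 show "AE p in lborel. (%n. betat (1 / Suc n) (f p) * chi (Suc n) (fst p) * psi p) ---> (f p)^2 * psi p"
 proof (rule AE_I2)
  fix p
  have "(%n. betat (1 / Suc n) (f p) * chi (Suc n) (fst p) * psi p) ---> (f p)^2 * 1 * psi p"
   by (intro tendsto_intros betat_lim chi_lim)
  then show "(%n. betat (1 / Suc n) (f p) * chi (Suc n) (fst p) * psi p) ---> (f p)^2 * psi p" by simp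
 qed
 show "AE p in lborel. norm (betat (1 / Suc n) (f p) * chi (Suc n) (fst p) * psi p) <= (f p)^2 * B" for n
 proof (rule AE_I2)
  fix p
  have "betat (1 / Suc n) (f p) * chi (Suc n) (fst p) * abs (psi p) <= (f p)^2 * 1 * B"
   using psi(2)[of p] by (intro mult_mono betat_le chi_bounds) (auto intro: betat_nonneg chi_bounds mult_nonneg_nonneg)
  then show "norm (betat (1 / Suc n) (f p) * chi (Suc n) (fst p) * psi p) <= (f p)^2 * B"
   by (simp add: abs_mult betat_nonneg chi_bounds)
 qed
qed

lemma integral_sq_test_le:
 assumes Ps: "loclip Ps" and Psb: "!!t p. t >= 0 ==> abs (Ps t p) <= m0"
  and t01: "0 <= t0" "t0 <= t1" and b: "continuous_on {t0..t1} b" "!!t. b t >= 0"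
  and dPs: "!!t p. t0 < t ==> t < t1 ==> rate_le (b t) (%n. abs (inc F Ps t p n))"
 shows "(LBINT p. (g t1 p)^2 * Ps t1 p) - (LBINT p. (g t0 p)^2 * Ps t0 p) <= m * integral {t0..t1} b"
proof (rule LIMSEQ_le)
 have Psm: "Ps t : bmeas" if "t >= 0" for t
  by (rule loclip_meas[OF Ps that])
 have t1: "t1 >= 0" using t01 by simp
 show "(%n. (LBINT p. betat (1 / Suc n) (g t1 p) * chi (Suc n) (fst p) * Ps t1 p) - (LBINT p. betat (1 / Suc n) (g t0 p) * chi (Suc n) (fst p) * Ps t0 p))
  ---> (LBINT p. (g t1 p)^2 * Ps t1 p) - (LBINT p. (g t0 p)^2 * Ps t0 p)"
  by (intro tendsto_diff cut_limit[where B=m0] gm gint Psm Psb t1 t01)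
 have "integral {t0..t1} (%t. b t + m0 * kap t * M / Suc n) = integral {t0..t1} b + (1 / Suc n) * integral {t0..t1} (%t. m0 * kap t * M)" for n
 proof -
  have "integral {t0..t1} (%t. b t + m0 * kap t * M / Suc n) = integral {t0..t1} b + integral {t0..t1} (%t. (1 / Suc n) * (m0 * kap t * M))"
   by (subst Henstock_Kurzweil_Integration.integral_add[symmetric]) (auto intro!: integrable_continuous_interval continuous_intros b)
  then show ?thesis by (simp only: integral_mult_right)
 qed
 then have "(%n. m * integral {t0..t1} (%t. b t + m0 * kap t * M / Suc n)) = (%n. m * (integral {t0..t1} b + (1 / Suc n) * integral {t0..t1} (%t. m0 * kap t * M)))" by simp
 moreover have "... ---> m * (integral {t0..t1} b + 0 * integral {t0..t1} (%t. m0 * kap t * M))"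
  by (intro tendsto_intros LIMSEQ_Suc[OF lim_1_over_n])
 ultimately show "(%n. m * integral {t0..t1} (%t. b t + m0 * kap t * M / Suc n)) ---> m * integral {t0..t1} b" by simp
 show "EX N. ALL n>=N. (LBINT p. betat (1 / Suc n) (g t1 p) * chi (Suc n) (fst p) * Ps t1 p) - (LBINT p. betat (1 / Suc n) (g t0 p) * chi (Suc n) (fst p) * Ps t0 p)
  <= m * integral {t0..t1} (%t. b t + m0 * kap t * M / Suc n)"
  by (intro exI allI impI integral_cut_le[OF F tr dec mass m Ps Psb t01 b dPs]) auto
qed

lemma integral_sq_test_abs:
 assumes Ps: "loclip Ps" and Psb: "!!t p. t >= 0 ==> abs (Ps t p) <= m0"
  and t01: "0 <= t0" "t0 <= t1" and b: "continuous_on {t0..t1} b" "!!t. b t >= 0"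
  and dPs: "!!t p. t0 < t ==> t < t1 ==> rate_le (b t) (%n. abs (inc F Ps t p n))"
 shows "abs ((LBINT p. (g t1 p)^2 * Ps t1 p) - (LBINT p. (g t0 p)^2 * Ps t0 p)) <= m * integral {t0..t1} b"
proof -
 have "(LBINT p. (g t1 p)^2 * - Ps t1 p) - (LBINT p. (g t0 p)^2 * - Ps t0 p) <= m * integral {t0..t1} b"
  by (rule integral_sq_test_le[OF loclip_uminus[OF Ps] _ t01 b])
   (use Psb dPs in \<open>auto simp: abs_minus_commute\<close>)
 then show ?thesis using integral_sq_test_le[OF assms] by simp
qed

text \<open>Pulled back by \<open>asy\<close>, the functions have support in one fixed ball, because
  \<open>vel\<close> becomes the plain velocity. Dominated convergence then applies.\<close>

lemma cut_conv:
 assumes et: "et > 0" and R: "R > 0"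
 shows "(%n. LBINT p. betat et (g (real n) p) * chi R (fst p)) ---> (LBINT p. betat et (mu p) * chi R (fst p))"
proof -
 note [measurable] = mum
 have gn [measurable]: "g (real n) : bmeas" for n by (rule gm) simp
 have ga [measurable]: "(%p. fin g n p) : bmeas" for n
  using gn asy_meas by measurable
 have bc: "isCont (betat et) x" for x unfolding betat_def by (intro continuous_intros)
 have "(LBINT p. betat et (g (real n) p) * chi R (fst p)) = (LBINT p. betat et (fin g n p) * chi R (fst p))" for n
 proof -
  have "(%p. betat et (g (real n) p) * chi R (fst p)) : bmeas" by measurable
  from lborel_pres_integral[OF asy_pres this, of "real n"] show ?thesis by simp
 qed
 moreover have "(%n. LBINT p. betat et (fin g n p) * chi R (fst p)) ---> (LBINT p. betat et (mu p) * chi R (fst p))"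
 proof (rule integral_dominated_convergence[where w="%p. A^2 * indicator (cball 0 (2 * R + A / et)) p"])
  show "integrable lborel (%p::phase. A^2 * indicator (cball 0 (2 * R + A / et)) p :: real)" by (rule integrable_indicator_cball)
  show "AE p in lborel. (%n. betat et (fin g n p) * chi R (fst p)) ---> betat et (mu p) * chi R (fst p)"
   by (intro AE_I2 tendsto_mult_right isCont_tendsto_compose[OF bc] conv)
  show "AE p in lborel. norm (betat et (fin g n p) * chi R (fst p)) <= A^2 * indicator (cball 0 (2 * R + A / et)) p" for n
  proof (rule AE_I2)
   fix p
   have b: "betat et (fin g n p) * chi R (fst p) <= A^2 * 1"
   proof (intro mult_mono chi_bounds)
    have "betat et (fin g n p) <= (fin g n p)^2" using et by (intro betat_le) auto
    also have "... <= A^2" using pdec_bd[OF dec, of "real n" "asy (real n) p"] A0 by (simp add: abs_le_square_iff[symmetric])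
    finally show "betat et (fin g n p) <= A^2" .
   qed auto
   show "norm (betat et (fin g n p) * chi R (fst p)) <= A^2 * indicator (cball 0 (2 * R + A / et)) p"
   proof (cases "betat et (fin g n p) = 0 | chi R (fst p) = 0")
    case False
    have "norm (snd p) <= A / et"
     using pdec_supp[OF dec _ et betat_supp, of "real n" "asy (real n) p"] False by simp
    moreover have "norm (fst p) <= 2 * R" using chi_supp[OF R] False by blast
    ultimately have "norm p <= 2 * R + A / et" using norm_Pair_le[of "fst p" "snd p"] by simp
    then show ?thesis using b by (simp add: abs_mult betat_nonneg chi_bounds)
   qed auto
  qed
 qed measurable
 ultimately show ?thesis by simp
qed

text \<open>With fixed cutoffs the integral changes by at most m M / R over any time interval, as
  \<open>kap\<close> has integral at most 1. Letting the later time tend to infinity before the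
  cutoffs are removed rules out any loss of mass.\<close>

lemma mass_eq: assumes t: "t >= 0" shows "(LBINT p. (g t p)^2) = (LBINT p. (mu p)^2)"
proof -
 have one: "loclip (%t p. 1 :: real)" by (rule loclip_const_time[where C=0]) auto
 have step: "abs ((LBINT p. betat et (g s p) * chi R (fst p)) - (LBINT p. betat et (g t p) * chi R (fst p))) <= m * M / R"
  if et: "et > 0" and R: "R > 0" and s: "s >= t" for et R s
 proof -
  have kI: "integral {t..s} kap <= 1" using integral_kap_le[OF t s] exp_le_one_iff[of "- 2 * t"] t by linarith
  have c: "m * integral {t..s} (%t. 0 + abs x * kap t * M / R) <= m * M / R" if "abs x = 1" for x :: real
  proof -
   have "integral {t..s} (%t. 0 + abs x * kap t * M / R) = integral {t..s} (%t. (M / R) * kap t)" using that by (simp add: mult.commute)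
   also have "... = (M / R) * integral {t..s} kap" by (rule integral_mult_right)
   also have "... <= (M / R) * 1" using kI M0 R by (intro mult_left_mono) auto
   finally show ?thesis using mult_left_mono[OF _ m] by fastforce
  qed
  have 1: "(LBINT p. betat et (g s p) * chi R (fst p) * 1) - (LBINT p. betat et (g t p) * chi R (fst p) * 1) <= m * integral {t..s} (%t. 0 + abs 1 * kap t * M / R)"
   by (rule integral_cut_le[OF F tr dec mass m one _ t s _ _ _ et R]) (auto intro: rate_le_const)
  have 2: "(LBINT p. betat et (g s p) * chi R (fst p) * - 1) - (LBINT p. betat et (g t p) * chi R (fst p) * - 1) <= m * integral {t..s} (%t. 0 + abs (- 1) * kap t * M / R)"
   by (rule integral_cut_le[OF F tr dec mass m loclip_uminus[OF one] _ t s _ _ _ et R]) (auto intro: rate_le_const)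
  show ?thesis using order_trans[OF 1 c[of 1]] order_trans[OF 2 c[of "-1"]] by auto
 qed
 have lim: "abs ((LBINT p. betat et (mu p) * chi R (fst p)) - (LBINT p. betat et (g t p) * chi R (fst p))) <= m * M / R"
  if et: "et > 0" and R: "R > 0" for et R
 proof (rule tendsto_upperbound[OF tendsto_rabs[OF tendsto_diff[OF cut_conv[OF et R] tendsto_const]]])
  obtain N :: nat where "t <= real N" using real_arch_simple by blast
  then show "EV n. abs ((LBINT p. betat et (g (real n) p) * chi R (fst p)) - (LBINT p. betat et (g t p) * chi R (fst p))) <= m * M / R"
   unfolding eventually_sequentially by (intro exI[of _ N]) (auto intro!: step[OF et R])
 qed simp
 have "abs ((LBINT p. (mu p)^2 * 1) - (LBINT p. (g t p)^2 * 1)) <= m * M * 0"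
 proof (rule LIMSEQ_le)
  show "(%n. abs ((LBINT p. betat (1 / Suc n) (mu p) * chi (Suc n) (fst p) * 1) - (LBINT p. betat (1 / Suc n) (g t p) * chi (Suc n) (fst p) * 1)))
   ---> (abs ((LBINT p. (mu p)^2 * 1) - (LBINT p. (g t p)^2 * 1)))"
   by (intro tendsto_rabs tendsto_diff cut_limit[where B=1] gm[OF t] gint[OF t] mum muint) auto
  show "(%n. m * M * (1 / real (Suc n))) ---> m * M * 0"
   by (intro tendsto_intros LIMSEQ_Suc[OF lim_1_over_n])
  show "EX N. ALL n>=N. abs ((LBINT p. betat (1 / Suc n) (mu p) * chi (Suc n) (fst p) * 1) - (LBINT p. betat (1 / Suc n) (g t p) * chi (Suc n) (fst p) * 1)) <= m * M * (1 / real (Suc n))"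
  proof (intro exI[of _ 0] allI impI)
   fix n :: nat
   show "abs ((LBINT p. betat (1 / Suc n) (mu p) * chi (Suc n) (fst p) * 1) - (LBINT p. betat (1 / Suc n) (g t p) * chi (Suc n) (fst p) * 1)) <= m * M * (1 / real (Suc n))"
    using lim[of "1 / Suc n" "real (Suc n)"] by simp
  qed
 qed
 then show ?thesis by simp
qed

text \<open>Scheffe's lemma: pointwise convergence and equal masses give convergence in L^1.
  Pointwise convergence alone would allow part of the density to escape.\<close>

lemma L1_conv: "(%n. LBINT p. abs ((fin g n p)^2 - (mu p)^2)) ---> 0"
proof -
 note [measurable] = mum
 have gn [measurable]: "g (real n) : bmeas" for n by (rule gm) simp
 have ga [measurable]: "(%p. fin g n p) : bmeas" for n
  using gn asy_meas by measurable
 have sqm: "(%p. (g (real n) p)^2) : bmeas" for n by measurable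
 have gi: "integrable lborel (%p. (fin g n p)^2)" for n
  using lborel_pres_integrable[OF asy_pres sqm] gint[of "real n"] by simp
 have eq: "(LBINT p. (fin g n p)^2) = (LBINT p. (mu p)^2)" for n
  using lborel_pres_integral[OF asy_pres sqm] mass_eq[of "real n"] by simp
 have "(%n. NN p. norm ((fin g n p)^2 - (mu p)^2)) ---> 0"
 proof (rule Scheffe_lemma2)
  show "(%p. (fin g n p)^2) : borel_measurable lborel" for n by measurable
  show "integrable lborel (%p. (mu p)^2)" by (rule muint)
  show "AE p in lborel. (%n. (fin g n p)^2) ---> (mu p)^2"
   by (intro AE_I2 tendsto_intros conv)
  have "(NN p. norm ((fin g n p)^2)) = ennreal (LBINT p. (fin g n p)^2)" for n
   using gi by (subst nn_integral_eq_integral) auto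
  moreover have "(NN p. norm ((mu p)^2)) = ennreal (LBINT p. (mu p)^2)"
   using muint by (subst nn_integral_eq_integral) auto
  ultimately show "(NN p. norm ((fin g n p)^2)) <= (NN p. norm ((mu p)^2))" for n
   by (simp add: eq)
 qed
 moreover have "(NN p. norm ((fin g n p)^2 - (mu p)^2)) = ennreal (LBINT p. abs ((fin g n p)^2 - (mu p)^2))" for n
  using gi muint by (subst nn_integral_eq_integral) auto
 ultimately have "(%n. ennreal (LBINT p. abs ((fin g n p)^2 - (mu p)^2))) ---> ennreal 0" by simp
 then show ?thesis by (subst (asm) tendsto_ennreal_iff) (auto intro: always_eventually)
qed

text \<open>Up to time n the integral drifts by at most \<open>m * U\<close>, and L^1 convergence
  replaces the density at time n by the final one. The test function itself need not
  converge.\<close>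

lemma integral_sq_test_lim:
 assumes Ps: "loclip Ps" and Psb: "!!t p. t >= 0 ==> abs (Ps t p) <= m0"
  and t0: "0 <= t0" and b: "continuous_on UNIV b" "!!t. b t >= 0"
  and bU: "!!s. t0 <= s ==> integral {t0..s} b <= U"
  and dPs: "!!t p. t0 < t ==> rate_le (b t) (%n. abs (inc F Ps t p n))"
  and ep: "ep > 0"
 shows "EV n. abs ((LBINT p. (g t0 p)^2 * Ps t0 p) - (LBINT p. (mu p)^2 * fin Ps n p)) <= m * U + ep"
proof -
 note [measurable] = mum
 have m0: "m0 >= 0" using Psb[of 0 0] by linarith
 have gn [measurable]: "g (real n) : bmeas" for n by (rule gm) simp
 have ga [measurable]: "(%p. fin g n p) : bmeas" for n
  using gn asy_meas by measurable
 have Psm [measurable]: "Ps (real n) : bmeas" for n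
  by (rule loclip_meas[OF Ps]) simp
 have Psa [measurable]: "(%p. fin Ps n p) : bmeas" for n
  using Psm asy_meas by measurable
 have sqm: "(%p. (g (real n) p)^2) : bmeas" for n by measurable
 have gi: "integrable lborel (%p. (fin g n p)^2)" for n
  using lborel_pres_integrable[OF asy_pres sqm] gint[of "real n"] by simp
 have bi: "integrable lborel (%p. f p * fin Ps n p)" if f: "integrable lborel f" "f : bmeas" for f n
 proof (rule Bochner_Integration.integrable_bound[where f="%p. abs (f p) * m0"])
  show "integrable lborel (%p. abs (f p) * m0)" using f by auto
  show "(%p. f p * fin Ps n p) : borel_measurable lborel" using f(2) Psa[of n] by simp
  show "AE p in lborel. norm (f p * fin Ps n p) <= norm (abs (f p) * m0)"
   using Psb[of "real n"] m0 by (intro AE_I2) (simp add: abs_mult mult_left_mono)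
 qed
 have "EV n. (LBINT p. abs ((fin g n p)^2 - (mu p)^2)) < ep / (m0 + 1)"
  using L1_conv ep m0 by (intro order_tendstoD(2)) auto
 moreover have "EV n. t0 <= real n" using filterlim_real_sequentially by (simp add: filterlim_at_top)
 ultimately show ?thesis
 proof eventually_elim
  case (elim n)
  have 1: "abs ((LBINT p. (g (real n) p)^2 * Ps (real n) p) - (LBINT p. (g t0 p)^2 * Ps t0 p)) <= m * U"
  proof -
   have "abs ((LBINT p. (g (real n) p)^2 * Ps (real n) p) - (LBINT p. (g t0 p)^2 * Ps t0 p)) <= m * integral {t0..real n} b"
    by (rule integral_sq_test_abs[OF Ps Psb t0 elim(2) _ b(2) dPs]) (use b(1) continuous_on_subset in auto)
   also have "... <= m * U" using bU[OF elim(2)] m by (rule mult_left_mono)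
   finally show ?thesis .
  qed
  have "(%p. (g (real n) p)^2 * Ps (real n) p) : bmeas" by measurable
  from lborel_pres_integral[OF asy_pres this, of "real n"]
  have 2: "(LBINT p. (g (real n) p)^2 * Ps (real n) p) = (LBINT p. (fin g n p)^2 * fin Ps n p)" by simp
  have "(LBINT p. (fin g n p)^2 * fin Ps n p) - (LBINT p. (mu p)^2 * fin Ps n p)
    = (LBINT p. (fin g n p)^2 * fin Ps n p - (mu p)^2 * fin Ps n p)"
   by (rule Bochner_Integration.integral_diff[symmetric]; rule bi) (use gi muint in measurable)
  also have "abs ... <= (LBINT p. abs ((fin g n p)^2 - (mu p)^2) * m0)"
   unfolding real_norm_def[symmetric]
  proof (rule norm_integral_le_integral)
   show "integrable lborel (%p. norm ((fin g n p)^2 - (mu p)^2) * m0)" using gi muint by auto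
   show "AE p in lborel. norm ((fin g n p)^2 * fin Ps n p - (mu p)^2 * fin Ps n p) <= norm ((fin g n p)^2 - (mu p)^2) * m0"
    unfolding left_diff_distrib[symmetric] norm_mult using Psb by (intro AE_I2 mult_left_mono) auto
  qed
  also have "... = (LBINT p. abs ((fin g n p)^2 - (mu p)^2)) * m0" by simp
  also have "... <= ep / (m0 + 1) * m0" using elim(1) m0 by (intro mult_right_mono) auto
  also have "... <= ep" using m0 ep by (simp add: field_simps)
  finally show ?case using 1 2 by linarith
 qed
qed

end

section \<open>A comparison principle with data at infinity\<close>

context asym
begin

text \<open>A maximum principle from infinity. \<open>U t\<close> is the integral of the admissible
  rate over [t, infinity), so the positive part of |w| - U - et does not decrease to first order
  along Euler steps. Its cut-off integral at time t is at most that at a later time plus O(1/R), and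
  the later ones tend to 0.\<close>

lemma comparison:
 assumes F: "fieldbd F M" and wl: "loclip w" and dec: "pdec A w"
  and mass: "!!t. t >= 0 ==> (NN p. ennreal ((w t p)^2)) <= ennreal m" and m: "m >= 0"
  and conv: "!!p. (%n. fin w n p) ---> 0"
  and D: "D >= 0" and nu: "nu > 0"
  and ae: "AE q in lborel. case q of (t, p) => 0 < t --> rate_le (D * exp (- (nu * t))) (%n. abs (inc F w t p n))"
  and t: "t >= 0"
 shows "abs (w t p) <= D / nu * exp (- (nu * t))"
proof (rule field_le_epsilon)
 fix et :: real assume et: "et > 0"
 have M: "M >= 0" by (rule fieldbd_nonneg[OF F])
 have A: "A >= 0" using dec by (simp add: pdec_def)
 define U where "U = (%t. D / nu * exp (- (nu * t)))"
 have U0: "U t >= 0" for t using D nu by (simp add: U_def)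
 have Ud: "(U has_real_derivative - (D * exp (- (nu * t)))) (at t)" for t
  using nu unfolding U_def by (auto intro!: derivative_eq_intros)
 define v where "v = (%t p. max 0 (abs (w t p) - U t - et))"
 have vl: "loclip v"
 proof -
  have "loclip (%t p. abs (w t p))" by (rule loclip_compose[OF loclip_const_time[where C=1] wl]) auto
  moreover have "loclip (%t (p::phase). U t)" by (rule loclip_time[OF Ud]) (intro continuous_intros)
  ultimately have "loclip (%t p. abs (w t p) - U t)" by (rule loclip_diff)
  from loclip_compose[OF loclip_const_time[where C=1 and f="%x. max 0 (x - et)"] this] show ?thesis unfolding v_def by auto
 qed
 \<comment> \<open>The margin \<open>et\<close> serves twice: \<open>v\<close> vanishes where |w| is
   small, so the cut-off function has compact support, and \<open>v\<close> is dominated by a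
   multiple of the integrable function w^2.\<close>
 have vw: "v t p <= (w t p)^2 / (4 * et)" "v t p ~= 0 ==> et < abs (w t p)" "0 <= v t p" "v t p <= abs (w t p)" for t p
 proof -
  have "0 <= (abs (w t p) - 2 * et)^2" by simp
  then have "(abs (w t p) - et) * (4 * et) <= (w t p)^2" by (simp add: power2_eq_square algebra_simps)
  then have "abs (w t p) - et <= (w t p)^2 / (4 * et)" using et by (simp add: pos_le_divide_eq)
  moreover have "0 <= (w t p)^2 / (4 * et)" using et by simp
  ultimately show "v t p <= (w t p)^2 / (4 * et)" using U0[of t] by (auto simp: v_def)
  show "v t p ~= 0 ==> et < abs (w t p)" using U0[of t] by (auto simp: v_def max_def split: if_splits)
  show "0 <= v t p" by (simp add: v_def)
  show "v t p <= abs (w t p)" using U0[of t] et by (auto simp: v_def)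
 qed
 have wm: "w s : bmeas" if "s >= 0" for s
  by (rule loclip_meas[OF wl that])
 have vm: "v s : bmeas" if "s >= 0" for s
  by (rule loclip_meas[OF vl that])
 have cutb: "norm (v s q * chi R (fst q)) <= A * indicator (cball 0 (2 * R + A / et + T * e)) q" if "0 <= s" "s <= T" "R > 0" for s q R T
 proof (cases "v s q = 0 | chi R (fst q) = 0")
  case False
  have "norm q <= 2 * R + A / et + T * e"
   by (rule norm_le_of_cut[OF dec that(1,2) et vw(2) that(3)]) (use False in auto)
  moreover have "v s q * chi R (fst q) <= A * 1"
   using vw(4)[of s q] pdec_bd[OF dec that(1), of q] A by (intro mult_mono chi_bounds) auto
  ultimately show ?thesis using vw(3)[of s q] chi_bounds[of R "fst q"] by (simp add: abs_mult)
 qed (use A in auto)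
 have main: "(LBINT q. v t q * chi R (fst q)) - (LBINT q. v s q * chi R (fst q)) <= m * M / (4 * et) / R"
  if R: "R > 0" and s: "t <= s" for R s
 proof -
  \<comment> \<open>\<open>transport_ineq\<close> bounds growth from above; applied to the negative
    function it bounds the decrease of the integral of \<open>v\<close>.\<close>
  have "(LBINT q. - (v s q * chi R (fst q))) - (LBINT q. - (v t q * chi R (fst q)))
   <= m * integral {t..s} (%r. kap r * M / R / (4 * et))"
  proof (rule transport_ineq[where F=F and M=M and R="2 * R + A / et + (s + 1) * e" and k="%r q. (w r q)^2"])
   show "loclip (%r q. - (v r q * chi R (fst q)))" by (intro loclip_uminus loclip_mult vl chi_fst_loclip[OF R])
   show "norm q <= 2 * R + A / et + (s + 1) * e" if "t <= r" "r <= s + 1" "- (v r q * chi R (fst q)) ~= 0" for r q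
    by (rule norm_le_of_cut[OF dec _ that(2) et vw(2) R]) (use that t in auto)
   show "(%q. (w r q)^2) : bmeas" if "t <= r" "r <= s" for r
   proof -
    have "w r : bmeas" by (rule wm) (use that t in auto)
    then show ?thesis by measurable
   qed
   show "continuous_on {t..s} (%r. kap r * M / R / (4 * et))" using R et by (intro continuous_intros) auto
   show "0 <= kap r * M / R / (4 * et)" for r using kap_pos[of r] M R et by (intro divide_nonneg_pos mult_nonneg_nonneg) auto
   show "AE q in lborel. case q of (r, q) => t < r --> r < s -->
     rate_le (kap r * M / R / (4 * et) * (w r q)^2) (inc F (%r q. - (v r q * chi R (fst q))) r q)"
    using ae
   proof (rule AE_mp, intro AE_I2 impI)
    fix x :: "real \<times> phase"
    obtain r q where rq: "x = (r, q)" by (cases x)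
    assume "case x of (t, p) => 0 < t --> rate_le (D * exp (- (nu * t))) (%n. abs (inc F w t p n))"
    then have x: "0 < r ==> rate_le (D * exp (- (nu * r))) (%n. abs (inc F w r q n))" by (simp add: rq)
    show "case x of (r, q) => t < r --> r < s -->
     rate_le (kap r * M / R / (4 * et) * (w r q)^2) (inc F (%r q. - (v r q * chi R (fst q))) r q)"
     unfolding rq prod.case
    proof (intro impI)
     assume "t < r" "r < s"
     then have r0: "r > 0" using t by simp
     define q' where "q' n = q + (1 / real (Suc n)) *R Wf F r q" for n
     define c c' where "c = chi R (fst q)" and "c' n = chi R (fst (q' n))" for n
     have c0: "0 <= c' n" "c' n <= 1" for n by (auto simp: c'_def chi_bounds)
     have "((%h. (U (r + h) - U r) / h) \<longlongrightarrow> - (D * exp (- (nu * r)))) (at 0)" using Ud[of r] by (simp add: DERIV_def)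
     then have lim: "(%n. (U (r + 1 / Suc n) - U r) / (1 / Suc n)) ---> - (D * exp (- (nu * r)))"
      by (rule filterlim_compose) (use LIMSEQ_Suc[OF lim_1_over_n] in "auto simp: filterlim_at simp del: of_nat_Suc")
     have "rate_le (- (D * exp (- (nu * r)))) (%n. U (r + 1 / Suc n) - U r)"
     proof (rule rate_leI)
      fix ep :: real assume "ep > 0"
      then have "EV n. (U (r + 1 / Suc n) - U r) / (1 / Suc n) < - (D * exp (- (nu * r))) + ep"
       by (intro order_tendstoD(2)[OF lim]) simp
      then show "EV n. U (r + 1 / Suc n) - U r <= (- (D * exp (- (nu * r))) + ep) / Suc n"
       by eventually_elim (simp add: pos_le_divide_eq del: of_nat_Suc)
     qed
     from rate_le_add[OF x[OF r0] this] have "rate_le 0 (%n. abs (inc F w r q n) + (U (r + 1 / Suc n) - U r))" by simp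
     then have "rate_le 0 (%n. max 0 (abs (inc F w r q n) + (U (r + 1 / Suc n) - U r)))" by (simp add: rate_le_def)
     moreover have "rate_le ((w r q)^2 / (4 * et) * (kap r * M / R)) (%n. (w r q)^2 / (4 * et) * abs (c' n - c))"
      using chi_step[OF R F, of r q] r0 et by (intro rate_le_cmult rate_le_const) (auto simp: c'_def c_def q'_def simp del: of_nat_Suc)
     ultimately have "rate_le (0 + (w r q)^2 / (4 * et) * (kap r * M / R)) (%n. max 0 (abs (inc F w r q n) + (U (r + 1 / Suc n) - U r)) + (w r q)^2 / (4 * et) * abs (c' n - c))"
      by (rule rate_le_add)
     then have "rate_le (kap r * M / R / (4 * et) * (w r q)^2) (%n. - (v (r + 1 / real (Suc n)) (q' n) * c' n) - - (v r q * c))"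
     proof (rule rate_le_mono)
      fix n
      define X where "X = max 0 (abs (inc F w r q n) + (U (r + 1 / Suc n) - U r))"
      have "v r q - v (r + 1 / Suc n) (q' n) <= X" unfolding v_def X_def q'_def by (auto simp: max_def)
      then have "(v r q - v (r + 1 / Suc n) (q' n)) * c' n <= X * c' n" using c0 by (intro mult_right_mono)
      also have "... <= X * 1" using c0 by (intro mult_left_mono) (auto simp: X_def)
      finally have 1: "(v r q - v (r + 1 / Suc n) (q' n)) * c' n <= X" by simp
      have "v r q * (c - c' n) <= v r q * abs (c' n - c)" using vw(3)[of r q] by (intro mult_left_mono) auto
      also have "... <= (w r q)^2 / (4 * et) * abs (c' n - c)" by (rule mult_right_mono[OF vw(1)]) simp
      finally have 2: "v r q * (c - c' n) <= (w r q)^2 / (4 * et) * abs (c' n - c)" .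
      have "- (v (r + 1 / Suc n) (q' n) * c' n) - - (v r q * c) = (v r q - v (r + 1 / Suc n) (q' n)) * c' n + v r q * (c - c' n)" by (simp add: algebra_simps)
      also have "... <= X + (w r q)^2 / (4 * et) * abs (c' n - c)" by (rule add_mono[OF 1 2])
      finally show "- (v (r + 1 / Suc n) (q' n) * c' n) - - (v r q * c) <= max 0 (abs (inc F w r q n) + (U (r + 1 / Suc n) - U r)) + (w r q)^2 / (4 * et) * abs (c' n - c)" by (simp only: X_def)
     qed (simp add: mult_ac)
     then show "rate_le (kap r * M / R / (4 * et) * (w r q)^2) (inc F (%r q. - (v r q * chi R (fst q))) r q)"
      by (simp only: q'_def c_def c'_def)
    qed
   qed
  qed (use F mass m t s in "auto simp: fieldbd_def")
  also have "m * integral {t..s} (%r. kap r * M / R / (4 * et)) = m * ((M / R / (4 * et)) * integral {t..s} kap)"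
   by (subst integral_mult_right[symmetric]) (simp add: mult_ac)
  also have "... <= m * ((M / R / (4 * et)) * 1)"
  proof (intro mult_left_mono m)
   have "exp (- 2 * t) <= 1" using t by simp
   then show "integral {t..s} kap <= 1" using integral_kap_le[OF t s] by linarith
  qed (use M R et in auto)
  finally show ?thesis by (simp add: mult_ac)
 qed
 have bound: "(LBINT q. v t q * chi R (fst q)) <= m * M / (4 * et) / R" if R: "R > 0" for R
 proof -
  have va [measurable]: "(%q. fin v n q) : bmeas" for n
   using vm[of "real n"] asy_meas by measurable
  have eq: "(LBINT q. v (real n) q * chi R (fst q)) = (LBINT q. fin v n q * chi R (fst q))" for n
  proof -
   have "(%q. v (real n) q * chi R (fst q)) : bmeas" using vm[of "real n"] by measurable
   from lborel_pres_integral[OF asy_pres this, of "real n"] show ?thesis by simp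
  qed
  have "(%n. LBINT q. fin v n q * chi R (fst q)) ---> (LBINT (q::phase). 0)"
  proof (rule integral_dominated_convergence[where w="%q. A * indicator (cball 0 (2 * R + A / et)) q"])
   show "integrable lborel (%q::phase. A * indicator (cball 0 (2 * R + A / et)) q :: real)" by (rule integrable_indicator_cball)
   show "AE q in lborel. (%n. fin v n q * chi R (fst q)) ---> 0"
   proof (intro AE_I2 tendsto_mult_left_zero)
    fix q
    show "(%n. fin v n q) ---> 0"
     by (rule Lim_null_comparison[OF _ tendsto_rabs_zero[OF conv[of q]]]) (use vw in "auto intro: always_eventually")
   qed
   show "AE q in lborel. norm (fin v n q * chi R (fst q)) <= A * indicator (cball 0 (2 * R + A / et)) q" for n
   proof (rule AE_I2)
    fix q
    show "norm (fin v n q * chi R (fst q)) <= A * indicator (cball 0 (2 * R + A / et)) q"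
    proof (cases "fin v n q = 0 | chi R (fst q) = 0")
     case False
     have "norm (snd q) <= A / et" using pdec_supp[OF dec _ et vw(2), of "real n" "asy (real n) q"] False by simp
     moreover have "norm (fst q) <= 2 * R" using chi_supp[OF R] False by blast
     ultimately have "norm q <= 2 * R + A / et" using norm_Pair_le[of "fst q" "snd q"] by simp
     moreover have "fin v n q * chi R (fst q) <= A * 1"
      using vw(4)[of "real n" "asy (real n) q"] pdec_bd[OF dec, of "real n" "asy (real n) q"] A by (intro mult_mono chi_bounds) auto
     ultimately show ?thesis using vw(3)[of "real n" "asy (real n) q"] chi_bounds[of R "fst q"] by (simp add: abs_mult)
    qed (use A in auto)
   qed
  qed measurable
  then have "(%n. LBINT q. v (real n) q * chi R (fst q)) ---> 0" by (simp add: eq)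
  then have "(%n. m * M / (4 * et) / R + (LBINT q. v (real n) q * chi R (fst q))) ---> m * M / (4 * et) / R + 0" by (intro tendsto_intros)
  moreover obtain N :: nat where "t <= real N" using real_arch_simple by blast
  ultimately have "(LBINT q. v t q * chi R (fst q)) <= m * M / (4 * et) / R + 0"
  proof (intro tendsto_lowerbound[where f="%n. m * M / (4 * et) / R + (LBINT q. v (real n) q * chi R (fst q))" and F=sequentially])
   show "EV n. (LBINT q. v t q * chi R (fst q)) <= m * M / (4 * et) / R + (LBINT q. v (real n) q * chi R (fst q))"
    unfolding eventually_sequentially
   proof (intro exI[of _ N] allI impI)
    fix n assume "N <= n"
    then have "t <= real n" using \<open>t <= real N\<close> by simp
    from main[OF R this] show "(LBINT q. v t q * chi R (fst q)) <= m * M / (4 * et) / R + (LBINT q. v (real n) q * chi R (fst q))" by linarith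
   qed
  qed simp_all
  then show ?thesis by simp
 qed
 have "(NN q. ennreal (v t q)) <= 0"
 proof -
  note [measurable] = vm[OF t]
  have "(NN q. ennreal (v t q)) = (NN q. liminf (%n. ennreal (v t q * chi (Suc n) (fst q))))"
  proof (rule nn_integral_cong)
   fix q
   have "(%n. ennreal (v t q * chi (Suc n) (fst q))) ---> ennreal (v t q * 1)" by (intro tendsto_ennrealI tendsto_intros chi_lim)
   then show "ennreal (v t q) = liminf (%n. ennreal (v t q * chi (Suc n) (fst q)))" by (metis lim_imp_Liminf mult.right_neutral trivial_limit_sequentially)
  qed
  also have "... <= liminf (%n. NN q. ennreal (v t q * chi (Suc n) (fst q)))"
   by (rule nn_integral_liminf) measurable
  also have "... <= liminf (%n. ennreal (m * M / (4 * et) * (1 / Suc n)))"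
  proof (intro Liminf_mono always_eventually allI)
   fix n
   have "integrable lborel (%q. v t q * chi (Suc n) (fst q))"
    by (rule Bochner_Integration.integrable_bound[OF integrable_indicator_cball[of A "2 * Suc n + A / et + t * e"]])
     (use cutb[OF t order_refl, of "real (Suc n)"] A in \<open>auto intro!: AE_I2\<close>)
   then have "(NN q. ennreal (v t q * chi (Suc n) (fst q))) = ennreal (LBINT q. v t q * chi (Suc n) (fst q))"
    by (rule nn_integral_eq_integral) (auto intro!: AE_I2 mult_nonneg_nonneg vw chi_bounds)
   then show "(NN q. ennreal (v t q * chi (Suc n) (fst q))) <= ennreal (m * M / (4 * et) * (1 / Suc n))"
    using bound[of "real (Suc n)"] by (simp add: ennreal_leI)
  qed
  also have "... = 0"
  proof -
   have "(%n. ennreal (m * M / (4 * et) * (1 / Suc n))) ---> ennreal (m * M / (4 * et) * 0)"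
    by (intro tendsto_ennrealI tendsto_intros LIMSEQ_Suc[OF lim_1_over_n])
   then show ?thesis using lim_imp_Liminf[OF trivial_limit_sequentially] by fastforce
  qed
  finally show ?thesis .
 qed
 then have "AE q in lborel. ennreal (v t q) = 0" using vm[OF t] by (subst nn_integral_0_iff_AE[symmetric]) auto
 then have "AE q in lborel. v t q = 0" by eventually_elim (use vw(3) in "auto simp: ennreal_eq_0_iff intro: antisym")
 from continuous_AE_zero[OF loclip_cont[OF vl t] this]
 have "v t p = 0" .
 then have "abs (w t p) - U t - et <= 0" unfolding v_def by linarith
 then show "abs (w t p) <= D / nu * exp (- (nu * t)) + et" by (simp add: U_def)
qed

end

section \<open>Ordinary differential equations\<close>

text \<open>The squared norm is differentiable even where the norm is not; |dl|^2 exp (-2 La) is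
  nonincreasing, with \<open>La\<close> an antiderivative of the rate.\<close>

lemma gronwall_forward:
 fixes dl :: "real => 'a::real_inner"
 assumes st: "s <= t"
  and d: "!!r. s <= r ==> r <= t ==> (dl has_vector_derivative dl' r) (at r)"
  and b: "!!r. s <= r ==> r <= t ==> norm (dl' r) <= rt r * norm (dl r)"
  and L: "!!r. s <= r ==> r <= t ==> (La has_real_derivative rt r) (at r)"
 shows "norm (dl t) <= norm (dl s) * exp (La t - La s)"
proof -
 define f where "f = (%r. (dl r \<bullet> dl r) * exp (- 2 * La r))"
 have "f t <= f s"
 proof (rule DERIV_nonpos_imp_nonincreasing[OF st])
  fix r assume r: "s <= r" "r <= t"
  have "((%r. dl r \<bullet> dl r) has_real_derivative 2 * (dl r \<bullet> dl' r)) (at r)"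
   unfolding has_field_derivative_def
   by (rule has_derivative_eq_rhs[OF has_derivative_inner[OF d[OF r, unfolded has_vector_derivative_def] d[OF r, unfolded has_vector_derivative_def]]])
    (auto simp: inner_commute fun_eq_iff)
  then have "(f has_real_derivative (2 * (dl r \<bullet> dl' r)) * exp (- 2 * La r) + (- 2 * rt r * exp (- 2 * La r)) * (dl r \<bullet> dl r)) (at r)"
   unfolding f_def by (rule DERIV_mult) (auto intro!: derivative_eq_intros L[OF r])
  moreover have "(2 * (dl r \<bullet> dl' r)) * exp (- 2 * La r) + (- 2 * rt r * exp (- 2 * La r)) * (dl r \<bullet> dl r) <= 0"
  proof -
   have "dl r \<bullet> dl' r <= norm (dl r) * norm (dl' r)" by (rule norm_cauchy_schwarz)
   also have "... <= norm (dl r) * (rt r * norm (dl r))" by (intro mult_left_mono b r) auto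
   also have "... = rt r * (dl r \<bullet> dl r)" by (simp add: power2_norm_eq_inner[symmetric] power2_eq_square)
   finally have "2 * exp (- 2 * La r) * (dl r \<bullet> dl' r) <= 2 * exp (- 2 * La r) * (rt r * (dl r \<bullet> dl r))"
    by (intro mult_left_mono) auto
   then show ?thesis by (simp add: algebra_simps)
  qed
  ultimately show "EX y. (f has_real_derivative y) (at r) & y <= 0" by blast
 qed
 then have "(norm (dl t))^2 * exp (- 2 * La t) <= (norm (dl s))^2 * exp (- 2 * La s)" by (simp add: f_def power2_norm_eq_inner)
 then have "(norm (dl t))^2 * exp (- 2 * La t) * exp (2 * La t) <= (norm (dl s))^2 * exp (- 2 * La s) * exp (2 * La t)"
  by (rule mult_right_mono) auto
 then have "(norm (dl t))^2 <= (norm (dl s))^2 * exp (2 * (La t - La s))" by (simp add: mult.assoc exp_add[symmetric] algebra_simps)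
 also have "... = (norm (dl s) * exp (La t - La s))^2" by (simp add: power_mult_distrib exp_double[symmetric] power2_eq_square exp_add[symmetric])
 finally show ?thesis by (rule power2_le_imp_le) auto
qed

lemma gronwall_backward:
 fixes dl :: "real => 'a::real_inner"
 assumes st: "s <= t"
  and d: "!!r. s <= r ==> r <= t ==> (dl has_vector_derivative dl' r) (at r)"
  and b: "!!r. s <= r ==> r <= t ==> norm (dl' r) <= rt r * norm (dl r)"
  and L: "!!r. s <= r ==> r <= t ==> (La has_real_derivative rt r) (at r)"
 shows "norm (dl s) <= norm (dl t) * exp (La t - La s)"
proof -
 have "norm ((%r. dl (- r)) (- s)) <= norm ((%r. dl (- r)) (- t)) * exp ((%r. - La (- r)) (- s) - (%r. - La (- r)) (- t))"
 proof (rule gronwall_forward[where dl="%r. dl (- r)" and La="%r. - La (- r)" and dl'="%r. - dl' (- r)" and rt="%r. rt (- r)"])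
  fix r assume r: "- t <= r" "r <= - s"
  then have r': "s <= - r" "- r <= t" by auto
  have "((%r. - r) has_vector_derivative (-1)) (at r)" by (auto intro!: derivative_eq_intros)
  from vector_diff_chain_at[OF this d[OF r']]
  show "((%r. dl (- r)) has_vector_derivative - dl' (- r)) (at r)" by (simp add: o_def)
  show "norm (- dl' (- r)) <= rt (- r) * norm (dl (- r))" using b[OF r'] by simp
  have "((%r. La (- r)) has_real_derivative rt (- r) * (-1)) (at r)"
   by (rule DERIV_chain'[of uminus]) (auto intro!: derivative_eq_intros L r')
  then show "((%r. - La (- r)) has_real_derivative rt (- r)) (at r)" using DERIV_minus by fastforce
 qed (use st in auto)
 then show ?thesis by simp
qed

lemma limit_of_exp_cauchy:
 fixes f :: "real => 'a::banach"
 assumes c: "!!r s. t <= r ==> r <= s ==> norm (f s - f r) <= B * exp (- (r / 2))"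
 obtains l where "(f \<longlongrightarrow> l) at_top" "!!r. t <= r ==> norm (l - f r) <= B * exp (- (r / 2))"
proof -
 have B: "B >= 0"
 proof -
  have "0 <= B * exp (- (t / 2))" using c[of t t] by simp
  then show ?thesis by (simp add: zero_le_mult_iff)
 qed
 have e0: "((%r::real. B * exp (- (r / 2))) \<longlongrightarrow> B * 0) at_top"
 proof (intro tendsto_intros filterlim_compose[OF exp_at_bot])
  show "filterlim (%r::real. - (r / 2)) at_bot at_top"
   unfolding filterlim_at_bot eventually_at_top_linorder
  proof
   fix Z :: real
   show "EX N. ALL n>=N. - (n / 2) <= Z" by (rule exI[of _ "- 2 * Z"]) auto
  qed
 qed
 have "Cauchy (%n. f (t + real n))"
 proof (rule metric_CauchyI)
  fix ep :: real assume ep: "ep > 0"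
  have "\<forall>\<^sub>F r in at_top. B * exp (- (r / 2)) < ep" using e0 ep by (simp add: order_tendstoD(2))
  then obtain R where R: "!!r. r >= R ==> B * exp (- (r / 2)) < ep" by (auto simp: eventually_at_top_linorder)
  obtain N :: nat where N: "R - t <= real N" using real_arch_simple by blast
  have *: "dist (f (t + real m)) (f (t + real n)) < ep" if "N <= m" "m <= n" for m n
  proof -
   have "norm (f (t + real n) - f (t + real m)) <= B * exp (- ((t + real m) / 2))" using that by (intro c) auto
   also have "... < ep" using N that by (intro R) auto
   finally show ?thesis by (simp add: dist_norm norm_minus_commute)
  qed
  show "EX M. ALL m>=M. ALL n>=M. dist (f (t + real m)) (f (t + real n)) < ep"
   by (rule exI[of _ N]) (metis * dist_commute linear)
 qed
 then obtain l where l: "(%n. f (t + real n)) ---> l" using Cauchy_convergent_iff convergent_def by blast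
 have b: "norm (l - f r) <= B * exp (- (r / 2))" if r: "t <= r" for r
 proof (rule tendsto_upperbound[OF tendsto_norm[OF tendsto_diff[OF l tendsto_const]]])
  obtain N :: nat where N: "r - t <= real N" using real_arch_simple by blast
  show "EV n. norm (f (t + real n) - f r) <= B * exp (- (r / 2))"
   unfolding eventually_sequentially by (rule exI[of _ N]) (use N r in "auto intro!: c")
 qed simp
 have "(f \<longlongrightarrow> l) at_top"
 proof (rule LIM_zero_cancel, rule Lim_null_comparison)
  show "\<forall>\<^sub>F r in at_top. norm (f r - l) <= B * exp (- (r / 2))"
   unfolding eventually_at_top_linorder by (rule exI[of _ t]) (use b in "auto simp: norm_minus_commute")
  show "((%r. B * exp (- (r / 2))) \<longlongrightarrow> 0) at_top" using e0 by simp
 qed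
 then show ?thesis using b that by blast
qed

text \<open>The oriented integral: \<open>integral\<close> over an interval with reversed end points
  is 0, so at least one of the two terms vanishes.\<close>

definition sint :: "(real => 'a::euclidean_space) => real => real => 'a" where
 "sint f s t = integral {s..t} f - integral {t..s} f"

lemma sint_same: "sint f s s = 0" by (simp add: sint_def)

lemma sint_deriv:
 assumes f: "continuous_on UNIV f"
 shows "((%t. sint f s t) has_vector_derivative f t) (at t)"
proof -
 define a where "a = min s t - 1"
 define b where "b = t + 1"
 have ci: "f integrable_on {u..v}" for u v
  using f by (intro integrable_continuous_interval) (auto intro: continuous_on_subset)
 have eq: "sint f s t' = integral {a..t'} f - integral {a..s} f" if "a <= t'" for t'
 proof (cases "s <= t'")
  case True
  have "integral {a..s} f + integral {s..t'} f = integral {a..t'} f"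
   using True by (intro Henstock_Kurzweil_Integration.integral_combine ci) (auto simp: a_def)
  moreover have "integral {t'..s} f = 0" using True by (cases "s = t'") auto
  ultimately show ?thesis by (simp add: sint_def algebra_simps)
 next
  case False
  have "integral {a..t'} f + integral {t'..s} f = integral {a..s} f"
   using False that by (intro Henstock_Kurzweil_Integration.integral_combine ci) auto
  then show ?thesis using False by (simp add: sint_def algebra_simps)
 qed
 have "((%u. integral {a..u} f) has_vector_derivative f t) (at t within {a..b})"
  using f by (intro integral_has_vector_derivative) (auto intro: continuous_on_subset simp: a_def b_def)
 then have "((%u. integral {a..u} f) has_vector_derivative f t) (at t)"
  by (subst (asm) at_within_interior) (auto simp: a_def b_def)
 then have "((%u. integral {a..u} f - integral {a..s} f) has_vector_derivative f t) (at t)"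
  by (auto intro!: derivative_eq_intros)
 then show ?thesis
  by (rule has_vector_derivative_transform_within_open[where S="{a<..}"]) (auto simp: eq a_def)
qed

lemma sint_bound:
 assumes f: "continuous_on UNIV f" and La: "La > 0" and b: "!!ta. norm (f ta) <= B * exp (La * abs (ta - s))"
 shows "norm (sint f s t) <= B / La * exp (La * abs (t - s))"
proof -
 have B: "B >= 0" using b[of s] norm_ge_zero[of "f s"] by (simp del: norm_ge_zero)
 have c: "continuous_on A (%t. sint f s t)" for A
  using sint_deriv[OF f] by (meson continuous_at_imp_continuous_on has_vector_derivative_continuous)
 consider "t = s" | "s < t" | "t < s" by linarith
 then show ?thesis
 proof cases
  case 1 then show ?thesis using B La by (simp add: sint_same)
 next
  case 2
  have "norm (sint f s t - sint f s s) <= B / La * exp (La * (t - s)) - B / La * exp (La * (s - s))"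
  proof (rule differentiable_bound_general[OF 2 c, where f'=f and \<phi>'="%ta. B * exp (La * (ta - s))"])
   fix x assume x: "s < x" "x < t"
   show "((%t. B / La * exp (La * (t - s))) has_vector_derivative B * exp (La * (x - s))) (at x)"
    using La by (auto intro!: derivative_eq_intros simp: has_real_derivative_iff_has_vector_derivative[symmetric])
   show "norm (f x) <= B * exp (La * (x - s))" using b[of x] x by simp
  qed (use La in \<open>auto intro!: continuous_intros sint_deriv f\<close>)
  then show ?thesis using 2 B La by (simp add: sint_same order_trans)
 next
  case 3
  have "norm (sint f s s - sint f s t) <= - (B / La * exp (La * (s - s))) - - (B / La * exp (La * (s - t)))"
  proof (rule differentiable_bound_general[OF 3 c, where f'=f and \<phi>'="%ta. B * exp (La * (s - ta))"])
   fix x assume x: "t < x" "x < s"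
   show "((%t. - (B / La * exp (La * (s - t)))) has_vector_derivative B * exp (La * (s - x))) (at x)"
    using La by (auto intro!: derivative_eq_intros simp: has_real_derivative_iff_has_vector_derivative[symmetric])
   show "norm (f x) <= B * exp (La * (s - x))" using b[of x] x by simp
  qed (use La in \<open>auto intro!: continuous_intros sint_deriv f\<close>)
  then show ?thesis using 3 B La by (simp add: sint_same order_trans)
 qed
qed

text \<open>The Bielecki weight \<open>exp (La |t - s|)\<close> makes the Picard map a contraction on the whole time axis.\<close>

theorem picard_global:
 fixes V :: "real => 'a::euclidean_space => 'a"
 assumes cont: "continuous_on UNIV (%(t, y). V t y)" and bd: "!!t y. norm (V t y) <= M"
  and lip: "!!t y y'. norm (V t y - V t y') <= L * norm (y - y')"
 obtains y where "y s = p" "!!t. (y has_vector_derivative V t (y t)) (at t)"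
proof -
 define La where "La = 2 * abs L + 1"
 have La: "La > 0" by (simp add: La_def)
 have M: "M >= 0" using bd[of 0 0] norm_ge_zero order_trans by blast
 define ex where "ex = (%t. exp (La * abs (t - s)))"
 have ex1: "ex t >= 1" "ex t > 0" for t using La by (auto simp: ex_def)
 have exc: "continuous_on A ex" for A unfolding ex_def by (intro continuous_intros)
 \<comment> \<open>The unknown is u = (y - p) / \<open>ex\<close>. The weight makes it bounded, so
   the fixed point is sought among bounded continuous functions, and
   \<open>La = 2 * abs L + 1\<close> gives the contraction constant 1/2.\<close>
 define G where "G = (%(u :: real \<Rightarrow>\<^sub>C 'a) ta. V ta (p + ex ta *R u ta))"
 have Gc: "continuous_on UNIV (G u)" for u
 proof -
  have "continuous_on UNIV (%ta. (ta, p + ex ta *R u ta))" by (intro continuous_intros exc) auto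
  from continuous_on_compose2[OF cont this] show ?thesis by (simp add: G_def)
 qed
 define T0 where "T0 = (%(u :: real \<Rightarrow>\<^sub>C 'a) t. (1 / ex t) *R sint (G u) s t)"
 have sc: "continuous_on UNIV (%t. sint f s t)" if "continuous_on UNIV f" for f :: "real => 'a"
  using sint_deriv[OF that] by (meson continuous_at_imp_continuous_on has_vector_derivative_continuous)
 have T0b: "norm (T0 u t) <= M / La" for u t
 proof -
  have "norm (sint (G u) s t) <= M / La * ex t" unfolding ex_def
  proof (rule sint_bound[OF Gc La])
   fix ta
   have "norm (G u ta) <= M * 1" using bd by (simp add: G_def)
   also have "... <= M * ex ta" using M ex1 by (intro mult_left_mono) auto
   finally show "norm (G u ta) <= M * exp (La * abs (ta - s))" by (simp add: ex_def)
  qed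
  then show ?thesis using ex1[of t] by (simp add: T0_def field_simps)
 qed
 have T0f: "T0 u : bcontfun" for u unfolding bcontfun_def
 proof (intro CollectI conjI)
  show "continuous_on UNIV (T0 u)" unfolding T0_def
   using ex1 by (intro continuous_intros sc Gc exc) (auto simp: less_imp_neq[symmetric])
  show "bounded (range (T0 u))" using T0b by (auto simp: bounded_iff)
 qed
 define T where "T = (%u. Bcontfun (T0 u))"
 have Tap: "apply_bcontfun (T u) t = T0 u t" for u t using T0f by (simp add: T_def Bcontfun_inverse)
 have "EX! u. T u = u"
 proof (rule banach_fix_type[where c="1/2"])
  show "ALL u v. dist (T u) (T v) <= 1 / 2 * dist u v"
  proof (intro allI dist_bound)
   fix u v t
   have df: "sint (G u) s t - sint (G v) s t = sint (%ta. G u ta - G v ta) s t"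
   proof -
    have ci: "G w integrable_on {a..b}" for w a b
     using Gc by (intro integrable_continuous_interval) (auto intro: continuous_on_subset)
    show ?thesis unfolding sint_def
     by (simp add: Henstock_Kurzweil_Integration.integral_diff[OF ci ci])
   qed
   have "norm (sint (%ta. G u ta - G v ta) s t) <= (abs L * dist u v) / La * ex t"
    unfolding ex_def
   proof (rule sint_bound[OF _ La])
    show "continuous_on UNIV (%ta. G u ta - G v ta)" by (intro continuous_intros Gc)
    fix ta
    have "norm (G u ta - G v ta) <= L * norm (ex ta *R (u ta - v ta))"
     using lip[of ta "p + ex ta *R u ta" "p + ex ta *R v ta"] by (simp add: G_def scaleR_diff_right)
    also have "... <= abs L * norm (ex ta *R (u ta - v ta))" by (intro mult_right_mono) auto
    also have "... = abs L * (ex ta * dist (u ta) (v ta))" using ex1(2)[of ta] by (simp add: dist_norm)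
    also have "... <= abs L * (ex ta * dist u v)" using ex1(2)[of ta] by (intro mult_left_mono dist_bounded) auto
    finally show "norm (G u ta - G v ta) <= abs L * dist u v * exp (La * abs (ta - s))" by (simp add: ex_def mult_ac)
   qed
   then have "norm (T0 u t - T0 v t) <= (abs L * dist u v) / La"
    using ex1(2)[of t] by (simp add: T0_def scaleR_diff_right[symmetric] df field_simps)
   also have "... <= 1 / 2 * dist u v"
    using mult_right_mono[of "2 * abs L" La "dist u v"] La by (simp add: La_def field_simps)
   finally show "dist (T u t) (T v t) <= 1 / 2 * dist u v" by (simp add: Tap dist_norm)
  qed
 qed auto
 then obtain u where u: "T u = u" by blast
 define y where "y = (%t. p + ex t *R u t)"
 have ye: "y t = p + sint (G u) s t" for t
 proof -
  have "u t = T0 u t" using Tap[of u t] u by simp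
  then show ?thesis using ex1(2)[of t] by (simp add: y_def T0_def)
 qed
 have "((%t. p + sint (G u) s t) has_vector_derivative G u t) (at t)" for t
  using sint_deriv[OF Gc, of u s t] by (auto intro!: derivative_eq_intros)
 then have "(y has_vector_derivative V t (y t)) (at t)" for t
  unfolding ye[abs_def, symmetric] by (simp add: G_def y_def)
 moreover have "y s = p" by (simp add: ye sint_same)
 ultimately show ?thesis using that by blast
qed

text \<open>Consecutive dyadic quotients 2^n (f(x + h/2^n) - f x) differ by 2^n times a second
  difference with increments h/2^(n+1). They converge geometrically, and the limit approximates the
  increment up to O(|h|^2). The second difference also yields additivity of the limit.\<close>

theorem differentiable_of_second_difference:
 fixes f :: "'a::euclidean_space => 'b::euclidean_space"
 assumes lip: "!!x y. norm (f x - f y) <= L * norm (x - y)"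
  and E2: "!!x h k. norm (f (x + h + k) - f (x + h) - f (x + k) + f x) <= C * norm h * norm k"
 obtains D where "(f has_derivative D) (at x)"
proof -
 define q where "q = (%n h. 2 ^ n *R (f (x + (1 / 2 ^ n) *R h) - f x))"
 have C: "C * norm h * norm h >= 0" for h :: 'a using order_trans[OF norm_ge_zero E2[of x h h]] .
 have step: "norm (q (Suc n) h - q n h) <= (C * norm h * norm h) * (1/2) ^ n" for n h
 proof -
  define k where "k = (1 / 2 ^ Suc n) *R h"
  have k2: "(1 / 2 ^ n) *R h = k + k" by (simp add: k_def scaleR_add_left[symmetric])
  have "q (Suc n) h - q n h = - (2 ^ n *R (f (x + k + k) - f (x + k) - f (x + k) + f x))"
  proof -
   have "(2::real) ^ Suc n = 2 ^ n + 2 ^ n" by simp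
   then show ?thesis unfolding q_def k2 k_def[symmetric] by (simp only: scaleR_add_left) (simp add: algebra_simps)
  qed
  then have "norm (q (Suc n) h - q n h) = 2 ^ n * norm (f (x + k + k) - f (x + k) - f (x + k) + f x)" by simp
  also have "... <= 2 ^ n * (C * norm k * norm k)" by (intro mult_left_mono E2) auto
  also have "... = (C * norm h * norm h) * (2 ^ n * ((1 / 2 ^ Suc n) * (1 / 2 ^ Suc n)))" by (simp add: k_def)
  also have "2 ^ n * ((1 / 2 ^ Suc n) * (1 / 2 ^ Suc n)) <= (1/2::real) ^ n" by (simp add: field_simps)
  finally show ?thesis using C[of h] by (simp add: mult_left_mono)
 qed
 have cs: "summable (%n. (C * norm h * norm h) * (1/2::real) ^ n)" for h :: 'a
  by (intro summable_mult summable_geometric) auto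
 have sm: "summable (%n. q (Suc n) h - q n h)" for h
  by (rule summable_comparison_test[OF _ cs[of h]]) (use step in auto)
 define D where "D = (%h. q 0 h + (\<Sum>n. q (Suc n) h - q n h))"
 have lim: "(%n. q n h) ---> D h" for h
 proof -
  have "(%n. q 0 h + (\<Sum>i<n. q (Suc i) h - q i h)) ---> D h"
   unfolding D_def by (intro tendsto_intros summable_LIMSEQ sm)
  moreover have "q 0 h + (\<Sum>i<n. q (Suc i) h - q i h) = q n h" for n
  proof (induction n)
   case (Suc n)
   then show ?case by (simp add: algebra_simps)
  qed simp
  ultimately show ?thesis by simp
 qed
 have rem: "norm (f (x + h) - f x - D h) <= 2 * (C * norm h * norm h)" for h
 proof -
  have "f (x + h) - f x - D h = - (\<Sum>n. q (Suc n) h - q n h)" by (simp add: D_def q_def)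
  moreover have "norm (\<Sum>n. q (Suc n) h - q n h) <= (\<Sum>n. (C * norm h * norm h) * (1/2) ^ n)"
  proof -
   have sn: "summable (%n. norm (q (Suc n) h - q n h))"
    by (rule summable_comparison_test[OF _ cs[of h]]) (use step in auto)
   have "norm (\<Sum>n. q (Suc n) h - q n h) <= (\<Sum>n. norm (q (Suc n) h - q n h))" by (rule summable_norm[OF sn])
   also have "... <= (\<Sum>n. (C * norm h * norm h) * (1/2) ^ n)" by (rule suminf_le[OF step sn cs])
   finally show ?thesis .
  qed
  moreover have "(\<Sum>n. (C * norm h * norm h) * (1/2::real) ^ n) = (C * norm h * norm h) * 2"
   by (subst suminf_mult) (auto simp: suminf_geometric)
  ultimately show ?thesis by simp
 qed
 have add: "D (h + k) = D h + D k" for h k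
 proof -
  have "(%n. q n (h + k) - q n h - q n k) ---> D (h + k) - D h - D k" by (intro tendsto_diff lim)
  moreover have "(%n. q n (h + k) - q n h - q n k) ---> 0"
  proof (rule Lim_null_comparison)
   show "EV n. norm (q n (h + k) - q n h - q n k) <= (C * norm h * norm k) * (1/2) ^ n"
   proof (rule always_eventually, rule allI)
    fix n
    define r :: real where "r = 1 / 2 ^ n"
    have r: "r > 0" "2 ^ n * r = 1" by (auto simp: r_def)
    have "q n (h + k) - q n h - q n k = 2 ^ n *R (f (x + r *R h + r *R k) - f (x + r *R h) - f (x + r *R k) + f x)"
     unfolding q_def r_def[symmetric] by (simp add: algebra_simps)
    then have "norm (q n (h + k) - q n h - q n k) = 2 ^ n * norm (f (x + r *R h + r *R k) - f (x + r *R h) - f (x + r *R k) + f x)" by simp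
    also have "... <= 2 ^ n * (C * norm (r *R h) * norm (r *R k))" by (intro mult_left_mono E2) auto
    also have "... = (2 ^ n * r) * (C * norm h * norm k) * r" using r by simp
    finally show "norm (q n (h + k) - q n h - q n k) <= (C * norm h * norm k) * (1/2) ^ n" unfolding r(2) by (simp add: r_def power_one_over)
   qed
   show "(%n. (C * norm h * norm k) * (1/2::real) ^ n) ---> 0"
    by (intro tendsto_mult_right_zero LIMSEQ_realpow_zero) auto
  qed
  ultimately have "D (h + k) - D h - D k = 0" by (rule LIMSEQ_unique)
  then show ?thesis by (simp add: algebra_simps)
 qed
 have Dl: "norm (D h) <= abs L * norm h" for h
 proof (rule tendsto_upperbound[OF tendsto_norm[OF lim]], rule always_eventually, rule allI)
  fix n
  have "norm (q n h) <= 2 ^ n * (L * norm ((1 / 2 ^ n) *R h))"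
   using lip[of "x + (1 / 2 ^ n) *R h" x] unfolding q_def norm_scaleR by (simp add: field_simps)
  also have "... = L * norm h" by simp
  also have "... <= abs L * norm h" by (intro mult_right_mono) auto
  finally show "norm (q n h) <= abs L * norm h" .
 qed simp
 have D0: "D 0 = 0" using add[of 0 0] by simp
 have Dneg: "D (- h) = - D h" for h using add[of h "- h"] D0 by (simp add: eq_neg_iff_add_eq_0 add.commute)
 have Dn: "D (real n *R h) = real n *R D h" for n h
  by (induction n) (auto simp: D0 add algebra_simps)
 have Dz: "D (of_int z *R h) = of_int z *R D h" for z h
 proof (cases "z >= 0")
  case True then show ?thesis using Dn[of "nat z" h] by simp
 next
  case False
  then have "of_int z *R h = - (real (nat (- z)) *R h)" by simp
  then show ?thesis using Dn[of "nat (- z)" h] Dneg False by simp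
 qed
 \<comment> \<open>Additivity gives homogeneity for integers. For real r, N r is split into its
   floor and a remainder of size at most 1; the boundedness of \<open>D\<close> makes the error,
   after division by N, arbitrarily small.\<close>
 have scale: "D (r *R h) = r *R D h" for r h
 proof -
  have "norm (D (r *R h) - r *R D h) <= ep" if ep: "ep > 0" for ep
  proof -
   define K where "K = 2 * (abs L * norm h)"
   obtain N :: nat where N: "K / ep < real N" "N > 0" by (metis reals_Archimedean2 gr0I less_trans of_nat_0 linorder_not_less order_less_le_trans of_nat_less_iff Suc_lessI lessI)
   define z where "z = \<lfloor>r * real N\<rfloor>"
   have zb: "abs (r * real N - of_int z) <= 1" by (simp add: z_def abs_le_iff) linarith
   have "real N *R (D (r *R h) - r *R D h) = D ((r * real N) *R h) - (r * real N) *R D h"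
    using Dn[of N "r *R h"] by (simp add: algebra_simps)
   also have "... = D ((r * real N - of_int z) *R h) - (r * real N - of_int z) *R D h"
    using add[of "(r * real N - of_int z) *R h" "of_int z *R h"] Dz[of z h] by (simp add: algebra_simps)
   finally have "real N * norm (D (r *R h) - r *R D h) = norm (D ((r * real N - of_int z) *R h) - (r * real N - of_int z) *R D h)"
    by (metis abs_of_nat norm_scaleR)
   also have "... <= norm (D ((r * real N - of_int z) *R h)) + norm ((r * real N - of_int z) *R D h)" by (rule norm_triangle_ineq4)
   also have "... <= 1 * (abs L * norm h) + 1 * (abs L * norm h)"
   proof (rule add_mono)
    have "norm (D ((r * real N - of_int z) *R h)) <= abs L * (abs (r * real N - of_int z) * norm h)" using Dl[of "(r * real N - of_int z) *R h"] by simp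
    also have "... <= abs L * (1 * norm h)" using zb by (intro mult_left_mono mult_right_mono) auto
    finally show "norm (D ((r * real N - of_int z) *R h)) <= 1 * (abs L * norm h)" by simp
    show "norm ((r * real N - of_int z) *R D h) <= 1 * (abs L * norm h)"
     unfolding norm_scaleR by (intro mult_mono zb Dl) auto
   qed
   finally have "real N * norm (D (r *R h) - r *R D h) <= K" by (simp add: K_def)
   also have "... <= real N * ep" using N ep by (simp add: field_simps)
   finally show ?thesis using N by simp
  qed
  then show ?thesis by (metis field_le_epsilon add_0 norm_le_zero_iff right_minus_eq)
 qed
 have "(f has_derivative D) (at x)"
  unfolding has_derivative_at_alt
 proof (intro conjI allI impI)
  show "bounded_linear D" by (rule bounded_linear_intro[where K="abs L"]) (use add scale Dl in "auto simp: mult.commute")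
  fix ep :: real assume ep: "0 < ep"
  define d where "d = ep / (2 * abs C + 1)"
  have d: "d > 0" using ep by (simp add: d_def)
  show "EX d>0. ALL y. norm (y - x) < d --> norm (f y - f x - D (y - x)) <= ep * norm (y - x)"
  proof (intro exI[of _ d] conjI d allI impI)
   fix y assume y: "norm (y - x) < d"
   have "norm (f y - f x - D (y - x)) <= 2 * (C * norm (y - x) * norm (y - x))" using rem[of "y - x"] by simp
   also have "... <= (2 * abs C + 1) * norm (y - x) * norm (y - x)"
    using mult_right_mono[of "2 * C" "2 * abs C + 1" "norm (y - x) * norm (y - x)"] by (simp add: mult_ac)
   also have "... <= (2 * abs C + 1) * d * norm (y - x)" using y by (intro mult_right_mono mult_left_mono) auto
   also have "(2 * abs C + 1) * d = ep" by (simp add: d_def)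
   finally show "norm (f y - f x - D (y - x)) <= ep * norm (y - x)" .
  qed
 qed
 then show ?thesis using that by blast
qed

section \<open>The flow from infinity\<close>

lemma kap_t_le1: "t >= 0 ==> kap t * t <= 1"
proof -
 assume t: "t >= 0"
 have "kap t * t <= 2 * exp (- 2 * t) * t" using t by (intro mult_right_mono kap_le_exp)
 also have "... = (2 * t) * exp (- 2 * t)" by simp
 also have "... <= exp (2 * t) * exp (- 2 * t)" using exp_ge_add_one_self[of "2 * t"] by (intro mult_right_mono) (linarith, simp)
 also have "... = 1" by (simp add: exp_add[symmetric])
 finally show ?thesis .
qed

lemma kap_lin_le: "t >= 0 ==> kap t * (1 + 3 * t) <= 4 * exp (- (t / 2))"
proof -
 assume t: "t >= 0"
 have "1 + 3 * t <= 2 * exp (3 / 2 * t)" using exp_ge_add_one_self[of "3 / 2 * t"] by linarith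
 then have "kap t * (1 + 3 * t) <= (2 * exp (- 2 * t)) * (2 * exp (3 / 2 * t))"
  using t kap_pos[of t] by (intro mult_mono kap_le_exp) auto
 also have "... = 4 * (exp (- 2 * t) * exp (3 / 2 * t))" by simp
 also have "exp (- 2 * t) * exp (3 / 2 * t) = exp (- (t / 2))" by (simp add: exp_add[symmetric])
 finally show ?thesis .
qed

lemma kap_le_half: "t >= 0 ==> kap t <= 2 * exp (- (t / 2))"
 using kap_le_exp[of t] by (rule order_trans) simp

lemma norm_derivative_le:
 fixes f :: "'a::real_normed_vector => 'b::real_normed_vector"
 assumes D: "(f has_derivative D) (at x)" and K: "!!y. norm (f y - f x) <= K * norm (y - x)"
 shows "norm (D h) <= K * norm h"
proof (cases "h = 0")
 case True
 then show ?thesis using linear_0[OF has_derivative_linear[OF D]] by simp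
next
 case False
 show ?thesis
 proof (rule field_le_epsilon)
  fix ep :: real assume ep: "ep > 0"
  define ep' where "ep' = ep / norm h"
  have ep': "ep' > 0" using ep False by (simp add: ep'_def)
  obtain d where d: "d > 0" "!!y. norm (y - x) < d ==> norm (f y - f x - D (y - x)) <= ep' * norm (y - x)"
   using D ep' unfolding has_derivative_at_alt by blast
  define s where "s = d / (2 * norm h)"
  have s: "s > 0" using d False by (simp add: s_def)
  have sh: "norm (s *R h) < d" using False d by (simp add: s_def)
  have "s * norm (D h) = norm (D (s *R h))" using s linear_scale[OF has_derivative_linear[OF D], of s h] by simp
  also have "... <= norm (f (x + s *R h) - f x) + norm (f (x + s *R h) - f x - D (s *R h))"
   using norm_triangle_ineq4[of "f (x + s *R h) - f x" "f (x + s *R h) - f x - D (s *R h)"] by simp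
  also have "... <= K * norm (s *R h) + ep' * norm (s *R h)"
   using K[of "x + s *R h"] d(2)[of "x + s *R h"] sh by (intro add_mono) auto
  also have "... = s * (K * norm h + ep)" using s False by (simp add: ep'_def algebra_simps)
  finally show "norm (D h) <= K * norm h + ep" using s by simp
 qed
qed

section \<open>Derivative and second differences of the asymptotic field\<close>

context asym
begin

definition DE :: "plane => plane => plane" where "DE x = (SOME D. (E has_derivative D) (at x))"

lemma DE_der: "(E has_derivative DE x) (at x)"
proof -
 obtain D where "(E has_derivative D) (at x)" using differentiable_of_second_difference[of E e e x, OF Elip E2] by blast
 then show ?thesis unfolding DE_def by (rule someI[where P="%D. (E has_derivative D) (at x)"])
qed

lemma DE_linear: "linear (DE x)" using DE_der by (rule has_derivative_linear)

lemma DE_bd: "norm (DE x h) <= e * norm h"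
 by (rule norm_derivative_le[OF DE_der Elip])

text \<open>For fixed x and y the map z -> E(z + y - x) - E z has derivative DE y - DE x at x, and
  by \<open>E2\<close> its Lipschitz constant is e |y - x|.\<close>

lemma DE_lip: "norm (DE y h - DE x h) <= e * norm (y - x) * norm h"
proof (rule norm_derivative_le[where f="%z. E (z + (y - x)) - E z"])
 have "(E has_derivative DE y) (at (x + (y - x)))" using DE_der by simp
 then have "((%z. E (z + (y - x))) has_derivative DE y) (at x)"
  by (rule has_derivative_compose[of "%z. z + (y - x)" "%z. z", rotated]) (auto intro!: derivative_eq_intros)
 then show "((%z. E (z + (y - x)) - E z) has_derivative (%h. DE y h - DE x h)) (at x)"
  by (intro derivative_intros DE_der)
 fix z
 have "E (z + (y - x)) - E z - (E (x + (y - x)) - E x) = E (x + (y - x) + (z - x)) - E (x + (y - x)) - E (x + (z - x)) + E x"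
  by (simp add: algebra_simps)
 also have "norm ... <= e * norm (y - x) * norm (z - x)" by (rule E2)
 finally show "norm (E (z + (y - x)) - E z - (E (x + (y - x)) - E x)) <= e * norm (y - x) * norm (z - x)" .
qed

text \<open>Together with \<open>E_second'\<close> this gives the coefficient min (|h|, 2) in front
  of |x - y|. The minimum is what makes the dependence on large displacements, and so on large
  velocities, logarithmic after integration in time.\<close>

lemma E_second: "norm (E (x + h) - E x - E (y + k) + E y) <= e * norm (h - k) + e * norm h * norm (x - y)"
proof -
 have "E (x + h) - E x - E (y + k) + E y = (E (y + h + (x - y)) - E (y + h) - E (y + (x - y)) + E y) + (E (y + h) - E (y + k))" by (simp add: algebra_simps)
 also have "norm ... <= e * norm h * norm (x - y) + e * norm (h - k)"
 proof (rule norm_triangle_mono)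
  show "norm (E (y + h + (x - y)) - E (y + h) - E (y + (x - y)) + E y) <= e * norm h * norm (x - y)" by (rule E2)
  show "norm (E (y + h) - E (y + k)) <= e * norm (h - k)" using Elip[of "y + h" "y + k"] by simp
 qed
 finally show ?thesis by simp
qed

lemma E_second': "norm (E (x + h) - E x - E (y + k) + E y) <= e * norm (h - k) + 2 * e * norm (x - y)"
proof -
 have "E (x + h) - E x - E (y + k) + E y = (E (x + h) - E (y + h)) + (E (y + h) - E (y + k)) + (E y - E x)" by (simp add: algebra_simps)
 also have "norm ... <= e * norm (x - y) + e * norm (h - k) + e * norm (x - y)"
  using Elip[of "x + h" "y + h"] Elip[of "y + h" "y + k"] Elip[of y x] by (intro norm_triangle_mono) (auto simp: norm_minus_commute)
 finally show ?thesis by simp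
qed

end

section \<open>Characteristics of a field close to the asymptotic one\<close>

text \<open>\<open>Fclose\<close> and \<open>Fclip\<close> are what the field of a solution is shown
  to satisfy in \<open>N_close\<close> and \<open>N_close_lip\<close>, so the class is stable under
  the fixed point map. The slow rate 1/16 comes from the choice of radii in
  \<open>N_lip\<close>.\<close>

locale flow = asym lam E e for lam E e +
 fixes F :: "real => plane => plane"
 assumes Fcont: "continuous_on UNIV (%(t, y). F t y)"
  and Fclose: "t >= 0 ==> norm (F t y - lam *R E y) <= e * exp (- (t / 2))"
  and Fclip: "t >= 0 ==> norm ((F t y - lam *R E y) - (F t y' - lam *R E y')) <= e * exp (- (t / 16)) * norm (y - y')"
begin

lemma norm_lamE: "norm (lam *R x) = norm (x :: plane)" using lam by simp

lemma Fbd: "t >= 0 ==> norm (F t y) <= 2 * e"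
proof -
 assume t: "t >= 0"
 have "norm (F t y) <= norm (F t y - lam *R E y) + norm (lam *R E y)" using norm_triangle_ineq[of "F t y - lam *R E y" "lam *R E y"] by simp
 also have "... <= e * exp (- (t / 2)) + e" unfolding norm_lamE using Fclose[OF t] Ebd by (intro add_mono)
 also have "... <= e * 1 + e" using t e0 by (intro add_right_mono mult_left_mono) auto
 finally show ?thesis by simp
qed

lemma Flip: "t >= 0 ==> norm (F t y - F t y') <= 2 * e * norm (y - y')"
proof -
 assume t: "t >= 0"
 have "F t y - F t y' = ((F t y - lam *R E y) - (F t y' - lam *R E y')) + lam *R (E y - E y')" by (simp add: algebra_simps)
 also have "norm ... <= e * exp (- (t / 16)) * norm (y - y') + e * norm (y - y')"
  using Fclip[OF t, of y y'] Elip[of y y'] norm_lamE[of "E y - E y'"] by (intro norm_triangle_mono) auto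
 also have "... <= e * 1 * norm (y - y') + e * norm (y - y')" using t e0 by (intro add_right_mono mult_right_mono mult_left_mono) auto
 finally show ?thesis by simp
qed

lemma Fcont2: "continuous_on UNIV f ==> continuous_on UNIV g ==> continuous_on UNIV (%x. F (f x) (g x))"
 using continuous_on_compose2[OF Fcont continuous_on_Pair[of UNIV f g]] by simp

lemma F_meas: "F t : bmeas"
 by (intro borel_measurable_continuous_onI Fcont2 continuous_intros)

lemma F_fieldbd: "fieldbd F (2 * e)"
 unfolding fieldbd_def using F_meas Fbd by blast

text \<open>The field is frozen at negative times so that \<open>picard_global\<close> applies on
  the whole time axis.\<close>

definition V :: "real => phase => phase" where "V t p = Wf F (max 0 t) p"

lemma V_cont: "continuous_on UNIV (%(t, p). V t p)"
proof -
 have m: "continuous_on UNIV (%x :: real \<times> phase. max 0 (fst x))" by (intro continuous_intros)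
 have k: "continuous_on UNIV (%x :: real \<times> phase. kap (max 0 (fst x)))" by (intro continuous_intros)
 have z: "continuous_on UNIV (%x :: real \<times> phase. zc (max 0 (fst x)) (snd x))" unfolding zc_def by (intro continuous_intros)
 have "continuous_on UNIV (%x :: real \<times> phase. (kap (max 0 (fst x)) *R F (max 0 (fst x)) (zc (max 0 (fst x)) (snd x)), F (max 0 (fst x)) (zc (max 0 (fst x)) (snd x))))"
  by (intro continuous_intros k Fcont2[OF m z])
 then show ?thesis by (simp add: V_def Wf_def split_def)
qed

lemma V_bd: "norm (V t p) <= 4 * e"
 using norm_Wf[of "max 0 t" F p "2 * e"] Fbd[of "max 0 t"] by (simp add: V_def)

lemma zc_diff: "zc t p - zc t p' = (fst p - fst p') - kap t *R (snd p - snd p')"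
 by (simp add: zc_def algebra_simps)

lemma V_lip: "norm (V t p - V t p') <= 8 * e * norm (p - p')"
proof -
 define s where "s = max 0 t"
 have s: "s >= 0" by (simp add: s_def)
 define w where "w = F s (zc s p) - F s (zc s p')"
 have k: "0 < kap s" "kap s <= 1" using kap_pos kap_le1[OF s] by auto
 note n = norm_fst_snd[of "p - p'", unfolded fst_diff snd_diff]
 have "norm (zc s p - zc s p') <= norm (fst p - fst p') + norm (kap s *R (snd p - snd p'))" unfolding zc_diff by (rule norm_triangle_ineq4)
 also have "... <= norm (p - p') + 1 * norm (p - p')"
  unfolding norm_scaleR using n k by (intro add_mono mult_mono) auto
 finally have z: "norm (zc s p - zc s p') <= 2 * norm (p - p')" by simp
 have w: "norm w <= 2 * e * (2 * norm (p - p'))" unfolding w_def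
  using order_trans[OF Flip[OF s] mult_left_mono[OF z]] e0 by simp
 have "V t p - V t p' = (kap s *R w, w)" by (simp add: V_def Wf_def s_def[symmetric] w_def scaleR_diff_right)
 then have "norm (V t p - V t p') <= norm (kap s *R w) + norm w" using norm_Pair_le[of "kap s *R w" w] by (simp only:)
 also have "... <= 1 * norm w + norm w" unfolding norm_scaleR using k by (intro add_right_mono mult_right_mono) auto
 finally show ?thesis using w by simp
qed

definition flw :: "real => phase => real => phase" where
 "flw s p = (SOME y. y s = p & (ALL t. (y has_vector_derivative V t (y t)) (at t)))"

lemma flw: "flw s p s = p" "(flw s p has_vector_derivative V t (flw s p t)) (at t)"
proof -
 obtain y where "y s = p" "!!t. (y has_vector_derivative V t (y t)) (at t)"
  using picard_global[OF V_cont V_bd V_lip, of s p] by blast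
 then have "EX y. y s = p & (ALL t. (y has_vector_derivative V t (y t)) (at t))" by blast
 from someI_ex[OF this] show "flw s p s = p" "(flw s p has_vector_derivative V t (flw s p t)) (at t)" unfolding flw_def by blast+
qed

lemma sol_dist:
 assumes "!!t. (y has_vector_derivative V t (y t)) (at t)" "!!t. (y' has_vector_derivative V t (y' t)) (at t)"
 shows "norm (y t - y' t) <= norm (y s - y' s) * exp (8 * e * abs (t - s))"
proof -
 have d: "((%r. y r - y' r) has_vector_derivative V r (y r) - V r (y' r)) (at r)" for r by (intro derivative_intros assms)
 have L: "((%r. 8 * e * r) has_real_derivative 8 * e) (at r)" for r by (auto intro!: derivative_eq_intros)
 show ?thesis
 proof (cases "s <= t")
  case True
  from gronwall_forward[OF True d V_lip L] True show ?thesis by (simp add: right_diff_distrib)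
 next
  case False
  then have "t <= s" by simp
  from gronwall_backward[OF this d V_lip L] False show ?thesis by (simp add: right_diff_distrib)
 qed
qed

lemma flw_unique:
 assumes "!!t. (y has_vector_derivative V t (y t)) (at t)" "y r = flw s p r"
 shows "y t = flw s p t"
 using sol_dist[OF assms(1) flw(2), of t s p r] assms(2) by simp

lemma flw_group: "flw r (flw s p r) t = flw s p t"
 by (rule flw_unique[OF flw(2)]) (rule flw(1))

lemma flw_time: "norm (flw s p t - flw s p r) <= 4 * e * abs (t - r)"
proof -
 have "norm (flw s p t - flw s p r) <= 4 * e * norm (t - r)"
 proof (rule differentiable_bound[of UNIV "flw s p" "%t h. h *R V t (flw s p t)"])
  fix x :: real
  show "(flw s p has_derivative (%h. h *R V x (flw s p x))) (at x within UNIV)" using flw(2)[of s p x] by (simp add: has_vector_derivative_def)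
  show "onorm (%h. h *R V x (flw s p x)) <= 4 * e"
   by (rule onorm_bound) (use e0 V_bd[of x "flw s p x"] in \<open>auto simp: mult.commute[of "4 * e"] intro!: mult_left_mono\<close>)
 qed auto
 then show ?thesis by simp
qed

text \<open>The time derivative of \<open>vel\<close> along a characteristic. The second term
  removes the linear growth of c; the last one accounts for the motion of a inside E(a).\<close>

definition vr :: "real => phase => plane" where
 "vr t p = F t (zc t p) - lam *R E (fst p) - (lam * t) *R DE (fst p) (kap t *R F t (zc t p))"

lemma vel_deriv:
 assumes y: "(y has_vector_derivative V t (y t)) (at t)" and t: "t >= 0"
 shows "((%t. vel t (y t)) has_vector_derivative vr t (y t)) (at t)"
proof -
 have mt: "max 0 t = t" using t by simp
 have f: "((%t. fst (y t)) has_vector_derivative kap t *R F t (zc t (y t))) (at t)"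
  using bounded_linear.has_vector_derivative[OF bounded_linear_fst y] by (simp add: V_def Wf_def mt)
 have s: "((%t. snd (y t)) has_vector_derivative F t (zc t (y t))) (at t)"
  using bounded_linear.has_vector_derivative[OF bounded_linear_snd y] by (simp add: V_def Wf_def mt)
 have Ef: "((%t. E (fst (y t))) has_vector_derivative DE (fst (y t)) (kap t *R F t (zc t (y t)))) (at t)"
  using has_derivative_compose[OF f[unfolded has_vector_derivative_def] DE_der[of "fst (y t)"]]
  by (simp add: has_vector_derivative_def linear_scale[OF DE_linear])
 have "((%t. (lam * t) *R E (fst (y t))) has_vector_derivative (lam * t) *R DE (fst (y t)) (kap t *R F t (zc t (y t))) + lam *R E (fst (y t))) (at t)"
  by (rule has_vector_derivative_scaleR[OF _ Ef]) (auto intro!: derivative_eq_intros)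
 from has_vector_derivative_diff[OF s this] show ?thesis
  by (simp add: vel_def vr_def algebra_simps)
qed

lemma norm_snd_diff_le:
 assumes t: "t >= 0"
 shows "norm (snd p - snd p') <= norm (vel t p - vel t p') + t * e * norm (fst p - fst p')"
proof -
 have "snd p - snd p' = (vel t p - vel t p') + (lam * t) *R (E (fst p) - E (fst p'))" by (simp add: vel_def algebra_simps)
 also have "norm ... <= norm (vel t p - vel t p') + t * (e * norm (fst p - fst p'))"
  using Elip[of "fst p" "fst p'"] lam t by (intro norm_triangle_mono) (auto simp: abs_mult intro: mult_left_mono)
 finally show ?thesis by (simp add: mult.assoc)
qed

lemma kap_snd_diff_le:
 assumes t: "t >= 0"
 shows "norm (kap t *R (snd p - snd p')) <= kap t * norm (vel t p - vel t p') + e * (kap t * t) * norm (fst p - fst p')"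
proof -
 have "kap t * norm (snd p - snd p') <= kap t * (norm (vel t p - vel t p') + t * e * norm (fst p - fst p'))"
  using kap_pos[of t] by (intro mult_left_mono norm_snd_diff_le t) auto
 also have "... = kap t * norm (vel t p - vel t p') + e * (kap t * t) * norm (fst p - fst p')" by (simp add: algebra_simps)
 finally show ?thesis unfolding norm_scaleR using kap_pos[of t] by simp
qed

lemma e_small: "e <= 1 / 10 ^ 9" "e <= 1" "0 < e" "e * e <= e"
 using e0 e1 by (auto intro!: mult_left_le)

lemma zc_diff_le:
 assumes t: "t >= 0"
 shows "norm (zc t p - zc t p') <= 2 * norm (fst p - fst p') + norm (vel t p - vel t p')"
proof -
 have "norm (zc t p - zc t p') <= norm (fst p - fst p') + norm (kap t *R (snd p - snd p'))" unfolding zc_diff by (rule norm_triangle_ineq4)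
 also have "... <= norm (fst p - fst p') + (kap t * norm (vel t p - vel t p') + e * (kap t * t) * norm (fst p - fst p'))"
  by (intro add_left_mono kap_snd_diff_le t)
 also have "... <= norm (fst p - fst p') + (1 * norm (vel t p - vel t p') + 1 * 1 * norm (fst p - fst p'))"
  using kap_le1[OF t] kap_pos[of t] kap_t_le1[OF t] e_small t by (intro add_left_mono add_mono mult_right_mono mult_mono) auto
 finally show ?thesis by simp
qed

text \<open>Three contributions decay: F - lam E by assumption, E(zc) - E(a) because zc and a differ
  by kap t c, and the motion of a because of its factor t kap t. The second costs one power of the
  velocity.\<close>

lemma vr_bd:
 assumes t: "t >= 0"
 shows "norm (vr t p) <= 5 * e * exp (- (t / 2)) * (1 + norm (vel t p))"
proof -
 define x where "x = exp (- (t / 2))"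
 define v where "v = norm (vel t p)"
 have k: "kap t > 0" by (rule kap_pos)
 have 1: "norm (F t (zc t p) - lam *R E (zc t p)) <= e * x" unfolding x_def by (rule Fclose[OF t])
 have 2: "norm (lam *R (E (zc t p) - E (fst p))) <= e * (kap t * (v + t * e))"
 proof -
  have "norm (E (zc t p) - E (fst p)) <= e * norm (zc t p - fst p)" by (rule Elip)
  also have "norm (zc t p - fst p) = kap t * norm (snd p)" using k by (simp add: zc_def)
  also have "e * (kap t * norm (snd p)) <= e * (kap t * (v + t * e))"
   unfolding v_def using k e0 norm_snd_le_vel[OF t, of p] by (intro mult_left_mono) auto
  finally show ?thesis by (simp only: norm_lamE)
 qed
 have 3: "norm ((lam * t) *R DE (fst p) (kap t *R F t (zc t p))) <= t * (e * (kap t * (2 * e)))"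
 proof -
  have "norm (DE (fst p) (kap t *R F t (zc t p))) <= e * norm (kap t *R F t (zc t p))" by (rule DE_bd)
  also have "... <= e * (kap t * (2 * e))" using k e0 Fbd[OF t, of "zc t p"] by (simp add: mult_left_mono)
  finally show ?thesis using lam t by (simp add: abs_mult mult_left_mono)
 qed
 have "vr t p = (F t (zc t p) - lam *R E (zc t p)) + lam *R (E (zc t p) - E (fst p)) - (lam * t) *R DE (fst p) (kap t *R F t (zc t p))"
  by (simp add: vr_def algebra_simps)
 then have "norm (vr t p) <= e * x + e * (kap t * (v + t * e)) + t * (e * (kap t * (2 * e)))"
  using norm_triangle_mono[OF norm_triangle_mono[OF 1 2] 3[folded norm_minus_cancel[of "(lam * t) *R DE (fst p) (kap t *R F t (zc t p))"]]] by simp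
 also have "... = e * (x + kap t * v + e * (3 * (kap t * t)))" by (simp add: algebra_simps)
 also have "... <= e * (x + kap t * v + 1 * (3 * (kap t * t)))"
  using e0 e_small k t by (intro mult_left_mono add_left_mono mult_right_mono) auto
 also have "... <= e * (5 * x * (1 + v))"
 proof (intro mult_left_mono)
  have "kap t * v <= 2 * x * v" unfolding x_def v_def using kap_le_half[OF t] by (intro mult_right_mono) auto
  moreover have "3 * (kap t * t) <= 4 * x" unfolding x_def using kap_lin_le[OF t] k by (simp add: algebra_simps)
  moreover have "0 <= x * v" unfolding x_def v_def by simp
  ultimately show "x + kap t * v + 1 * (3 * (kap t * t)) <= 5 * x * (1 + v)" by (simp add: algebra_simps)
 qed (use e0 in auto)
 finally show ?thesis by (simp add: x_def v_def mult_ac)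
qed

end

text \<open>A substitute for the minimum that can be integrated exactly: at x = V exp (-2t) the
  right-hand side is the time derivative of -2 ln (1 + V exp (-2t)).\<close>

lemma min_frac_le:
 fixes x :: real
 assumes "x >= 0" shows "min (2 * x) 2 <= 4 * x / (1 + x)"
proof (cases "x <= 1")
 case True
 have "2 * x * (1 + x) <= 2 * x * 2" using True assms by (intro mult_left_mono) auto
 then have "2 * x <= 4 * x / (1 + x)" using assms by (simp add: pos_le_divide_eq)
 then show ?thesis by simp
next
 case False
 then have "2 <= 4 * x / (1 + x)" using assms by (simp add: pos_le_divide_eq)
 then show ?thesis by simp
qed

lemma norm_Pair_ge: "norm x + norm y <= 2 * norm (x, y)"
 using norm_fst_le[of x y] norm_snd_le[of y x] by simp

context flow
begin

text \<open>F(zc) - lam E(a) is split into (F - lam E)(zc), small in Lipschitz norm, and lam (E(zc)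
  - E(a)), whose variation is a second difference of E. The latter produces the term in
  \<open>Vb\<close>. The bound involves the velocity of only one of the two points.\<close>

lemma vr_lip:
 assumes t: "t >= 0" and Vb: "norm (vel t p) <= Vb"
 shows "norm (kap t *R (F t (zc t p) - F t (zc t p')), vr t p - vr t p')
  <= 2 * e * (34 * exp (- (t / 16)) + 4 * (Vb * exp (- 2 * t)) / (1 + Vb * exp (- 2 * t))) * norm (fst p - fst p', vel t p - vel t p')"
proof -
 define x where "x = Vb * exp (- 2 * t)"
 define d1 where "d1 = norm (fst p - fst p')"
 define d2 where "d2 = norm (vel t p - vel t p')"
 define D where "D = d1 + d2"
 have d0: "d1 >= 0" "d2 >= 0" "D >= 0" "d1 <= D" "d2 <= D" by (auto simp: d1_def d2_def D_def)
 have V0: "Vb >= 0" using Vb norm_ge_zero order_trans by blast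
 have k: "kap t > 0" "kap t <= 1" "0 <= kap t * t" using kap_pos kap_le1[OF t] t by (auto simp: less_imp_le)
 have z: "norm (zc t p - zc t p') <= 2 * D" by (rule order_trans[OF zc_diff_le[OF t, of p p', folded d1_def d2_def]]) (use d0(2) in "simp add: D_def")
 have Fd: "norm (F t (zc t p) - F t (zc t p')) <= 4 * e * D"
  using order_trans[OF Flip[OF t] mult_left_mono[OF z]] e0 by simp
 have A: "norm (kap t *R (F t (zc t p) - F t (zc t p'))) <= e * (4 * kap t * D)"
  using mult_left_mono[OF Fd, of "kap t"] k by simp
 have B1: "norm ((F t (zc t p) - lam *R E (zc t p)) - (F t (zc t p') - lam *R E (zc t p'))) <= e * (2 * exp (- (t / 16)) * D)"
 proof -
  have "e * exp (- (t / 16)) * norm (zc t p - zc t p') <= e * exp (- (t / 16)) * (2 * D)" using z e0 by (intro mult_left_mono) auto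
  then show ?thesis using Fclip[OF t, of "zc t p" "zc t p'"] by (simp add: mult_ac)
 qed
 define h where "h = - (kap t *R snd p)"
 define h' where "h' = - (kap t *R snd p')"
 have zh: "zc t p = fst p + h" "zc t p' = fst p' + h'" by (auto simp: zc_def h_def h'_def)
 have hh: "norm (h - h') <= (kap t + kap t * t) * D"
 proof -
  have "norm (h - h') = norm (kap t *R (snd p - snd p'))" by (simp add: h_def h'_def scaleR_diff_right norm_minus_commute)
  also have "... <= kap t * d2 + e * (kap t * t) * d1" unfolding d1_def d2_def by (rule kap_snd_diff_le[OF t])
  also have "... <= kap t * D + 1 * (kap t * t) * D"
   using k d0 e_small by (intro add_mono mult_mono mult_left_mono) auto
  finally show ?thesis by (simp add: algebra_simps)
 qed
 have hn: "norm h <= kap t * Vb + kap t * t"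
 proof -
  have "norm h = kap t * norm (snd p)" using k by (simp add: h_def)
  also have "... <= kap t * (Vb + t * e)" using norm_snd_le_vel[OF t, of p] Vb k by (intro mult_left_mono) auto
  also have "... <= kap t * (Vb + t * 1)" using t k e_small by (intro mult_left_mono add_left_mono) auto
  finally show ?thesis by (simp add: algebra_simps)
 qed
 define m where "m = 4 * x / (1 + x)"
 have x0: "x >= 0" using V0 by (simp add: x_def)
 have m0: "m >= 0" using x0 by (simp add: m_def)
 have km: "min (kap t * Vb) 2 <= m"
 proof -
  have "kap t * Vb <= 2 * x" unfolding x_def using mult_right_mono[OF kap_le_exp[of t] V0] by (simp add: mult_ac)
  then show ?thesis using min_frac_le[OF x0] by (simp add: m_def)
 qed
 have B2: "norm (E (fst p + h) - E (fst p) - E (fst p' + h') + E (fst p')) <= e * ((kap t + kap t * t) * D + (m + kap t * t) * D)"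
 proof -
  have "norm (E (fst p + h) - E (fst p) - E (fst p' + h') + E (fst p')) <= e * norm (h - h') + e * (min (norm h) 2 * d1)"
   using E_second[of "fst p" h "fst p'" h'] E_second'[of "fst p" h "fst p'" h'] by (auto simp: d1_def min_def)
  also have "... <= e * ((kap t + kap t * t) * D) + e * ((m + kap t * t) * D)"
  proof (intro add_mono mult_left_mono hh)
   have "min (norm h) 2 <= m + kap t * t" using hn km k by linarith
   then show "min (norm h) 2 * d1 <= (m + kap t * t) * D" using d0 m0 k by (intro mult_mono) auto
  qed (use e0 in auto)
  finally show ?thesis by (simp add: distrib_left)
 qed
 have B3: "norm ((lam * t) *R (DE (fst p) (kap t *R F t (zc t p)) - DE (fst p') (kap t *R F t (zc t p')))) <= e * (6 * (kap t * t) * D)"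
 proof -
  have "DE (fst p) (kap t *R F t (zc t p)) - DE (fst p') (kap t *R F t (zc t p'))
   = (DE (fst p) (kap t *R F t (zc t p)) - DE (fst p') (kap t *R F t (zc t p))) + DE (fst p') (kap t *R (F t (zc t p) - F t (zc t p')))"
   by (simp add: linear_diff[OF DE_linear] scaleR_diff_right)
  also have "norm ... <= e * d1 * (kap t * (2 * e)) + e * (kap t * (4 * e * D))"
  proof (rule norm_triangle_mono)
   have "norm (DE (fst p) (kap t *R F t (zc t p)) - DE (fst p') (kap t *R F t (zc t p))) <= e * d1 * norm (kap t *R F t (zc t p))"
    unfolding d1_def by (rule DE_lip)
   also have "... <= e * d1 * (kap t * (2 * e))" using k Fbd[OF t, of "zc t p"] d0 e0 by (intro mult_left_mono) auto
   finally show "norm (DE (fst p) (kap t *R F t (zc t p)) - DE (fst p') (kap t *R F t (zc t p))) <= e * d1 * (kap t * (2 * e))" .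
   have "norm (DE (fst p') (kap t *R (F t (zc t p) - F t (zc t p')))) <= e * norm (kap t *R (F t (zc t p) - F t (zc t p')))" by (rule DE_bd)
   also have "... <= e * (kap t * (4 * e * D))" using k Fd e0 by (intro mult_left_mono) auto
   finally show "norm (DE (fst p') (kap t *R (F t (zc t p) - F t (zc t p')))) <= e * (kap t * (4 * e * D))" .
  qed
  also have "... <= e * D * (kap t * (2 * e)) + e * (kap t * (4 * e * D))"
   using d0 e0 k by (intro add_right_mono mult_right_mono mult_left_mono) auto
  also have "... = e * (6 * e * (kap t * D))" by (simp add: algebra_simps)
  also have "... <= e * (6 * 1 * (kap t * D))" using e_small d0 k by (intro mult_left_mono mult_right_mono) auto
  finally have "norm (DE (fst p) (kap t *R F t (zc t p)) - DE (fst p') (kap t *R F t (zc t p'))) <= e * (6 * (kap t * D))" by simp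
  from mult_left_mono[OF this t] show ?thesis using lam t by (simp add: abs_mult mult_ac)
 qed
 have vd: "vr t p - vr t p' = ((F t (zc t p) - lam *R E (zc t p)) - (F t (zc t p') - lam *R E (zc t p')))
   + lam *R (E (fst p + h) - E (fst p) - E (fst p' + h') + E (fst p'))
   + - ((lam * t) *R (DE (fst p) (kap t *R F t (zc t p)) - DE (fst p') (kap t *R F t (zc t p'))))"
  unfolding vr_def zh[symmetric] by (simp add: algebra_simps)
 have "norm (vr t p - vr t p') <= e * (2 * exp (- (t / 16)) * D) + e * ((kap t + kap t * t) * D + (m + kap t * t) * D) + e * (6 * (kap t * t) * D)"
  unfolding vd by (intro norm_triangle_mono B1) (use B2 B3 in "simp_all only: norm_lamE norm_minus_cancel")
 with A have "norm (kap t *R (F t (zc t p) - F t (zc t p')), vr t p - vr t p') <= e * (4 * kap t * D) + (e * (2 * exp (- (t / 16)) * D) + e * ((kap t + kap t * t) * D + (m + kap t * t) * D) + e * (6 * (kap t * t) * D))"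
  using norm_Pair_le[of "kap t *R (F t (zc t p) - F t (zc t p'))" "vr t p - vr t p'"] by linarith
 also have "... = e * D * (2 * exp (- (t / 16)) + (5 * kap t + 8 * (kap t * t)) + m)" by (simp add: algebra_simps)
 also have "... <= e * D * (34 * exp (- (t / 16)) + m)"
 proof -
  have "5 * kap t + 8 * (kap t * t) <= 8 * (kap t * (1 + 3 * t))" using k by (simp add: algebra_simps)
  also have "... <= 8 * (4 * exp (- (t / 2)))" using kap_lin_le[OF t] by simp
  also have "... <= 32 * exp (- (t / 16))" using t by simp
  finally show ?thesis using e0 d0 by (intro mult_left_mono) auto
 qed
 also have "... <= e * (2 * norm (fst p - fst p', vel t p - vel t p')) * (34 * exp (- (t / 16)) + m)"
  using norm_Pair_ge[of "fst p - fst p'" "vel t p - vel t p'"] e0 m0 unfolding D_def d1_def d2_def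
  by (intro mult_right_mono mult_left_mono) auto
 finally show ?thesis unfolding m_def x_def by (simp only: mult_ac)
qed

text \<open>Straightened coordinates, inverse to \<open>asy\<close>, in which the characteristics
  converge as time tends to infinity.\<close>

definition st :: "real => phase => phase" where "st t p = (fst p, vel t p)"

lemma st_deriv:
 assumes y: "(y has_vector_derivative V t (y t)) (at t)" and t: "t >= 0"
 shows "((%t. st t (y t)) has_vector_derivative (kap t *R F t (zc t (y t)), vr t (y t))) (at t)"
proof -
 have "((%t. fst (y t)) has_vector_derivative kap t *R F t (zc t (y t))) (at t)"
  using bounded_linear.has_vector_derivative[OF bounded_linear_fst y] t by (simp add: V_def Wf_def)
 from has_vector_derivative_Pair[OF this vel_deriv[OF y t]] show ?thesis by (simp add: st_def)
qed

lemma exp_small: "0 <= c ==> c <= 10 ^ 7 ==> exp (c * e) <= 6 / 5"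
proof -
 assume c: "0 <= c" "c <= 10 ^ 7"
 have ce: "0 <= c * e" "c * e <= 1 / 10" using c e0 mult_mono[OF c(2) e1] by auto
 have "exp (c * e) <= 1 + c * e + (c * e)^2" using ce by (intro exp_bound) auto
 also have "(c * e)^2 <= (1/10)^2" using ce by (intro power_mono)
 finally show ?thesis using ce by (simp add: power2_eq_square)
qed

lemma vel_compare:
 assumes y: "!!t. (y has_vector_derivative V t (y t)) (at t)" and ts: "0 <= t" "t <= s"
 shows "1 + norm (vel s (y s)) <= 3 * (1 + norm (vel t (y t)))" "1 + norm (vel t (y t)) <= 3 * (1 + norm (vel s (y s)))"
proof -
 \<comment> \<open>Appending the constant component 1 turns the affine bound \<open>vr_bd\<close>
   into a linear one, so that both Gronwall lemmas apply.\<close>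
 define dl where "dl = (%r. (1::real, vel r (y r)))"
 have d: "(dl has_vector_derivative (0, vr r (y r))) (at r)" if "t <= r" "r <= s" for r
  unfolding dl_def using that ts by (intro has_vector_derivative_Pair vel_deriv y) (auto intro!: derivative_eq_intros)
 have one: "1 + norm v <= 2 * norm (1::real, v)" "norm (1::real, v) <= 1 + norm v" for v :: plane
  using norm_Pair_ge[of "1::real" v] norm_Pair_le[of "1::real" v] by auto
 have b: "norm (0::real, vr r (y r)) <= (10 * e * exp (- (r / 2))) * norm (dl r)" if "t <= r" "r <= s" for r
 proof -
  have "norm (0::real, vr r (y r)) <= 5 * e * exp (- (r / 2)) * (1 + norm (vel r (y r)))"
   using vr_bd[of r "y r"] that ts by (simp add: norm_Pair)
  also have "... <= 5 * e * exp (- (r / 2)) * (2 * norm (dl r))" unfolding dl_def using e0 one by (intro mult_left_mono) auto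
  finally show ?thesis by simp
 qed
 have L: "((%r. - 20 * e * exp (- (r / 2))) has_real_derivative 10 * e * exp (- (r / 2))) (at r)" for r
  by (auto intro!: derivative_eq_intros)
 have ex: "exp (- 20 * e * exp (- (s / 2)) - - 20 * e * exp (- (t / 2))) <= 6 / 5"
 proof -
  have "- 20 * e * exp (- (s / 2)) - - 20 * e * exp (- (t / 2)) <= 20 * e"
  proof -
   have "20 * e * exp (- (t / 2)) <= 20 * e * 1" using e0 ts by (intro mult_left_mono) auto
   moreover have "0 <= 20 * e * exp (- (s / 2))" using e0 by simp
   ultimately show ?thesis by linarith
  qed
  then have "exp (- 20 * e * exp (- (s / 2)) - - 20 * e * exp (- (t / 2))) <= exp (20 * e)" by simp
  moreover have "exp (20 * e) <= 6 / 5" by (rule exp_small) auto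
  ultimately show ?thesis by linarith
 qed
 have 1: "norm (dl s) <= norm (dl t) * (6 / 5)"
  using gronwall_forward[OF ts(2) d b L] mult_left_mono[OF ex norm_ge_zero[of "dl t"]] by (rule order_trans)
 have 2: "norm (dl t) <= norm (dl s) * (6 / 5)"
  using gronwall_backward[OF ts(2) d b L] mult_left_mono[OF ex norm_ge_zero[of "dl s"]] by (rule order_trans)
 have "1 + norm (vel s (y s)) <= 2 * norm (dl s)" "1 + norm (vel t (y t)) <= 2 * norm (dl t)"
  "norm (dl t) <= 1 + norm (vel t (y t))" "norm (dl s) <= 1 + norm (vel s (y s))" unfolding dl_def by (rule one)+
 moreover have "0 <= norm (vel s (y s))" "0 <= norm (vel t (y t))" by auto
 ultimately show "1 + norm (vel s (y s)) <= 3 * (1 + norm (vel t (y t)))" "1 + norm (vel t (y t)) <= 3 * (1 + norm (vel s (y s)))"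
  using 1 2 by argo+
qed

lemma st_cauchy:
 assumes y: "!!t. (y has_vector_derivative V t (y t)) (at t)" and t: "0 <= t" "t <= r" "r <= s"
 shows "norm (st s (y s) - st r (y r)) <= (34 * e * (1 + norm (vel t (y t)))) * exp (- (r / 2))"
proof (cases "r = s")
 case False
 then have rs: "r < s" using t by simp
 define v where "v = 1 + norm (vel t (y t))"
 have v: "v >= 1" by (simp add: v_def)
 have cont: "continuous_on {r..s} (%t. st t (y t))"
 proof (rule continuous_at_imp_continuous_on, rule ballI)
  fix x assume "x : {r..s}"
  then show "isCont (%t. st t (y t)) x" using st_deriv[OF y, of x] t by (auto intro: has_vector_derivative_continuous)
 qed
 have "norm (st s (y s) - st r (y r)) <= - (34 * e * v) * exp (- (s / 2)) - - (34 * e * v) * exp (- (r / 2))"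
 proof (rule differentiable_bound_general[OF rs cont, where \<phi>'="%x. 17 * e * v * exp (- (x / 2))" and f'="%x. (kap x *R F x (zc x (y x)), vr x (y x))"])
  fix x assume x: "r < x" "x < s"
  then have x0: "x >= 0" using t by simp
  show "((%t. st t (y t)) has_vector_derivative (kap x *R F x (zc x (y x)), vr x (y x))) (at x)" by (rule st_deriv[OF y x0])
  show "((%x. - (34 * e * v) * exp (- (x / 2))) has_vector_derivative 17 * e * v * exp (- (x / 2))) (at x)"
   by (auto intro!: derivative_eq_intros simp: has_real_derivative_iff_has_vector_derivative[symmetric])
  have "norm (kap x *R F x (zc x (y x))) <= kap x * (2 * e)" using Fbd[OF x0] kap_pos[of x] by (simp add: mult_left_mono)
  also have "... <= (2 * exp (- (x / 2))) * (2 * e)" using kap_le_half[OF x0] e0 by (intro mult_right_mono) auto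
  also have "... <= (2 * e * exp (- (x / 2))) * 2" by simp
  finally have 1: "norm (kap x *R F x (zc x (y x))) <= 4 * (e * exp (- (x / 2)))" by simp
  have "norm (vr x (y x)) <= 5 * e * exp (- (x / 2)) * (1 + norm (vel x (y x)))" by (rule vr_bd[OF x0])
  also have "... <= 5 * e * exp (- (x / 2)) * (3 * v)"
   unfolding v_def using vel_compare(1)[OF y, of t x] x t e0 by (intro mult_left_mono) auto
  finally have 2: "norm (vr x (y x)) <= 15 * (e * exp (- (x / 2)) * v)" by simp
  have n: "norm (kap x *R F x (zc x (y x)), vr x (y x)) <= norm (kap x *R F x (zc x (y x))) + norm (vr x (y x))" by (rule norm_Pair_le)
  have k: "norm (kap x *R F x (zc x (y x))) <= 2 * (e * exp (- (x / 2)) * v)"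
  proof -
   have "norm (kap x *R F x (zc x (y x))) <= kap x * (2 * e)" using Fbd[OF x0] kap_pos[of x] by (simp add: mult_left_mono)
   \<comment> \<open>With q = exp (-x/2) this is 2 q^4 <= (1 + q^4) q. The factor 1, where
     \<open>kap_le_half\<close> has 2, keeps the total rate at 2 + 15 = 17, whose integral gives the
     constant 34.\<close>
   also have "kap x <= exp (- (x / 2))"
   proof -
    have "2 * exp (- 2 * x) <= (1 + exp (- 2 * x)) * exp (- (x / 2))"
    proof -
     define q where "q = exp (- (x / 2))"
     have q: "0 < q" "q <= 1" using x0 by (auto simp: q_def)
     have "exp (- 2 * x) = q ^ 4" by (simp add: q_def exp_of_nat_mult[symmetric])
     moreover have "2 * q ^ 4 <= (1 + q ^ 4) * q"
     proof -
      have "q ^ 4 <= q" using q power_decreasing[of 1 4 q] by simp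
      moreover have "q ^ 4 <= q ^ 4 * q | True" by simp
      moreover have "0 <= q * ((1 - q ^ 3) * (1 - q ^ 1) + q ^ 3 * (1 - q) * 0)" using q by (auto intro!: mult_nonneg_nonneg simp: power_le_one)
      moreover have "0 <= q * (1 - q) * (1 - q ^ 3)" using q by (auto intro!: mult_nonneg_nonneg simp: power_le_one)
      moreover have "(1 + q ^ 4) * q - 2 * q ^ 4 = q * (1 - q) * (1 - q ^ 3) + q * (q - q ^ 3) + 0 * q"
       by (simp add: algebra_simps power_numeral_reduce)
      moreover have "q ^ 3 <= q" using q power_decreasing[of 1 3 q] by simp
      then have "0 <= q * (q - q ^ 3)" using q by (intro mult_nonneg_nonneg) auto
      ultimately show ?thesis by linarith
     qed
     ultimately show ?thesis by (simp add: q_def)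
    qed
    then show ?thesis unfolding kap_eq by (simp add: pos_divide_le_eq add_pos_pos mult.commute)
   qed
   then have "kap x * (2 * e) <= exp (- (x / 2)) * (2 * e)" using e0 by (intro mult_right_mono) auto
   also have "... <= 2 * (e * exp (- (x / 2)) * v)" using v e0 by simp
   finally show ?thesis .
  qed
  show "norm (kap x *R F x (zc x (y x)), vr x (y x)) <= 17 * e * v * exp (- (x / 2))"
   using n 2 k by (simp add: mult_ac)
 qed (auto intro!: continuous_intros)
 also have "... <= (34 * e * v) * exp (- (r / 2))" using e0 v by simp
 finally show ?thesis by (simp add: v_def)
qed (use e0 in "auto intro!: mult_nonneg_nonneg add_nonneg_nonneg")

section \<open>The final state map\<close>

text \<open>The labels (x, v) of the asymptotic curve approached by the characteristic through
  \<open>p\<close> at time \<open>t\<close>. Composing the datum with this map gives the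
  solution.\<close>

definition Phi :: "real => phase => phase" where
 "Phi t p = Lim at_top (%r. st r (flw t p r))"

lemma Phi_lim:
 assumes t: "t >= 0"
 shows "((%r. st r (flw t p r)) \<longlongrightarrow> Phi t p) at_top"
  and "norm (Phi t p - st t p) <= 34 * e * (1 + norm (vel t p)) * exp (- (t / 2))"
proof -
 obtain l where l: "((%r. st r (flw t p r)) \<longlongrightarrow> l) at_top"
  "!!r. t <= r ==> norm (l - st r (flw t p r)) <= (34 * e * (1 + norm (vel t (flw t p t)))) * exp (- (r / 2))"
  using limit_of_exp_cauchy[of t "%r. st r (flw t p r)", OF st_cauchy[OF flw(2) t]] by blast
 have "Phi t p = l" unfolding Phi_def by (rule tendsto_Lim[OF _ l(1)]) simp
 then show "((%r. st r (flw t p r)) \<longlongrightarrow> Phi t p) at_top"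
  "norm (Phi t p - st t p) <= 34 * e * (1 + norm (vel t p)) * exp (- (t / 2))"
  using l(1) l(2)[of t] by (auto simp: flw(1))
qed

lemma Phi_inv: "Phi r (flw t p r) = Phi t p"
 unfolding Phi_def by (simp add: flw_group)

lemma Phi_vel:
 assumes t: "t >= 0"
 shows "1 + norm (snd (Phi t p)) <= 3 * (1 + norm (vel t p))" "1 + norm (vel t p) <= 3 * (1 + norm (snd (Phi t p)))"
proof -
 have l: "((%r. 1 + norm (vel r (flw t p r))) \<longlongrightarrow> 1 + norm (snd (Phi t p))) at_top"
  using tendsto_add[OF tendsto_const tendsto_norm[OF tendsto_snd[OF Phi_lim(1)[OF t, of p]]], of 1] by (simp add: st_def)
 have ev: "\<forall>\<^sub>F r in at_top. 1 + norm (vel r (flw t p r)) <= 3 * (1 + norm (vel t p)) & 1 + norm (vel t p) <= 3 * (1 + norm (vel r (flw t p r)))"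
  unfolding eventually_at_top_linorder
 proof (intro exI[of _ t] allI impI)
  fix r assume "t <= r"
  from vel_compare[OF flw(2) t this, of t p]
  show "1 + norm (vel r (flw t p r)) <= 3 * (1 + norm (vel t p)) & 1 + norm (vel t p) <= 3 * (1 + norm (vel r (flw t p r)))"
   by (simp only: flw(1))
 qed
 show "1 + norm (snd (Phi t p)) <= 3 * (1 + norm (vel t p))"
  by (rule tendsto_upperbound[OF l]) (use ev in "auto elim: eventually_mono")
 show "1 + norm (vel t p) <= 3 * (1 + norm (snd (Phi t p)))"
  by (rule tendsto_lowerbound[OF tendsto_mult[OF tendsto_const l]]) (use ev in "auto elim: eventually_mono")
qed

text \<open>Gronwall with the rate of \<open>vr_lip\<close>. The exponent is O(e) plus 4 e ln (1 +
  V0), and 4 e <= 1, so the constant grows at most linearly in the velocity; the weight on the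
  gradient of the datum will cancel this growth.\<close>

lemma Phi_lip:
 assumes t: "t >= 0"
 shows "norm (Phi t p - Phi t p') <= 8 * (1 + norm (vel t p)) * norm (st t p - st t p')"
proof -
 define V0 where "V0 = 3 * (1 + norm (vel t p))"
 have V0: "V0 >= 3" by (simp add: V0_def)
 define dl where "dl = (%r. st r (flw t p r) - st r (flw t p' r))"
 \<comment> \<open>An explicit antiderivative of the rate: 544 = 34 * 16, and the logarithm
   integrates the fraction that replaced the minimum.\<close>
 define La where "La = (%r. 2 * e * (- 544 * exp (- (r / 16)) - 2 * ln (1 + V0 * exp (- 2 * r))))"
 have pos: "1 + V0 * exp (- 2 * r) > 0" for r using V0 by (intro add_pos_nonneg) auto
 have L: "(La has_real_derivative 2 * e * (34 * exp (- (r / 16)) + 4 * (V0 * exp (- 2 * r)) / (1 + V0 * exp (- 2 * r)))) (at r)" for r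
  unfolding La_def using pos[of r] by (auto intro!: derivative_eq_intros simp: field_simps)
 have bd: "norm (dl s) <= 8 * (1 + norm (vel t p)) * norm (st t p - st t p')" if ts: "t <= s" for s
 proof -
  have "norm (dl s) <= norm (dl t) * exp (La s - La t)"
  proof (rule gronwall_forward[OF ts _ _ L])
   fix r assume r: "t <= r" "r <= s"
   then have r0: "r >= 0" using t by simp
   let ?p = "flw t p r" and ?p' = "flw t p' r"
   show "(dl has_vector_derivative (kap r *R (F r (zc r ?p) - F r (zc r ?p')), vr r ?p - vr r ?p')) (at r)"
    unfolding dl_def using has_vector_derivative_diff[OF st_deriv[OF flw(2)[of t p] r0] st_deriv[OF flw(2)[of t p'] r0]]
    by (simp add: scaleR_diff_right)
   have "norm (vel r ?p) <= V0" using vel_compare(1)[OF flw(2)[of t p] t r(1)] by (simp add: V0_def flw(1))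
   from vr_lip[OF r0 this, of ?p']
   show "norm (kap r *R (F r (zc r ?p) - F r (zc r ?p')), vr r ?p - vr r ?p') <= 2 * e * (34 * exp (- (r / 16)) + 4 * (V0 * exp (- 2 * r)) / (1 + V0 * exp (- 2 * r))) * norm (dl r)"
    by (simp add: dl_def st_def)
  qed
  also have "... <= norm (dl t) * (8 * (1 + norm (vel t p)))"
  proof (rule mult_left_mono)
   have "La s - La t <= 1088 * e + ln (1 + V0)"
   proof -
    have "- 544 * exp (- (s / 16)) <= 0" by simp
    moreover have "544 * exp (- (t / 16)) <= 544" using t by simp
    moreover have "0 <= ln (1 + V0 * exp (- 2 * s))" using V0 by (intro ln_ge_zero) auto
    moreover have "ln (1 + V0 * exp (- 2 * t)) <= ln (1 + V0)" using V0 t pos[of t] by (subst ln_le_cancel_iff) (auto simp: mult_left_le)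
    ultimately have "(- 544 * exp (- (s / 16)) - 2 * ln (1 + V0 * exp (- 2 * s))) - (- 544 * exp (- (t / 16)) - 2 * ln (1 + V0 * exp (- 2 * t))) <= 544 + 2 * ln (1 + V0)" by linarith
    then have "2 * e * ((- 544 * exp (- (s / 16)) - 2 * ln (1 + V0 * exp (- 2 * s))) - (- 544 * exp (- (t / 16)) - 2 * ln (1 + V0 * exp (- 2 * t)))) <= 2 * e * (544 + 2 * ln (1 + V0))"
     using e0 by (intro mult_left_mono) auto
    also have "... = 1088 * e + (4 * e) * ln (1 + V0)" by (simp add: algebra_simps)
    also have "(4 * e) * ln (1 + V0) <= 1 * ln (1 + V0)" using e1 V0 by (intro mult_right_mono ln_ge_zero) auto
    finally show ?thesis by (simp add: La_def algebra_simps)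
   qed
   then have "exp (La s - La t) <= exp (1088 * e) * (1 + V0)" using V0 by (simp flip: exp_le_cancel_iff[of _ "_ + _"] add: exp_add)
   also have "... <= (6 / 5) * (1 + V0)" using exp_small[of 1088] V0 by (intro mult_right_mono) auto
   also have "... <= 8 * (1 + norm (vel t p))" by (simp add: V0_def)
   finally show "exp (La s - La t) <= 8 * (1 + norm (vel t p))" .
  qed simp
  finally show ?thesis by (simp add: dl_def flw(1) mult_ac)
 qed
 have "((%s. norm (dl s)) \<longlongrightarrow> norm (Phi t p - Phi t p')) at_top"
  unfolding dl_def by (intro tendsto_norm tendsto_diff Phi_lim t)
 then show ?thesis
  by (rule tendsto_upperbound) (use bd in "auto simp: eventually_at_top_linorder intro!: exI[of _ t]")
qed

end

section \<open>Weighted Lipschitz data carried by the flow\<close>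

text \<open>The difference form of a bound on the gradient multiplied by 1 + |v|. By symmetry the
  weight may be taken at either of the two points.\<close>

definition wlip :: "real => (phase => real) => bool" where
 "wlip K H \<longleftrightarrow> K >= 0 & (ALL p q. abs (H p - H q) <= K / (1 + norm (snd p)) * norm (p - q))"

lemma wlipD: "wlip K H ==> abs (H p - H q) <= K / (1 + norm (snd p)) * norm (p - q)"
 unfolding wlip_def by blast

lemma one_norm_pos: "0 < 1 + norm x" by (rule add_pos_nonneg) auto

lemma wlip_lip: "wlip K H ==> abs (H p - H q) <= K * norm (p - q)"
proof -
 assume H: "wlip K H"
 have "K / (1 + norm (snd p)) <= K / 1" using H by (intro divide_left_mono) (auto simp: wlip_def one_norm_pos)
 then have "K / (1 + norm (snd p)) * norm (p - q) <= K * norm (p - q)" by (intro mult_right_mono) auto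
 then show ?thesis using wlipD[OF H, of p q] by linarith
qed

lemma wlip_cont: "wlip K H ==> continuous_on UNIV H"
proof -
 assume H: "wlip K H"
 have "K-lipschitz_on UNIV H" by (intro lipschitz_onI) (use wlip_lip[OF H] H in "auto simp: dist_norm wlip_def")
 then show ?thesis by (rule lipschitz_on_continuous_on)
qed

text \<open>The weighted function \<open>(1 + |snd p|) H p\<close> has compact support too, so it is globally Lipschitz.\<close>

lemma wlip_of_compact_support:
 assumes H: "loclip (%(t::real). H)" and supp: "!!q. H q ~= 0 ==> norm q <= R"
 shows "EX K. wlip K H"
proof -
 define W where "W = (%q. (1 + norm (snd q)) * H q)"
 have "loclip (%(t::real) q::phase. 1 + norm (snd q))"
 proof (rule loclip_const_time[where C=1])
  show "norm (1 + norm (snd p) - (1 + norm (snd p'))) <= 1 * norm (p - p')" for p p' :: "phase"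
   using norm_triangle_ineq3[of "snd p" "snd p'"] norm_fst_snd(2)[of "p - p'"] by simp
 qed
 from loclip_mult[OF this H] have "loclip (%(t::real). W)" by (simp add: W_def)
 then obtain L where L0: "L >= 0" and L': "!!t t' p p'. t : {0..0::real} ==> t' : {0..0} ==> norm (W p - W p') <= L * (abs (t - t') + norm (p - p'))"
  by (rule loclip_support[OF _ order_refl, of _ 0 R]) (use supp in "auto simp: W_def")
 have L: "abs (W p - W p') <= L * norm (p - p')" for p p' using L'[of 0 0 p p'] by simp
 have "continuous_on (cball 0 R) H" using loclip_cont[OF H, of 0] continuous_on_subset by auto
 then have "bounded (H ` cball 0 R)" by (intro compact_imp_bounded compact_continuous_image) auto
 then obtain B where "ALL q:H ` cball 0 R. norm q <= B" unfolding bounded_iff by blast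
 then have B: "norm q <= R ==> abs (H q) <= B" for q by simp
 have B': "abs (H q) <= abs B" for q using B[of q] supp[of q] by (cases "H q = 0") auto
 have "abs (H p - H q) <= (L + abs B) / (1 + norm (snd p)) * norm (p - q)" for p q
 proof -
  have "(1 + norm (snd p)) * (H p - H q) = (W p - W q) + (norm (snd q) - norm (snd p)) * H q" by (simp add: W_def algebra_simps)
  also have "abs ... <= L * norm (p - q) + norm (p - q) * abs B"
  proof (rule order_trans[OF abs_triangle_ineq add_mono[OF L]], unfold abs_mult, rule mult_mono[OF _ B'])
   show "abs (norm (snd q) - norm (snd p)) <= norm (p - q)"
    using norm_triangle_ineq3[of "snd q" "snd p"] norm_fst_snd(2)[of "p - q"] by (simp add: norm_minus_commute)
  qed auto
  finally have "(1 + norm (snd p)) * abs (H p - H q) <= (L + abs B) * norm (p - q)" using one_norm_pos[of "snd p"] by (simp add: abs_mult distrib_right mult.commute)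
  then show ?thesis using one_norm_pos[of "snd p"] by (simp add: pos_le_divide_eq mult.commute)
 qed
 moreover have "0 <= L + abs B" using L0 by simp
 ultimately show ?thesis unfolding wlip_def by blast
qed

context flow
begin

lemma st_diff: "t >= 0 ==> norm (st t p - st t p') <= norm (fst p - fst p') + (norm (snd p - snd p') + t * e * norm (fst p - fst p'))"
proof -
 assume t: "t >= 0"
 have "vel t p - vel t p' = (snd p - snd p') - (lam * t) *R (E (fst p) - E (fst p'))" by (simp add: vel_def algebra_simps)
 also have "norm ... <= norm (snd p - snd p') + norm ((lam * t) *R (E (fst p) - E (fst p')))" by (rule norm_triangle_ineq4)
 also have "norm ((lam * t) *R (E (fst p) - E (fst p'))) <= t * (e * norm (fst p - fst p'))"
  using Elip lam t by (auto simp: abs_mult intro!: mult_left_mono)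
 finally have "norm (vel t p - vel t p') <= norm (snd p - snd p') + t * e * norm (fst p - fst p')" by (simp add: mult.assoc)
 then show ?thesis using norm_Pair_le[of "fst p - fst p'" "vel t p - vel t p'"] by (simp add: st_def)
qed

text \<open>The weight at \<open>Phi t p\<close> cancels the linear growth in
  \<open>Phi_lip\<close>, as velocities along a characteristic are comparable. In straightened
  coordinates no loss remains, neither in velocity nor in time.\<close>

lemma H_st:
 assumes H: "wlip K H" and t: "t >= 0"
 shows "abs (H (Phi t p) - H (Phi t p')) <= 24 * K * norm (st t p - st t p')"
proof -
 have K: "K >= 0" using H by (simp add: wlip_def)
 let ?n = "1 + norm (snd (Phi t p))"
 have "abs (H (Phi t p) - H (Phi t p')) <= K / ?n * norm (Phi t p - Phi t p')" by (rule wlipD[OF H])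
 also have "... <= K / ?n * (8 * (3 * ?n) * norm (st t p - st t p'))"
 proof (rule mult_left_mono)
  have "8 * (1 + norm (vel t p)) * norm (st t p - st t p') <= 8 * (3 * ?n) * norm (st t p - st t p')"
   using Phi_vel(2)[OF t, of p] by (intro mult_right_mono mult_left_mono) auto
  then show "norm (Phi t p - Phi t p') <= 8 * (3 * ?n) * norm (st t p - st t p')" using Phi_lip[OF t, of p p'] by linarith
 qed (use K one_norm_pos[of "snd (Phi t p)"] in auto)
 also have "... = 24 * K * norm (st t p - st t p')" using one_norm_pos[of "snd (Phi t p)"] by (simp add: field_simps)
 finally show ?thesis .
qed

lemma H_lip:
 assumes H: "wlip K H" and t: "t >= 0"
 shows "abs (H (Phi t p) - H (Phi t p')) <= 48 * K * (1 + t) * norm (p - p')"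
proof -
 have K: "K >= 0" using H by (simp add: wlip_def)
 note n = norm_fst_snd[of "p - p'", unfolded fst_diff snd_diff]
 have "norm (st t p - st t p') <= norm (p - p') + (norm (p - p') + t * 1 * norm (p - p'))"
  by (rule order_trans[OF st_diff[OF t]]) (use n t e_small e0 in "intro add_mono mult_mono; simp")
 also have "... <= 2 * (1 + t) * norm (p - p')" using t by (simp add: algebra_simps)
 finally have "24 * K * norm (st t p - st t p') <= 24 * K * (2 * (1 + t) * norm (p - p'))" using K by (intro mult_left_mono) auto
 also have "... = 48 * K * (1 + t) * norm (p - p')" by simp
 finally show ?thesis using H_st[OF H t, of p p'] by linarith
qed

text \<open>A general displacement of (a, c) costs a factor t, from the term t E(a) in
  \<open>vel\<close>. In the directions (k w, w) this factor meets k t <= 2, so the bound is uniform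
  in time. These are the displacements that a change of field produces in an Euler step.\<close>

lemma H_dir:
 assumes H: "wlip K H" and t: "t >= 0" and k: "0 <= k" "k <= 1" "k * t <= 2"
 shows "abs (H (Phi t (p + (k *R w, w))) - H (Phi t p)) <= 72 * K * norm w"
proof -
 have K: "K >= 0" using H by (simp add: wlip_def)
 have "norm (st t (p + (k *R w, w)) - st t p) <= k * norm w + (norm w + e * (k * t) * norm w)"
  using st_diff[OF t, of "p + (k *R w, w)" p] k by (simp add: mult_ac)
 also have "... <= 1 * norm w + (norm w + (1 / 2) * 2 * norm w)" using k t e0 e1 by (intro add_mono mult_right_mono mult_mono) auto
 finally have "24 * K * norm (st t (p + (k *R w, w)) - st t p) <= 24 * K * (3 * norm w)" using K by (intro mult_left_mono) auto
 then show ?thesis using H_st[OF H t, of "p + (k *R w, w)" p] by simp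
qed

lemma H_flow:
 assumes H: "wlip K H" and t: "s >= 0"
 shows "abs (H (Phi s p') - H (Phi t p)) <= 48 * K * (1 + s) * norm (p' - flw t p s)"
 using H_lip[OF assms, of p' "flw t p s"] by (simp add: Phi_inv)

lemma flw_shift: "norm (p - flw t' p' t) <= abs (t - t') + norm (p - p')"
proof -
 have "norm (p - flw t' p' t) <= norm (p - p') + norm (flw t' p' t - flw t' p' t')"
  using norm_triangle_ineq[of "p - p'" "p' - flw t' p' t"] by (simp add: flw(1) norm_minus_commute)
 also have "norm (flw t' p' t - flw t' p' t') <= 1 * abs (t - t')" by (rule order_trans[OF flw_time]) (use e_small e1 in "intro mult_right_mono, auto")
 finally show ?thesis by simp
qed

lemma H_loclip: assumes H: "wlip K H" shows "loclip (%t p. H (Phi t p))"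
proof (rule loclipI)
 fix T :: real
 have K: "K >= 0" using H by (simp add: wlip_def)
 show "EX L. ALL t:{0..T}. ALL t':{0..T}. ALL p p'. norm (H (Phi t p) - H (Phi t' p')) <= L * (abs (t - t') + norm (p - p'))"
 proof (intro exI[of _ "48 * K * (1 + T)"] allI ballI)
  fix t t' p p' assume t: "t : {0..T}" "t' : {0..T}"
  have "abs (H (Phi t p) - H (Phi t' p')) <= 48 * K * (1 + t) * norm (p - flw t' p' t)" by (rule H_flow[OF H]) (use t in auto)
  also have "... <= 48 * K * (1 + T) * (abs (t - t') + norm (p - p'))" using flw_shift K t by (intro mult_mono) auto
  finally show "norm (H (Phi t p) - H (Phi t' p')) <= 48 * K * (1 + T) * (abs (t - t') + norm (p - p'))" by simp
 qed
qed

text \<open>Differentiability of the characteristic in time, sampled at the steps 1/(n+1); nothing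
  uniform in \<open>p\<close> is claimed.\<close>

lemma euler_error:
 assumes t: "t > 0"
 shows "rate_le 0 (%n. norm (p + (1 / Suc n) *R Wf F t p - flw t p (t + 1 / Suc n)))"
proof -
 have "((%h. norm ((flw t p (t + h) - flw t p t - h *R V t p)) / norm h) \<longlongrightarrow> 0) (at 0)"
  using flw(2)[of t p t] unfolding has_vector_derivative_def has_derivative_at flw(1) by simp
 then have "(%n. norm ((flw t p (t + 1 / Suc n) - flw t p t - (1 / Suc n) *R V t p)) / norm (1 / Suc n)) ---> 0"
  by (rule filterlim_compose) (use LIMSEQ_Suc[OF lim_1_over_n] in "auto simp: filterlim_at simp del: of_nat_Suc")
 then have "(%n. real (Suc n) * norm (p + (1 / Suc n) *R Wf F t p - flw t p (t + 1 / Suc n))) ---> 0"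
  by (rule Lim_transform_eventually) (use t in "auto simp: V_def flw(1) norm_minus_commute algebra_simps simp del: of_nat_Suc intro!: always_eventually")
 then show ?thesis unfolding rate_0_iff[symmetric] by simp
qed

lemma H_quot:
 assumes H: "wlip K H" and t: "t > 0"
 shows "rate_le 0 (%n. abs (inc F (%t p. H (Phi t p)) t p n))"
proof (rule rate_le_mono[OF rate_le_cmult[OF euler_error[OF t, of p], of "48 * K * (2 + t)"]])
 have K: "K >= 0" using H by (simp add: wlip_def)
 then show "0 <= 48 * K * (2 + t)" using t by simp
 fix n
 have h: "0 < 1 / real (Suc n)" "1 / real (Suc n) <= 1" by auto
 define X where "X = norm (p + (1 / real (Suc n)) *R Wf F t p - flw t p (t + 1 / Suc n))"
 have "abs (inc F (%t p. H (Phi t p)) t p n) <= 48 * K * (1 + (t + 1 / Suc n)) * X"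
  unfolding X_def by (rule H_flow[OF H]) (use t h in linarith)
 also have "... <= 48 * K * (2 + t) * X" using K h by (intro mult_right_mono mult_left_mono) (auto simp: X_def)
 finally show "abs (inc F (%t p. H (Phi t p)) t p n) <= 48 * K * (2 + t) * norm (p + (1 / real (Suc n)) *R Wf F t p - flw t p (t + 1 / Suc n))"
  by (simp only: X_def)
qed simp

lemma H_transported: assumes H: "wlip K H" shows "transported F (%t p. H (Phi t p))"
 unfolding transported_def using H_loclip[OF H] H_quot[OF H] by auto

lemma st_asy [simp]: "st t (asy t q) = q" by (simp add: st_def)

text \<open>The decay of \<open>wlip\<close> in velocity cancels the factor 1 + |v| in
  \<open>Phi_lim\<close>, so the rate is uniform over phase space.\<close>

lemma H_conv:
 assumes H: "wlip K H" and t: "t >= 0"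
 shows "abs (H (Phi t (asy t q)) - H q) <= 34 * e * K * exp (- (t / 2))"
proof -
 have K: "K >= 0" using H by (simp add: wlip_def)
 have "abs (H q - H (Phi t (asy t q))) <= K / (1 + norm (snd q)) * norm (q - Phi t (asy t q))" by (rule wlipD[OF H])
 also have "... <= K / (1 + norm (snd q)) * (34 * e * (1 + norm (snd q)) * exp (- (t / 2)))"
  using Phi_lim(2)[OF t, of "asy t q"] K by (intro mult_left_mono) (auto simp: norm_minus_commute)
 also have "... = 34 * e * K * exp (- (t / 2))" using one_norm_pos[of "snd q"] by (simp add: field_simps)
 finally show ?thesis by (simp add: abs_minus_commute)
qed

lemma exp_half_lim: "(%n. c * exp (- (real n / 2))) ---> 0"
proof -
 have "exp (- (real n / 2)) = exp (- (1 / 2)) ^ n" for n by (simp add: exp_of_nat_mult[symmetric])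
 then show ?thesis using LIMSEQ_realpow_zero[of "exp (- (1/2 :: real))"] by (auto intro!: tendsto_mult_right_zero)
qed

lemma H_lim:
 assumes H: "wlip K H" shows "(%n. H (fin Phi n q)) ---> H q"
proof -
 have "(%n. H (fin Phi n q) - H q) ---> 0"
  by (rule Lim_null_comparison[OF _ exp_half_lim]) (use H_conv[OF H, of "real _" q] in \<open>auto intro!: always_eventually\<close>)
 then show ?thesis by (simp add: LIM_zero_iff)
qed

lemma Phi_bounded:
 assumes t: "t >= 0" and R: "norm (Phi t p) <= R"
 shows "norm (st t p) <= 2 * R + 1"
proof -
 have "norm (st t p) <= norm (Phi t p) + norm (Phi t p - st t p)" using norm_triangle_ineq4[of "Phi t p" "Phi t p - st t p"] by simp
 also have "norm (Phi t p - st t p) <= 34 * e * (1 + norm (vel t p)) * exp (- (t / 2))" by (rule Phi_lim(2)[OF t])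
 also have "... <= (1 / 2) * (1 + norm (vel t p)) * 1" using t e0 e1 by (intro mult_mono) auto
 finally have "norm (st t p) <= R + 1 / 2 + norm (vel t p) / 2" using R by (simp add: add_divide_distrib)
 moreover have "norm (vel t p) <= norm (st t p)" unfolding st_def using norm_snd_le[of "vel t p" "fst p"] .
 ultimately show ?thesis by linarith
qed

text \<open>No Jacobian of the flow is computed: \<open>transport_ineq\<close> applied to the
  negative bounds the integral at time t by those at later times, and these converge to the integral
  of \<open>H\<close> after pulling back by \<open>asy\<close>.\<close>

lemma H_mass:
 assumes H: "wlip K H" and H0: "!!q. H q >= 0" and supp: "!!q. H q ~= 0 ==> norm q <= R" and t: "t >= 0"
 shows "(NN p. ennreal (H (Phi t p))) <= (NN p. ennreal (H p))"
proof -
 have Hc: "continuous_on UNIV H" by (rule wlip_cont[OF H])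
 note [measurable] = borel_measurable_continuous_onI[OF Hc]
 have loc: "loclip (%t p. H (Phi t p))" by (rule H_loclip[OF H])
 have Pm: "(%p. H (Phi s p)) : bmeas" if "s >= 0" for s by (rule loclip_meas[OF loc that])
 obtain B where B: "B >= 0" "!!q. H q <= B"
 proof -
  have "compact (H ` cball 0 R)" by (intro compact_continuous_image continuous_on_subset[OF Hc]) auto
  then obtain B where B: "!!q. norm q <= R ==> norm (H q) <= B" unfolding bounded_iff[THEN iffD1, OF compact_imp_bounded] by (meson bounded_iff compact_imp_bounded imageI mem_cball_0)
  have "H q <= max B 0" for q using B[of q] supp[of q] by (cases "H q = 0") auto
  then show ?thesis by (intro that[of "max B 0"]) auto
 qed
 have cut: "norm p <= 2 * R + 1 + s * e" if "s >= 0" "H (Phi s p) ~= 0" for s p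
 proof -
  have "norm (st s p) <= 2 * R + 1" by (rule Phi_bounded[OF that(1) supp[OF that(2)]])
  moreover have "norm p <= norm (st s p) + norm (p - st s p)" by (rule norm_triangle_sub)
  moreover have "norm (p - st s p) <= s * e"
  proof -
   have "p - st s p = (0, (lam * s) *R E (fst p))" by (cases p) (simp add: st_def vel_def)
   then show ?thesis using Ebd[of "fst p"] lam that by (simp add: abs_mult mult_left_mono)
  qed
  ultimately show ?thesis by linarith
 qed
 have int: "integrable lborel (%p. H (Phi s p))" if s: "s >= 0" for s
  by (rule integrable_continuous_support[OF loclip_cont[OF loc s] cut[OF s]])
 have intH: "integrable lborel H"
  by (rule integrable_continuous_support[OF Hc supp])
 have dec: "(LBINT p. H (Phi t p)) <= (LBINT p. H (Phi s p))" if s: "t <= s" for s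
 proof -
  have "(LBINT p. - H (Phi s p)) - (LBINT p. - H (Phi t p)) <= 0 * integral {t..s} (%_. 0)"
  proof (rule transport_ineq[where F=F and M="2 * e" and k="%_ _. 0" and R="2 * R + 1 + (s + 1) * e"])
   show "loclip (%t p. - H (Phi t p))" by (rule loclip_uminus[OF loc])
   show "norm p <= 2 * R + 1 + (s + 1) * e" if "t <= r" "r <= s + 1" "- H (Phi r p) ~= 0" for r p
   proof -
    have "r * e <= (s + 1) * e" using that e0 by (intro mult_right_mono) auto
    moreover have "r >= 0" using that t by linarith
    ultimately show ?thesis using cut[of r p] that by fastforce
   qed
   show "AE q in lborel. case q of (r, p) => t < r --> r < s --> rate_le (0 * 0) (inc F (%r p. - H (Phi r p)) r p)"
   proof (intro AE_I2, clarify)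
    fix r p assume "t < r"
    then have "r > 0" using t by simp
    from H_quot[OF H this, of p] show "rate_le (0 * 0) (inc F (%r p. - H (Phi r p)) r p)"
     by (rule rate_le_mono) auto
   qed
  qed (use F_meas Fbd t s in auto)
  then show ?thesis by simp
 qed
 have "(%n. LBINT q. H (fin Phi n q)) ---> (LBINT q. H q)"
 proof (rule integral_dominated_convergence)
  show "integrable lborel (%q::phase. B * indicator (cball 0 (2 * R + 1)) q)" by (intro integrable_mult_right integrable_indicator_cball)
  show "AE q in lborel. (%n. H (fin Phi n q)) ---> H q" by (intro AE_I2 H_lim[OF H])
  fix n
  show "(%q. H (fin Phi n q)) : borel_measurable lborel" using measurable_compose[OF asy_meas Pm[of "real n"]] by simp
  show "AE q in lborel. norm (H (fin Phi n q)) <= B * indicator (cball 0 (2 * R + 1)) q"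
  proof (intro AE_I2)
   fix q show "norm (H (fin Phi n q)) <= B * indicator (cball 0 (2 * R + 1)) q"
    using Phi_bounded[of "real n" "asy (real n) q" R, OF _ supp] B H0
    by (cases "H (fin Phi n q) = 0") (simp_all add: indicator_def)
  qed
 qed simp
 then have "(%n. LBINT q. H (Phi (real n) q)) ---> (LBINT q. H q)"
  using lborel_pres_integral[OF asy_pres Pm] by simp
 then have "(LBINT p. H (Phi t p)) <= (LBINT q. H q)"
  by (rule tendsto_lowerbound[OF _ eventually_sequentiallyI[of "nat \<lceil>t\<rceil>"]]) (auto intro!: dec simp: nat_ceiling_le_eq)
 then show ?thesis using nn_integral_eq_integral[OF int[OF t]] nn_integral_eq_integral[OF intH] H0 by (simp add: ennreal_leI)
qed

end

section \<open>Estimates of the field\<close>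

lemma norm_le_of_inner:
 fixes x :: "'a::real_inner"
 assumes "!!u. norm u <= 1 ==> x \<bullet> u <= B" "B >= 0"
 shows "norm x <= B"
proof (cases "x = 0")
 case False
 have "x \<bullet> (x /\<^sub>R norm x) <= B" by (rule assms(1)) (use False in simp)
 then show ?thesis using False by (simp add: dot_square_norm power2_eq_square field_simps)
qed (use assms in simp)

lemma integrable_bounded_mult:
 fixes f :: "'a::euclidean_space => real" and k :: "'a => 'b::euclidean_space"
 assumes f: "integrable lborel f" and k: "k : bmeas" and b: "!!p. norm (k p) <= B"
 shows "integrable lborel (%p. f p *R k p)"
proof (rule Bochner_Integration.integrable_bound[where f="%p. abs (f p) * B"])
 show "integrable lborel (%p. abs (f p) * B)" using f by auto
 show "(%p. f p *R k p) : borel_measurable lborel" using borel_measurable_integrable[OF f] k by measurable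
 have "B >= 0" using b norm_ge_zero order_trans by blast
 then show "AE p in lborel. norm (f p *R k p) <= norm (abs (f p) * B)" using b by (intro AE_I2) (auto simp: abs_mult intro: mult_left_mono)
qed

section \<open>Truncation error for densities with velocity decay\<close>

text \<open>Velocity is integrated at cost 32 around the centre \<open>c0 z\<close>, which may
  depend on position, and the position integral costs 16 r; their product is 512 r.\<close>

lemma jr_density:
 fixes f :: "phase => real" and c0 :: "plane => plane"
 assumes fm [measurable]: "f : bmeas" and fb: "!!z c. abs (f (z, c)) <= B / (1 + norm (c - c0 z)) ^ 3" and B: "B >= 0" and r: "r > 0"
 shows "(NN p. ennreal (abs (f p) * jr r (y - fst p))) <= ennreal (512 * r * B)"
proof -
 have [measurable]: "(%p. ennreal (abs (f p) * jr r (y - fst p))) : bmeas" by measurable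
 have "(NN p. ennreal (abs (f p) * jr r (y - fst p))) = (NN z. NN c. ennreal (abs (f (z, c)) * jr r (y - z)))"
  by (subst nn_integral_lborel_prod(1)) auto
 also have "... <= (NN z. ennreal (32 * B) * ennreal (jr r (y - z)))"
 proof (rule nn_integral_mono)
  fix z
  have "(NN c. ennreal (abs (f (z, c)) * jr r (y - z))) <= (NN c. ennreal (B * jr r (y - z)) * ennreal (1 / (1 + norm (c - c0 z)) ^ 3))"
  proof (rule nn_integral_mono)
   fix c
   have "abs (f (z, c)) * jr r (y - z) <= B / (1 + norm (c - c0 z)) ^ 3 * jr r (y - z)" using fb jr_nonneg by (rule mult_right_mono)
   then show "ennreal (abs (f (z, c)) * jr r (y - z)) <= ennreal (B * jr r (y - z)) * ennreal (1 / (1 + norm (c - c0 z)) ^ 3)"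
    using B jr_nonneg by (subst ennreal_mult[symmetric]) (auto intro!: ennreal_leI divide_nonneg_nonneg zero_le_power add_nonneg_nonneg simp: mult.commute)
  qed
  also have "... <= ennreal (B * jr r (y - z)) * ennreal 32"
   by (subst nn_integral_cmult) (auto intro!: mult_left_mono nn_integral_weight3[unfolded ennreal_numeral])
  also have "... = ennreal (32 * B) * ennreal (jr r (y - z))"
   using B jr_nonneg[of r "y - z"] by (subst (1 2) ennreal_mult[symmetric]) (auto simp: mult_ac)
  finally show "(NN c. ennreal (abs (f (z, c)) * jr r (y - z))) <= ennreal (32 * B) * ennreal (jr r (y - z))" .
 qed
 also have "... <= ennreal (32 * B) * ennreal (16 * r)"
  by (subst nn_integral_cmult) (auto intro!: mult_left_mono nn_integral_jr r)
 also have "... = ennreal (512 * r * B)" using B r by (subst ennreal_mult[symmetric]) (auto simp: mult_ac)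
 finally show ?thesis .
qed

lemma Kn_density:
 fixes f :: "phase => real" and c0 :: "plane => plane"
 assumes fi: "integrable lborel f" and fb: "!!z c. abs (f (z, c)) <= B / (1 + norm (c - c0 z)) ^ 3" and B: "B >= 0"
 shows "integrable lborel (%p. f p *R Kn (y - fst p))"
  and "r > 0 ==> norm ((LBINT p. f p *R Kn (y - fst p)) - (LBINT p. f p *R Kr r (y - fst p))) <= 512 * r * B"
proof -
 have fm [measurable]: "f : bmeas" using fi by auto
 have d: "integrable lborel (%p. f p *R (Kn (y - fst p) - Kr r (y - fst p)))"
  "norm (LBINT p. f p *R (Kn (y - fst p) - Kr r (y - fst p))) <= 512 * r * B" if r: "r > 0" for r
 proof -
  have j: "integrable lborel (%p. abs (f p) * jr r (y - fst p))"
  proof (rule integrableI_bounded)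
   show "(NN p. ennreal (norm (abs (f p) * jr r (y - fst p)))) < \<infinity>"
    using jr_density[OF fm fb B r, of y] by (auto simp: abs_mult jr_nonneg intro: le_less_trans)
  qed measurable
  have le: "norm (f p *R (Kn (y - fst p) - Kr r (y - fst p))) <= abs (f p) * jr r (y - fst p)" for p
   using Kn_Kr[OF r] by (simp add: mult_left_mono)
  show i: "integrable lborel (%p. f p *R (Kn (y - fst p) - Kr r (y - fst p)))"
   by (rule Bochner_Integration.integrable_bound[OF j]) (use le in "auto simp: jr_nonneg abs_mult")
  have "norm (LBINT p. f p *R (Kn (y - fst p) - Kr r (y - fst p))) <= (LBINT p. abs (f p) * jr r (y - fst p))"
   by (rule Bochner_Integration.integral_norm_bound_integral[OF i j]) (rule le)
  also have "... <= 512 * r * B"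
   using jr_density[OF fm fb B r, of y] nn_integral_eq_integral[OF j] B r by (simp add: jr_nonneg)
  finally show "norm (LBINT p. f p *R (Kn (y - fst p) - Kr r (y - fst p))) <= 512 * r * B" .
 qed
 have k: "integrable lborel (%p. f p *R Kr r (y - fst p))" if "r > 0" for r
  by (rule integrable_bounded_mult[OF fi]) (measurable, rule Kr_bound[OF that])
 show i: "integrable lborel (%p. f p *R Kn (y - fst p))"
  using Bochner_Integration.integrable_add[OF d(1)[OF zero_less_one] k[OF zero_less_one]] by (simp add: scaleR_diff_right)
 show "r > 0 ==> norm ((LBINT p. f p *R Kn (y - fst p)) - (LBINT p. f p *R Kr r (y - fst p))) <= 512 * r * B"
  using d(2)[of r] by (simp add: scaleR_diff_right Bochner_Integration.integral_diff[OF i k])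
qed

section \<open>The rescaled self-consistent field\<close>

text \<open>By homogeneity of the kernel this is cosh t times the physical field at the point cosh t
  y; see \<open>efield_ph\<close>.\<close>

definition Nf :: "(real => phase => real) => real => plane => plane" where
 "Nf g t y = (1 / (2 * pi)) *R (LBINT p. (g t p)^2 *R Kn (y - zc t p))"

definition unz :: "real => phase => phase" where "unz t p = (fst p + kap t *R snd p, snd p)"

lemma zc_unz [simp]: "zc t (unz t p) = fst p" by (simp add: zc_def unz_def)
lemma unz_pres: "lborel_pres (unz t)" using lborel_pres_unzc[of t] by (simp add: unz_def[abs_def])
lemma unz_meas [measurable]: "unz t : bmeas" by (rule lborel_pres_measurable[OF unz_pres])

lemma pi_le: "norm ((1 / (2 * pi)) *R x) <= norm x"
proof -
 have "1 / (2 * pi) * norm x <= 1 * norm x" using pi_gt3 by (intro mult_right_mono) (auto simp: divide_le_eq)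
 then show ?thesis by simp
qed

lemma kap_t2: "t >= 0 ==> kap t * (t * t) <= 2"
proof -
 assume t: "t >= 0"
 have "t <= exp t" using exp_ge_add_one_self[of t] by linarith
 then have "t * t <= exp t * exp t" using t by (intro mult_mono) auto
 then have "kap t * (t * t) <= (2 * exp (- 2 * t)) * exp (2 * t)" using kap_le_exp[of t] t by (intro mult_mono) (auto simp: exp_add[symmetric])
 also have "... = 2 * (exp (- 2 * t) * exp (2 * t))" by simp
 also have "exp (- 2 * t) * exp (2 * t) = (1::real)" by (simp add: exp_add[symmetric])
 finally show ?thesis by simp
qed

context asym
begin

text \<open>Integration over c at fixed z = \<open>zc\<close> calls for a velocity centre that
  depends on z alone, whereas \<open>vel\<close> evaluates E at a = z + kap t c. Replacing E(a) by
  E(z) costs e t kap t |c|, which stays small even though c grows linearly in time.\<close>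

lemma vel_c0:
 assumes t: "t >= 0"
 shows "norm (vel t (unz t (z, c)) - (c - (lam * t) *R E z)) <= kap t * (t * e) * (norm (c - (lam * t) *R E z) + t * e)"
  and "1 + norm (c - (lam * t) *R E z) <= 2 * (1 + norm (vel t (unz t (z, c))))"
proof -
 define c0 where "c0 = (lam * t) *R E z"
 have k: "0 < kap t" "kap t * t <= 1" using kap_pos kap_t_le1[OF t] by auto
 have c: "norm c <= norm (c - c0) + t * e"
 proof -
  have "norm c0 <= t * e" using Ebd[of z] lam t by (simp add: c0_def abs_mult mult_left_mono)
  then show ?thesis using norm_triangle_sub[of c c0] by linarith
 qed
 have "vel t (unz t (z, c)) - (c - c0) = - ((lam * t) *R (E (z + kap t *R c) - E z))" by (simp add: vel_def unz_def c0_def algebra_simps)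
 then have "norm (vel t (unz t (z, c)) - (c - c0)) = t * norm (E (z + kap t *R c) - E z)" using lam t by (simp add: abs_mult)
 also have "... <= t * (e * (kap t * norm c))" using Elip[of "z + kap t *R c" z] t k by (intro mult_left_mono) auto
 also have "... <= t * (e * (kap t * (norm (c - c0) + t * e)))" using c t e0 k by (intro mult_left_mono) auto
 finally show 1: "norm (vel t (unz t (z, c)) - (c - (lam * t) *R E z)) <= kap t * (t * e) * (norm (c - (lam * t) *R E z) + t * e)" by (simp add: c0_def mult_ac)
 have "kap t * (t * e) * (norm (c - c0) + t * e) = e * (kap t * t) * norm (c - c0) + e * e * (kap t * (t * t))" by (simp add: algebra_simps)
 also have "... <= (1 / 4) * 1 * norm (c - c0) + (1 / 4) * (1 / 4) * 2"
  using e0 e1 k t kap_t2[OF t] by (intro add_mono mult_mono mult_nonneg_nonneg) auto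
 finally have "norm (vel t (unz t (z, c)) - (c - c0)) <= (1 / 4) * norm (c - c0) + 1 / 8" using 1 by (simp add: c0_def)
 moreover have "norm (c - c0) <= norm (vel t (unz t (z, c))) + norm (vel t (unz t (z, c)) - (c - c0))"
  using norm_triangle_ineq4[of "vel t (unz t (z, c))" "vel t (unz t (z, c)) - (c - c0)"] by simp
 ultimately show "1 + norm (c - (lam * t) *R E z) <= 2 * (1 + norm (vel t (unz t (z, c))))" unfolding c0_def[symmetric]
  using norm_ge_zero[of "c - c0"] norm_ge_zero[of "vel t (unz t (z, c))"] by argo
qed

lemma vel_density:
 assumes t: "t >= 0" and fb: "!!p. abs (f p) <= B / (1 + norm (vel t p)) ^ 3" and B: "B >= 0"
 shows "abs (f (unz t (z, c))) <= (8 * B) / (1 + norm (c - (lam * t) *R E z)) ^ 3"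
proof -
 let ?n = "1 + norm (vel t (unz t (z, c)))" and ?m = "1 + norm (c - (lam * t) *R E z)"
 have p: "?n > 0" "?m > 0" by (rule one_norm_pos)+
 have "?m ^ 3 <= (2 * ?n) ^ 3" by (intro power_mono vel_c0(2)[OF t]) (use p in simp)
 then have "B * ?m ^ 3 <= B * (8 * ?n ^ 3)" using B by (intro mult_left_mono) (simp_all only: power_mult_distrib, simp_all)
 then have "B / ?n ^ 3 <= (8 * B) / ?m ^ 3" using p by (simp add: divide_le_eq pos_le_divide_eq mult_ac)
 then show ?thesis using fb[of "unz t (z, c)"] by linarith
qed

lemma Kn_vel:
 assumes t: "t >= 0" and fi: "integrable lborel f" and fb: "!!p. abs (f p) <= B / (1 + norm (vel t p)) ^ 3" and B: "B >= 0"
 shows "integrable lborel (%p. f p *R Kn (y - zc t p))"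
  and "r > 0 ==> norm ((LBINT p. f p *R Kn (y - zc t p)) - (LBINT p. f p *R Kr r (y - zc t p))) <= 4096 * r * B"
proof -
 have fm [measurable]: "f : bmeas" using fi by auto
 have fu: "integrable lborel (%p. f (unz t p))" using lborel_pres_integrable[OF unz_pres fm] fi by simp
 have B8: "8 * B >= 0" using B by simp
 have d: "abs (f (unz t (z, c))) <= (8 * B) / (1 + norm (c - (lam * t) *R E z)) ^ 3" for z c by (rule vel_density[OF t fb B])
 note K = Kn_density[OF fu d B8, where y=y]
 show "integrable lborel (%p. f p *R Kn (y - zc t p))"
  using lborel_pres_integrable[OF unz_pres, of "%p. f p *R Kn (y - zc t p)" t] K(1) by simp
 show "r > 0 ==> norm ((LBINT p. f p *R Kn (y - zc t p)) - (LBINT p. f p *R Kr r (y - zc t p))) <= 4096 * r * B"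
  using lborel_pres_integral[OF unz_pres, of "%p. f p *R Kn (y - zc t p)" t]
   lborel_pres_integral[OF unz_pres, of "%p. f p *R Kr r (y - zc t p)" t] K(2)[of r] by simp
qed

lemma pdec_sq: assumes "pdec A g" "t >= 0" shows "abs ((g t p)^2) <= A^2 / (1 + norm (vel t p)) ^ 3"
proof -
 let ?n = "1 + norm (vel t p)"
 have "(g t p)^2 <= (A / ?n ^ 4)^2" using assms unfolding pdec_def by (metis abs_ge_zero power2_abs power_mono)
 also have "... = A^2 / ?n ^ 8" by (simp add: power_divide power_mult[symmetric])
 also have "... <= A^2 / ?n ^ 3" by (intro divide_left_mono power_increasing mult_pos_pos zero_less_power one_norm_pos) auto
 finally show ?thesis by simp
qed

end

text \<open>The weighted mass bounds the first moment of c by O(1 + t), the pointwise decay controls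
  the singularity of the kernel, and \<open>EN\<close> makes \<open>E\<close> the field of the final
  datum.\<close>

locale wsol = sol +
 assumes wm: "t >= 0 ==> (NN p. ennreal (((1 + norm (vel t p)) * g t p)^2)) <= ennreal m"
  and mud: "abs (mu p) <= A / (1 + norm (snd p)) ^ 4"
  and EN: "E y = (1 / (2 * pi)) *R (LBINT p. (mu p)^2 *R Kn (y - fst p))"
begin

lemma N_int: "t >= 0 ==> integrable lborel (%p. (g t p)^2 *R Kn (y - zc t p))"
 by (rule Kn_vel(1)[OF _ gint pdec_sq[OF dec]]) auto

text \<open>The coefficient \<open>k\<close> stands in place of \<open>kap t\<close>, so that the
  time in the kernel and the time in the density can be varied separately.\<close>

definition Gr :: "real => real => real => plane => plane" where
 "Gr r k t y = (LBINT p. (g t p)^2 *R Kr r (y - (fst p - k *R snd p)))"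

lemma Gr_int: "t >= 0 ==> r > 0 ==> integrable lborel (%p. (g t p)^2 *R Kr r (y - (fst p - k *R snd p)))"
 by (rule integrable_bounded_mult[OF gint]) (auto intro: Kr_bound)

lemma N_Gr: "t >= 0 ==> r > 0 ==> norm ((LBINT p. (g t p)^2 *R Kn (y - zc t p)) - Gr r (kap t) t y) <= 4096 * r * A^2"
 using Kn_vel(2)[OF _ gint pdec_sq[OF dec], of t r y] by (simp add: Gr_def zc_def)

lemma moment:
 assumes t: "t >= 0"
 shows "integrable lborel (%p. (g t p)^2 * norm (snd p))" "(LBINT p. (g t p)^2 * norm (snd p)) <= (1 + t) * m"
proof -
 have [measurable]: "g t : bmeas" "vel t : bmeas" using gm[OF t] unfolding vel_def[abs_def] by measurable
 have "(NN p. ennreal ((g t p)^2 * norm (snd p))) <= (NN p. ennreal (1 + t) * ennreal (((1 + norm (vel t p)) * g t p)^2))"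
 proof (rule nn_integral_mono)
  fix p
  let ?v = "norm (vel t p)"
  have "t * e <= t * 1" using t e1 by (intro mult_left_mono) auto
  then have "norm (snd p) <= ?v + t" using norm_snd_le_vel[OF t, of p] by linarith
  also have "... <= (1 + t) * (1 + ?v)^2" using t by (simp add: power2_eq_square algebra_simps)
  finally have "(g t p)^2 * norm (snd p) <= (g t p)^2 * ((1 + t) * (1 + ?v)^2)" by (intro mult_left_mono) auto
  then show "ennreal ((g t p)^2 * norm (snd p)) <= ennreal (1 + t) * ennreal (((1 + ?v) * g t p)^2)"
   using t by (subst ennreal_mult[symmetric]) (auto simp: power_mult_distrib mult_ac intro!: ennreal_leI)
 qed
 also have "... <= ennreal (1 + t) * ennreal m" by (subst nn_integral_cmult) (auto intro!: mult_left_mono wm t)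
 also have "... = ennreal ((1 + t) * m)" using t m by (subst ennreal_mult) auto
 finally have le: "(NN p. ennreal ((g t p)^2 * norm (snd p))) <= ennreal ((1 + t) * m)" .
 show i: "integrable lborel (%p. (g t p)^2 * norm (snd p))"
  by (rule integrableI_bounded) (use le in "auto intro: le_less_trans")
 show "(LBINT p. (g t p)^2 * norm (snd p)) <= (1 + t) * m"
  using le nn_integral_eq_integral[OF i] t m by simp
qed

lemma Gr_k:
 assumes t: "t >= 0" and r: "r > 0"
 shows "norm (Gr r k t y - Gr r k' t y) <= abs (k - k') * ((1 + t) * m) / r^2"
proof -
 have "Gr r k t y - Gr r k' t y = (LBINT p. (g t p)^2 *R Kr r (y - (fst p - k *R snd p)) - (g t p)^2 *R Kr r (y - (fst p - k' *R snd p)))"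
  unfolding Gr_def by (rule Bochner_Integration.integral_diff[symmetric]; rule Gr_int[OF t r])
 also have "norm ... <= (LBINT p. abs (k - k') / r^2 * ((g t p)^2 * norm (snd p)))"
 proof (rule Bochner_Integration.integral_norm_bound_integral)
  fix p
  have "norm (Kr r (y - (fst p - k *R snd p)) - Kr r (y - (fst p - k' *R snd p))) <= norm ((y - (fst p - k *R snd p)) - (y - (fst p - k' *R snd p))) / r^2" by (rule Kr_lip[OF r])
  also have "(y - (fst p - k *R snd p)) - (y - (fst p - k' *R snd p)) = (k - k') *R snd p" by (simp add: algebra_simps)
  finally have "(g t p)^2 * norm (Kr r (y - (fst p - k *R snd p)) - Kr r (y - (fst p - k' *R snd p))) <= (g t p)^2 * (norm ((k - k') *R snd p) / r^2)" by (rule mult_left_mono) simp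
  then show "norm ((g t p)^2 *R Kr r (y - (fst p - k *R snd p)) - (g t p)^2 *R Kr r (y - (fst p - k' *R snd p))) <= abs (k - k') / r^2 * ((g t p)^2 * norm (snd p))"
   by (simp add: scaleR_diff_right[symmetric] mult_ac)
 qed (use Gr_int[OF t r] moment(1)[OF t] in auto)
 also have "... = abs (k - k') / r^2 * (LBINT p. (g t p)^2 * norm (snd p))" by simp
 also have "... <= abs (k - k') / r^2 * ((1 + t) * m)" using moment(2)[OF t] by (intro mult_left_mono) auto
 finally show ?thesis by simp
qed

lemma Gr_y:
 assumes t: "t >= 0" and r: "r > 0"
 shows "norm (Gr r k t y - Gr r k t y') <= m * norm (y - y') / r^2"
proof -
 have "Gr r k t y - Gr r k t y' = (LBINT p. (g t p)^2 *R Kr r (y - (fst p - k *R snd p)) - (g t p)^2 *R Kr r (y' - (fst p - k *R snd p)))"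
  unfolding Gr_def by (rule Bochner_Integration.integral_diff[symmetric]; rule Gr_int[OF t r])
 also have "norm ... <= (LBINT p. (g t p)^2 * (norm (y - y') / r^2))"
 proof (rule Bochner_Integration.integral_norm_bound_integral)
  fix p
  have "norm (Kr r (y - (fst p - k *R snd p)) - Kr r (y' - (fst p - k *R snd p))) <= norm (y - y') / r^2"
   using Kr_lip[OF r, of "y - (fst p - k *R snd p)" "y' - (fst p - k *R snd p)"] by simp
  from mult_left_mono[OF this, of "(g t p)^2"]
  show "norm ((g t p)^2 *R Kr r (y - (fst p - k *R snd p)) - (g t p)^2 *R Kr r (y' - (fst p - k *R snd p))) <= (g t p)^2 * (norm (y - y') / r^2)"
   unfolding scaleR_diff_right[symmetric] norm_scaleR by simp
 qed (use Gr_int[OF t r] gint[OF t] in auto)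
 also have "... = (LBINT p. (g t p)^2) * (norm (y - y') / r^2)" by simp
 also have "... <= m * (norm (y - y') / r^2)" using gint_le[OF t] by (intro mult_right_mono) auto
 finally show ?thesis by simp
qed

definition psi :: "real => plane => plane => real => phase => real" where
 "psi r y u k p = Kr r (y - (fst p - k *R snd p)) \<bullet> u"

lemma psi_lip:
 assumes r: "r > 0" and u: "norm u <= 1"
 shows "abs (psi r y u k p - psi r y u k p') <= norm ((fst p - k *R snd p) - (fst p' - k *R snd p')) / r^2"
proof -
 have "abs (psi r y u k p - psi r y u k p') <= norm (Kr r (y - (fst p - k *R snd p)) - Kr r (y - (fst p' - k *R snd p'))) * norm u"
  unfolding psi_def inner_diff_left[symmetric] by (rule Cauchy_Schwarz_ineq2)
 also have "... <= norm (Kr r (y - (fst p - k *R snd p)) - Kr r (y - (fst p' - k *R snd p'))) * 1" using u by (intro mult_left_mono) auto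
 also have "... <= norm ((fst p - k *R snd p) - (fst p' - k *R snd p')) / r^2"
  using Kr_lip[OF r, of "y - (fst p - k *R snd p)" "y - (fst p' - k *R snd p')"] unfolding diff_diff_eq2[symmetric] diff_diff_eq
  by (simp add: norm_minus_commute algebra_simps)
 finally show ?thesis .
qed

lemma psi_bd: "r > 0 ==> norm u <= 1 ==> abs (psi r y u k p) <= 1 / r"
 using Cauchy_Schwarz_ineq2[of "Kr r (y - (fst p - k *R snd p))" u] mult_mono[OF Kr_bound[of r "y - (fst p - k *R snd p)"], of "norm u" 1]
 by (simp add: psi_def)

lemma psi_loclip: "r > 0 ==> norm u <= 1 ==> loclip (%t. psi r y u k)"
proof (rule loclip_const_time[where C="(1 + abs k) / r^2"])
 fix p p' :: "phase" assume r: "r > 0" and u: "norm u <= 1"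
 note n = norm_fst_snd[of "p - p'", unfolded fst_diff snd_diff]
 have "(fst p - k *R snd p) - (fst p' - k *R snd p') = (fst p - fst p') - k *R (snd p - snd p')" by (simp add: algebra_simps)
 also have "norm ... <= norm (fst p - fst p') + norm (k *R (snd p - snd p'))" by (rule norm_triangle_ineq4)
 also have "... <= norm (p - p') + abs k * norm (p - p')" unfolding norm_scaleR using n by (intro add_mono mult_left_mono) auto
 finally have "norm ((fst p - k *R snd p) - (fst p' - k *R snd p')) / r^2 <= ((1 + abs k) * norm (p - p')) / r^2"
  by (intro divide_right_mono) (auto simp: distrib_right)
 then show "norm (psi r y u k p - psi r y u k p') <= (1 + abs k) / r^2 * norm (p - p')" using psi_lip[OF r u, of y k p p'] by simp
qed

text \<open>Along an Euler step a - k c moves with speed (kap t - k) F. At k = 0 the rate is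
  proportional to \<open>kap t\<close>, hence integrable up to infinity, and this links the
  truncated field to its limit.\<close>

lemma psi_rate:
 assumes r: "r > 0" and u: "norm u <= 1" and t: "t >= 0"
 shows "rate_le (abs (kap t - k) * M / r^2) (%n. abs (inc F (%_. psi r y u k) t p n))"
proof (rule rate_le_const)
 fix n
 define h where "h = 1 / real (Suc n)"
 have h: "h > 0" by (simp add: h_def)
 have "(fst (p + h *R Wf F t p) - k *R snd (p + h *R Wf F t p)) - (fst p - k *R snd p) = (h * (kap t - k)) *R F t (zc t p)"
  by (simp add: Wf_def algebra_simps)
 then have "norm ((fst (p + h *R Wf F t p) - k *R snd (p + h *R Wf F t p)) - (fst p - k *R snd p)) <= h * (abs (kap t - k) * M)"
  using F t h by (auto simp: fieldbd_def abs_mult intro!: mult_left_mono)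
 then have "abs (psi r y u k (p + h *R Wf F t p) - psi r y u k p) <= h * (abs (kap t - k) * M) / r^2"
  using psi_lip[OF r u, of y k "p + h *R Wf F t p" p] r by (meson divide_right_mono order_trans zero_le_power2)
 then show "abs (inc F (%_. psi r y u k) t p n) <= abs (kap t - k) * M / r^2 / Suc n" by (simp add: h_def mult.commute)
qed

lemma Gr_inner: "t >= 0 ==> r > 0 ==> Gr r k t y \<bullet> u = (LBINT p. (g t p)^2 * psi r y u k p)"
 unfolding Gr_def psi_def using integral_inner_left[OF Gr_int] by simp

lemma Gr_t:
 assumes t: "0 <= t'" "t' <= t" and r: "r > 0" and k: "0 <= k" "k <= 1"
 shows "norm (Gr r k t y - Gr r k t' y) <= m * M / r^2 * (t - t')"
proof (rule norm_le_of_inner)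
 fix u :: plane assume u: "norm u <= 1"
 have t0: "t >= 0" using t by simp
 have "abs ((LBINT p. (g t p)^2 * psi r y u k p) - (LBINT p. (g t' p)^2 * psi r y u k p)) <= m * integral {t'..t} (%_. M / r^2)"
 proof (rule integral_sq_test_abs[where Ps="%t. psi r y u k" and ?m0.0="1/r"])
  show "rate_le (M / r^2) (%n. abs (inc F (%_. psi r y u k) s p n))" if "t' < s" for s p
  proof -
   have s: "s >= 0" using that t by simp
   have "abs (kap s - k) * M / r^2 <= 1 * M / r^2"
    using kap_pos[of s] kap_le1[OF s] k M0 by (intro divide_right_mono mult_right_mono) auto
   then show ?thesis using rate_le_mono[OF psi_rate[OF r u s] order_refl] by simp
  qed
 qed (use psi_loclip[OF r u] psi_bd[OF r u] t M0 in auto)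
 then show "(Gr r k t y - Gr r k t' y) \<bullet> u <= m * M / r^2 * (t - t')"
  using t by (simp add: inner_diff_left Gr_inner[OF t0 r] Gr_inner[OF t(1) r] mult_ac)
qed (use t M0 m in auto)

text \<open>The chain goes from the kernel to its truncation at time t, from k = kap t to k = 0,
  from time t to infinity, and back to the full kernel. With r = exp (-t/2) the costs are of order
  r, kap t (1 + t) / r^2, exp (-2t) / r^2 and r, all O(r).\<close>

lemma N_asymptotic:
 assumes t: "t >= 0"
 shows "norm (Nf g t y - E y) <= (4608 * A^2 + 4 * m + m * M) * exp (- (t / 2))"
proof -
 define r where "r = exp (- (t / 2))"
 have r: "r > 0" "r <= 1" using t by (auto simp: r_def)
 have r4: "exp (- 2 * t) = r ^ 4" by (simp add: r_def exp_of_nat_mult[symmetric])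
 have a2: "norm (Gr r (kap t) t y - Gr r 0 t y) <= 4 * m * r"
 proof -
  have k: "kap t * (1 + t) <= 4 * r ^ 3"
  proof -
   have "1 + t <= 2 * exp (t / 2)" using exp_ge_add_one_self[of "t / 2"] by linarith
   then have "kap t * (1 + t) <= (2 * exp (- 2 * t)) * (2 * exp (t / 2))" using kap_le_exp[of t] t by (intro mult_mono) auto
   also have "... = 4 * (exp (- 2 * t) * exp (t / 2))" by simp
   also have "exp (- 2 * t) * exp (t / 2) = r ^ 3" by (simp add: r_def exp_of_nat_mult[symmetric] exp_add[symmetric])
   finally show ?thesis .
  qed
  have "norm (Gr r (kap t) t y - Gr r 0 t y) <= kap t * (1 + t) * m / r^2" using Gr_k[OF t r(1), of "kap t" y 0] kap_pos[of t] by (simp add: mult_ac)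
  also have "... <= 4 * r ^ 3 * m / r^2" using k m by (intro divide_right_mono mult_right_mono) auto
  also have "... = 4 * m * r" using r by (simp add: power2_eq_square power3_eq_cube)
  finally show ?thesis .
 qed
 have mui: "integrable lborel (%p. (mu p)^2)" by (rule muint)
 note [measurable] = mum
 have musq: "abs ((mu (z, c))^2) <= A^2 / (1 + norm (c - 0)) ^ 3" for z c
 proof -
  have "(mu (z, c))^2 <= (A / (1 + norm c) ^ 4)^2" using mud[of "(z, c)"] by (metis abs_ge_zero power2_abs power_mono snd_conv)
  also have "... = A^2 / (1 + norm c) ^ 8" by (simp add: power_divide power_mult[symmetric])
  also have "... <= A^2 / (1 + norm c) ^ 3" by (intro divide_left_mono power_increasing mult_pos_pos zero_less_power one_norm_pos) auto
  finally show ?thesis by simp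
 qed
 have a4: "norm ((LBINT p. (mu p)^2 *R Kn (y - fst p)) - (LBINT p. (mu p)^2 *R Kr r (y - fst p))) <= 512 * r * A^2"
  by (rule Kn_density(2)[where ?c0.0="%_. 0", OF mui musq _ r(1)]) simp
 have ki: "integrable lborel (%p. (mu p)^2 *R Kr r (y - fst p))"
  by (rule integrable_bounded_mult[OF mui]) (auto intro: Kr_bound r)
 have a3: "norm (Gr r 0 t y - (LBINT p. (mu p)^2 *R Kr r (y - fst p))) <= m * M * r"
 proof (rule norm_le_of_inner)
  fix u :: plane assume u: "norm u <= 1"
  have imu: "(LBINT p. (mu p)^2 *R Kr r (y - fst p)) \<bullet> u = (LBINT p. (mu p)^2 * psi r y u 0 p)"
   unfolding psi_def using integral_inner_left[OF ki] by simp
  show "(Gr r 0 t y - (LBINT p. (mu p)^2 *R Kr r (y - fst p))) \<bullet> u <= m * M * r"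
  proof (rule field_le_epsilon)
   fix ep :: real assume ep: "ep > 0"
   have "EV n. abs ((LBINT p. (g t p)^2 * psi r y u 0 p) - (LBINT p. (mu p)^2 * psi r y u 0 (asy (real n) p))) <= m * (M / r^2 * exp (- 2 * t)) + ep"
   proof (rule integral_sq_test_lim[where Ps="%t. psi r y u 0" and ?m0.0="1/r" and b="%s. M / r^2 * abs (kap s)"])
    show "integral {t..s} (%s. M / r^2 * abs (kap s)) <= M / r^2 * exp (- 2 * t)" if "t <= s" for s
     using integral_kap_le[OF t that] M0 kap_pos by (simp add: abs_of_pos divide_right_mono mult_left_mono)
    show "rate_le (M / r^2 * abs (kap s)) (%n. abs (inc F (%_. psi r y u 0) s p n))" if "t < s" for s p
     using psi_rate[OF r(1) u, of s 0 y p] that t by (simp add: mult.commute del: of_nat_Suc)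
   qed (use psi_loclip[OF r(1) u] psi_bd[OF r(1) u] t M0 ep r(1) in \<open>auto intro!: continuous_intros\<close>)
   then have "abs ((LBINT p. (g t p)^2 * psi r y u 0 p) - (LBINT p. (mu p)^2 * psi r y u 0 p)) <= m * (M / r^2 * exp (- 2 * t)) + ep"
    by (simp add: psi_def)
   also have "m * (M / r^2 * exp (- 2 * t)) = m * M * r^2" unfolding r4 using r by (simp add: power2_eq_square power4_eq_xxxx)
   also have "... <= m * M * r" using r m M0 by (intro mult_left_mono) (auto simp: power2_eq_square mult_left_le)
   finally show "(Gr r 0 t y - (LBINT p. (mu p)^2 *R Kr r (y - fst p))) \<bullet> u <= m * M * r + ep"
    using Gr_inner[OF t r(1), of 0 y u] imu by (simp add: inner_diff_left)
  qed
 qed (use m M0 r in auto)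
 have "Nf g t y - E y = (1 / (2 * pi)) *R ((LBINT p. (g t p)^2 *R Kn (y - zc t p)) - (LBINT p. (mu p)^2 *R Kn (y - fst p)))"
  by (simp add: Nf_def EN scaleR_diff_right)
 also have "norm ... <= norm ((LBINT p. (g t p)^2 *R Kn (y - zc t p)) - (LBINT p. (mu p)^2 *R Kn (y - fst p)))" by (rule pi_le)
 also have "(LBINT p. (g t p)^2 *R Kn (y - zc t p)) - (LBINT p. (mu p)^2 *R Kn (y - fst p)) =
  ((LBINT p. (g t p)^2 *R Kn (y - zc t p)) - Gr r (kap t) t y) + (Gr r (kap t) t y - Gr r 0 t y) + (Gr r 0 t y - (LBINT p. (mu p)^2 *R Kr r (y - fst p)))
  + - ((LBINT p. (mu p)^2 *R Kn (y - fst p)) - (LBINT p. (mu p)^2 *R Kr r (y - fst p)))" by simp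
 also have "norm ... <= 4096 * r * A^2 + 4 * m * r + m * M * r + 512 * r * A^2"
  by (intro norm_triangle_mono N_Gr[OF t r(1)] a2 a3) (use a4 in "simp only: norm_minus_cancel")
 finally show ?thesis by (simp add: r_def[symmetric] algebra_simps)
qed

text \<open>At a fixed truncation radius the field is locally Lipschitz in space and time; the
  radius is set by the tolerance alone, and the neighbourhood is chosen afterwards.\<close>

lemma N_continuous: "continuous_on ({0..} \<times> UNIV) (%(t, y). Nf g t y)"
 unfolding continuous_on_iff
proof (intro ballI allI impI)
 fix x :: "real \<times> plane" and ep :: real assume x: "x : {0..} \<times> UNIV" and ep: "ep > 0"
 obtain t y where ty: "x = (t, y)" by (cases x)
 have t: "t >= 0" using x ty by simp
 define q where "q = 8192 * A^2 + 1"
 have q: "q > 0" by (simp add: q_def add_nonneg_pos)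
 define r where "r = ep / (3 * q)"
 have r: "r > 0" using ep q by (simp add: r_def)
 define L where "L = m / r^2 + (2 + t) * m / r^2 + m * M / r^2 + 1"
 have L: "L > 0" using m M0 t by (auto simp: L_def intro!: add_nonneg_pos add_nonneg_nonneg)
 have G: "norm (Gr r (kap s) s y - Gr r (kap s') s' y) <= ((2 + t) * m / r^2 + m * M / r^2) * (s - s')" if s: "0 <= s'" "s' <= s" "s <= t + 1" for s s'
 proof -
  have "Gr r (kap s) s y - Gr r (kap s') s' y = (Gr r (kap s) s y - Gr r (kap s') s y) + (Gr r (kap s') s y - Gr r (kap s') s' y)" by simp
  also have "norm ... <= abs (kap s - kap s') * ((1 + s) * m) / r^2 + m * M / r^2 * (s - s')"
   by (intro norm_triangle_mono Gr_k Gr_t) (use s r kap_le1[OF s(1)] kap_pos[of s'] in auto)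
  also have "abs (kap s - kap s') * ((1 + s) * m) / r^2 <= (s - s') * ((2 + t) * m) / r^2"
   using kap_lip[of s s'] s m t by (intro divide_right_mono mult_mono) auto
  finally show ?thesis by (simp add: algebra_simps)
 qed
 define d where "d = min 1 (ep / (3 * L))"
 have d: "d > 0" using ep L by (simp add: d_def)
 show "EX d>0. ALL x':{0..} \<times> UNIV. dist x' x < d --> dist (case x' of (t, y) => Nf g t y) (case x of (t, y) => Nf g t y) < ep"
 proof (intro exI[of _ d] conjI ballI impI d)
  fix x' assume x': "x' : {0..} \<times> (UNIV :: plane set)" "dist x' x < d"
  obtain t' y' where ty': "x' = (t', y')" by (cases x')
  have t': "t' >= 0" using x' ty' by simp
  have dd: "abs (t' - t) < d" "norm (y' - y) < d"
   using x'(2) dist_fst_le[of x' x] dist_snd_le[of x' x] by (auto simp: ty ty' dist_norm)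
  have Gt: "norm (Gr r (kap t') t' y - Gr r (kap t) t y) <= ((2 + t) * m / r^2 + m * M / r^2) * abs (t' - t)"
  proof (cases "t' <= t")
   case True
   then show ?thesis using G[of t' t] t' by (simp add: norm_minus_commute)
  next
   case False
   then show ?thesis using G[of t t'] t dd(1) by (simp add: d_def)
  qed
  have c: "((2 + t) * m / r^2 + m * M / r^2) >= 0" "m / r^2 >= 0" using m M0 t by auto
  let ?I = "%t y. LBINT p. (g t p)^2 *R Kn (y - zc t p)"
  have "dist (Nf g t' y') (Nf g t y) = norm ((1 / (2 * pi)) *R (?I t' y' - ?I t y))" by (simp add: Nf_def dist_norm scaleR_diff_right)
  also have "... <= norm (?I t' y' - ?I t y)" by (rule pi_le)
  also have "?I t' y' - ?I t y = (?I t' y' - Gr r (kap t') t' y') + (Gr r (kap t') t' y' - Gr r (kap t') t' y) + (Gr r (kap t') t' y - Gr r (kap t) t y) + - (?I t y - Gr r (kap t) t y)" by simp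
  also have "norm ... <= 4096 * r * A^2 + m / r^2 * d + ((2 + t) * m / r^2 + m * M / r^2) * d + 4096 * r * A^2"
  proof (intro norm_triangle_mono N_Gr t' r)
   show "norm (Gr r (kap t') t' y' - Gr r (kap t') t' y) <= m / r^2 * d"
    using Gr_y[OF t' r, of "kap t'" y' y] mult_left_mono[OF less_imp_le[OF dd(2)] c(2)] by simp
   show "norm (Gr r (kap t') t' y - Gr r (kap t) t y) <= ((2 + t) * m / r^2 + m * M / r^2) * d"
    using Gt mult_left_mono[OF less_imp_le[OF dd(1)] c(1)] by linarith
   show "norm (- (?I t y - Gr r (kap t) t y)) <= 4096 * r * A^2" unfolding norm_minus_cancel by (rule N_Gr[OF t r])
  qed
  also have "... <= r * (8192 * A^2 + 1) + L * d" using r d by (simp add: L_def algebra_simps)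
  also have "r * (8192 * A^2 + 1) = ep / 3" unfolding q_def[symmetric] using q by (simp add: r_def)
  also have "L * d <= L * (ep / (3 * L))" using L by (intro mult_left_mono) (auto simp: d_def)
  also have "L * (ep / (3 * L)) = ep / 3" using L by simp
  finally show "dist (case x' of (t, y) => Nf g t y) (case x of (t, y) => Nf g t y) < ep" using ep by (simp add: ty ty')
 qed
qed

end

section \<open>Backward stability of the characteristics\<close>

lemma kap_deriv: "(kap has_real_derivative - (1 - (tanh t)^2)) (at t)"
 unfolding kap_def[abs_def] using cosh_real_nonzero[of t] by (auto intro!: derivative_eq_intros)

lemma kap_nonpos_deriv: "0 <= 1 - (tanh (t::real))^2"
 using tanh_real_bounds[of t] by (simp add: abs_square_le_1 abs_le_iff less_imp_le)

context flow
begin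

text \<open>A kick of size (kap s, 1) m0 at time s moves \<open>zc\<close> at the earlier time t
  only by O(kap t m0). As the force cancels in \<open>zc\<close>, its difference is driven by - kap'
  times the difference of c, which gives the factor \<open>kap\<close>; the difference of c is
  driven by F, which is Lipschitz in \<open>zc\<close>.\<close>

lemma backward:
 assumes ts: "0 <= t" "t <= s" and a: "norm (fst p - fst p') <= kap s * m0" and c: "norm (snd p - snd p') <= m0"
 shows "norm (zc t (flw s p t) - zc t (flw s p' t)) <= 4 * kap t * m0"
proof -
 define y where "y = flw s p"
 define y' where "y' = flw s p'"
 have ys: "y s = p" "y' s = p'" by (auto simp: y_def y'_def flw(1))
 define dc where "dc = (%ta. snd (y ta) - snd (y' ta))"
 define dz where "dz = (%ta. zc ta (y ta) - zc ta (y' ta))"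
 define dF where "dF = (%ta. F ta (zc ta (y ta)) - F ta (zc ta (y' ta)))"
 have m0: "m0 >= 0" using c norm_ge_zero order_trans by blast
 have yd: "((%ta. fst (flw s q ta)) has_vector_derivative kap ta *R F ta (zc ta (flw s q ta))) (at ta)"
  "((%ta. snd (flw s q ta)) has_vector_derivative F ta (zc ta (flw s q ta))) (at ta)" if "ta >= 0" for q ta
  using bounded_linear.has_vector_derivative[OF bounded_linear_fst flw(2)[of s q ta]] bounded_linear.has_vector_derivative[OF bounded_linear_snd flw(2)[of s q ta]] that
  by (simp_all add: V_def Wf_def)
 have dcd: "(dc has_vector_derivative dF ta) (at ta)" if "ta >= 0" for ta
  unfolding dc_def dF_def y_def y'_def by (intro has_vector_derivative_diff yd that)
 have dzd: "(dz has_vector_derivative (1 - (tanh ta)^2) *R dc ta) (at ta)" if ta: "ta >= 0" for ta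
 proof -
  have "((%ta. fst (y ta) - fst (y' ta) - kap ta *R dc ta) has_vector_derivative
   (kap ta *R F ta (zc ta (y ta)) - kap ta *R F ta (zc ta (y' ta))) - (kap ta *R dF ta + (- (1 - (tanh ta)^2)) *R dc ta)) (at ta)"
   unfolding y_def y'_def by (intro has_vector_derivative_diff yd ta has_vector_derivative_scaleR kap_deriv dcd)
  moreover have "(%ta. fst (y ta) - fst (y' ta) - kap ta *R dc ta) = dz" by (auto simp: dz_def dc_def zc_diff)
  ultimately show ?thesis by (simp add: dF_def algebra_simps)
 qed
 have cont: "continuous_on {u..v} dc" "continuous_on {u..v} dz" if "t <= u" for u v
  by (rule continuous_at_imp_continuous_on, intro ballI, rule has_vector_derivative_continuous, (rule dcd dzd), use that ts in simp)+
 have "EX x:{t..s}. ALL y:{t..s}. norm (dc y) <= norm (dc x)"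
  by (rule continuous_attains_sup) (use ts cont(1)[of t s] in "auto intro: continuous_on_norm")
 then obtain ta0 where ta0: "ta0 : {t..s}" "!!ta. ta : {t..s} ==> norm (dc ta) <= norm (dc ta0)" by blast
 \<comment> \<open>\<open>S\<close> is the largest difference of c on [t, s]. The two bounds close
   to S <= m0 + (2 m0 + S) / 10, whence S <= 2 m0.\<close>
 define S where "S = norm (dc ta0)"
 have S0: "S >= 0" by (simp add: S_def)
 have dzs: "norm (dz s) <= 2 * kap s * m0"
 proof -
  have "dz s = (fst p - fst p') - kap s *R (snd p - snd p')" by (simp add: dz_def ys zc_diff)
  also have "norm ... <= kap s * m0 + kap s * m0"
  proof -
   have "norm (kap s *R (snd p - snd p')) <= kap s * m0" using c kap_pos[of s] by simp
   then show ?thesis using norm_triangle_ineq4[of "fst p - fst p'" "kap s *R (snd p - snd p')"] a by linarith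
  qed
  finally show ?thesis by (simp add: mult_ac)
 qed
 have dz: "norm (dz ta) <= kap ta * (2 * m0 + S)" if ta: "t <= ta" "ta <= s" for ta
 proof -
  have "norm (dz s - dz ta) <= - S * kap s - - S * kap ta"
  proof (cases "ta = s")
   case False
   show ?thesis
   proof (rule differentiable_bound_general[where f'="%ta. (1 - (tanh ta)^2) *R dc ta" and \<phi>'="%ta. - S * - (1 - (tanh ta)^2)"])
    fix x assume x: "ta < x" "x < s"
    show "(dz has_vector_derivative (1 - (tanh x)^2) *R dc x) (at x)" by (rule dzd) (use x ta ts in simp)
    show "((%x. - S * kap x) has_vector_derivative - S * - (1 - (tanh x)^2)) (at x)"
     unfolding has_real_derivative_iff_has_vector_derivative[symmetric] by (intro DERIV_cmult kap_deriv)
    have dcS: "norm (dc x) <= S" unfolding S_def by (rule ta0(2)) (use x ta in simp)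
    show "norm ((1 - (tanh x)^2) *R dc x) <= - S * - (1 - (tanh x)^2)"
     unfolding norm_scaleR abs_of_nonneg[OF kap_nonpos_deriv] minus_mult_minus using mult_left_mono[OF dcS kap_nonpos_deriv[of x]] by (simp only: mult.commute)
   qed (use False ta cont(2) in \<open>auto intro!: continuous_intros\<close>)
  qed simp
  moreover have "norm (dz ta) <= norm (dz s) + norm (dz s - dz ta)" using norm_triangle_ineq4[of "dz s" "dz s - dz ta"] by simp
  moreover have "2 * kap s * m0 <= kap ta * (2 * m0)" using kap_antimono[of ta s] ta m0 by (simp add: mult_right_mono)
  moreover have "0 <= S * kap s" using S0 kap_pos[of s] by (simp add: less_imp_le)
  ultimately show ?thesis using dzs by (simp add: algebra_simps)
 qed
 have "S <= 2 * m0"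
 proof -
  define B where "B = 2 * m0 + S"
  have B: "B >= 0" using m0 S0 by (simp add: B_def)
  have "norm (dc s - dc ta0) <= - (2 * e * B) * exp (- 2 * s) - - (2 * e * B) * exp (- 2 * ta0)"
  proof (cases "ta0 = s")
   case False
   show ?thesis
   proof (rule differentiable_bound_general[where f'=dF and \<phi>'="%x. 4 * e * B * exp (- 2 * x)"])
    fix x assume x: "ta0 < x" "x < s"
    then have x0: "x >= 0" "t <= x" using ta0 ts by auto
    show "(dc has_vector_derivative dF x) (at x)" by (rule dcd) (use x0 in simp)
    show "((%x. - (2 * e * B) * exp (- 2 * x)) has_vector_derivative 4 * e * B * exp (- 2 * x)) (at x)"
     unfolding has_real_derivative_iff_has_vector_derivative[symmetric] by (auto intro!: derivative_eq_intros)
    have "norm (dF x) <= 2 * e * norm (dz x)" unfolding dF_def dz_def by (rule Flip[OF x0(1)])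
    also have "... <= 2 * e * (2 * exp (- 2 * x) * B)"
     using dz[OF x0(2)] x kap_le_exp[of x] B e0 by (intro mult_left_mono order_trans[OF dz[OF x0(2)]]) (auto simp: B_def[symmetric] intro: mult_right_mono)
    finally show "norm (dF x) <= 4 * e * B * exp (- 2 * x)" by (simp add: mult_ac)
   qed (use False ta0 cont(1) in \<open>auto intro!: continuous_intros\<close>)
  qed simp
  moreover have "0 <= 2 * e * B * exp (- 2 * s)" using e0 B by simp
  moreover have "2 * e * B * exp (- 2 * ta0) <= 2 * e * B * 1" using e0 B ta0 ts by (intro mult_left_mono) auto
  moreover have "2 * e * B <= 1 / 10 * B" using e1 B by (intro mult_right_mono) auto
  moreover have "S <= norm (dc s) + norm (dc s - dc ta0)" unfolding S_def using norm_triangle_ineq4[of "dc s" "dc s - dc ta0"] by simp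
  moreover have "norm (dc s) <= m0" using c by (simp add: dc_def ys)
  ultimately show ?thesis using m0 unfolding B_def by (simp only: mult_minus_left) argo
 qed
 then have "kap t * (2 * m0 + S) <= kap t * (4 * m0)" using kap_pos[of t] by (intro mult_left_mono) auto
 then show ?thesis using dz[of t] ts by (simp add: dz_def y_def y'_def)
qed

end

section \<open>The solution generated by the datum\<close>

locale nice = flow +
 fixes mu :: "phase => real"
 assumes mudec: "abs (mu q) <= e / (1 + norm (snd q)) ^ 4"
  and muw: "wlip e mu"
  and muwm: "(NN q. ennreal (((1 + norm (snd q)) * mu q)^2)) <= ennreal (e^2)"
  and Eq: "E y = (1 / (2 * pi)) *R (LBINT p. (mu p)^2 *R Kn (y - fst p))"
begin

definition G :: "real => phase => real" where "G t p = mu (Phi t p)"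

lemma mumeas [measurable]: "mu : bmeas"
 by (rule borel_measurable_continuous_onI[OF wlip_cont[OF muw]])

text \<open>81 = 3^4, where 3 is the factor by which velocities can change between time t and
  infinity.\<close>

lemma G_pdec: "pdec (81 * e) G"
 unfolding pdec_def G_def
proof (intro conjI allI impI)
 fix t p assume t: "(t::real) >= 0"
 let ?n = "1 + norm (vel t p)" and ?m = "1 + norm (snd (Phi t p))"
 have p: "?n > 0" "?m > 0" by (rule one_norm_pos)+
 have "?n ^ 4 <= (3 * ?m) ^ 4" by (intro power_mono Phi_vel(2) t) (use p in simp)
 then have "e * ?n ^ 4 <= e * (81 * ?m ^ 4)" using e0 by (intro mult_left_mono) (simp_all only: power_mult_distrib, simp_all)
 then have "e / ?m ^ 4 <= 81 * e / ?n ^ 4" using p by (simp add: divide_le_eq pos_le_divide_eq mult_ac)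
 then show "abs (mu (Phi t p)) <= 81 * e / ?n ^ 4" using mudec[of "Phi t p"] by linarith
qed (use e0 in simp)

text \<open>\<open>H_mass\<close> asks for compact support and a weighted Lipschitz bound, so the
  squared weighted datum is cut off in both variables and the cutoffs are removed by Fatou's lemma.
  The factor 9 is the square of the comparison factor of velocities.\<close>

lemma G_wm:
 assumes t: "t >= 0"
 shows "(NN p. ennreal (((1 + norm (vel t p)) * G t p)^2)) <= ennreal (9 * e^2)"
proof -
 define W where "W = (%q. ((1 + norm (snd q)) * mu q)^2)"
 define H where "H = (%n q. chi (real (Suc n)) (fst q) * chi (real (Suc n)) (snd q) * W q)"
 have W0: "W q >= 0" for q by (simp add: W_def)
 have ns: "norm (snd p - snd p') <= norm (p - p')" for p p' :: "phase"
  using norm_fst_snd(2)[of "p - p'"] by simp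
 have Wl: "loclip (%(t::real). W)"
 proof -
  have "loclip (%(t::real) q. (1 + norm (snd q)) * mu q)"
  proof (rule loclip_mult[OF loclip_const_time[where C=1] loclip_const_time])
   show "norm (mu p - mu p') <= e * norm (p - p')" for p p' using wlip_lip[OF muw] by simp
   fix p p' :: "phase"
   show "norm (1 + norm (snd p) - (1 + norm (snd p'))) <= 1 * norm (p - p')"
    using norm_triangle_ineq3[of "snd p" "snd p'"] ns[of p p'] by simp
  qed
  from loclip_mult[OF this this] show ?thesis by (simp add: W_def power2_eq_square)
 qed
 have Hl: "loclip (%(t::real). H n)" for n
  unfolding H_def
 proof (intro loclip_mult Wl chi_fst_loclip loclip_const_time[where C=1])
  fix p p' :: "phase"
  have "abs (chi (real (Suc n)) (snd p) - chi (real (Suc n)) (snd p')) <= norm (snd p - snd p') / real (Suc n)" by (rule chi_lip) simp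
  also have "... <= norm (snd p - snd p') / 1" by (intro divide_left_mono) auto
  finally show "norm (chi (real (Suc n)) (snd p) - chi (real (Suc n)) (snd p')) <= 1 * norm (p - p')" using ns[of p p'] by simp
 qed simp
 have Hs: "norm q <= 4 * real (Suc n)" if "H n q ~= 0" for n q
 proof -
  have "norm (fst q) <= 2 * real (Suc n)" "norm (snd q) <= 2 * real (Suc n)" by (rule chi_supp; use that in "auto simp: H_def")+
  then show ?thesis using norm_Pair_le[of "fst q" "snd q"] by simp
 qed
 have H0: "H n q >= 0" for n q unfolding H_def using chi_bounds W0 by simp
 have HW: "H n q <= W q" for n q
 proof -
  have "H n q <= 1 * 1 * W q" unfolding H_def using chi_bounds W0 by (intro mult_mono) auto
  then show ?thesis by simp
 qed
 obtain K where K: "!!n. wlip (K n) (H n)" using wlip_of_compact_support[OF Hl Hs] by metis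
 have le: "(NN p. ennreal (H n (Phi t p))) <= ennreal (e^2)" for n
 proof -
  have "(NN p. ennreal (H n (Phi t p))) <= (NN p. ennreal (H n p))" by (rule H_mass[OF K H0 Hs t])
  also have "... <= (NN p. ennreal (W p))" by (intro nn_integral_mono ennreal_leI HW)
  also have "... <= ennreal (e^2)" unfolding W_def by (rule muwm)
  finally show ?thesis .
 qed
 have Hm: "(%p. H n (Phi t p)) : bmeas" for n by (rule borel_measurable_continuous_onI[OF loclip_cont[OF H_loclip[OF K] t]])
 have lim: "(%n. ennreal (H n q)) ---> ennreal (W q)" for q
 proof -
  have "(%n. H n q) ---> 1 * 1 * W q" unfolding H_def by (intro tendsto_intros chi_lim)
  then show ?thesis by simp
 qed
 have "(NN p. ennreal (W (Phi t p))) = (NN p. liminf (%n. ennreal (H n (Phi t p))))"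
  using lim_imp_Liminf[OF _ lim] by simp
 also have "... <= liminf (%n. NN p. ennreal (H n (Phi t p)))" by (rule nn_integral_liminf) (use Hm in simp)
 also have "... <= liminf (%n. ennreal (e^2))" by (intro Liminf_mono always_eventually allI le)
 also have "... = ennreal (e^2)" by (simp add: Liminf_const)
 finally have W: "(NN p. ennreal (W (Phi t p))) <= ennreal (e^2)" .
 have Gm: "G t : bmeas" unfolding G_def[abs_def] by (rule borel_measurable_continuous_onI[OF loclip_cont[OF H_loclip[OF muw] t]])
 have Wm: "(%p. W (Phi t p)) : bmeas"
  by (rule borel_measurable_LIMSEQ_metric[OF Hm]) (use lim[of "Phi t _"] H0 W0 in \<open>simp add: H_def tendsto_ennreal_iff\<close>)
 have "(NN p. ennreal (((1 + norm (vel t p)) * G t p)^2)) <= (NN p. ennreal 9 * ennreal (W (Phi t p)))"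
 proof (rule nn_integral_mono)
  fix p
  have "(1 + norm (vel t p))^2 <= (3 * (1 + norm (snd (Phi t p))))^2" by (intro power_mono Phi_vel(2) t) simp
  then have "(1 + norm (vel t p))^2 * (mu (Phi t p))^2 <= (3 * (1 + norm (snd (Phi t p))))^2 * (mu (Phi t p))^2" by (rule mult_right_mono) simp
  then have "((1 + norm (vel t p)) * G t p)^2 <= 9 * W (Phi t p)" by (simp only: G_def W_def power_mult_distrib) simp
  then show "ennreal (((1 + norm (vel t p)) * G t p)^2) <= ennreal 9 * ennreal (W (Phi t p))"
   using W0 by (subst ennreal_mult[symmetric]) (auto intro!: ennreal_leI)
 qed
 also have "... = ennreal 9 * (NN p. ennreal (W (Phi t p)))" by (rule nn_integral_cmult) (use Wm in simp)
 also have "... <= ennreal 9 * ennreal (e^2)" using W by (intro mult_left_mono) auto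
 also have "... = ennreal (9 * e^2)" by (rule ennreal_mult[symmetric]) auto
 finally show ?thesis .
qed

text \<open>The constructed function meets the conditions imposed on a competitor, so every estimate
  proved for competitors applies to it as well.\<close>

sublocale ws: wsol lam E e F G "2 * e" "81 * e" "9 * e^2" mu
proof
 show "fieldbd F (2 * e)" by (rule F_fieldbd)
 show "transported F G" using H_transported[OF muw] by (simp add: G_def[abs_def])
 show "pdec (81 * e) G" by (rule G_pdec)
 show "(NN p. ennreal (((1 + norm (vel t p)) * G t p)^2)) <= ennreal (9 * e^2)" if "t >= 0" for t by (rule G_wm[OF that])
 show "(NN p. ennreal ((G t p)^2)) <= ennreal (9 * e^2)" if "t >= 0" for t
 proof -
  have "(NN p. ennreal ((G t p)^2)) <= (NN p. ennreal (((1 + norm (vel t p)) * G t p)^2))"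
   by (intro nn_integral_mono ennreal_leI weight_ge)
  then show ?thesis using G_wm[OF that] by (rule order_trans)
 qed
 have "(NN p. ennreal ((mu p)^2)) <= (NN q. ennreal (((1 + norm (snd q)) * mu q)^2))"
  by (intro nn_integral_mono ennreal_leI weight_ge)
 also have "... <= ennreal (e^2)" by (rule muwm)
 also have "... <= ennreal (9 * e^2)" by (intro ennreal_leI) simp
 finally show "(NN p. ennreal ((mu p)^2)) <= ennreal (9 * e^2)" .
 show "(%n. fin G n p) ---> mu p" for p unfolding G_def by (rule H_lim[OF muw])
 show "abs (mu p) <= 81 * e / (1 + norm (snd p)) ^ 4" for p
 proof -
  have "e / (1 + norm (snd p)) ^ 4 <= 81 * e / (1 + norm (snd p)) ^ 4" using e0 by (intro divide_right_mono) auto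
  then show ?thesis using mudec[of p] by linarith
 qed
 show "E y = (1 / (2 * pi)) *R (LBINT p. (mu p)^2 *R Kn (y - fst p))" for y by (rule Eq)
qed (use e0 in auto)

end

section \<open>Comparing the fields of two solutions\<close>

text \<open>An Euler step from time s is kicked with the factor \<open>kap s\<close> but is followed
  backward from time s + h; exp 2 <= 9 bounds the mismatch.\<close>

lemma kap_ratio: "0 <= h ==> h <= 1 ==> kap s <= 9 * kap (s + h)"
proof -
 assume h: "0 <= h" "h <= 1"
 have e2: "exp (2 :: real) <= 9"
  using power_mono[OF exp_le, of 2] by (simp add: exp_of_nat_mult[symmetric])
 have "exp (- 2 * s) = exp (2 * h) * exp (- 2 * (s + h))" by (simp add: exp_add[symmetric])
 also have "... <= 9 * exp (- 2 * (s + h))" using h e2 by (intro mult_right_mono) (auto intro: order_trans[of _ "exp 2"])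
 finally have a: "exp (- 2 * s) <= 9 * exp (- 2 * (s + h))" .
 have "exp (- 2 * (s + h)) <= exp (- 2 * s)" using h by simp
 then have "2 * exp (- 2 * s) / (1 + exp (- 2 * s)) <= 2 * (9 * exp (- 2 * (s + h))) / (1 + exp (- 2 * (s + h)))"
  using a by (intro frac_le) (auto intro: add_pos_pos)
 then show ?thesis unfolding kap_eq by simp
qed

lemma integral_exp_le:
 fixes K nu s t :: real
 assumes "nu > 0" "K >= 0" "t <= s"
 shows "integral {t..s} (%s. K * exp (- (nu * s))) <= K / nu * exp (- (nu * t))"
proof -
 have "((%s. K * exp (- (nu * s))) has_integral (- (K / nu) * exp (- (nu * s)) - (- (K / nu) * exp (- (nu * t))))) {t..s}"
  by (rule fundamental_theorem_of_calculus[OF assms(3)])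
   (use assms in "auto intro!: derivative_eq_intros simp: has_real_derivative_iff_has_vector_derivative[symmetric]")
 from integral_unique[OF this] have "integral {t..s} (%s. K * exp (- (nu * s))) = K / nu * exp (- (nu * t)) - K / nu * exp (- (nu * s))" by simp
 moreover have "0 <= K / nu * exp (- (nu * s))" using assms by (intro mult_nonneg_nonneg) auto
 ultimately show ?thesis by linarith
qed

lemma norm_zc_le: "t >= 0 ==> norm (zc t p - zc t p') <= 2 * norm (p - p')"
proof -
 assume t: "t >= 0"
 have "zc t p - zc t p' = (fst p - fst p') - kap t *R (snd p - snd p')" by (simp add: zc_def algebra_simps)
 also have "norm ... <= norm (fst p - fst p') + norm (kap t *R (snd p - snd p'))" by (rule norm_triangle_ineq4)
 also have "... <= norm (p - p') + 1 * norm (p - p')" unfolding norm_scaleR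
  using norm_fst_le[of "fst p - fst p'" "snd p - snd p'"] norm_snd_le[of "snd p - snd p'" "fst p - fst p'"] kap_le1[OF t] kap_pos[of t] unfolding minus_prod_def
  by (intro add_mono mult_mono) auto
 finally show ?thesis by simp
qed

context flow
begin

text \<open>The truncated kernel of time \<open>t\<close> as a function of the state at time
  \<open>s\<close>, pulled back along the flow of \<open>F\<close>. It is constant along that flow,
  and at s = t it is the kernel tested against \<open>u\<close>.\<close>

definition Psi :: "real => plane => plane => real => real => phase => real" where
 "Psi r y u t s p = Kr r (y - zc t (flw s p t)) \<bullet> u"

lemma Psi_diff:
 assumes r: "r > 0" and u: "norm u <= 1"
 shows "abs (Psi r y u t s p - Psi r y u t s' p') <= norm (zc t (flw s p t) - zc t (flw s' p' t)) / r^2"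
proof -
 have "abs (Psi r y u t s p - Psi r y u t s' p') <= norm (Kr r (y - zc t (flw s p t)) - Kr r (y - zc t (flw s' p' t))) * norm u"
  unfolding Psi_def inner_diff_left[symmetric] by (rule Cauchy_Schwarz_ineq2)
 also have "... <= norm (Kr r (y - zc t (flw s p t)) - Kr r (y - zc t (flw s' p' t))) * 1" using u by (intro mult_left_mono) auto
 also have "... <= norm (zc t (flw s p t) - zc t (flw s' p' t)) / r^2"
  using Kr_lip[OF r, of "y - zc t (flw s p t)" "y - zc t (flw s' p' t)"] by (simp add: norm_minus_commute)
 finally show ?thesis .
qed

lemma Psi_bd: "r > 0 ==> norm u <= 1 ==> abs (Psi r y u t s p) <= 1 / r"
 using Cauchy_Schwarz_ineq2[of "Kr r (y - zc t (flw s p t))" u] mult_mono[OF Kr_bound[of r "y - zc t (flw s p t)"], of "norm u" 1]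
 by (simp add: Psi_def)

lemma Psi_lip:
 assumes r: "r > 0" and u: "norm u <= 1" and t: "t >= 0"
 shows "abs (Psi r y u t s' p' - Psi r y u t s p) <= 2 / r^2 * exp (8 * e * abs (t - s')) * norm (p' - flw s p s')"
proof -
 have "norm (zc t (flw s' p' t) - zc t (flw s p t)) <= 2 * norm (flw s' p' t - flw s' (flw s p s') t)"
  using norm_zc_le[OF t] by (simp add: flw_group)
 also have "norm (flw s' p' t - flw s' (flw s p s') t) <= norm (p' - flw s p s') * exp (8 * e * abs (t - s'))"
  using sol_dist[OF flw(2)[of s' p'] flw(2)[of s' "flw s p s'"], of t s'] by (simp add: flw(1))
 finally have "norm (zc t (flw s' p' t) - zc t (flw s p t)) / r^2 <= (2 * (norm (p' - flw s p s') * exp (8 * e * abs (t - s')))) / r^2"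
  by (intro divide_right_mono) auto
 then show ?thesis using Psi_diff[OF r u, of y t s' p' s p] by (simp add: mult_ac)
qed

lemma Psi_loclip:
 assumes r: "r > 0" and u: "norm u <= 1" and t: "t >= 0"
 shows "loclip (Psi r y u t)"
proof (rule loclipI)
 fix T :: real
 define L where "L = 2 / r^2 * exp (8 * e * (t + T))"
 show "EX L. ALL s:{0..T}. ALL s':{0..T}. ALL p p'. norm (Psi r y u t s p - Psi r y u t s' p') <= L * (abs (s - s') + norm (p - p'))"
 proof (intro exI[of _ L] ballI allI)
  fix s s' p p' assume s: "s : {0..T}" "s' : {0..T}"
  have "abs (Psi r y u t s p - Psi r y u t s' p') <= 2 / r^2 * exp (8 * e * abs (t - s)) * norm (p - flw s' p' s)" by (rule Psi_lip[OF r u t])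
  also have "... <= L * (abs (s - s') + norm (p - p'))" unfolding L_def using flw_shift s t e0
   by (intro mult_mono mult_left_mono) auto
  finally show "norm (Psi r y u t s p - Psi r y u t s' p') <= L * (abs (s - s') + norm (p - p'))" by simp
 qed
qed

lemma Wf_split: "p + h *R Wf F' s p = (p + h *R Wf F s p) + (kap s *R (h *R (F' s (zc s p) - F s (zc s p))), h *R (F' s (zc s p) - F s (zc s p)))"
 by (cases p) (simp add: Wf_def algebra_simps)

text \<open>A step with the field F' differs from one with F by the kick h (kap s, 1)(F' - F), of
  the shape that \<open>backward\<close> handles, and the kernel has Lipschitz constant 1/r^2. F'
  enters through its value at one point only, so it needs no flow. The constant is 36 = 4 *
  9.\<close>

lemma Psi_rate:
 assumes r: "r > 0" and u: "norm u <= 1" and t: "0 <= t" "t < s" and d: "norm (F s (zc s p) - F' s (zc s p)) <= d"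
 shows "rate_le (36 * kap t / r^2 * d) (%n. abs (inc F' (Psi r y u t) s p n))"
proof -
 have s: "s > 0" using t by simp
 define C where "C = 2 / r^2 * exp (8 * e * (s + 1))"
 have C: "C >= 0" by (simp add: C_def)
 define X where "X n = norm (p + (1 / real (Suc n)) *R Wf F s p - flw s p (s + 1 / Suc n))" for n
 have "rate_le (36 * kap t / r^2 * d + C * 0) (%n. 36 * kap t / r^2 * d / Suc n + C * X n)"
  unfolding X_def by (intro rate_le_add rate_le_const rate_le_cmult[OF euler_error[OF s] C]) simp
 then show ?thesis
 proof (rule rate_le_mono)
  fix n
  define h where "h = 1 / real (Suc n)"
  have h: "0 < h" "h <= 1" by (auto simp: h_def)
  define w where "w = F' s (zc s p) - F s (zc s p)"
  have w: "norm w <= d" using d by (simp add: w_def norm_minus_commute)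
  define q1 where "q1 = p + h *R Wf F s p"
  define q2 where "q2 = p + h *R Wf F' s p"
  have q: "q2 = q1 + (kap s *R (h *R w), h *R w)" unfolding q1_def q2_def w_def by (rule Wf_split)
  have "norm (zc t (flw (s + h) q2 t) - zc t (flw (s + h) q1 t)) <= 4 * kap t * (9 * (h * norm w))"
  proof (rule backward)
   show "norm (fst q2 - fst q1) <= kap (s + h) * (9 * (h * norm w))"
    using mult_right_mono[OF kap_ratio[of h s], of "h * norm w"] h kap_pos[of s] by (simp add: q mult_ac)
   show "norm (snd q2 - snd q1) <= 9 * (h * norm w)" using h by (simp add: q)
  qed (use t h in auto)
  also have "... <= h * (36 * kap t * d)" using w h kap_pos[of t] by (simp add: mult_left_mono)
  finally have "norm (zc t (flw (s + h) q2 t) - zc t (flw (s + h) q1 t)) / r^2 <= h * (36 * kap t * d) / r^2" by (intro divide_right_mono) auto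
  then have 1: "abs (Psi r y u t (s + h) q2 - Psi r y u t (s + h) q1) <= h * (36 * kap t / r^2 * d)"
   using Psi_diff[OF r u, of y t "s + h" q2 "s + h" q1] by simp
  have "abs (Psi r y u t (s + h) q1 - Psi r y u t s p) <= 2 / r^2 * exp (8 * e * abs (t - (s + h))) * norm (q1 - flw s p (s + h))" by (rule Psi_lip[OF r u t(1)])
  also have "... <= C * norm (q1 - flw s p (s + h))" unfolding C_def using t h e0 by (intro mult_right_mono mult_left_mono) auto
  finally have "abs (Psi r y u t (s + h) q2 - Psi r y u t s p) <= h * (36 * kap t / r^2 * d) + C * norm (q1 - flw s p (s + h))" using 1 by linarith
  then show "abs (inc F' (Psi r y u t) s p n) <= 36 * kap t / r^2 * d / Suc n + C * X n" by (simp add: h_def q1_def q2_def X_def mult.commute)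
 qed simp
qed

end

locale two_sols = nice lam E e F mu + w2: wsol lam E e F2 g2 M2 A2 m2 mu for lam E e F mu F2 g2 M2 A2 m2 +
 fixes D nu :: real
 assumes D: "D >= 0" and nu: "nu > 0" and FF: "t >= 0 ==> norm (F t y - F2 t y) <= D * exp (- (nu * t))"
begin

text \<open>Along Euler steps of \<open>F2\<close> the competitor is constant to first order, and
  \<open>G\<close> fails to be so only through the change of field, which by \<open>H_dir\<close>
  costs 72 e |F - F2|. The comparison principle integrates this from infinity.\<close>

lemma g_diff:
 assumes t: "t >= 0"
 shows "abs (G t p - g2 t p) <= 72 * e * D / nu * exp (- (nu * t))"
proof (rule comparison[where w="%t p. G t p - g2 t p" and F=F2 and M=M2 and A="81 * e + A2" and m="18 * e^2 + 2 * m2" and D="72 * e * D", OF w2.F])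
 show "loclip (%t p. G t p - g2 t p)" by (rule loclip_diff[OF ws.gl w2.gl])
 show "pdec (81 * e + A2) (%t p. G t p - g2 t p)"
  unfolding pdec_def
 proof (intro conjI allI impI)
  show "0 <= 81 * e + A2" using G_pdec w2.dec by (simp add: pdec_def)
  fix t p assume t: "(t::real) >= 0"
  have "abs (G t p) <= 81 * e / (1 + norm (vel t p)) ^ 4" "abs (g2 t p) <= A2 / (1 + norm (vel t p)) ^ 4"
   using G_pdec w2.dec t unfolding pdec_def by blast+
  then show "abs (G t p - g2 t p) <= (81 * e + A2) / (1 + norm (vel t p)) ^ 4" by (simp add: add_divide_distrib)
 qed
 show "(NN p. ennreal ((G t p - g2 t p)^2)) <= ennreal (18 * e^2 + 2 * m2)" if t: "t >= 0" for t
 proof -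
  note [measurable] = ws.gm[OF t] w2.gm[OF t]
  have "(NN p. ennreal ((G t p - g2 t p)^2)) <= (NN p. 2 * ennreal ((G t p)^2) + 2 * ennreal ((g2 t p)^2))"
  proof (rule nn_integral_mono)
   fix p
   have "0 <= (G t p + g2 t p)^2" by simp
   then have "(G t p - g2 t p)^2 <= 2 * (G t p)^2 + 2 * (g2 t p)^2" by (simp add: power2_eq_square algebra_simps)
   then have "ennreal ((G t p - g2 t p)^2) <= ennreal (2 * (G t p)^2 + 2 * (g2 t p)^2)" by (rule ennreal_leI)
   then show "ennreal ((G t p - g2 t p)^2) <= 2 * ennreal ((G t p)^2) + 2 * ennreal ((g2 t p)^2)" by (simp add: ennreal_plus ennreal_mult)
  qed
  also have "... = 2 * (NN p. ennreal ((G t p)^2)) + 2 * (NN p. ennreal ((g2 t p)^2))"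
   by (subst nn_integral_add) (auto simp: nn_integral_cmult)
  also have "... <= 2 * ennreal (9 * e^2) + 2 * ennreal m2" by (intro add_mono mult_left_mono ws.mass w2.mass t) auto
  also have "... = ennreal (18 * e^2 + 2 * m2)" using w2.m by (simp add: ennreal_plus ennreal_mult flip: ennreal_numeral) (simp add: mult.assoc[symmetric] ennreal_mult[symmetric])
  finally show ?thesis .
 qed
 show "0 <= 18 * e^2 + 2 * m2" using w2.m by simp
 show "(%n. fin G n p - fin g2 n p) ---> 0" for p
  using tendsto_diff[OF ws.conv w2.conv, of p p] by simp
 show "AE q in lborel. case q of (t, p) => 0 < t -->
   rate_le (72 * e * D * exp (- (nu * t))) (%n. abs (inc F2 (%t p. G t p - g2 t p) t p n))"
  using conjunct2[OF w2.tr[unfolded transported_def]]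
 proof (rule AE_mp, intro AE_I2 impI)
  fix x :: "real \<times> phase"
  obtain t p where xp: "x = (t, p)" by (cases x)
  assume x: "case x of (t, p) => 0 < t --> rate_le 0 (%n. abs (inc F2 g2 t p n))"
  show "case x of (t, p) => 0 < t -->
   rate_le (72 * e * D * exp (- (nu * t))) (%n. abs (inc F2 (%t p. G t p - g2 t p) t p n))"
   unfolding xp prod.case
  proof (intro impI)
   assume t: "t > 0"
   have r1: "rate_le 0 (%n. abs (inc F2 g2 t p n))" using x t by (simp only: xp prod.case)
   have r2: "rate_le 0 (%n. abs (inc F G t p n))" unfolding G_def by (rule H_quot[OF muw t])
   define d where "d n = abs (G (t + 1 / real (Suc n)) (p + (1 / real (Suc n)) *R Wf F2 t p) - G (t + 1 / real (Suc n)) (p + (1 / real (Suc n)) *R Wf F t p))" for n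
   have "rate_le (72 * e * D * exp (- (nu * t))) d"
   proof (rule rate_le_const)
    fix n
    define h where "h = 1 / real (Suc n)"
    have h: "0 < h" "h <= 1" by (auto simp: h_def)
    define w where "w = F2 t (zc t p) - F t (zc t p)"
    have w: "norm w <= D * exp (- (nu * t))" using FF[of t "zc t p"] t by (simp add: w_def norm_minus_commute)
    have k: "0 <= kap t" "kap t <= 1" "kap t * (t + h) <= 2"
     using kap_pos[of t] kap_le1[of t] kap_t_le1[of t] t h mult_mono[of "kap t" 1 h 1] by (auto simp: distrib_left)
    have "d n <= 72 * e * norm (h *R w)"
     unfolding d_def h_def[symmetric] G_def w_def Wf_split[where F'=F2] by (rule H_dir[OF muw _ k]) (use t h in simp)
    also have "... <= 72 * e * (h * (D * exp (- (nu * t))))" using w h e0 by (simp add: mult_left_mono)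
    finally show "d n <= 72 * e * D * exp (- (nu * t)) / Suc n" by (simp add: h_def)
   qed
   from rate_le_add[OF rate_le_add[OF r1 r2] this]
   show "rate_le (72 * e * D * exp (- (nu * t))) (%n. abs (inc F2 (%t p. G t p - g2 t p) t p n))"
    by (rule rate_le_mono) (auto simp: d_def)
  qed
 qed
qed (use D nu e0 t in auto)

text \<open>Within radius r = exp (-t/2) the densities are compared pointwise by
  \<open>g_diff\<close>. Beyond it both integrals are compared with the same final integral against
  \<open>Psi\<close>, with no drift for \<open>G\<close> and a drift due to F - F2 for the
  competitor. Each part gains a factor r over the decay assumed for the fields, and integration in
  time gives 1/nu.\<close>

lemma N_diff:
 assumes t: "t >= 0"
 shows "norm (Nf G t y - Nf g2 t y) <= (294912 * e * (81 * e + A2) + 72 * m2) * (D / nu) * exp (- ((nu + 1 / 2) * t))"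
proof -
 define r where "r = exp (- (t / 2))"
 define W where "W = 72 * e * D / nu * exp (- (nu * t))"
 have r: "r > 0" by (simp add: r_def)
 have W: "W >= 0" using D nu e0 by (simp add: W_def)
 have A: "81 * e + A2 >= 0" using G_pdec w2.dec by (simp add: pdec_def)
 define f where "f = (%p. (G t p)^2 - (g2 t p)^2)"
 have fi: "integrable lborel f" unfolding f_def by (intro Bochner_Integration.integrable_diff ws.gint w2.gint t)
 have fb: "abs (f p) <= W * (81 * e + A2) / (1 + norm (vel t p)) ^ 3" for p
 proof -
  let ?n = "1 + norm (vel t p)"
  have "abs (G t p) <= 81 * e / ?n ^ 4" "abs (g2 t p) <= A2 / ?n ^ 4" using G_pdec w2.dec t unfolding pdec_def by blast+
  then have s: "abs (G t p + g2 t p) <= (81 * e + A2) / ?n ^ 4" by (simp add: add_divide_distrib)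
  also have "... <= (81 * e + A2) / ?n ^ 3" using A by (intro divide_left_mono power_increasing mult_pos_pos zero_less_power one_norm_pos) auto
  finally have "abs (G t p - g2 t p) * abs (G t p + g2 t p) <= W * ((81 * e + A2) / ?n ^ 3)"
   using g_diff[OF t, of p] W by (intro mult_mono) (auto simp: W_def)
  then show ?thesis by (simp add: f_def abs_mult[symmetric] power2_eq_square algebra_simps)
 qed
 have inner: "norm ((LBINT p. f p *R Kn (y - zc t p)) - (LBINT p. f p *R Kr r (y - zc t p))) <= 4096 * r * (W * (81 * e + A2))"
  by (rule Kn_vel(2)[OF t fi fb _ r]) (use W A in simp)
 have Kf: "(LBINT p. f p *R Kn (y - zc t p)) = (LBINT p. (G t p)^2 *R Kn (y - zc t p)) - (LBINT p. (g2 t p)^2 *R Kn (y - zc t p))"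
  unfolding f_def scaleR_diff_left by (rule Bochner_Integration.integral_diff[OF ws.N_int[OF t] w2.N_int[OF t]])
 have Kf': "(LBINT p. f p *R Kr r (y - zc t p)) = ws.Gr r (kap t) t y - w2.Gr r (kap t) t y"
  unfolding f_def scaleR_diff_left ws.Gr_def w2.Gr_def zc_def
  by (rule Bochner_Integration.integral_diff[OF ws.Gr_int[OF t r] w2.Gr_int[OF t r]])
 define U where "U = 36 * kap t / r^2 * D / nu * exp (- (nu * t))"
 have outer: "norm (ws.Gr r (kap t) t y - w2.Gr r (kap t) t y) <= m2 * U"
 proof (rule norm_le_of_inner)
  fix u :: plane assume u: "norm u <= 1"
  have psi: "ws.psi r y u (kap t) p = Psi r y u t t p" "w2.psi r y u (kap t) p = Psi r y u t t p" for p
   by (simp_all add: Psi_def flw(1) ws.psi_def w2.psi_def zc_def)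
  show "(ws.Gr r (kap t) t y - w2.Gr r (kap t) t y) \<bullet> u <= m2 * U"
  proof (rule field_le_epsilon)
   fix ep :: real assume ep: "ep > 0"
   have ep2: "ep / 2 > 0" using ep by simp
   have 1: "EV n. abs ((LBINT p. (G t p)^2 * Psi r y u t t p) - (LBINT p. (mu p)^2 * Psi r y u t (real n) (asy (real n) p))) <= 9 * e^2 * 0 + ep / 2"
   proof (rule ws.integral_sq_test_lim[OF Psi_loclip[OF r u t] Psi_bd[OF r u] t _ _ _ _ ep2, where b="%_. 0"])
    show "rate_le 0 (%n. abs (inc F (Psi r y u t) s p n))" if "t < s" for s p
     using Psi_rate[OF r u t that, of p F 0 y] by simp
   qed auto
   have 2: "EV n. abs ((LBINT p. (g2 t p)^2 * Psi r y u t t p) - (LBINT p. (mu p)^2 * Psi r y u t (real n) (asy (real n) p))) <= m2 * U + ep / 2"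
   proof (rule w2.integral_sq_test_lim[OF Psi_loclip[OF r u t] Psi_bd[OF r u] t _ _ _ _ ep2, where b="%s. 36 * kap t / r^2 * D * exp (- (nu * s))"])
    show "integral {t..s} (%s. 36 * kap t / r^2 * D * exp (- (nu * s))) <= U" if "t <= s" for s
     unfolding U_def using kap_pos[of t] D by (intro integral_exp_le nu that) auto
    show "rate_le (36 * kap t / r^2 * D * exp (- (nu * s))) (%n. abs (inc F2 (Psi r y u t) s p n))" if "t < s" for s p
     using Psi_rate[OF r u t that, of p F2 "D * exp (- (nu * s))" y] that FF[of s] t by (simp add: mult.assoc)
   qed (use kap_pos[of t] D r in "auto intro!: continuous_intros")
   have "EX n::nat. abs ((LBINT p. (G t p)^2 * Psi r y u t t p) - (LBINT p. (mu p)^2 * Psi r y u t (real n) (asy (real n) p))) <= 9 * e^2 * 0 + ep / 2 &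
    abs ((LBINT p. (g2 t p)^2 * Psi r y u t t p) - (LBINT p. (mu p)^2 * Psi r y u t (real n) (asy (real n) p))) <= m2 * U + ep / 2"
    using eventually_happens'[OF _ eventually_conj[OF 1 2]] by simp
   then have "(LBINT p. (G t p)^2 * Psi r y u t t p) - (LBINT p. (g2 t p)^2 * Psi r y u t t p) <= m2 * U + ep" by (elim exE) argo
   then show "(ws.Gr r (kap t) t y - w2.Gr r (kap t) t y) \<bullet> u <= m2 * U + ep"
    by (simp add: inner_diff_left ws.Gr_inner[OF t r] w2.Gr_inner[OF t r] psi)
  qed
 qed (use w2.m kap_pos[of t] D nu in \<open>auto simp: U_def\<close>)
 have "Nf G t y - Nf g2 t y = (1 / (2 * pi)) *R (LBINT p. f p *R Kn (y - zc t p))"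
  unfolding Kf by (simp add: Nf_def scaleR_diff_right)
 also have "norm ... <= norm (LBINT p. f p *R Kn (y - zc t p))" by (rule pi_le)
 also have "... <= 4096 * r * (W * (81 * e + A2)) + m2 * U"
  using norm_triangle_mono[OF inner outer[folded Kf']] by simp
 also have "... <= 4096 * r * (W * (81 * e + A2)) + m2 * (72 * r * (D / nu) * exp (- (nu * t)))"
 proof -
  have "kap t <= 2 * exp (- 2 * t)" by (rule kap_le_exp)
  also have "exp (- 2 * t) = r * r * (r * r)" by (simp add: r_def exp_add[symmetric])
  also have "2 * (r * r * (r * r)) <= 2 * r * r^2"
  proof -
   have "r <= 1" using t by (simp add: r_def)
   then have "r * (r * r * r) <= 1 * (r * r * r)" using r by (intro mult_right_mono) auto
   then show ?thesis by (simp add: power2_eq_square mult_ac)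
  qed
  finally have "kap t / r^2 <= 2 * r" using r by (simp add: divide_le_eq)
  then have "36 * (kap t / r^2) * (D / nu) * exp (- (nu * t)) <= 36 * (2 * r) * (D / nu) * exp (- (nu * t))"
   using D nu by (intro mult_right_mono mult_left_mono) auto
  then have "U <= 72 * r * (D / nu) * exp (- (nu * t))" by (simp add: U_def)
  then show ?thesis using w2.m by (intro add_left_mono mult_left_mono) auto
 qed
 also have "... = (294912 * e * (81 * e + A2) + 72 * m2) * (D / nu) * (r * exp (- (nu * t)))" by (simp add: W_def algebra_simps add_divide_distrib)
 also have "r * exp (- (nu * t)) = exp (- ((nu + 1 / 2) * t))" by (simp add: r_def exp_add[symmetric] algebra_simps)
 finally show ?thesis .
qed

end

section \<open>Lipschitz estimate for the deviation of the field from its limit\<close>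

definition J :: "real => plane => real" where "J R w = (if norm w < R then 1 else 0)"

lemma J_meas [measurable]: "J R : bmeas" unfolding J_def by measurable

lemma J_nonneg [simp]: "0 <= J R w" by (simp add: J_def)

lemma inv_sq_le: "r > 0 ==> R > 0 ==> 1 / (max r (norm w))^2 <= (1 / r^2) * J R w + 1 / R^2"
proof (cases "norm w < R")
 case True
 assume r: "r > 0" "R > 0"
 have "1 / (max r (norm w))^2 <= 1 / r^2" using r by (intro divide_left_mono power_mono) auto
 moreover have "0 <= 1 / R^2" by simp
 ultimately show ?thesis using True unfolding J_def by (simp only: if_True mult_1_right)
next
 case False
 assume r: "r > 0" "R > 0"
 have "1 / (max r (norm w))^2 <= 1 / R^2" using r False by (intro divide_left_mono power_mono mult_pos_pos zero_less_power) auto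
 then show ?thesis using False by (simp add: J_def)
qed

text \<open>A second radius takes the place of the logarithm that an inverse square kernel would
  produce in the plane: within \<open>R\<close> the density bound gives B R^2 / r^2, and beyond
  \<open>R\<close> only the total mass enters.\<close>

lemma outer_density:
 fixes f :: "phase => real" and c0 :: "plane => plane"
 assumes fi: "integrable lborel f" and fb: "!!z c. abs (f (z, c)) <= B / (1 + norm (c - c0 z)) ^ 3" and B: "B >= 0"
  and m: "(LBINT p. abs (f p)) <= m" and r: "r > 0" "R > 0"
 shows "integrable lborel (%p. abs (f p) * (1 / (max r (norm (y - fst p)))^2))"
  and "(LBINT p. abs (f p) * (1 / (max r (norm (y - fst p)))^2)) <= 128 * B * R^2 / r^2 + m / R^2"
proof -
 have fm [measurable]: "f : bmeas" using fi by auto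
 have ai: "integrable lborel (%p. abs (f p))" using fi by auto
 have m0: "m >= 0" using m order_trans[OF integral_nonneg_AE] by (metis AE_I2 abs_ge_zero)
 have near: "(NN p. ennreal (abs (f p) * J R (y - fst p))) <= ennreal (128 * B * R^2)"
 proof -
  have "(NN p. ennreal (abs (f p) * J R (y - fst p))) = (NN z. NN c. ennreal (abs (f (z, c)) * J R (y - z)))"
   by (subst nn_integral_lborel_prod(1)) auto
  also have "... <= (NN z. ennreal (32 * B) * indicator (ball y R) z)"
  proof (rule nn_integral_mono)
   fix z
   have "(NN c. ennreal (abs (f (z, c)) * J R (y - z))) <= (NN c. (ennreal B * indicator (ball y R) z) * ennreal (1 / (1 + norm (c - c0 z)) ^ 3))"
   proof (rule nn_integral_mono)
    fix c
    show "ennreal (abs (f (z, c)) * J R (y - z)) <= (ennreal B * indicator (ball y R) z) * ennreal (1 / (1 + norm (c - c0 z)) ^ 3)"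
     using fb[of z c] B by (auto simp: indicator_def J_def dist_norm norm_minus_commute ennreal_mult[symmetric] intro!: ennreal_leI divide_nonneg_nonneg)
   qed
   also have "... <= (ennreal B * indicator (ball y R) z) * ennreal 32"
    by (subst nn_integral_cmult) (auto intro!: mult_left_mono nn_integral_weight3[unfolded ennreal_numeral])
   also have "... = ennreal (32 * B) * indicator (ball y R) z" using B by (auto simp: indicator_def ennreal_mult[symmetric] mult.commute simp flip: ennreal_numeral)
   finally show "(NN c. ennreal (abs (f (z, c)) * J R (y - z))) <= ennreal (32 * B) * indicator (ball y R) z" .
  qed
  also have "... = ennreal (32 * B) * ennreal (pi * R^2)" using r emeasure_ball_plane[of R y] by (subst nn_integral_cmult_indicator) auto
  also have "... <= ennreal (32 * B) * ennreal (4 * R^2)" using pi_less_4 by (intro mult_left_mono ennreal_leI mult_right_mono) auto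
  also have "... = ennreal (128 * B * R^2)" using B by (subst ennreal_mult[symmetric]) auto
  finally show ?thesis .
 qed
 have ni: "integrable lborel (%p. abs (f p) * J R (y - fst p))"
  by (rule integrableI_bounded) (use near in "auto simp: abs_mult intro: le_less_trans")
 have nn: "(LBINT p. abs (f p) * J R (y - fst p)) <= 128 * B * R^2"
  using near nn_integral_eq_integral[OF ni] B by simp
 have bi: "integrable lborel (%p. (1 / r^2) * (abs (f p) * J R (y - fst p)) + (1 / R^2) * abs (f p))"
  by (intro Bochner_Integration.integrable_add integrable_mult_right ni ai)
 have le: "abs (f p) * (1 / (max r (norm (y - fst p)))^2) <= (1 / r^2) * (abs (f p) * J R (y - fst p)) + (1 / R^2) * abs (f p)" for p
  using mult_left_mono[OF inv_sq_le[OF r, of "y - fst p"], of "abs (f p)"] by (simp add: algebra_simps)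
 show i: "integrable lborel (%p. abs (f p) * (1 / (max r (norm (y - fst p)))^2))"
 proof (rule Bochner_Integration.integrable_bound[OF bi])
  show "AE p in lborel. norm (abs (f p) * (1 / (max r (norm (y - fst p)))^2)) <= norm ((1 / r^2) * (abs (f p) * J R (y - fst p)) + (1 / R^2) * abs (f p))"
   using le by (intro AE_I2) (simp add: abs_of_nonneg add_nonneg_nonneg)
 qed measurable
 have "(LBINT p. abs (f p) * (1 / (max r (norm (y - fst p)))^2)) <= (LBINT p. (1 / r^2) * (abs (f p) * J R (y - fst p)) + (1 / R^2) * abs (f p))"
  by (rule integral_mono[OF i bi le])
 also have "... = (1 / r^2) * (LBINT p. abs (f p) * J R (y - fst p)) + (1 / R^2) * (LBINT p. abs (f p))"
  using ni ai by (subst Bochner_Integration.integral_add) auto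
 also have "... <= (1 / r^2) * (128 * B * R^2) + (1 / R^2) * m" using nn m by (intro add_mono mult_left_mono) auto
 finally show "(LBINT p. abs (f p) * (1 / (max r (norm (y - fst p)))^2)) <= 128 * B * R^2 / r^2 + m / R^2" by simp
qed

text \<open>The singular part of the kernel is not Lipschitz, so the shift of the base point is
  moved onto the density by a translation of positions, where the bound \<open>fl\<close> applies.
  The truncated part is differenced directly through \<open>Kr_diff_symm\<close>.\<close>

lemma field_lip:
 fixes f :: "phase => real" and c0 :: "plane => plane"
 assumes fi: "integrable lborel f" and fb: "!!z c. abs (f (z, c)) <= B / (1 + norm (c - c0 z)) ^ 3" and B: "B >= 0"
  and fl: "!!z z' c. abs (f (z, c) - f (z', c)) <= L * norm (z - z') * (1 / (1 + norm (c - c0 z)) ^ 3 + 1 / (1 + norm (c - c0 z')) ^ 3)" and L: "L >= 0"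
  and m: "(LBINT p. abs (f p)) <= m" and r: "r > 0" "R > 0" and c0: "continuous_on UNIV c0"
 shows "norm ((LBINT p. f p *R Kn (y - fst p)) - (LBINT p. f p *R Kn (y' - fst p)))
  <= norm (y - y') * (1024 * r * L + 2 * (128 * B * R^2 / r^2 + m / R^2))"
proof -
 have fm [measurable]: "f : bmeas" using fi by auto
 define d where "d = y' - y"
 define T where "T = (%p :: phase. (fst p + d, snd p))"
 have Tp: "lborel_pres T" unfolding T_def by (rule lborel_pres_shear_fst) simp
 have [measurable]: "T : bmeas" by (rule lborel_pres_measurable[OF Tp])
 define k where "k = (%w. Kn w - Kr r w)"
 have [measurable]: "k : bmeas" unfolding k_def by measurable
 have Ki: "integrable lborel (%p. f p *R Kn (x - fst p))" for x by (rule Kn_density(1)[OF fi fb B])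
 have Kri: "integrable lborel (%p. f p *R Kr r (x - fst p))" for x
  by (rule integrable_bounded_mult[OF fi]) (measurable, rule Kr_bound[OF r(1)])
 have ki: "integrable lborel (%p. f p *R k (x - fst p))" for x
  unfolding k_def scaleR_diff_right by (intro Bochner_Integration.integrable_diff Ki Kri)
 have split: "(LBINT p. f p *R Kn (x - fst p)) = (LBINT p. f p *R k (x - fst p)) + (LBINT p. f p *R Kr r (x - fst p))" for x
  unfolding Bochner_Integration.integral_add[OF ki Kri, symmetric] by (simp add: k_def scaleR_diff_right)
 have sh: "(%p. f (T p) *R k (y' - fst (T p))) = (%p. f (T p) *R k (y - fst p))" by (simp add: T_def d_def algebra_simps)
 have kT: "integrable lborel (%p. f (T p) *R k (y - fst p))" "(LBINT p. f p *R k (y' - fst p)) = (LBINT p. f (T p) *R k (y - fst p))"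
  using lborel_pres_integrable[OF Tp, of "%p. f p *R k (y' - fst p)"] ki[of y'] lborel_pres_integral[OF Tp, of "%p. f p *R k (y' - fst p)"] unfolding sh by simp_all
 have [measurable]: "c0 : bmeas" by (rule borel_measurable_continuous_onI[OF c0])
 define h where "h = (%(c1 :: plane => plane) (p :: phase). 1 / (1 + norm (snd p - c1 (fst p))) ^ 3)"
 have h0: "h c1 p >= 0" for c1 p by (simp add: h_def)
 have hd: "integrable lborel (%p. h c1 p * jr r (y - fst p))" "(LBINT p. h c1 p * jr r (y - fst p)) <= 512 * r" if [measurable]: "c1 : bmeas" for c1
 proof -
  have hm [measurable]: "h c1 : bmeas" unfolding h_def by measurable
  have *: "(NN p. ennreal (abs (h c1 p) * jr r (y - fst p))) <= ennreal (512 * r * 1)"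
   by (rule jr_density[OF hm _ _ r(1), where ?c0.0=c1]) (auto simp: h_def)
  show i: "integrable lborel (%p. h c1 p * jr r (y - fst p))"
   by (rule integrableI_bounded) (use * h0 jr_nonneg in "auto simp: abs_mult intro: le_less_trans")
  show "(LBINT p. h c1 p * jr r (y - fst p)) <= 512 * r"
   using * nn_integral_eq_integral[OF i] h0 jr_nonneg r by simp
 qed
 define c1 where "c1 = (%z. c0 (z + d))"
 have [measurable]: "c1 : bmeas" unfolding c1_def by measurable
 have inner: "norm ((LBINT p. f p *R k (y - fst p)) - (LBINT p. f p *R k (y' - fst p))) <= L * norm d * (1024 * r)"
 proof -
  have "(LBINT p. f p *R k (y - fst p)) - (LBINT p. f p *R k (y' - fst p)) = (LBINT p. f p *R k (y - fst p) - f (T p) *R k (y - fst p))"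
   unfolding kT(2) by (rule Bochner_Integration.integral_diff[OF ki kT(1), symmetric])
  also have "norm ... <= (LBINT p. (L * norm d) * (h c0 p * jr r (y - fst p) + h c1 p * jr r (y - fst p)))"
  proof (rule Bochner_Integration.integral_norm_bound_integral)
   fix p
   have "abs (f p - f (T p)) <= (L * norm d) * (h c0 p + h c1 p)"
    using fl[of "fst p" "snd p" "fst p + d"] by (simp add: T_def h_def c1_def)
   then have "abs (f p - f (T p)) * norm (k (y - fst p)) <= ((L * norm d) * (h c0 p + h c1 p)) * jr r (y - fst p)"
    using Kn_Kr[OF r(1)] L h0 by (intro mult_mono) (auto simp: k_def intro!: mult_nonneg_nonneg add_nonneg_nonneg)
   then show "norm (f p *R k (y - fst p) - f (T p) *R k (y - fst p)) <= (L * norm d) * (h c0 p * jr r (y - fst p) + h c1 p * jr r (y - fst p))"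
    unfolding scaleR_diff_left[symmetric] norm_scaleR by (simp add: algebra_simps)
  qed (use ki kT hd in "auto intro!: integrable_mult_right Bochner_Integration.integrable_add Bochner_Integration.integrable_diff")
  also have "... = (L * norm d) * ((LBINT p. h c0 p * jr r (y - fst p)) + (LBINT p. h c1 p * jr r (y - fst p)))"
   using hd by (simp add: Bochner_Integration.integral_add)
  also have "... <= (L * norm d) * (512 * r + 512 * r)" using L by (intro mult_left_mono add_mono hd) auto
  finally show ?thesis by simp
 qed
 have outer: "norm ((LBINT p. f p *R Kr r (y - fst p)) - (LBINT p. f p *R Kr r (y' - fst p))) <= norm d * (2 * (128 * B * R^2 / r^2 + m / R^2))"
 proof -
  note od = outer_density[OF fi fb B m r]
  have "(LBINT p. f p *R Kr r (y - fst p)) - (LBINT p. f p *R Kr r (y' - fst p)) = (LBINT p. f p *R Kr r (y - fst p) - f p *R Kr r (y' - fst p))"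
   by (rule Bochner_Integration.integral_diff[OF Kri Kri, symmetric])
  also have "norm ... <= (LBINT p. norm d * (abs (f p) * (1 / (max r (norm (y - fst p)))^2) + abs (f p) * (1 / (max r (norm (y' - fst p)))^2)))"
  proof (rule Bochner_Integration.integral_norm_bound_integral)
   fix p :: "phase"
   have "norm (Kr r (y - fst p) - Kr r (y' - fst p)) <= norm d * (1 / (max r (norm (y - fst p)))^2 + 1 / (max r (norm (y' - fst p)))^2)"
    using Kr_diff_symm[OF r(1), of "y - fst p" "y' - fst p"] by (simp add: d_def norm_minus_commute)
   from mult_left_mono[OF this, of "abs (f p)"]
   show "norm (f p *R Kr r (y - fst p) - f p *R Kr r (y' - fst p)) <= norm d * (abs (f p) * (1 / (max r (norm (y - fst p)))^2) + abs (f p) * (1 / (max r (norm (y' - fst p)))^2))"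
    unfolding scaleR_diff_right[symmetric] norm_scaleR by (simp add: algebra_simps)
  qed (use od(1) Kri in "intro integrable_mult_right Bochner_Integration.integrable_add Bochner_Integration.integrable_diff, auto")
  also have "... = norm d * ((LBINT p. abs (f p) * (1 / (max r (norm (y - fst p)))^2)) + (LBINT p. abs (f p) * (1 / (max r (norm (y' - fst p)))^2)))"
   by (subst integral_mult_right_zero, subst Bochner_Integration.integral_add[OF od(1) od(1)]) simp
  also have "... <= norm d * ((128 * B * R^2 / r^2 + m / R^2) + (128 * B * R^2 / r^2 + m / R^2))" by (intro mult_left_mono add_mono od(2)) auto
  finally show ?thesis by simp
 qed
 have "norm ((LBINT p. f p *R Kn (y - fst p)) - (LBINT p. f p *R Kn (y' - fst p))) <= L * norm d * (1024 * r) + norm d * (2 * (128 * B * R^2 / r^2 + m / R^2))"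
  unfolding split using norm_triangle_mono[OF inner outer] by (simp add: algebra_simps)
 then show ?thesis by (simp add: d_def norm_minus_commute algebra_simps)
qed

lemma sq_diff_le:
 fixes x y :: real
 assumes "abs (x - y) <= d" "abs x + abs y <= s" "d >= 0"
 shows "abs (x^2 - y^2) <= d * s"
proof -
 have "abs (x^2 - y^2) = abs (x - y) * abs (x + y)" by (simp add: power2_eq_square algebra_simps flip: abs_mult)
 also have "... <= d * s" using assms by (intro mult_mono) auto
 finally show ?thesis .
qed

lemma kap_sq_lin: "0 <= t ==> 0 <= a ==> a <= 1 ==> kap t * (1 + t * a)^2 <= 8 * exp (- (t / 2))"
proof -
 assume t: "t >= 0" and a: "0 <= a" "a <= 1"
 have "t * a <= t * 1" using t a by (intro mult_left_mono) auto
 also have "1 + t * 1 <= 2 * exp (t / 2)" using exp_ge_add_one_self[of "t / 2"] by linarith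
 finally have "1 + t * a <= 2 * exp (t / 2)" by simp
 then have "(1 + t * a)^2 <= (2 * exp (t / 2))^2" using t a by (intro power_mono) auto
 also have "... = 4 * exp t" by (simp add: power_mult_distrib exp_of_nat_mult[symmetric])
 finally have "kap t * (1 + t * a)^2 <= (2 * exp (- 2 * t)) * (4 * exp t)" using kap_le_exp[of t] by (intro mult_mono) auto
 also have "... = 8 * (exp (- 2 * t) * exp t)" by simp
 also have "exp (- 2 * t) * exp t = exp (- t)" by (simp add: exp_add[symmetric])
 also have "8 * exp (- t) <= 8 * exp (- (t / 2))" using t by simp
 finally show ?thesis by simp
qed

context nice
begin

text \<open>Solution and datum are brought to the common variables (\<open>zc\<close>, c). The datum
  may be composed with \<open>st\<close> in its field because \<open>asy\<close> preserves measure
  and position. Thus Nf - E becomes one integral of \<open>fd\<close> against one kernel, and both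
  squares decay around the same centre \<open>c0\<close>.\<close>

definition fd :: "real => phase => real" where
 "fd t q = (G t (unz t q))^2 - (mu (st t q))^2"

abbreviation c0 :: "real => plane => plane" where "c0 t z \<equiv> (lam * t) *R E z"

lemma st_pair: "st t (z, c) = (z, c - c0 t z)" by (simp add: st_def vel_def)

lemma st_meas [measurable]: "st t : bmeas"
 unfolding st_def[abs_def] vel_def[abs_def] by measurable

lemma must_int: "integrable lborel (%q. (mu (st t q))^2)" "(LBINT q. (mu (st t q))^2) = (LBINT q. (mu q)^2)"
 using lborel_pres_integrable[OF asy_pres, of "%q. (mu (st t q))^2" t] ws.muint lborel_pres_integral[OF asy_pres, of "%q. (mu (st t q))^2" t] by simp_all

lemma Gunz_int: "t >= 0 ==> integrable lborel (%q. (G t (unz t q))^2)" "t >= 0 ==> (LBINT q. (G t (unz t q))^2) <= 9 * e^2"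
proof -
 assume t: "t >= 0"
 note [measurable] = ws.gm[OF t]
 have m: "(%p. (G t p)^2) : bmeas" by measurable
 show "integrable lborel (%q. (G t (unz t q))^2)" using lborel_pres_integrable[OF unz_pres m] ws.gint[OF t] by simp
 show "(LBINT q. (G t (unz t q))^2) <= 9 * e^2" using lborel_pres_integral[OF unz_pres m] ws.gint_le[OF t] by simp
qed

lemma fd_int: "t >= 0 ==> integrable lborel (fd t)"
 unfolding fd_def[abs_def] by (intro Bochner_Integration.integrable_diff Gunz_int must_int)

lemma fd_mass: "t >= 0 ==> (LBINT q. abs (fd t q)) <= 18 * e^2"
proof -
 assume t: "t >= 0"
 have "(LBINT q. abs (fd t q)) <= (LBINT q. (G t (unz t q))^2 + (mu (st t q))^2)"
  using fd_int[OF t] Gunz_int(1)[OF t] must_int(1)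
  by (intro integral_mono) (auto simp: fd_def abs_le_iff intro!: Bochner_Integration.integrable_add integrable_abs add_nonneg_nonneg)
 also have "... = (LBINT q. (G t (unz t q))^2) + (LBINT q. (mu (st t q))^2)"
  by (rule Bochner_Integration.integral_add[OF Gunz_int(1)[OF t] must_int(1)])
 also have "(LBINT q. (mu (st t q))^2) <= 9 * e^2"
  using ws.mumass ws.m unfolding must_int(2) by (simp add: nn_integral_eq_integral[OF ws.muint])
 finally show ?thesis using Gunz_int(2)[OF t] by simp
qed

lemma G_c0: "t >= 0 ==> abs (G t (unz t (z, c))) <= 1296 * e / (1 + norm (c - c0 t z)) ^ 3"
proof -
 assume t: "t >= 0"
 let ?n = "1 + norm (vel t (unz t (z, c)))" and ?m = "1 + norm (c - c0 t z)"
 have p: "?n > 0" "?m >= 1" "?m > 0" using one_norm_pos by auto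
 have "?m ^ 3 <= (2 * ?n) ^ 3" by (intro power_mono vel_c0(2)[OF t]) simp
 then have "81 * e * ?m ^ 3 <= 81 * e * (8 * ?n ^ 3)" using e0 by (intro mult_left_mono) (simp_all only: power_mult_distrib, simp_all)
 then have "81 * e / ?n ^ 3 <= (648 * e) / ?m ^ 3" using p by (simp add: divide_le_eq pos_le_divide_eq mult_ac)
 moreover have "81 * e / ?n ^ 4 <= 81 * e / ?n ^ 3" using e0 by (intro divide_left_mono power_increasing mult_pos_pos zero_less_power one_norm_pos) auto
 moreover have "(648 * e) / ?m ^ 3 <= (1296 * e) / ?m ^ 3" using e0 p by (intro divide_right_mono) auto
 moreover have "abs (G t (unz t (z, c))) <= 81 * e / ?n ^ 4" using G_pdec t unfolding pdec_def by blast
 ultimately show ?thesis by linarith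
qed

lemma mu_c0: "abs (mu (st t (z, c))) <= e / (1 + norm (c - c0 t z)) ^ 3"
proof -
 have "e / (1 + norm (c - c0 t z)) ^ 4 <= e / (1 + norm (c - c0 t z)) ^ 3"
  using e0 by (intro divide_left_mono power_increasing mult_pos_pos zero_less_power one_norm_pos) auto
 then show ?thesis using mudec[of "st t (z, c)"] by (simp add: st_pair)
qed

text \<open>Two discrepancies occur: \<open>Phi\<close> against \<open>st\<close> at the same point,
  and \<open>st\<close> at \<open>unz t (z, c)\<close> against \<open>st\<close> at
  \<open>(z, c)\<close>. Both are O(exp (-t/2)) times 1 + |velocity|, and the weight in
  \<open>wlip\<close> absorbs the velocity.\<close>

lemma G_mu:
 assumes t: "t >= 0"
 shows "abs (G t (unz t (z, c)) - mu (st t (z, c))) <= 9 * e * exp (- (t / 2))"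
proof -
 define p where "p = unz t (z, c)"
 define v where "v = c - c0 t z"
 have "abs (mu (st t p) - mu (Phi t p)) <= e / (1 + norm (snd (st t p))) * norm (st t p - Phi t p)" by (rule wlipD[OF muw])
 also have "... <= e / (1 + norm (vel t p)) * (34 * e * (1 + norm (vel t p)) * exp (- (t / 2)))"
  using Phi_lim(2)[OF t, of p] e0 by (intro mult_mono) (auto simp: st_def norm_minus_commute)
 also have "... = 34 * e * (e * exp (- (t / 2)))" using one_norm_pos[of "vel t p"] by (simp add: field_simps)
 also have "... <= 1 * (e * exp (- (t / 2)))" using e0 e1 by (intro mult_right_mono) auto
 finally have 1: "abs (mu (st t p) - mu (Phi t p)) <= e * exp (- (t / 2))" by simp
 have k: "kap t > 0" by (rule kap_pos)
 have cn: "norm c <= norm v + t * e" using norm_snd_le_vel[OF t, of "(z, c)"] by (simp add: v_def vel_def)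
 have "norm (st t (z, c) - st t p) <= norm (kap t *R c) + norm (v - vel t p)"
  unfolding p_def st_def using norm_Pair_le[of "- (kap t *R c)" "v - vel t p"] by (simp add: unz_def v_def vel_def p_def)
 also have "... <= kap t * (norm v + t * e) + kap t * (t * e) * (norm v + t * e)"
  using vel_c0(1)[OF t, of z c] k cn by (intro add_mono) (auto simp: p_def v_def norm_minus_commute)
 also have "... = kap t * (1 + t * e) * (norm v + t * e)" by (simp add: algebra_simps)
 also have "... <= kap t * (1 + t * e) * ((1 + t * e) * (1 + norm v))"
  using k t e0 by (intro mult_left_mono) (auto simp: algebra_simps)
 also have "... = (kap t * (1 + t * e)^2) * (1 + norm v)" by (simp add: power2_eq_square)
 also have "... <= (8 * exp (- (t / 2))) * (1 + norm v)" using kap_sq_lin[OF t, of e] e0 e1 by (intro mult_right_mono) auto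
 finally have n: "norm (st t (z, c) - st t p) <= (8 * exp (- (t / 2))) * (1 + norm v)" .
 have "abs (mu (st t (z, c)) - mu (st t p)) <= e / (1 + norm v) * norm (st t (z, c) - st t p)" using wlipD[OF muw, of "st t (z, c)" "st t p"] by (simp add: st_pair v_def)
 also have "... <= e / (1 + norm v) * ((8 * exp (- (t / 2))) * (1 + norm v))" using n e0 by (intro mult_left_mono) auto
 also have "... = 8 * (e * exp (- (t / 2)))" using one_norm_pos[of v] by (simp add: field_simps)
 finally show ?thesis using 1 by (simp add: G_def p_def[symmetric] abs_le_iff)
qed

lemma fd_bound:
 assumes t: "t >= 0"
 shows "abs (fd t (z, c)) <= (11673 * e^2 * exp (- (t / 2))) / (1 + norm (c - c0 t z)) ^ 3"
proof -
 have "abs (G t (unz t (z, c))) + abs (mu (st t (z, c))) <= 1297 * e / (1 + norm (c - c0 t z)) ^ 3"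
  using add_mono[OF G_c0[OF t, of z c] mu_c0[of t z c]] by (simp add: add_divide_distrib[symmetric])
 from sq_diff_le[OF G_mu[OF t] this] show ?thesis using e0 by (simp add: fd_def power2_eq_square mult_ac)
qed

lemma fd_lip:
 assumes t: "t >= 0"
 shows "abs (fd t (z, c) - fd t (z', c)) <= 31105 * e^2 * (1 + t * e) * norm (z - z') * (1 / (1 + norm (c - c0 t z)) ^ 3 + 1 / (1 + norm (c - c0 t z')) ^ 3)"
proof -
 define N where "N = 1 / (1 + norm (c - c0 t z)) ^ 3 + 1 / (1 + norm (c - c0 t z')) ^ 3"
 define d where "d = (1 + t * e) * norm (z - z')"
 have d: "d >= 0" using t e0 by (simp add: d_def)
 have s1: "norm (st t (unz t (z, c)) - st t (unz t (z', c))) <= d" "norm (st t (z, c) - st t (z', c)) <= d"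
  using st_diff[OF t, of "unz t (z, c)" "unz t (z', c)"] st_diff[OF t, of "(z, c)" "(z', c)"] by (simp_all add: unz_def d_def algebra_simps)
 have "24 * e * norm (st t (unz t (z, c)) - st t (unz t (z', c))) <= 24 * e * d" using s1 e0 by (intro mult_left_mono) auto
 then have G1: "abs (G t (unz t (z, c)) - G t (unz t (z', c))) <= 24 * e * d"
  using H_st[OF muw t, of "unz t (z, c)" "unz t (z', c)"] unfolding G_def by linarith
 have G2: "abs (G t (unz t (z, c))) + abs (G t (unz t (z', c))) <= 1296 * e * N"
  using add_mono[OF G_c0[OF t, of z c] G_c0[OF t, of z' c]] by (simp add: N_def distrib_left)
 have "e * norm (st t (z, c) - st t (z', c)) <= e * d" using s1 e0 by (intro mult_left_mono) auto
 then have m1: "abs (mu (st t (z, c)) - mu (st t (z', c))) <= e * d" using wlip_lip[OF muw, of "st t (z, c)" "st t (z', c)"] by linarith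
 have m2: "abs (mu (st t (z, c))) + abs (mu (st t (z', c))) <= e * N"
  using add_mono[OF mu_c0[of t z c] mu_c0[of t z' c]] by (simp add: N_def distrib_left)
 define X where "X = e * e * d * N"
 have "abs ((G t (unz t (z, c)))^2 - (G t (unz t (z', c)))^2) <= 31104 * X" using sq_diff_le[OF G1 G2] e0 d by (simp add: X_def mult_ac)
 moreover have "abs ((mu (st t (z, c)))^2 - (mu (st t (z', c)))^2) <= X" using sq_diff_le[OF m1 m2] e0 d by (simp add: X_def mult_ac)
 ultimately have "abs (fd t (z, c) - fd t (z', c)) <= 31105 * X" unfolding fd_def by linarith
 then show ?thesis by (simp add: X_def N_def[symmetric] d_def power2_eq_square mult_ac)
qed

text \<open>r = exp (-t/8) beats the growth 1 + t e of the Lipschitz constant of \<open>fd\<close>,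
  leaving exp (-t/16). With R = exp (t/16) the other errors are exp (-t/2) R^2 / r^2 = exp (-t/8)
  and R^-2 = exp (-t/8).\<close>

lemma N_lip:
 assumes t: "t >= 0"
 shows "norm ((Nf G t y - E y) - (Nf G t y' - E y')) <= 35000000 * e^2 * exp (- (t / 16)) * norm (y - y')"
proof -
 define r where "r = exp (- (t / 8))"
 define R where "R = exp (t / 16)"
 have r: "r > 0" "R > 0" by (auto simp: r_def R_def)
 have f: "(LBINT q. fd t q *R Kn (x - fst q)) = (LBINT p. (G t p)^2 *R Kn (x - zc t p)) - (LBINT p. (mu p)^2 *R Kn (x - fst p))" for x
 proof -
  note [measurable] = ws.gm[OF t]
  have a: "(LBINT p. (G t p)^2 *R Kn (x - zc t p)) = (LBINT q. (G t (unz t q))^2 *R Kn (x - fst q))"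
   "integrable lborel (%q. (G t (unz t q))^2 *R Kn (x - fst q))"
   using lborel_pres_integral[OF unz_pres, of "%p. (G t p)^2 *R Kn (x - zc t p)" t] lborel_pres_integrable[OF unz_pres, of "%p. (G t p)^2 *R Kn (x - zc t p)" t] ws.N_int[OF t] by simp_all
  have sq: "abs ((mu (st t (z, c)))^2) <= (e * e) / (1 + norm (c - c0 t z)) ^ 3" for z c
   using sq_diff_le[of "mu (st t (z, c))" 0 e "e / (1 + norm (c - c0 t z)) ^ 3"] mu_c0[of t z c] e0
    divide_left_mono[of 1 "(1 + norm (c - c0 t z)) ^ 3" e] one_norm_pos[of "c - c0 t z"] by (simp add: one_le_power)
  have b: "integrable lborel (%q. (mu (st t q))^2 *R Kn (x - fst q))"
   by (rule Kn_density(1)[OF must_int(1) sq]) simp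
  have c: "(LBINT p. (mu p)^2 *R Kn (x - fst p)) = (LBINT q. (mu (st t q))^2 *R Kn (x - fst q))"
   using lborel_pres_integral[OF asy_pres, of "%q. (mu (st t q))^2 *R Kn (x - fst q)" t] by simp
  show ?thesis unfolding a(1) c fd_def scaleR_diff_left by (rule Bochner_Integration.integral_diff[OF a(2) b])
 qed
 define B where "B = 11673 * e^2 * exp (- (t / 2))"
 define L where "L = 31105 * e^2 * (1 + t * e)"
 have "norm ((LBINT q. fd t q *R Kn (y - fst q)) - (LBINT q. fd t q *R Kn (y' - fst q)))
  <= norm (y - y') * (1024 * r * L + 2 * (128 * B * R^2 / r^2 + 18 * e^2 / R^2))"
  by (rule field_lip[OF fd_int[OF t] fd_bound[OF t, folded B_def] _ fd_lip[OF t, folded L_def] _ fd_mass[OF t] r])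
   (use t e0 E_cont in "auto simp: B_def L_def intro!: continuous_intros")
 also have "... <= norm (y - y') * (35000000 * e^2 * exp (- (t / 16)))"
 proof (rule mult_left_mono)
  define x where "x = exp (- (t / 16))"
  have x: "0 < x" "x <= 1" using t by (auto simp: x_def)
  have pw: "r = x^2" "exp (- (t / 2)) = x ^ 8" "R = 1 / x" unfolding r_def x_def R_def
   by (simp_all add: exp_of_nat_mult[symmetric] exp_minus field_simps)
  have x2: "x^2 <= x" using x by (simp add: power2_eq_square mult_left_le)
  have l: "r * (1 + t * e) <= x"
  proof -
   have "t * e <= t * (1 / 16)" using t e1 by (intro mult_left_mono) auto
   then have "1 + t * e <= exp (t / 16)" using exp_ge_add_one_self[of "t / 16"] by linarith
   then have "r * (1 + t * e) <= r * exp (t / 16)" using r by (intro mult_left_mono) auto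
   also have "... = x" by (simp add: r_def x_def exp_add[symmetric])
   finally show ?thesis .
  qed
  have "1024 * r * L = 31851520 * e^2 * (r * (1 + t * e))" by (simp add: L_def)
  also have "... <= 31851520 * e^2 * x" using l by (intro mult_left_mono) auto
  finally have a: "1024 * r * L <= 31851520 * e^2 * x" .
  have "128 * B * R^2 / r^2 = 1494144 * e^2 * x^2" unfolding B_def pw using x by (simp add: power_divide field_simps power_numeral_reduce)
  also have "... <= 1494144 * e^2 * x" using x2 by (intro mult_left_mono) auto
  finally have b: "128 * B * R^2 / r^2 <= 1494144 * e^2 * x" .
  have "18 * e^2 / R^2 = 18 * e^2 * x^2" unfolding pw using x by (simp add: power_divide)
  also have "... <= 18 * e^2 * x" using x2 by (intro mult_left_mono) auto
  finally have c: "18 * e^2 / R^2 <= 18 * e^2 * x" .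
  have "p + 2 * (q + s) <= 35000000 * X" if "p <= 31851520 * X" "q <= 1494144 * X" "s <= 18 * X" "0 <= X" for p q s X :: real
   using that by (simp add: distrib_left)
  from this[of "1024 * r * L" "e^2 * x" "128 * B * R^2 / r^2" "18 * e^2 / R^2", folded mult.assoc] show "1024 * r * L + 2 * (128 * B * R^2 / r^2 + 18 * e^2 / R^2) <= 35000000 * e^2 * exp (- (t / 16))"
   using a b c x unfolding x_def[symmetric] by (simp only: zero_le_mult_iff) simp
 qed simp
 finally have *: "norm ((LBINT q. fd t q *R Kn (y - fst q)) - (LBINT q. fd t q *R Kn (y' - fst q))) <= norm (y - y') * (35000000 * e^2 * exp (- (t / 16)))" .
 have "(Nf G t y - E y) - (Nf G t y' - E y') = (1 / (2 * pi)) *R ((LBINT q. fd t q *R Kn (y - fst q)) - (LBINT q. fd t q *R Kn (y' - fst q)))"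
  unfolding f by (simp add: Nf_def Eq[of y] Eq[of y'] scaleR_diff_right)
 then have "norm ((Nf G t y - E y) - (Nf G t y' - E y')) <= norm ((LBINT q. fd t q *R Kn (y - fst q)) - (LBINT q. fd t q *R Kn (y' - fst q)))"
  using pi_le by (simp only:)
 with * show ?thesis by (simp add: mult_ac)
qed

lemma N_close: "t >= 0 ==> norm (lam *R Nf G t y - lam *R E y) <= e * exp (- (t / 2))"
proof -
 assume t: "t >= 0"
 have "norm (lam *R Nf G t y - lam *R E y) = norm (Nf G t y - E y)" using norm_lamE[of "Nf G t y - E y"] by (simp add: scaleR_diff_right)
 also have "... <= (4608 * (81 * e)^2 + 4 * (9 * e^2) + 9 * e^2 * (2 * e)) * exp (- (t / 2))" by (rule ws.N_asymptotic[OF t])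
 also have "... <= e * exp (- (t / 2))"
 proof (rule mult_right_mono)
  \<comment> \<open>The numerical factor is about 3.02 * 10^7, well below 10^9; this is what lets
    the quadratic quantity on the left fall below \<open>e\<close>.\<close>
  have "(4608 * 6561 + 36 + 18 * e) * e <= (30300000) * (1 / 10 ^ 9)" using e0 e1 by (intro mult_mono) auto
  then have "((4608 * 6561 + 36 + 18 * e) * e) * e <= 1 * e" using e0 by (intro mult_right_mono) auto
  then show "4608 * (81 * e)^2 + 4 * (9 * e^2) + 9 * e^2 * (2 * e) <= e" by (simp add: power2_eq_square algebra_simps)
 qed simp
 finally show ?thesis .
qed

lemma N_close_lip: "t >= 0 ==> norm ((lam *R Nf G t y - lam *R E y) - (lam *R Nf G t y' - lam *R E y')) <= e * exp (- (t / 16)) * norm (y - y')"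
proof -
 assume t: "t >= 0"
 have "norm ((lam *R Nf G t y - lam *R E y) - (lam *R Nf G t y' - lam *R E y')) = norm ((Nf G t y - E y) - (Nf G t y' - E y'))"
  using norm_lamE[of "(Nf G t y - E y) - (Nf G t y' - E y')"] by (simp add: scaleR_diff_right)
 also have "... <= 35000000 * e^2 * exp (- (t / 16)) * norm (y - y')" by (rule N_lip[OF t])
 also have "... <= e * exp (- (t / 16)) * norm (y - y')"
 proof (intro mult_right_mono)
  have "(35000000 * e) * e <= 1 * e" using e0 e1 by (intro mult_right_mono) auto
  then show "35000000 * e^2 <= e" by (simp add: power2_eq_square)
 qed auto
 finally show ?thesis .
qed

end

section \<open>Existence and uniqueness for the profile\<close>

lemma eval_cont: "continuous_on UNIV (%u :: 'a::topological_space \<Rightarrow>\<^sub>C 'b::metric_space. apply_bcontfun u x)"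
 by (rule lipschitz_on_continuous_on[of 1], rule lipschitz_onI) (simp_all add: dist_bounded)

locale datum = asym +
 fixes mu :: "phase => real"
 assumes na: "nice_axioms E e mu"
begin

abbreviation GF :: "(real => plane => plane) => real => phase => real" where "GF F \<equiv> nice.G lam E F mu"

text \<open>A field is encoded by the bounded continuous function u = exp (t/2) (F - lam E), which
  builds the decay rate into the supremum norm; \<open>max 0 t\<close> keeps the weight equal to 1
  at negative times.\<close>

definition Fu :: "((real \<times> plane) \<Rightarrow>\<^sub>C plane) => real => plane => plane" where
 "Fu u t y = lam *R E y + exp (- (max 0 t / 2)) *R apply_bcontfun u (t, y)"

text \<open>7/16 = 1/2 - 1/16: the Lipschitz bound of the field decays like exp (-t/16) and is
  multiplied by the weight exp (t/2). The conditions are preserved by uniform convergence, so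
  contraction in the supremum norm suffices.\<close>

definition X :: "((real \<times> plane) \<Rightarrow>\<^sub>C plane) set" where
 "X = {u. (ALL x. norm (apply_bcontfun u x) <= e) &
  (ALL t y y'. norm (apply_bcontfun u (t, y) - apply_bcontfun u (t, y')) <= e * exp (7 / 16 * max 0 t) * norm (y - y'))}"

lemma X_closed: "closed X"
 unfolding X_def by (intro closed_Collect_conj closed_Collect_all closed_Collect_le continuous_intros eval_cont)

lemma Fu_nice: assumes u: "u : X" shows "nice lam E e (Fu u) mu"
proof (intro nice.intro flow.intro flow_axioms.intro na)
 show "asym lam E e" by unfold_locales
 show "continuous_on UNIV (%(t, y). Fu u t y)"
  unfolding Fu_def split_def by (intro continuous_intros continuous_on_compose2[OF E_cont[of UNIV]]) auto
 fix t :: real and y y' assume t: "t >= 0"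
 have ub: "norm (apply_bcontfun u (t, y)) <= e" "norm (apply_bcontfun u (t, y) - apply_bcontfun u (t, y')) <= e * exp (7 / 16 * t) * norm (y - y')"
  using u t by (auto simp: X_def) (metis max_absorb2)+
 show "norm (Fu u t y - lam *R E y) <= e * exp (- (t / 2))" using ub(1) t by (simp add: Fu_def mult.commute)
 have "norm (Fu u t y - lam *R E y - (Fu u t y' - lam *R E y')) = exp (- (t / 2)) * norm (apply_bcontfun u (t, y) - apply_bcontfun u (t, y'))"
  using t by (simp add: Fu_def scaleR_diff_right[symmetric])
 also have "... <= exp (- (t / 2)) * (e * exp (7 / 16 * t) * norm (y - y'))" using ub(2) by (intro mult_left_mono) auto
 also have "... = e * (exp (- (t / 2)) * exp (7 / 16 * t)) * norm (y - y')" by simp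
 also have "exp (- (t / 2)) * exp (7 / 16 * t) = exp (- (t / 16))" by (simp add: exp_add[symmetric])
 finally show "norm (Fu u t y - lam *R E y - (Fu u t y' - lam *R E y')) <= e * exp (- (t / 16)) * norm (y - y')" .
qed

definition Tu :: "((real \<times> plane) \<Rightarrow>\<^sub>C plane) => ((real \<times> plane) \<Rightarrow>\<^sub>C plane)" where
 "Tu u = Bcontfun (%(t, y). exp (max 0 t / 2) *R (lam *R Nf (GF (Fu u)) (max 0 t) y - lam *R E y))"

lemma Tu_apply:
 assumes u: "u : X"
 shows "apply_bcontfun (Tu u) (t, y) = exp (max 0 t / 2) *R (lam *R Nf (GF (Fu u)) (max 0 t) y - lam *R E y)"
  and "Tu u : X"
proof -
 interpret n: nice lam E e "Fu u" mu by (rule Fu_nice[OF u])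
 have b: "norm (exp (max 0 t / 2) *R (lam *R Nf n.G (max 0 t) y - lam *R E y)) <= e" for t y
 proof -
  have "exp (max 0 t / 2) * norm (lam *R Nf n.G (max 0 t) y - lam *R E y) <= exp (max 0 t / 2) * (e * exp (- (max 0 t / 2)))"
   by (intro mult_left_mono n.N_close) auto
  also have "... = e * (exp (max 0 t / 2) * exp (- (max 0 t / 2)))" by simp
  also have "exp (max 0 t / 2) * exp (- (max 0 t / 2)) = 1" by (simp add: exp_add[symmetric])
  finally show ?thesis by simp
 qed
 have nc: "continuous_on UNIV (%x :: real \<times> plane. Nf n.G (max 0 (fst x)) (snd x))"
 proof -
  have "continuous_on UNIV (%x :: real \<times> plane. (max 0 (fst x), snd x))" by (intro continuous_intros)
  moreover have "range (%x :: real \<times> plane. (max 0 (fst x), snd x)) <= {0..} \<times> UNIV" by auto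
  ultimately show ?thesis using continuous_on_compose2[OF n.ws.N_continuous] by force
 qed
 have "(%(t, y). exp (max 0 t / 2) *R (lam *R Nf n.G (max 0 t) y - lam *R E y)) : bcontfun"
 proof (rule bcontfun_normI)
  show "continuous_on UNIV (%(t, y). exp (max 0 t / 2) *R (lam *R Nf n.G (max 0 t) y - lam *R E y))"
   unfolding split_def by (intro continuous_intros nc continuous_on_compose2[OF E_cont[of UNIV]]) auto
  show "norm (case x of (t, y) => exp (max 0 t / 2) *R (lam *R Nf n.G (max 0 t) y - lam *R E y)) <= e" for x
   using b by (cases x) (simp only: prod.case)
 qed
 then have ap: "apply_bcontfun (Tu u) (t, y) = exp (max 0 t / 2) *R (lam *R Nf n.G (max 0 t) y - lam *R E y)" for t y
  by (simp add: Tu_def Bcontfun_inverse)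
 then show "apply_bcontfun (Tu u) (t, y) = exp (max 0 t / 2) *R (lam *R Nf (GF (Fu u)) (max 0 t) y - lam *R E y)" .
 have l: "norm (apply_bcontfun (Tu u) (t, y) - apply_bcontfun (Tu u) (t, y')) <= e * exp (7 / 16 * max 0 t) * norm (y - y')" for t y y'
 proof -
  define s where "s = max 0 t"
  have s: "s >= 0" by (simp add: s_def)
  have "norm (apply_bcontfun (Tu u) (t, y) - apply_bcontfun (Tu u) (t, y')) = exp (s / 2) * norm ((lam *R Nf n.G s y - lam *R E y) - (lam *R Nf n.G s y' - lam *R E y'))"
   by (simp add: ap s_def scaleR_diff_right[symmetric] abs_mult)
  also have "... <= exp (s / 2) * (e * exp (- (s / 16)) * norm (y - y'))" by (intro mult_left_mono n.N_close_lip s) auto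
  also have "... = e * (exp (s / 2) * exp (- (s / 16))) * norm (y - y')" by simp
  also have "exp (s / 2) * exp (- (s / 16)) = exp (7 / 16 * s)" by (simp add: exp_add[symmetric])
  finally show ?thesis by (simp add: s_def)
 qed
 show "Tu u : X" using b l unfolding X_def by (auto simp: ap)
qed

text \<open>With nu = 1/2 and D the distance, \<open>N_diff\<close> returns the decay exp (-t), of
  which the weight consumes half. Its constant is quadratic in \<open>e\<close>, hence below
  1/2.\<close>

lemma Tu_contraction:
 assumes u: "u : X" "v : X"
 shows "dist (Tu u) (Tu v) <= 1 / 2 * dist u v"
proof (rule dist_bound)
 fix x :: "real \<times> plane"
 obtain t y where x: "x = (t, y)" by (cases x)
 define s where "s = max 0 t"
 have s: "s >= 0" by (simp add: s_def)
 interpret n1: nice lam E e "Fu u" mu by (rule Fu_nice[OF u(1)])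
 interpret n2: nice lam E e "Fu v" mu by (rule Fu_nice[OF u(2)])
 define D where "D = dist u v"
 have D: "D >= 0" by (simp add: D_def)
 interpret t: two_sols lam E e "Fu u" mu "Fu v" n2.G "2 * e" "81 * e" "9 * e^2" D "1 / 2"
 proof (intro two_sols.intro two_sols_axioms.intro n1.nice_axioms n2.ws.wsol_axioms D)
  fix t :: real and y assume t: "t >= 0"
  have "norm (Fu u t y - Fu v t y) = exp (- (t / 2)) * dist (apply_bcontfun u (t, y)) (apply_bcontfun v (t, y))"
   using t by (simp add: Fu_def scaleR_diff_right[symmetric] dist_norm)
  also have "... <= exp (- (t / 2)) * D" unfolding D_def by (intro mult_left_mono dist_bounded) auto
  finally show "norm (Fu u t y - Fu v t y) <= D * exp (- (1 / 2 * t))" by (simp add: mult.commute)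
 qed simp
 have "dist (apply_bcontfun (Tu u) x) (apply_bcontfun (Tu v) x) = exp (s / 2) * norm (lam *R (Nf n1.G s y - Nf n2.G s y))"
  by (simp add: x Tu_apply[OF u(1)] Tu_apply[OF u(2)] s_def dist_norm scaleR_diff_right[symmetric] abs_mult)
 also have "... = exp (s / 2) * norm (Nf n1.G s y - Nf n2.G s y)" unfolding n1.norm_lamE ..
 also have "... <= exp (s / 2) * ((294912 * e * (81 * e + 81 * e) + 72 * (9 * e^2)) * (D / (1 / 2)) * exp (- ((1 / 2 + 1 / 2) * s)))"
  by (intro mult_left_mono t.N_diff s) auto
 also have "... = ((294912 * 162 + 648) * 2 * e * e * D) * (exp (s / 2) * exp (- s))" by (simp add: power2_eq_square algebra_simps)
 also have "exp (s / 2) * exp (- s) = exp (- (s / 2))" by (simp add: exp_add[symmetric])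
 also have "((294912 * 162 + 648) * 2 * e * e * D) * exp (- (s / 2)) <= ((294912 * 162 + 648) * 2 * (1 / 10 ^ 9) * 1 * D) * 1"
  using e0 e1 D s by (intro mult_mono mult_nonneg_nonneg) auto
 also have "... <= 1 / 2 * D" using D by simp
 finally show "dist (apply_bcontfun (Tu u) x) (apply_bcontfun (Tu v) x) <= 1 / 2 * dist u v" by (simp add: D_def)
qed

lemma selfconsistent_field: "EX F. nice lam E e F mu & (ALL t>=0. ALL y. F t y = lam *R Nf (GF F) t y)"
proof -
 have "0 : X" using e0 by (auto simp: X_def)
 have "EX! u. u : X & Tu u = u"
  by (rule Banach_fix[where c="1/2"]) (use X_closed \<open>0 : X\<close> Tu_apply(2) Tu_contraction in \<open>auto simp: complete_eq_closed\<close>)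
 then obtain u where u: "u : X" "Tu u = u" by blast
 show ?thesis
 proof (intro exI[of _ "Fu u"] conjI allI impI Fu_nice u)
  fix t :: real and y assume t: "t >= 0"
  have "apply_bcontfun u (t, y) = exp (t / 2) *R (lam *R Nf (GF (Fu u)) t y - lam *R E y)"
   using Tu_apply(1)[OF u(1), of t y] t by (simp add: u(2))
  then show "Fu u t y = lam *R Nf (GF (Fu u)) t y" using t by (simp add: Fu_def exp_minus)
 qed
qed

text \<open>\<open>A2\<close> and \<open>m2\<close> may be large, so comparing fields need not
  contract. Instead every pass of \<open>N_diff\<close> raises the decay rate nu by 1/2 and divides
  by the old nu. Starting from the common limit \<open>lam *R E\<close>, k passes leave (2 C)^k / k!
  times the initial constant, which tends to 0 as k grows.\<close>

lemma unique_solution: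
 assumes n: "nice lam E e F mu" and F: "!!t y. t >= 0 ==> F t y = lam *R Nf (GF F) t y"
  and w: "wsol lam E e F2 g2 M2 A2 m2 mu" and F2: "!!t y. t >= 0 ==> F2 t y = lam *R Nf g2 t y"
  and t: "t >= 0"
 shows "g2 t p = GF F t p"
proof -
 interpret n: nice lam E e F mu by (rule n)
 interpret w: wsol lam E e F2 g2 M2 A2 m2 mu by (rule w)
 define C where "C = 294912 * e * (81 * e + A2) + 72 * m2"
 have C: "C >= 0" using e0 w.dec w.m by (simp add: C_def pdec_def)
 define K where "K = 4608 * A2^2 + 4 * m2 + m2 * M2"
 have K: "K >= 0" using w.m w.M0 by (simp add: K_def)
 define Dn where "Dn = (%n. (e + K) * ((2 * C) ^ n / fact n))"
 have Dn: "Dn n >= 0" for n using C K e0 by (simp add: Dn_def)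
 have two: "two_sols lam E e F mu F2 g2 M2 A2 m2 D nu" if "D >= 0" "nu > 0" "!!t y. t >= 0 ==> norm (F t y - F2 t y) <= D * exp (- (nu * t))" for D nu
  by (intro two_sols.intro two_sols_axioms.intro n w that)
 have it: "norm (F t y - F2 t y) <= Dn k * exp (- (real (Suc k) / 2 * t))" if "t >= 0" for k t y
  using that
 proof (induction k arbitrary: t y)
  case 0
  have "norm (F2 t y - lam *R E y) <= K * exp (- (t / 2))"
   using w.N_asymptotic[OF 0, of y] n.norm_lamE[of "Nf g2 t y - E y"] F2[OF 0] by (simp add: K_def scaleR_diff_right)
  moreover have "norm (F t y - lam *R E y) <= e * exp (- (t / 2))" by (rule n.Fclose[OF 0])
  moreover have "norm (F t y - F2 t y) <= norm (F t y - lam *R E y) + norm (F2 t y - lam *R E y)"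
   using norm_triangle_ineq4[of "F t y - lam *R E y" "F2 t y - lam *R E y"] by simp
  ultimately show ?case by (simp add: Dn_def distrib_right)
 next
  case (Suc k)
  interpret t: two_sols lam E e F mu F2 g2 M2 A2 m2 "Dn k" "real (Suc k) / 2"
   by (rule two[OF Dn]) (use Suc.IH in auto)
  have "norm (F t y - F2 t y) = norm (Nf n.G t y - Nf g2 t y)"
   using n.norm_lamE[of "Nf n.G t y - Nf g2 t y"] F[OF Suc.prems] F2[OF Suc.prems] by (simp add: scaleR_diff_right)
  also have "... <= C * (Dn k / (real (Suc k) / 2)) * exp (- ((real (Suc k) / 2 + 1 / 2) * t))" unfolding C_def by (rule t.N_diff[OF Suc.prems])
  also have "C * (Dn k / (real (Suc k) / 2)) = Dn (Suc k)" by (simp add: Dn_def field_simps)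
  also have "real (Suc k) / 2 + 1 / 2 = real (Suc (Suc k)) / 2" by simp
  finally show ?case .
 qed
 have lim: "Dn ---> 0"
  using summable_LIMSEQ_zero[OF summable_exp[of "2 * C"]] unfolding Dn_def by (intro tendsto_mult_right_zero) (simp add: divide_inverse mult.commute)
 have FF: "norm (F t y - F2 t y) <= 0 * exp (- (1 * t))" if t: "t >= 0" for t y
 proof -
  have "norm (F t y - F2 t y) <= Dn k" for k
  proof -
   have "Dn k * exp (- (real (Suc k) / 2 * t)) <= Dn k * 1" using t Dn by (intro mult_left_mono) auto
   then show ?thesis using it[OF t, of y k] by linarith
  qed
  then have "norm (F t y - F2 t y) <= 0" by (intro LIMSEQ_le_const[OF lim]) auto
  then show ?thesis by simp
 qed
 interpret t: two_sols lam E e F mu F2 g2 M2 A2 m2 0 1 by (rule two) (use FF in auto)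
 show ?thesis using t.g_diff[OF t, of p] by simp
qed

end

section \<open>Bump functions and mollification\<close>

text \<open>exp (-1/t) over powers of t. The derivative of a member is a linear combination of
  members, so smoothness across 0 is obtained for all orders at once.\<close>

definition fl :: "nat => real => real" where "fl n t = (if t > 0 then exp (- (1 / t)) / t ^ n else 0)"

lemma fl_nonneg: "0 <= fl n t" by (simp add: fl_def)

text \<open>From x/m <= exp (x/m) with x = 1/t and m = n + k one gets x^m <= m^m exp x. The spare
  power t^k, at k = 2, yields differentiability at 0.\<close>

lemma fl_le: "t >= 0 ==> fl n t <= real (n + k) ^ (n + k) * t ^ k"
proof (cases "t > 0")
 case True
 define m where "m = n + k"
 have "(1 / t) ^ m <= real m ^ m * exp (1 / t)"
 proof (cases "m = 0")
  case False
  have "(1 / t / m) ^ m <= exp (1 / t / m) ^ m" using True exp_ge_add_one_self[of "1 / t / m"] by (intro power_mono) (linarith, simp)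
  also have "... = exp (1 / t)" using False by (simp add: exp_of_nat_mult[symmetric])
  finally have "real m ^ m * (1 / t / m) ^ m <= real m ^ m * exp (1 / t)" by (intro mult_left_mono) auto
  then show ?thesis using False by (simp flip: power_mult_distrib)
 qed (use True in simp)
 then have "exp (- (1 / t)) * (1 / t) ^ m <= exp (- (1 / t)) * (real m ^ m * exp (1 / t))" by (intro mult_left_mono) auto
 also have "... = real m ^ m * (exp (- (1 / t)) * exp (1 / t))" by simp
 also have "exp (- (1 / t)) * exp (1 / t) = 1" by (simp add: exp_add[symmetric])
 finally show ?thesis using True by (simp add: fl_def power_divide power_add field_simps m_def)
qed (simp add: fl_def)

lemma fl_deriv: "(fl n has_real_derivative (fl (n + 2) t - n * fl (n + 1) t)) (at t)"
proof -
 consider "t > 0" | "t < 0" | "t = 0" by linarith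
 then show ?thesis
 proof cases
  case 1
  have "((%t. exp (- (1 / t)) / t ^ n) has_real_derivative (fl (n + 2) t - n * fl (n + 1) t)) (at t)"
   using 1 by (auto intro!: derivative_eq_intros simp: fl_def field_simps power2_eq_square) (cases n; simp add: field_simps)
  then show ?thesis
   by (rule DERIV_cong_ev[THEN iffD1, rotated -1]) (use 1 in \<open>auto intro: eventually_mono[OF eventually_gt_at_top] simp: fl_def eventually_nhds intro!: exI[of _ "{0<..}"]\<close>)
 next
  case 2
  have "((%t. 0) has_real_derivative (fl (n + 2) t - n * fl (n + 1) t)) (at t)" using 2 by (simp add: fl_def)
  then show ?thesis
   by (rule DERIV_cong_ev[THEN iffD1, rotated -1]) (use 2 in \<open>auto simp: fl_def eventually_nhds intro!: exI[of _ "{..<0}"]\<close>)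
 next
  case 3
  have b: "abs (fl n h) <= real (n + 2) ^ (n + 2) * h^2" for h
   using fl_le[of h n 2] fl_nonneg[of n h] by (cases "h >= 0") (auto simp: fl_def)
  have "(%h. (fl n (0 + h) - fl n 0) / h) \<midarrow>0\<rightarrow> 0"
  proof (rule Lim_null_comparison)
   show "((%h. real (n + 2) ^ (n + 2) * abs h) \<longlongrightarrow> 0) (at 0)" by (intro tendsto_mult_right_zero) (auto intro!: tendsto_eq_intros)
   show "\<forall>\<^sub>F h in at 0. norm ((fl n (0 + h) - fl n 0) / h) <= real (n + 2) ^ (n + 2) * abs h"
   proof (rule eventually_at_filter[THEN iffD2], rule always_eventually, intro allI impI)
    fix h :: real assume "h ~= 0"
    then show "norm ((fl n (0 + h) - fl n 0) / h) <= real (n + 2) ^ (n + 2) * abs h"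
     using b[of h] by (simp add: fl_def[of n 0] divide_le_eq power2_eq_square abs_mult[symmetric] mult.assoc)
   qed
  qed
  then show ?thesis using 3 by (simp add: DERIV_def fl_def)
 qed
qed

text \<open>A class that contains the bump and is closed under directional derivatives, so that
  \<open>cont_diff\<close> of every order follows by induction.\<close>

inductive_set bump_class :: "real => 'a::euclidean_space => ('a => real) set" for dl z where
 base: "(%x. fl n (dl^2 - (x - z) \<bullet> (x - z))) : bump_class dl z"
| scale: "f : bump_class dl z ==> (%x. c * f x) : bump_class dl z"
| coord: "f : bump_class dl z ==> (%x. ((x - z) \<bullet> b) * f x) : bump_class dl z"
| add: "f : bump_class dl z ==> g : bump_class dl z ==> (%x. f x + g x) : bump_class dl z"

lemma base_deriv:
 "((%x. fl n (dl^2 - (x - z) \<bullet> (x - z))) has_derivative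
  (%h. (-2) * (((x - z) \<bullet> h) * (fl (n + 2) (dl^2 - (x - z) \<bullet> (x - z)) + (- real n) * fl (n + 1) (dl^2 - (x - z) \<bullet> (x - z)))))) (at x)"
proof -
 have "((%x. dl^2 - (x - z) \<bullet> (x - z)) has_derivative (%h. - 2 * ((x - z) \<bullet> h))) (at x)"
  by (auto intro!: derivative_eq_intros simp: inner_commute)
 from has_derivative_compose[OF this fl_deriv[of n "dl^2 - (x - z) \<bullet> (x - z)", unfolded has_field_derivative_def]]
 show ?thesis by (simp add: algebra_simps)
qed

lemma bump_deriv:
 assumes "f : bump_class dl z"
 shows "EX D. (ALL x. (f has_derivative D x) (at x)) & (ALL b. (%x. D x b) : bump_class dl z)"
 using assms
proof induction
 case (base n)
 show ?case
  by (intro exI[of _ "%x h. (-2) * (((x - z) \<bullet> h) * (fl (n + 2) (dl^2 - (x - z) \<bullet> (x - z)) + (- real n) * fl (n + 1) (dl^2 - (x - z) \<bullet> (x - z))))"] conjI allI base_deriv bump_class.intros)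
next
 case (scale f c)
 then obtain D where D: "!!x. (f has_derivative D x) (at x)" "!!b. (%x. D x b) : bump_class dl z" by blast
 show ?case by (intro exI[of _ "%x h. c * D x h"] conjI allI bump_class.scale D has_derivative_mult_right)
next
 case (coord f b)
 then obtain D where D: "!!x. (f has_derivative D x) (at x)" "!!b. (%x. D x b) : bump_class dl z" by blast
 show ?case
 proof (intro exI[of _ "%x h. ((x - z) \<bullet> b) * D x h + (h \<bullet> b) * f x"] conjI allI bump_class.intros D coord.hyps)
  fix x
  have "((%x. (x - z) \<bullet> b) has_derivative (%h. h \<bullet> b)) (at x)" by (auto intro!: derivative_eq_intros)
  from has_derivative_mult[OF this D(1)] show "((%x. (x - z) \<bullet> b * f x) has_derivative (%h. (x - z) \<bullet> b * D x h + h \<bullet> b * f x)) (at x)" .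
 qed
next
 case (add f g)
 then obtain D D' where D: "!!x. (f has_derivative D x) (at x)" "!!b. (%x. D x b) : bump_class dl z"
  "!!x. (g has_derivative D' x) (at x)" "!!b. (%x. D' x b) : bump_class dl z" by blast
 show ?case by (intro exI[of _ "%x h. D x h + D' x h"] conjI allI bump_class.add D has_derivative_add)
qed

lemma bump_cont_diff: "f : bump_class dl z ==> cont_diff k f"
proof (induction k arbitrary: f)
 case 0
 then obtain D where "!!x. (f has_derivative D x) (at x)" using bump_deriv by blast
 then show ?case by (auto intro!: continuous_at_imp_continuous_on has_derivative_continuous)
next
 case (Suc k)
 then obtain D where D: "!!x. (f has_derivative D x) (at x)" "!!b. (%x. D x b) : bump_class dl z" using bump_deriv by blast
 have "frechet_derivative f (at x) = D x" for x using frechet_derivative_at[OF D(1)] by simp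
 moreover have "f differentiable_on UNIV" using D(1) by (auto simp: differentiable_on_def differentiable_def)
 ultimately show ?case using Suc.IH[OF D(2)] by simp
qed

definition bump :: "real => 'a::euclidean_space => real" where "bump dl x = fl 0 (dl^2 - x \<bullet> x)"
definition dbump :: "real => 'a => 'a::euclidean_space => real" where "dbump dl b x = (-2) * ((x \<bullet> b) * fl 2 (dl^2 - x \<bullet> x))"

lemma bump_deriv': "((%x. bump dl (x - z)) has_derivative (%h. dbump dl h (x - z))) (at x)"
 using base_deriv[of 0 dl z x] by (simp add: bump_def dbump_def numeral_2_eq_2)

lemma bump_supp: "dl > 0 ==> bump dl x ~= 0 ==> norm x < dl"
proof -
 assume d: "dl > 0" and "bump dl x ~= 0"
 then have "(norm x)^2 < dl^2" by (auto simp: bump_def fl_def dot_square_norm split: if_splits)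
 then show ?thesis using d power2_less_imp_less by fastforce
qed

lemma bump_test: "dl > 0 ==> test_function (%x. bump dl (x - z))"
 unfolding test_function_def
proof (intro conjI allI)
 assume d: "dl > 0"
 show "cont_diff k (%x. bump dl (x - z))" for k unfolding bump_def by (rule bump_cont_diff[OF bump_class.base])
 have "{x. bump dl (x - z) ~= 0} <= cball z dl" using less_imp_le[OF bump_supp[OF d]] by (auto simp: dist_norm norm_minus_commute)
 then show "compact (closure {x. bump dl (x - z) ~= 0})"
  by (simp add: compact_closure bounded_subset[OF bounded_cball])
qed

lemma bump_nonneg: "0 <= bump dl x" by (simp add: bump_def fl_nonneg)

lemma fl_le_one: "0 < dl ==> abs (fl n (dl^2 - x \<bullet> x)) <= real n ^ n"
 using fl_le[of "dl^2 - x \<bullet> x" n 0] fl_nonneg[of n "dl^2 - x \<bullet> x"] by (cases "dl^2 - x \<bullet> x >= 0") (auto simp: fl_def)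

text \<open>The second derivative is bounded through fl n <= n^n for n = 2, 3, 4: 8 = 2 * 4 and 1240
  = 4 * (256 + 2 * 27), the square of the width bounding the squared coordinate.\<close>

lemma dbump_lip:
 fixes b :: "'a::euclidean_space"
 assumes b: "norm b = 1" and d: "dl > 0"
 shows "abs (dbump dl b (w + h *R b) - dbump dl b w) <= (8 + 1240 * dl^2) * abs h"
proof -
 define q where "q = (%x::'a. dl^2 - x \<bullet> x)"
 have qx: "dl^2 - x \<bullet> x = q x" for x by (simp add: q_def)
 define D where "D = (%x. (-2) * (fl 2 (q x) + (x \<bullet> b) * ((-2) * ((x \<bullet> b) * (fl 4 (q x) + (- 2) * fl 3 (q x))))))"
 have der: "((%h. dbump dl b (w + h *R b)) has_real_derivative D (w + h *R b)) (at h)" for h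
 proof -
  have l: "((%h. w + h *R b) has_derivative (%h. h *R b)) (at h)" by (auto intro!: derivative_eq_intros)
  have 1: "((%x. fl 2 (q x)) has_derivative (%k. (-2) * ((x \<bullet> k) * (fl 4 (q x) + (- 2) * fl 3 (q x))))) (at x)" for x
   using base_deriv[of 2 dl 0 x] by (simp add: q_def)
  have "(dbump dl b has_derivative (%k. (-2) * ((x \<bullet> b) * ((-2) * ((x \<bullet> k) * (fl 4 (q x) + (- 2) * fl 3 (q x)))) + (k \<bullet> b) * fl 2 (q x)))) (at x)" for x
   unfolding dbump_def[abs_def] qx
   by (intro has_derivative_mult_right has_derivative_mult[OF _ 1]) (auto intro!: derivative_eq_intros)
  from has_derivative_compose[OF l this] show ?thesis
   by (rule has_derivative_imp_has_field_derivative) (use b in "simp add: D_def norm_eq_1 algebra_simps")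
 qed
 have bd: "norm (D x) <= 8 + 1240 * dl^2" for x
 proof (cases "q x > 0")
  case True
  then have "x \<bullet> x <= dl^2" by (simp add: q_def)
  moreover have "(x \<bullet> b)^2 <= (x \<bullet> x) * (b \<bullet> b)" by (rule Cauchy_Schwarz_ineq)
  ultimately have xb: "(x \<bullet> b)^2 <= dl^2" using b by (simp add: norm_eq_1)
  have f: "abs (fl 2 (q x)) <= 4" "abs (fl 4 (q x)) <= 256" "abs (fl 3 (q x)) <= 27"
   using fl_le_one[OF d, of 2 x] fl_le_one[OF d, of 4 x] fl_le_one[OF d, of 3 x] by (simp_all add: q_def)
  have "D x = (-2) * fl 2 (q x) + 4 * ((x \<bullet> b)^2 * (fl 4 (q x) - 2 * fl 3 (q x)))" by (simp add: D_def power2_eq_square algebra_simps)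
  moreover have "abs ((x \<bullet> b)^2 * (fl 4 (q x) - 2 * fl 3 (q x))) <= dl^2 * 310"
   unfolding abs_mult using xb f by (intro mult_mono) auto
  ultimately show ?thesis using f(1) by simp
 qed (simp add: D_def fl_def)
 have "norm (dbump dl b (w + h *R b) - dbump dl b (w + 0 *R b)) <= (8 + 1240 * dl^2) * norm (h - 0)"
  by (rule field_differentiable_bound[where S=UNIV and f'="%h. D (w + h *R b)"]) (use der bd in auto)
 then show ?thesis by simp
qed

lemma bump_taylor:
 fixes b :: "'a::euclidean_space"
 assumes b: "norm b = 1" and d: "dl > 0"
 shows "abs (bump dl (w + h *R b) - bump dl w - h * dbump dl b w) <= (8 + 1240 * dl^2) * h^2"
proof -
 have l: "((%h. w + h *R b) has_derivative (%h. h *R b)) (at h)" for h by (auto intro!: derivative_eq_intros)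
 have bd: "(bump dl has_derivative (%h. dbump dl h x)) (at x)" for x using bump_deriv'[of dl 0 x] by simp
 have der: "((%h. bump dl (w + h *R b) - h * dbump dl b w) has_real_derivative dbump dl b (w + k *R b) - dbump dl b w) (at k)" for k
 proof -
  have "((%h. bump dl (w + h *R b)) has_real_derivative dbump dl b (w + k *R b)) (at k)"
   by (rule has_derivative_imp_has_field_derivative[OF has_derivative_compose[OF l bd]]) (simp add: dbump_def)
  then show ?thesis by (auto intro!: derivative_eq_intros)
 qed
 have "norm ((bump dl (w + h *R b) - h * dbump dl b w) - (bump dl (w + 0 *R b) - 0 * dbump dl b w)) <= ((8 + 1240 * dl^2) * abs h) * norm (h - 0)"
 proof (rule field_differentiable_bound[where S="{-abs h..abs h}" and f'="%k. dbump dl b (w + k *R b) - dbump dl b w"])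
  fix k assume k: "k : {-abs h..abs h}"
  show "((%h. bump dl (w + h *R b) - h * dbump dl b w) has_real_derivative dbump dl b (w + k *R b) - dbump dl b w) (at k within {-abs h..abs h})"
   by (rule DERIV_subset[OF der]) simp
  have "(8 + 1240 * dl^2) * abs k <= (8 + 1240 * dl^2) * abs h" using k by (intro mult_left_mono) auto
  then show "norm (dbump dl b (w + k *R b) - dbump dl b w) <= (8 + 1240 * dl^2) * abs h" using dbump_lip[OF b d, of w k] by simp
 qed auto
 then show ?thesis by (simp add: power2_eq_square mult.assoc algebra_simps)
qed

lemma bump_cont: "continuous_on A (bump dl)"
 using has_derivative_continuous[OF bump_deriv'[of dl 0]] by (auto intro!: continuous_at_imp_continuous_on)

lemma dbump_cont: "continuous_on A (dbump dl (b :: 'a::euclidean_space))"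
proof -
 have "isCont (fl 2) t" for t using DERIV_isCont[OF fl_deriv] .
 then have "continuous_on UNIV (fl 2)" by (simp add: continuous_at_imp_continuous_on)
 then have "continuous_on A (%x :: 'a. fl 2 (dl^2 - x \<bullet> x))"
  by (rule continuous_on_compose2[where g="fl 2" and f="%x. dl^2 - x \<bullet> x"]) (intro continuous_intros, simp)
 then show ?thesis unfolding dbump_def[abs_def] by (intro continuous_on_mult continuous_on_const continuous_on_inner continuous_on_id)
qed

lemma bump_meas [measurable]: "bump dl : bmeas" "dbump dl b : bmeas"
 by (intro borel_measurable_continuous_onI bump_cont dbump_cont)+

section \<open>Mollification and what weak derivatives say about differences\<close>

lemma vector_bound:
 fixes f :: "real => 'b::real_normed_vector"
 assumes "convex S" and d: "!!r. r : S ==> (f has_vector_derivative f' r) (at r)" and b: "!!r. r : S ==> norm (f' r) <= B" and "x : S" "y : S"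
 shows "norm (f x - f y) <= B * norm (x - y)"
proof (rule differentiable_bound[of S f "%r h. h *R f' r"])
 fix r assume r: "r : S"
 show "(f has_derivative (%h. h *R f' r)) (at r within S)" using d[OF r] by (simp add: has_vector_derivative_def has_derivative_at_withinI)
 have "0 <= B" using b[OF r] norm_ge_zero order_trans by blast
 then show "onorm (%h. h *R f' r) <= B" by (intro onorm_bound) (use b[OF r] in "auto simp: mult.commute[of B] intro: mult_left_mono")
qed (use assms in auto)

lemma locint_mult:
 fixes f :: "'a::euclidean_space => 'b::euclidean_space"
 assumes f: "locally_integrable f" and k [measurable]: "k : bmeas" and b: "!!y. abs (k y) <= M" and s: "!!y. k y ~= 0 ==> norm (y - z) <= r"
 shows "integrable lborel (%y. k y *R f y)" "norm (LBINT y. k y *R f y) <= M * (LBINT y. indicator (cball z r) y * norm (f y))"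
proof -
 have fm [measurable]: "f : bmeas" using f by (simp add: locally_integrable_def)
 have i: "integrable lborel (%y. indicator (cball z r) y *R f y)" using f compact_cball unfolding locally_integrable_def set_integrable_def by blast
 have i2: "integrable lborel (%y. M * (indicator (cball z r) y * norm (f y)))"
  using integrable_norm[OF i] by simp
 have le: "norm (k y *R f y) <= M * (indicator (cball z r) y * norm (f y))" for y
  using b[of y] s[of y] by (cases "k y = 0") (auto simp: indicator_def dist_norm norm_minus_commute intro!: mult_right_mono)
 show ii: "integrable lborel (%y. k y *R f y)"
  by (rule Bochner_Integration.integrable_bound[OF i2]) (measurable, rule AE_I2, rule order_trans[OF le], simp)
 have "norm (LBINT y. k y *R f y) <= (LBINT y. M * (indicator (cball z r) y * norm (f y)))"
  by (rule Bochner_Integration.integral_norm_bound_integral[OF ii i2 le])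
 then show "norm (LBINT y. k y *R f y) <= M * (LBINT y. indicator (cball z r) y * norm (f y))" by simp
qed

text \<open>The bump is not normalised; its mass \<open>mI\<close> is carried along and cancelled at
  the end of each limit argument.\<close>

definition moll :: "real => ('a::euclidean_space => 'b::euclidean_space) => 'a => 'b" where
 "moll dl f x = (LBINT y. bump dl (y - x) *R f y)"

lemma bump_le1: "0 < dl ==> abs (bump dl x) <= 1" using fl_le_one[of dl 0 x] by (simp add: bump_def)

lemma dbump_supp: "0 < dl ==> dbump dl b x ~= 0 ==> norm x < dl"
proof -
 assume d: "dl > 0" and "dbump dl b x ~= 0"
 then have "(norm x)^2 < dl^2" by (auto simp: dbump_def fl_def dot_square_norm split: if_splits)
 then show ?thesis using d power2_less_imp_less by fastforce
qed

lemma moll_int: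
 assumes "locally_integrable f" "dl > 0"
 shows "integrable lborel (%y. bump dl (y - x) *R f y)"
 by (rule locint_mult(1)[OF assms(1), where M=1 and z=x and r=dl]) (auto simp: bump_le1 assms less_imp_le[OF bump_supp[OF assms(2)]])

text \<open>The bump centred at the point is a test function, and the sign from moving its centre
  cancels the sign in the definition of the weak derivative. Integrating the quadratic Taylor
  remainder of the bump against \<open>f\<close> gives an ordinary derivative.\<close>

lemma moll_deriv:
 fixes f g :: "'a::euclidean_space => 'b::euclidean_space"
 assumes w: "has_weak_deriv f b g" and b: "b : Basis" and d: "dl > 0"
 shows "((%s. moll dl f (x + s *R b)) has_vector_derivative moll dl g (x + s *R b)) (at s)"
proof -
 define z where "z = x + s *R b"
 define M where "M = 8 + 1240 * dl^2"
 have lf: "locally_integrable f" using w by (simp add: has_weak_deriv_def)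
 have nb: "norm b = 1" using b by simp
 have dB: "abs (dbump dl b y) <= 8 * dl" for y
 proof (cases "dbump dl b y = 0")
  case False
  have "abs (y \<bullet> b) <= dl" using Cauchy_Schwarz_ineq2[of y b] nb dbump_supp[OF d False] by simp
  then have "abs (y \<bullet> b) * abs (fl 2 (dl^2 - y \<bullet> y)) <= dl * 4" using fl_le_one[OF d, of 2 y] by (intro mult_mono) auto
  then show ?thesis by (simp add: dbump_def abs_mult)
 qed (use d in simp)
 have di: "integrable lborel (%y. dbump dl b (y - z) *R f y)"
  by (rule locint_mult(1)[OF lf, where M="8 * dl" and z=z and r=dl]) (auto simp: dB less_imp_le[OF dbump_supp[OF d]])
 have fd: "frechet_derivative (%y. bump dl (y - z)) (at y) b = dbump dl b (y - z)" for y
  using frechet_derivative_at[OF bump_deriv'[of dl z y]] by (metis (no_types))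
 have "ALL phi. test_function phi --> (LBINT x. frechet_derivative phi (at x) b *R f x) = - (LBINT x. phi x *R g x)" using w by (simp add: has_weak_deriv_def)
 from this[rule_format, OF bump_test[OF d, of z]]
 have weak: "(LBINT y. dbump dl b (y - z) *R f y) = - moll dl g z" by (simp only: fd moll_def)
 define C where "C = M * (LBINT y. indicator (cball z (dl + 1)) y * norm (f y))"
 have main: "norm (moll dl f (z + h *R b) - moll dl f z - h *R moll dl g z) <= C * h^2" if h: "abs h <= 1" for h
 proof (cases "h = 0")
  case False
  \<comment> \<open>The Taylor remainder of the moved bump divided by h^2: bounded by
    \<open>M\<close> and supported in a fixed ball for |h| <= 1.\<close>
  define k where "k = (%y. (bump dl (y - (z + h *R b)) - bump dl (y - z) + h * dbump dl b (y - z)) / h^2)"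
  have [measurable]: "k : bmeas" unfolding k_def by measurable
  have kb: "abs (k y) <= M" for y
  proof -
   have "abs (bump dl ((y - z) + (- h) *R b) - bump dl (y - z) - (- h) * dbump dl b (y - z)) <= M * (- h)^2" unfolding M_def by (rule bump_taylor[OF nb d])
   then show ?thesis using False by (simp add: k_def divide_le_eq algebra_simps)
  qed
  have ks: "norm (y - z) <= dl + 1" if "k y ~= 0" for y
  proof -
   have "bump dl (y - (z + h *R b)) ~= 0 | bump dl (y - z) ~= 0 | dbump dl b (y - z) ~= 0" using that by (auto simp: k_def)
   then show ?thesis
   proof (elim disjE)
    assume "bump dl (y - (z + h *R b)) ~= 0"
    from bump_supp[OF d this] have "norm (y - z - h *R b) < dl" by (simp add: algebra_simps)
    then show ?thesis using norm_triangle_sub[of "y - z" "h *R b"] h nb by simp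
   qed (use bump_supp[OF d, of "y - z"] dbump_supp[OF d, of b "y - z"] in auto)
  qed
  have ki: "(LBINT y. k y *R f y) = (1 / h^2) *R (moll dl f (z + h *R b) - moll dl f z - h *R moll dl g z)"
  proof -
   have "(LBINT y. k y *R f y) = (LBINT y. (1 / h^2) *R (bump dl (y - (z + h *R b)) *R f y - bump dl (y - z) *R f y + h *R (dbump dl b (y - z) *R f y)))"
    by (intro Bochner_Integration.integral_cong) (simp_all add: k_def algebra_simps add_divide_distrib diff_divide_distrib)
   also have "... = (1 / h^2) *R (moll dl f (z + h *R b) - moll dl f z + h *R (LBINT y. dbump dl b (y - z) *R f y))"
    unfolding moll_def integral_scaleR_right
     Bochner_Integration.integral_add[OF Bochner_Integration.integrable_diff[OF moll_int[OF lf d] moll_int[OF lf d]] integrable_scaleR_right[OF di]]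
     Bochner_Integration.integral_diff[OF moll_int[OF lf d] moll_int[OF lf d]] ..
   finally show ?thesis unfolding weak by simp
  qed
  have "norm (LBINT y. k y *R f y) <= C" unfolding C_def by (rule locint_mult(2)[OF lf _ kb ks]) measurable
  then show ?thesis unfolding ki using False by (simp add: divide_le_eq)
 qed simp
 have "((%h. norm (moll dl f (x + (s + h) *R b) - moll dl f (x + s *R b) - h *R moll dl g (x + s *R b)) / norm h) \<longlongrightarrow> 0) (at 0)"
 proof (rule Lim_null_comparison)
  show "((%h. C * abs h) \<longlongrightarrow> 0) (at 0)" by (intro tendsto_mult_right_zero) (auto intro!: tendsto_eq_intros)
  show "\<forall>\<^sub>F h in at 0. norm (norm (moll dl f (x + (s + h) *R b) - moll dl f (x + s *R b) - h *R moll dl g (x + s *R b)) / norm h) <= C * abs h"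
   unfolding eventually_at
  proof (intro exI[of _ 1] conjI ballI impI)
   fix h :: real assume h: "h ~= 0 & dist h 0 < 1"
   have "z + h *R b = x + (s + h) *R b" by (simp add: z_def algebra_simps)
   then show "norm (norm (moll dl f (x + (s + h) *R b) - moll dl f (x + s *R b) - h *R moll dl g (x + s *R b)) / norm h) <= C * abs h"
    using main[of h] h by (simp add: z_def[symmetric] divide_le_eq power2_eq_square abs_mult[symmetric] mult.assoc)
  qed simp
 qed
 then show ?thesis unfolding has_vector_derivative_def has_derivative_at by (simp add: bounded_linear_scaleR_left)
qed

definition mI :: "real => 'a::euclidean_space itself => real" where "mI dl (T :: 'a itself) = (LBINT (y::'a). bump dl y)"

lemma bump_int: "dl > 0 ==> integrable lborel (%y::'a::euclidean_space. bump dl (y - x))"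
 by (rule integrable_continuous_support[where R="norm x + dl"])
  (auto dest!: bump_supp intro: order_trans[OF norm_triangle_sub[of _ x]] intro!: continuous_on_compose2[OF bump_cont] continuous_intros)

lemma bump_integral:
 fixes x :: "'a::euclidean_space"
 shows "(LBINT y. bump dl (y - x)) = mI dl TYPE('a)"
proof -
 have "mI dl TYPE('a) = (\<integral>y. bump dl y \<partial>distr lborel borel ((+) (- x)))" unfolding mI_def by (simp only: lborel_distr_plus)
 also have "... = (LBINT y. bump dl (y - x))" by (subst integral_distr) simp_all
 finally show ?thesis ..
qed

lemma mI_pos: "dl > 0 ==> mI dl TYPE('a::euclidean_space) > 0"
proof -
 assume d: "dl > 0"
 have i: "integrable lborel (bump dl :: 'a => real)" using bump_int[OF d, of 0] by simp
 have "mI dl TYPE('a) ~= 0"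
 proof
  assume "mI dl TYPE('a) = 0"
  then have "AE x in lborel. bump dl (x :: 'a) = 0" unfolding mI_def by (subst (asm) integral_nonneg_eq_0_iff_AE[OF i]) (auto simp: bump_nonneg)
  then have "bump dl (0 :: 'a) = 0" by (rule continuous_AE_zero[OF bump_cont])
  then show False using d by (simp add: bump_def fl_def)
 qed
 then show ?thesis using integral_nonneg_AE[of "bump dl :: 'a => real" lborel] by (simp add: mI_def bump_nonneg less_le)
qed

lemma moll_bound:
 fixes f :: "'a::euclidean_space => 'b::euclidean_space"
 assumes f: "locally_integrable f" and d: "dl > 0" and b: "AE y in lborel. norm (y - x) < dl --> norm (f y) <= C"
 shows "norm (moll dl f x) <= C * mI dl TYPE('a)"
proof -
 have "norm (moll dl f x) <= (LBINT y. C * bump dl (y - x))" unfolding moll_def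
 proof (rule norm_integral_le_integral)
  show "AE y in lborel. norm (bump dl (y - x) *R f y) <= C * bump dl (y - x)"
   using b
  proof eventually_elim
   case (elim y)
   then show ?case using bump_supp[OF d, of "y - x"] bump_nonneg[of dl "y - x"] by (cases "bump dl (y - x) = 0") (auto simp: mult.commute intro: mult_left_mono)
  qed
 qed (use bump_int[OF d] in auto)
 then show ?thesis by (simp add: bump_integral)
qed

lemma locint_cont: "continuous_on UNIV (f :: 'a::euclidean_space => 'b::euclidean_space) ==> locally_integrable f"
 unfolding locally_integrable_def
 by (auto intro: borel_measurable_continuous_onI borel_integrable_compact continuous_on_subset simp: set_integrable_def)

lemma moll_approx:
 fixes f :: "'a::euclidean_space => 'b::euclidean_space"
 assumes f: "continuous_on UNIV f" and d: "dl > 0" and b: "!!y. norm (y - x) < dl ==> norm (f y - f x) <= C"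
 shows "norm (moll dl f x - mI dl TYPE('a) *R f x) <= C * mI dl TYPE('a)"
proof -
 have "moll dl f x - mI dl TYPE('a) *R f x = moll dl (%y. f y - f x) x"
  unfolding moll_def scaleR_diff_right bump_integral[symmetric, of _ x]
  using moll_int[OF locint_cont[OF f] d, of x] bump_int[OF d, of x] by (subst Bochner_Integration.integral_diff) auto
 moreover have "continuous_on UNIV (%y. f y - f x)" using f by (intro continuous_intros)
 ultimately show ?thesis using moll_bound[OF locint_cont d, of "%y. f y - f x" x C] b by auto
qed

lemma moll_diff:
 fixes f g :: "'a::euclidean_space => 'b::euclidean_space"
 assumes w: "has_weak_deriv f b g" and b: "b : Basis" and d: "dl > 0"
  and C: "!!r. 0 <= r ==> r <= 1 ==> norm (moll dl g (x + (r * s) *R b)) <= C"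
 shows "norm (moll dl f (x + s *R b) - moll dl f x) <= C * abs s"
proof -
 have d1: "((%r. moll dl f (x + (r * s) *R b)) has_vector_derivative s *R moll dl g (x + (r * s) *R b)) (at r)" for r
 proof -
  have "((%r. r * s) has_vector_derivative s) (at r)"
   unfolding has_real_derivative_iff_has_vector_derivative[symmetric] by (auto intro!: derivative_eq_intros)
  from vector_diff_chain_at[OF this moll_deriv[OF w b d, of x "r * s"]] show ?thesis by (simp add: o_def)
 qed
 have "norm (moll dl f (x + (1 * s) *R b) - moll dl f (x + (0 * s) *R b)) <= (C * abs s) * norm (1 - 0 :: real)"
 proof (rule vector_bound[of "{0..1}", OF _ d1])
  fix r :: real assume r: "r : {0..1}"
  show "norm (s *R moll dl g (x + (r * s) *R b)) <= C * abs s" using mult_left_mono[OF C[of r], of "abs s"] r by (simp add: mult.commute)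
 qed auto
 then show ?thesis by simp
qed

lemma moll_close:
 fixes f :: "'a::euclidean_space => 'b::euclidean_space"
 assumes f: "continuous_on UNIV f" and ep: "ep > 0"
 shows "EX d>0. ALL dl. 0 < dl --> dl <= d --> norm (moll dl f x - mI dl TYPE('a) *R f x) <= ep * mI dl TYPE('a)"
proof -
 obtain d where d: "d > 0" "!!y. norm (y - x) < d ==> norm (f y - f x) < ep"
  using f ep unfolding continuous_on_iff dist_norm by (metis UNIV_I)
 show ?thesis by (intro exI[of _ d] conjI allI impI d moll_approx f less_imp_le[OF d(2)]) auto
qed

text \<open>The mollified \<open>f\<close> has the mollified \<open>g\<close> as derivative along
  \<open>b\<close>, and the width tends to 0. It is kept below the distance from the segment to the
  sphere of radius \<open>rh\<close>, so that only values of \<open>g\<close> covered by the bound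
  are averaged.\<close>

lemma dir_lip:
 fixes f g :: "'a::euclidean_space => 'b::euclidean_space"
 assumes f: "continuous_on UNIV f" and w: "has_weak_deriv f b g" and b: "b : Basis"
  and ae: "AE y in lborel. norm (y - p) < rh --> norm (g y) <= C" and x: "norm (x - p) < rh" "norm (x + s *R b - p) < rh"
 shows "norm (f (x + s *R b) - f x) <= C * abs s"
proof (rule field_le_epsilon)
 fix ep :: real assume ep: "ep > 0"
 then have e2: "ep / 2 > 0" by simp
 obtain d1 where d1: "d1 > 0" "!!dl. 0 < dl ==> dl <= d1 ==> norm (moll dl f x - mI dl TYPE('a) *R f x) <= ep / 2 * mI dl TYPE('a)" using moll_close[OF f e2, of x] by blast
 obtain d2 where d2: "d2 > 0" "!!dl. 0 < dl ==> dl <= d2 ==> norm (moll dl f (x + s *R b) - mI dl TYPE('a) *R f (x + s *R b)) <= ep / 2 * mI dl TYPE('a)" using moll_close[OF f e2, of "x + s *R b"] by blast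
 define m where "m = max (norm (x - p)) (norm (x + s *R b - p))"
 define dl where "dl = min (min d1 d2) (rh - m)"
 have dl: "dl > 0" "dl <= d1" "dl <= d2" "dl + m <= rh" using d1(1) d2(1) x by (auto simp: dl_def m_def)
 let ?I = "mI dl TYPE('a)"
 have I: "?I > 0" by (rule mI_pos[OF dl(1)])
 have "norm (moll dl f (x + s *R b) - moll dl f x) <= (C * ?I) * abs s"
 proof (rule moll_diff[OF w b dl(1)])
  fix r :: real assume r: "0 <= r" "r <= 1"
  show "norm (moll dl g (x + (r * s) *R b)) <= C * ?I"
  proof (rule moll_bound[OF _ dl(1)])
   show "locally_integrable g" using w by (simp add: has_weak_deriv_def)
   have "x + (r * s) *R b - p = (1 - r) *R (x - p) + r *R (x + s *R b - p)" by (simp add: algebra_simps)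
   also have "norm ... <= (1 - r) * m + r * m"
    using r by (intro norm_triangle_mono) (auto simp: m_def intro: mult_left_mono)
   finally have n: "norm (x + (r * s) *R b - p) <= m" by (simp add: algebra_simps)
   show "AE y in lborel. norm (y - (x + (r * s) *R b)) < dl --> norm (g y) <= C"
    using ae
   proof (rule AE_mp, intro AE_I2 impI)
    fix y assume *: "norm (y - p) < rh --> norm (g y) <= C" and y: "norm (y - (x + (r * s) *R b)) < dl"
    have "norm (y - p) <= norm (y - (x + (r * s) *R b)) + norm (x + (r * s) *R b - p)"
     using norm_triangle_ineq[of "y - (x + (r * s) *R b)" "x + (r * s) *R b - p"] by simp
    then show "norm (g y) <= C" using * y n dl(4) by linarith
   qed
  qed
 qed
 moreover have "?I *R (f (x + s *R b) - f x) = (moll dl f (x + s *R b) - moll dl f x) + (moll dl f x - ?I *R f x) + - (moll dl f (x + s *R b) - ?I *R f (x + s *R b))"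
  by (simp add: algebra_simps)
 ultimately have "norm (?I *R (f (x + s *R b) - f x)) <= (C * ?I) * abs s + ep / 2 * ?I + ep / 2 * ?I"
  by (simp only:) (intro norm_triangle_mono d1(2) dl; simp only: norm_minus_cancel d2(2) dl)
 then have "?I * norm (f (x + s *R b) - f x) <= ?I * (C * abs s + ep)" unfolding norm_scaleR abs_of_pos[OF I] by (simp add: distrib_left mult_ac)
 then show "norm (f (x + s *R b) - f x) <= C * abs s + ep" using I by simp
qed

text \<open>The bound on \<open>k\<close> controls increments of the mollified \<open>g\<close> in
  direction \<open>b'\<close>, and these are the derivatives along \<open>b\<close> of the
  corresponding increments of the mollified \<open>f\<close>.\<close>

lemma second_dir:
 fixes f g :: "'a::euclidean_space => 'b::euclidean_space"
 assumes f: "continuous_on UNIV f" and w: "has_weak_deriv f b g" "has_weak_deriv g b' k" and b: "b : Basis" "b' : Basis"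
  and ae: "AE y in lborel. norm (k y) <= C"
 shows "norm (f (x + t *R b' + s *R b) - f (x + s *R b) - (f (x + t *R b') - f x)) <= C * abs t * abs s"
proof (rule field_le_epsilon)
 fix ep :: real assume ep: "ep > 0"
 then have e4: "ep / 4 > 0" by simp
 obtain d where d: "!!y. d y > 0" "!!y dl. 0 < dl ==> dl <= d y ==> norm (moll dl f y - mI dl TYPE('a) *R f y) <= ep / 4 * mI dl TYPE('a)" using moll_close[OF f e4] by metis
 define dl where "dl = min (min (d x) (d (x + s *R b))) (min (d (x + t *R b')) (d (x + t *R b' + s *R b)))"
 have dl: "dl > 0" using d(1) by (simp add: dl_def)
 let ?I = "mI dl TYPE('a)"
 let ?M = "%y. moll dl f y"
 have I: "?I > 0" by (rule mI_pos[OF dl])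
 have g: "norm (moll dl g (z + t *R b') - moll dl g z) <= (C * ?I) * abs t" for z
  by (rule moll_diff[OF w(2) b(2) dl], rule moll_bound[OF _ dl]) (use w ae in "auto simp: has_weak_deriv_def elim: eventually_mono")
 have der: "((%r. ?M (x + t *R b' + r *R b) - ?M (x + r *R b)) has_vector_derivative moll dl g (x + t *R b' + r *R b) - moll dl g (x + r *R b)) (at r)" for r
  by (intro has_vector_derivative_diff moll_deriv w b dl)
 have "norm ((?M (x + t *R b' + s *R b) - ?M (x + s *R b)) - (?M (x + t *R b' + 0 *R b) - ?M (x + 0 *R b))) <= ((C * ?I) * abs t) * norm (s - 0)"
  by (rule vector_bound[OF convex_UNIV der]) (use g[of "x + _ *R b"] in \<open>auto simp: add_ac\<close>)
 then have a: "norm (?M (x + t *R b' + s *R b) - ?M (x + s *R b) - (?M (x + t *R b') - ?M x)) <= ((C * ?I) * abs t) * abs s" by simp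
 have e: "norm (?M y - ?I *R f y) <= ep / 4 * ?I" if "y : {x, x + s *R b, x + t *R b', x + t *R b' + s *R b}" for y
  by (rule d(2)[OF dl]) (use that in \<open>auto simp: dl_def\<close>)
 have "?I *R (f (x + t *R b' + s *R b) - f (x + s *R b) - (f (x + t *R b') - f x))
  = (?M (x + t *R b' + s *R b) - ?M (x + s *R b) - (?M (x + t *R b') - ?M x)) + - (?M (x + t *R b' + s *R b) - ?I *R f (x + t *R b' + s *R b))
   + (?M (x + s *R b) - ?I *R f (x + s *R b)) + (?M (x + t *R b') - ?I *R f (x + t *R b')) + - (?M x - ?I *R f x)"
  by (simp add: algebra_simps)
 also have "norm ... <= ((C * ?I) * abs t) * abs s + ep / 4 * ?I + ep / 4 * ?I + ep / 4 * ?I + ep / 4 * ?I"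
  by (intro norm_triangle_mono a) (simp_all only: norm_minus_cancel, (rule e, simp)+)
 finally have "?I * norm (f (x + t *R b' + s *R b) - f (x + s *R b) - (f (x + t *R b') - f x)) <= ?I * (C * abs t * abs s + ep)" unfolding norm_scaleR abs_of_pos[OF I] by (simp add: distrib_left mult_ac)
 then show "norm (f (x + t *R b' + s *R b) - f (x + s *R b) - (f (x + t *R b') - f x)) <= C * abs t * abs s + ep" using I by simp
qed

text \<open>The increment is built up one coordinate at a time; partial sums have norm at most the
  sum of the absolute coordinates, so the path stays in the ball where the directional bound
  holds.\<close>

lemma coord_sum:
 fixes g :: "'a::euclidean_space => 'b::real_normed_vector"
 assumes s: "(\<Sum>b\<in>Basis. abs (h \<bullet> b)) < rh"
  and g: "!!x b s. b : Basis ==> norm (x - p) < rh ==> norm (x + s *R b - p) < rh ==> norm (g (x + s *R b) - g x) <= C * abs s"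
 shows "norm (g (p + h) - g p) <= C * (\<Sum>b\<in>Basis. abs (h \<bullet> b))"
proof -
 have nA: "norm (\<Sum>b\<in>A. (h \<bullet> b) *R b) < rh" if "A <= Basis" for A
 proof -
  have "norm (\<Sum>b\<in>A. (h \<bullet> b) *R b) <= (\<Sum>b\<in>A. abs (h \<bullet> b))" using that by (intro sum_norm_le) auto
  also have "... <= (\<Sum>b\<in>Basis. abs (h \<bullet> b))" using that by (intro sum_mono2) auto
  finally show ?thesis using s by simp
 qed
 have "norm (g (p + (\<Sum>b\<in>A. (h \<bullet> b) *R b)) - g p) <= C * (\<Sum>b\<in>A. abs (h \<bullet> b))" if "finite A" "A <= Basis" for A
  using that
 proof (induction A)
  case (insert b A)
  let ?x = "p + (\<Sum>b\<in>A. (h \<bullet> b) *R b)"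
  have e: "p + (\<Sum>b\<in>insert b A. (h \<bullet> b) *R b) = ?x + (h \<bullet> b) *R b" using insert.hyps by (simp add: algebra_simps)
  have "norm (g (?x + (h \<bullet> b) *R b) - g ?x) <= C * abs (h \<bullet> b)"
   by (rule g) (use insert.prems nA[of A] nA[of "insert b A", folded add_diff_cancel_left'[of p]] in \<open>auto simp: e[symmetric]\<close>)
  moreover have "norm (g ?x - g p) <= C * (\<Sum>b\<in>A. abs (h \<bullet> b))" using insert by simp
  ultimately have "norm ((g (?x + (h \<bullet> b) *R b) - g ?x) + (g ?x - g p)) <= C * abs (h \<bullet> b) + C * (\<Sum>b\<in>A. abs (h \<bullet> b))" by (rule norm_triangle_mono)
  then have "norm (g (?x + (h \<bullet> b) *R b) - g p) <= C * abs (h \<bullet> b) + C * (\<Sum>b\<in>A. abs (h \<bullet> b))" by simp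
  then show ?case unfolding e using insert.hyps by (simp add: distrib_left)
 qed simp
 from this[OF finite_Basis subset_refl] show ?thesis by (simp add: euclidean_representation)
qed

lemma sum_coord_le: "(\<Sum>b\<in>Basis. abs (h \<bullet> b)) <= DIM('a) * norm (h :: 'a::euclidean_space)"
 using sum_bounded_above[of Basis "%b. abs (h \<bullet> b)" "norm h"] by (simp add: Basis_le_norm)

lemma lip_of_weak:
 fixes f :: "'a::euclidean_space => 'b::euclidean_space"
 assumes f: "continuous_on UNIV f" and w: "!!b. b : Basis ==> has_weak_deriv f b (g b)"
  and ae: "!!b. b : Basis ==> AE y in lborel. norm (y - p) < rh --> norm (g b y) <= C" and C: "C >= 0" and h: "DIM('a) * norm h < rh"
 shows "norm (f (p + h) - f p) <= C * (DIM('a) * norm h)"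
proof -
 have "norm (f (p + h) - f p) <= C * (\<Sum>b\<in>Basis. abs (h \<bullet> b))"
  by (rule coord_sum[where rh=rh]) (use sum_coord_le[of h] h in "auto intro: dir_lip[OF f w _ ae]")
 also have "... <= C * (DIM('a) * norm h)" using sum_coord_le C by (rule mult_left_mono)
 finally show ?thesis .
qed

lemma second_of_weak:
 fixes f :: "'a::euclidean_space => 'b::euclidean_space"
 assumes f: "continuous_on UNIV f" and w: "!!b. b : Basis ==> has_weak_deriv f b (g b)" "!!b b'. b : Basis ==> b' : Basis ==> has_weak_deriv (g b) b' (k b b')"
  and ae: "!!b b'. b : Basis ==> b' : Basis ==> AE y in lborel. norm (k b b' y) <= C" and C: "C >= 0"
 shows "norm (f (x + h + h') - f (x + h) - f (x + h') + f x) <= C * (DIM('a))^2 * norm h * norm h'"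
proof -
 let ?S = "%h :: 'a. \<Sum>b\<in>Basis. abs (h \<bullet> b)"
 have 1: "norm ((f (x + h + s *R b) - f (x + h)) - (f (x + s *R b) - f x)) <= (C * abs s) * ?S h" if b: "b : Basis" for x h s b
 proof (rule coord_sum[where g="%x. f (x + s *R b) - f x" and rh="?S h + 1"])
  fix x b' :: 'a and t assume b': "b' : Basis"
  show "norm ((f (x + t *R b' + s *R b) - f (x + t *R b')) - (f (x + s *R b) - f x)) <= C * abs s * abs t"
   using second_dir[OF f w(1)[OF b] w(2)[OF b b'] b b' ae[OF b b'], of x t s] by (simp add: algebra_simps)
 qed simp
 have "norm ((f (x + h' + h) - f (x + h')) - (f (x + h) - f x)) <= (C * ?S h) * ?S h'"
 proof (rule coord_sum[where g="%x. f (x + h) - f x" and rh="?S h' + 1"])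
  fix x b s assume b: "(b :: 'a) : Basis"
  show "norm ((f (x + s *R b + h) - f (x + s *R b)) - (f (x + h) - f x)) <= C * ?S h * abs s"
   using 1[OF b, of x h s] by (simp add: algebra_simps)
 qed simp
 also have "... <= (C * (DIM('a) * norm h)) * (DIM('a) * norm h')"
  using C by (intro mult_mono mult_left_mono sum_coord_le) (auto intro!: sum_nonneg)
 finally show ?thesis by (simp add: power2_eq_square algebra_simps)
qed

section \<open>From norm bounds to pointwise hypotheses\<close>

text \<open>Measurability comes for free: the essential supremum of a non-measurable function is
  top, which a real bound excludes.\<close>

lemma Linf_AE:
 assumes "Linf_norm f <= ereal C" shows "AE x in lborel. abs (f x) <= C"
proof -
 have "(%x. ereal (abs (f x))) : borel_measurable lborel"
  by (rule ccontr) (use assms esssup_non_measurable[of "%x. ereal (abs (f x))" lborel] in \<open>simp add: Linf_norm_def top_ereal_def\<close>)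
 from esssup_AE[of "%x. ereal (abs (f x))" lborel] show ?thesis
  using assms unfolding Linf_norm_def by (auto elim!: eventually_mono) (meson ereal_less_eq(3) order_trans)
qed

lemma continuous_AE_le:
 fixes f :: "'a::euclidean_space => real"
 assumes "continuous_on UNIV f" "AE x in lborel. f x <= C" shows "f x <= C"
proof -
 have "continuous_on UNIV (%x. max 0 (f x - C))" using assms(1) by (intro continuous_intros)
 moreover have "AE x in lborel. max 0 (f x - C) = 0" using assms(2) by (auto elim: eventually_mono)
 ultimately have "max 0 (f x - C) = 0" by (rule continuous_AE_zero)
 then show ?thesis by (simp add: max_def split: if_splits)
qed

lemma Linf_nonneg: "0 <= Linf_norm f"
proof (rule ccontr)
 assume "~ 0 <= Linf_norm f"
 then have "Linf_norm f < 0" by simp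
 then obtain c where "Linf_norm f < ereal c" "ereal c < 0" using ereal_dense2 by blast
 then have "AE x in lborel. abs (f x) <= c" "c < 0" by (auto intro: Linf_AE less_imp_le)
 then have "AE (x :: 'a) in lborel. False" by (auto elim!: eventually_mono)
 then show False by (simp add: ae_filter_eq_bot_iff flip: trivial_limit_def)
qed

lemma weak_le_grad:
 assumes "set bs <= Basis" "length bs = k" shows "norm (weak_deriv bs f x) <= grad_norm k f x"
proof -
 have "finite {bs. set bs <= (Basis :: 'a set) & length bs = k}" by (rule finite_lists_length_eq) simp
 then have "(norm (weak_deriv bs f x))^2 <= (\<Sum>bs\<in>{bs. set bs <= Basis & length bs = k}. (norm (weak_deriv bs f x))^2)"
  using assms by (intro member_le_sum) auto
 then show ?thesis unfolding grad_norm_def by (rule real_le_rsqrt)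
qed

lemma jbracket_ge: "1 + norm v <= 2 * jbracket v" "(1 + norm v)^2 <= 2 * (jbracket v)^2" "(1 + norm v) ^ 4 <= 4 * jbracket v ^ 4" "1 <= jbracket v"
proof -
 have "0 <= (1 - norm v)^2" by simp
 then show 2: "(1 + norm v)^2 <= 2 * (jbracket v)^2" by (simp add: jbracket_def power2_eq_square algebra_simps)
 have "((1 + norm v)^2)^2 <= (2 * (jbracket v)^2)^2" by (rule power_mono[OF 2]) simp
 then show "(1 + norm v) ^ 4 <= 4 * jbracket v ^ 4" by (simp add: power_mult_distrib flip: power_mult)
 show 1: "1 <= jbracket v" by (simp add: jbracket_def)
 have "2 * (jbracket v)^2 <= (2 * jbracket v)^2" by (simp add: power_mult_distrib)
 then have "(1 + norm v)^2 <= (2 * jbracket v)^2" using 2 by linarith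
 then show "1 + norm v <= 2 * jbracket v" by (rule power2_le_imp_le) (use 1 in simp)
qed

lemma jbracket_cont: "continuous_on A f ==> continuous_on A (%x. jbracket (f x))"
 unfolding jbracket_def by (intro continuous_intros)

lemma efield_Kn: "efield_kernel g y = (%p. (g p)^2 *R Kn (y - fst p))"
 by (auto simp: efield_kernel_def Kn_def)

lemma ereal_sum_le:
 fixes a b c d f :: ereal
 assumes s: "a + b + c + d + f <= ereal x" and n: "0 <= a" "0 <= b" "0 <= c" "0 <= d" "0 <= f"
 shows "a <= ereal x" "b <= ereal x" "c <= ereal x" "f <= ereal x"
 using order_trans[OF add_increasing2[OF n(5) add_increasing2[OF n(4) add_increasing2[OF n(3) add_increasing2[OF n(2) order_refl]]]] s]
  order_trans[OF add_increasing2[OF n(5) add_increasing2[OF n(4) add_increasing2[OF n(3) add_increasing[OF n(1) order_refl]]]] s]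
  order_trans[OF add_increasing2[OF n(5) add_increasing2[OF n(4) add_increasing[OF add_nonneg_nonneg[OF n(1,2)] order_refl]]] s]
  order_trans[OF add_increasing[OF add_nonneg_nonneg[OF add_nonneg_nonneg[OF add_nonneg_nonneg[OF n(1,2)] n(3)] n(4)] order_refl] s]
 by blast+

lemma L2_nonneg: "0 <= L2_norm f" by (simp add: L2_norm_def integral_nonneg_AE)

lemma L2_D:
 assumes "L2_norm f <= ereal C"
 shows "f : bmeas" "(NN x. ennreal ((f x)^2)) <= ennreal (C^2)"
proof -
 have f: "f : borel_measurable lborel" "integrable lborel (%x. (f x)^2)" "sqrt (LBINT x. (f x)^2) <= C"
  using assms by (auto simp: L2_norm_def split: if_splits)
 then show "f : bmeas" by simp
 have "0 <= (LBINT x. (f x)^2)" by simp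
 then have "(LBINT x. (f x)^2) <= C^2" using f(3) power_mono[OF f(3), of 2] by simp
 then show "(NN x. ennreal ((f x)^2)) <= ennreal (C^2)" using f(2) by (simp add: nn_integral_eq_integral ennreal_leI)
qed

text \<open>The field is a uniform limit, as r tends to 0, of truncated fields that are Lipschitz in
  y.\<close>

lemma field_continuous:
 fixes f :: "phase => real" and c0 :: "plane => plane"
 assumes fi: "integrable lborel f" and f0: "!!p. f p >= 0" and fb: "!!z c. abs (f (z, c)) <= B / (1 + norm (c - c0 z)) ^ 3" and B: "B >= 0"
 shows "continuous_on UNIV (%y. LBINT p. f p *R Kn (y - fst p))"
 unfolding continuous_on_iff
proof (intro ballI allI impI)
 fix y :: plane and ep :: real assume ep: "ep > 0"
 define q where "q = 1024 * B + 1"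
 have q: "q > 0" using B by (simp add: q_def)
 define r where "r = ep / (3 * q)"
 have r: "r > 0" using ep q by (simp add: r_def)
 have fm [measurable]: "f : bmeas" using fi by auto
 define m where "m = (LBINT p. f p)"
 have m: "m >= 0" using f0 by (simp add: m_def integral_nonneg_AE)
 let ?I = "%y. LBINT p. f p *R Kn (y - fst p)" and ?R = "%y. LBINT p. f p *R Kr r (y - fst p)"
 have Kri: "integrable lborel (%p. f p *R Kr r (y - fst p))" for y
  by (rule integrable_bounded_mult[OF fi]) (measurable, rule Kr_bound[OF r])
 have a: "norm (?I y - ?R y) <= 512 * r * B" for y by (rule Kn_density(2)[OF fi fb B r])
 have b: "norm (?R y - ?R y') <= m * (norm (y - y') / r^2)" for y y'
 proof -
  have "?R y - ?R y' = (LBINT p. f p *R Kr r (y - fst p) - f p *R Kr r (y' - fst p))" by (rule Bochner_Integration.integral_diff[OF Kri Kri, symmetric])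
  also have "norm ... <= (LBINT p. f p * (norm (y - y') / r^2))"
  proof (rule norm_integral_le_integral)
   show "AE p in lborel. norm (f p *R Kr r (y - fst p) - f p *R Kr r (y' - fst p)) <= f p * (norm (y - y') / r^2)"
   proof (rule AE_I2)
    fix p :: "phase"
    have "norm (Kr r (y - fst p) - Kr r (y' - fst p)) <= norm (y - y') / r^2" using Kr_lip[OF r, of "y - fst p" "y' - fst p"] by simp
    from mult_left_mono[OF this f0[of p]] show "norm (f p *R Kr r (y - fst p) - f p *R Kr r (y' - fst p)) <= f p * (norm (y - y') / r^2)"
     unfolding scaleR_diff_right[symmetric] norm_scaleR using f0[of p] by simp
   qed
  qed (use fi in auto)
  finally show ?thesis by (simp add: m_def)
 qed
 define M where "M = m + 1"
 have M: "M > 0" "m <= M" using m by (auto simp: M_def)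
 define d where "d = ep * r^2 / (3 * M)"
 have d: "d > 0" using ep r M by (simp add: d_def)
 show "EX d>0. ALL y':UNIV. dist y' y < d --> dist (?I y') (?I y) < ep"
 proof (intro exI[of _ d] conjI d ballI impI)
  fix y' assume y': "dist y' y < d"
  have "?I y' - ?I y = (?I y' - ?R y') + (?R y' - ?R y) + - (?I y - ?R y)" by simp
  also have "norm ... <= 512 * r * B + m * (norm (y' - y) / r^2) + 512 * r * B"
   by (intro norm_triangle_mono a b) (simp only: norm_minus_cancel a)
  also have "m * (norm (y' - y) / r^2) <= M * (d / r^2)" using y' m M by (intro mult_mono divide_right_mono) (auto simp: dist_norm)
  also have "M * (d / r^2) = ep / 3" using M r by (simp add: d_def)
  also have "512 * r * B + ep / 3 + 512 * r * B <= r * q + ep / 3" using r by (simp add: q_def algebra_simps)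
  also have "r * q = ep / 3" using q by (simp add: r_def)
  finally show "dist (?I y') (?I y) < ep" using ep by (simp add: dist_norm)
 qed
qed

text \<open>If q is close to p on the scale n = 1 + |v|, the weight is comparable to n on the ball
  of radius n/2 and the gradient bound applies; the factor 4 in this case is the dimension of phase
  space. Otherwise |p - q| is at least n/8 and the size of \<open>mu\<close> suffices, which
  produces the constant 64.\<close>

lemma wlip_of_weak:
 fixes mu :: "phase => real"
 assumes c: "continuous_on UNIV mu" and w: "!!b. b : Basis ==> has_weak_deriv mu b (g b)" and ep: "ep >= 0"
  and ae: "!!b. b : Basis ==> AE y in lborel. norm (g b y) <= 2 * ep / (1 + norm (snd y))" and bd: "!!q. abs (mu q) <= 4 * ep"
 shows "wlip (64 * ep) mu"
 unfolding wlip_def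
proof (intro conjI allI)
 fix p q :: "phase"
 define n where "n = 1 + norm (snd p)"
 have n: "n >= 1" by (simp add: n_def)
 have "abs (mu p - mu q) <= 64 * ep / n * norm (p - q)"
 proof (cases "4 * norm (q - p) < n / 2")
  case True
  have "norm (mu (p + (q - p)) - mu p) <= 4 * ep / n * (DIM(phase) * norm (q - p))"
  proof (rule lip_of_weak[OF c w])
   fix b :: "phase" assume b: "b : Basis"
   show "AE y in lborel. norm (y - p) < n / 2 --> norm (g b y) <= 4 * ep / n"
    using ae[OF b]
   proof (rule AE_mp, intro AE_I2 impI)
    fix y assume g: "norm (g b y) <= 2 * ep / (1 + norm (snd y))" and y: "norm (y - p) < n / 2"
    have "norm (snd p) <= norm (snd y) + norm (snd y - snd p)" using norm_triangle_sub[of "snd p" "snd y"] by (simp add: norm_minus_commute)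
    moreover have "norm (snd y - snd p) <= norm (y - p)" using norm_snd_le[of "snd y - snd p" "fst y - fst p"] unfolding minus_prod_def .
    ultimately have "n / 2 <= 1 + norm (snd y)" using y by (simp add: n_def)
    then have "2 * ep / (1 + norm (snd y)) <= 2 * ep / (n / 2)" using ep n by (intro divide_left_mono) auto
    then show "norm (g b y) <= 4 * ep / n" using g by simp
   qed
  qed (use True ep n in auto)
  also have "... = 16 * ep / n * norm (q - p)" by simp
  also have "... <= 64 * ep / n * norm (q - p)" using ep n by (intro mult_right_mono divide_right_mono) auto
  finally show ?thesis by (simp add: abs_minus_commute norm_minus_commute)
 next
  case False
  then have "1 <= 8 * norm (p - q) / n" using n by (simp add: norm_minus_commute pos_le_divide_eq)
  then have "8 * ep * 1 <= 8 * ep * (8 * norm (p - q) / n)" using ep by (intro mult_left_mono) auto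
  then show ?thesis using bd[of p] bd[of q] by (simp add: abs_le_iff)
 qed
 then show "abs (mu p - mu q) <= 64 * ep / (1 + norm (snd p)) * norm (p - q)" by (simp add: n_def)
qed (use ep in simp)

text \<open>The factor 64 is dictated by \<open>wlip_of_weak\<close>; the other conversions lose at
  most 4. Continuity, assumed for the datum and deduced for its field by truncation, turns a.e.
  bounds into bounds at every point.\<close>

lemma datum_of_norms:
 assumes lam: "lam : {-1, 1 :: real}" and e: "0 < e" "e <= 1 / 10 ^ 9"
  and H: "continuous_on UNIV mu" "W_inf 2 mu" "E = efield mu" "W_inf 3 E"
   "L2_norm (%(x, v). jbracket v * mu (x, v)) + Linf_norm (%(x, v). jbracket v ^ 4 * mu (x, v))
   + Linf_norm (%(x, v). jbracket v * grad_norm 1 mu (x, v)) + Linf_norm (%(x, v). (jbracket v)^2 * grad_norm 2 mu (x, v))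
   + W_inf_norm 3 E <= ereal (e / 64)"
 shows "datum lam E e mu"
proof -
 define ep where "ep = e / 64"
 have ep: "ep > 0" "e = 64 * ep" using e by (auto simp: ep_def)
 note s = ereal_sum_le[OF H(5)[folded ep_def] L2_nonneg Linf_nonneg Linf_nonneg Linf_nonneg]
 have W0: "0 <= W_inf_norm 3 E" unfolding W_inf_norm_def by (intro sum_nonneg Linf_nonneg)
 have "continuous_on UNIV (%q. abs (jbracket (snd q) ^ 4 * mu q))" using H(1) by (intro continuous_intros jbracket_cont)
 moreover have "AE q in lborel. abs (jbracket (snd q) ^ 4 * mu q) <= ep" using Linf_AE[OF s(2)[OF W0]] by (simp add: split_def)
 ultimately have j4: "abs (jbracket (snd q) ^ 4 * mu q) <= ep" for q by (rule continuous_AE_le)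
 have dec: "abs (mu q) <= 4 * ep / (1 + norm (snd q)) ^ 4" for q
 proof -
  have "(1 + norm (snd q)) ^ 4 * abs (mu q) <= 4 * jbracket (snd q) ^ 4 * abs (mu q)" using jbracket_ge(3) by (intro mult_right_mono) auto
  also have "... <= 4 * ep" using j4[of q] by (simp add: abs_mult)
  finally show ?thesis using zero_less_power[OF one_norm_pos[of "snd q"], of 4] by (simp add: pos_le_divide_eq mult.commute)
 qed
 have dec4: "abs (mu q) <= 4 * ep" for q
 proof -
  have "4 * ep / (1 + norm (snd q)) ^ 4 <= 4 * ep / 1" using ep by (intro divide_left_mono) (auto simp: one_le_power zero_less_power one_norm_pos less_imp_neq[OF one_norm_pos, symmetric])
  then show ?thesis using dec[of q] by simp
 qed
 have wm: "(NN q. ennreal (((1 + norm (snd q)) * mu q)^2)) <= ennreal (2 * ep^2)"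
 proof -
  have m: "(%q. jbracket (snd q) * mu q) : bmeas" and i: "(NN q. ennreal ((jbracket (snd q) * mu q)^2)) <= ennreal (ep^2)"
   using L2_D[OF s(1)[OF W0]] by (simp_all add: split_def)
  have "(NN q. ennreal (((1 + norm (snd q)) * mu q)^2)) <= (NN q. ennreal 2 * ennreal ((jbracket (snd q) * mu q)^2))"
  proof (rule nn_integral_mono)
   fix q
   have "(1 + norm (snd q))^2 * (mu q)^2 <= 2 * (jbracket (snd q))^2 * (mu q)^2" using jbracket_ge(2) by (intro mult_right_mono) auto
   then show "ennreal (((1 + norm (snd q)) * mu q)^2) <= ennreal 2 * ennreal ((jbracket (snd q) * mu q)^2)"
    by (subst ennreal_mult[symmetric]) (auto simp: power_mult_distrib intro!: ennreal_leI)
  qed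
  also have "... = ennreal 2 * (NN q. ennreal ((jbracket (snd q) * mu q)^2))" using borel_measurable_power[OF m, of 2] by (intro nn_integral_cmult) simp
  also have "... <= ennreal 2 * ennreal (ep^2)" using i by (intro mult_left_mono) auto
  finally show ?thesis by (simp add: ennreal_mult)
 qed
 have EN: "E y = (1 / (2 * pi)) *R (LBINT p. (mu p)^2 *R Kn (y - fst p))" for y by (simp add: H(3) efield_def efield_Kn)
 have w1: "wlip (64 * ep) mu"
 proof (rule wlip_of_weak[OF H(1)])
  fix b :: "phase" assume b: "b : Basis"
  have "ALL b bs. set (b # bs) <= Basis & length (b # bs) <= 2 --> has_weak_deriv (weak_deriv bs mu) b (weak_deriv (b # bs) mu)" using H(2) unfolding W_inf_def by blast
  from this[rule_format, of b "[]"] show "has_weak_deriv mu b (weak_deriv [b] mu)" using b by simp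
  have "AE q in lborel. abs (jbracket (snd q) * grad_norm 1 mu q) <= ep" using Linf_AE[OF s(3)[OF W0]] by (simp add: split_def)
  then show "AE q in lborel. norm (weak_deriv [b] mu q) <= 2 * ep / (1 + norm (snd q))"
  proof eventually_elim
   case (elim q)
   have "norm (weak_deriv [b] mu q) <= grad_norm 1 mu q" by (rule weak_le_grad) (use b in auto)
   then have "(1 + norm (snd q)) * norm (weak_deriv [b] mu q) <= 2 * jbracket (snd q) * grad_norm 1 mu q"
    using jbracket_ge(1)[of "snd q"] jbracket_ge(4)[of "snd q"] by (intro mult_mono) auto
   moreover have "jbracket (snd q) * grad_norm 1 mu q <= ep" using elim by linarith
   ultimately show ?case using one_norm_pos[of "snd q"] by (simp add: pos_le_divide_eq mult_ac del: weak_deriv.simps)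
  qed
 qed (use ep dec4 in auto)
 have mui: "integrable lborel (%p. (mu p)^2)"
 proof (rule integrable_sq_of_nn[OF borel_measurable_continuous_onI[OF H(1)]])
  have "(NN p. ennreal ((mu p)^2)) <= (NN q. ennreal (((1 + norm (snd q)) * mu q)^2))"
  proof (intro nn_integral_mono ennreal_leI)
   fix q
   have "1 * (mu q)^2 <= (1 + norm (snd q))^2 * (mu q)^2" by (intro mult_right_mono) (auto simp: one_le_power)
   then show "(mu q)^2 <= ((1 + norm (snd q)) * mu q)^2" by (simp add: power_mult_distrib)
  qed
  then show "(NN p. ennreal ((mu p)^2)) <= ennreal (2 * ep^2)" using wm by (rule order_trans)
 qed
 have Ec: "continuous_on UNIV E"
 proof -
  have "continuous_on UNIV (%y. LBINT p. (mu p)^2 *R Kn (y - fst p))"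
  proof (rule field_continuous[OF mui, where ?c0.0="%_. 0"])
   fix z c
   have "abs ((mu (z, c))^2 - 0^2) <= 4 * ep * (4 * ep / (1 + norm c) ^ 3)"
   proof (rule sq_diff_le)
    have "4 * ep / (1 + norm c) ^ 4 <= 4 * ep / (1 + norm c) ^ 3"
     using ep by (intro divide_left_mono power_increasing mult_pos_pos zero_less_power one_norm_pos) auto
    then show "abs (mu (z, c)) + abs 0 <= 4 * ep / (1 + norm c) ^ 3" using dec[of "(z, c)"] by simp
   qed (use dec4 ep in auto)
   then show "abs ((mu (z, c))^2) <= (16 * ep^2) / (1 + norm (c - 0)) ^ 3" by (simp add: power2_eq_square)
  qed auto
  then show ?thesis unfolding EN by (intro continuous_intros)
 qed
 have wE: "has_weak_deriv (weak_deriv bs E) b (weak_deriv (b # bs) E)" if "set (b # bs) <= Basis" "length (b # bs) <= 3" for b bs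
  using H(4) that unfolding W_inf_def by blast
 have gE: "AE y in lborel. norm (weak_deriv bs E y) <= ep" if "set bs <= Basis" "length bs <= 3" for bs
 proof -
  have "Linf_norm (grad_norm (length bs) E) <= W_inf_norm 3 E" unfolding W_inf_norm_def
   using sum_mono2[of "{..3}" "{length bs}" "%j. Linf_norm (grad_norm j E)"] that(2) by (simp add: Linf_nonneg)
  also have "... <= ereal ep" by (rule s(4)[OF W0])
  finally have "AE y in lborel. abs (grad_norm (length bs) E y) <= ep" by (rule Linf_AE)
  then show ?thesis
  proof eventually_elim
   case (elim y)
   then show ?case using weak_le_grad[OF that(1) refl, of E y] by linarith
  qed
 qed
 have gE1: "AE y in lborel. norm (y - p) < rh --> norm (weak_deriv [b] E y) <= ep" if "b : Basis" for b p rh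
  by (rule AE_mp[OF gE[of "[b]"]]) (use that in auto)
 show ?thesis
 proof (intro datum.intro asym.intro datum_axioms.intro nice_axioms.intro)
  show "abs lam = 1" using lam by auto
  show "norm (E x) <= e" for x
  proof -
   have "norm (E x) <= ep" by (rule continuous_AE_le[of "%x. norm (E x)"]) (use Ec gE[of "[]"] in \<open>auto intro!: continuous_intros\<close>)
   then show ?thesis using ep by simp
  qed
  show "norm (E x - E y) <= e * norm (x - y)" for x y
  proof -
   have "norm (E (y + (x - y)) - E y) <= ep * (DIM(plane) * norm (x - y))"
    by (rule lip_of_weak[OF Ec, where g="%b. weak_deriv [b] E" and rh="3 * norm (x - y) + 1"])
     (use wE[of _ "[]"] gE1 ep in \<open>auto simp: add_nonneg_pos simp del: weak_deriv.simps(2)\<close>)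
   also have "... <= e * norm (x - y)" using ep by simp
   finally show ?thesis by simp
  qed
  show "norm (E (x + h + k) - E (x + h) - E (x + k) + E x) <= e * norm h * norm k" for x h k
  proof -
   have "norm (E (x + h + k) - E (x + h) - E (x + k) + E x) <= ep * (DIM(plane))^2 * norm h * norm k"
    by (rule second_of_weak[OF Ec, where g="%b. weak_deriv [b] E" and k="%b b'. weak_deriv [b', b] E"])
     (use wE[of _ "[]"] wE[of _ "[_]"] gE[of "[_, _]"] ep in \<open>auto simp del: weak_deriv.simps(2)\<close>)
   also have "... <= e * norm h * norm k" using ep by (intro mult_right_mono) auto
   finally show ?thesis .
  qed
  show "abs (mu q) <= e / (1 + norm (snd q)) ^ 4" for q
  proof -
   have "4 * ep / (1 + norm (snd q)) ^ 4 <= e / (1 + norm (snd q)) ^ 4" using ep by (intro divide_right_mono) auto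
   then show ?thesis using dec[of q] by linarith
  qed
  show "wlip e mu" using w1 ep by simp
  have "ennreal (2 * ep^2) <= ennreal (e^2)" using ep by (intro ennreal_leI) (simp add: power_mult_distrib)
  then show "(NN q. ennreal (((1 + norm (snd q)) * mu q)^2)) <= ennreal (e^2)" using wm by (rule order_trans[rotated])
 qed (use e EN in auto)
qed

section \<open>Strong solutions in profile coordinates\<close>

text \<open>The map from (a, c) to (X, V), with \<open>cf\<close> as its inverse. Its coefficient
  matrix has determinant exp (-t) (cosh t + sinh t) = 1.\<close>

definition ph :: "real => phase => phase" where
 "ph t p = (cosh t *R fst p + (- exp (- t)) *R snd p, sinh t *R fst p + exp (- t) *R snd p)"

definition cf :: "real => phase => phase" where
 "cf t p = (exp (- t) *R fst p + exp (- t) *R snd p, (- sinh t) *R fst p + cosh t *R snd p)"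

lemma exp_cosh_sinh: "exp (- t) * cosh t + exp (- t) * sinh t = (1::real)"
 by (simp add: cosh_def sinh_def exp_add[symmetric] field_simps)

lemma ph_cf [simp]: "ph t (cf t p) = p"
proof -
 have 1: "exp (- t) * cosh t + exp (- t) * sinh t = 1" by (rule exp_cosh_sinh)
 have "cosh t *R (exp (- t) *R x + exp (- t) *R v) + (- exp (- t)) *R ((- sinh t) *R x + cosh t *R v) = (exp (- t) * cosh t + exp (- t) * sinh t) *R x"
  "sinh t *R (exp (- t) *R x + exp (- t) *R v) + exp (- t) *R ((- sinh t) *R x + cosh t *R v) = (exp (- t) * cosh t + exp (- t) * sinh t) *R v"
  for x v :: plane by (simp_all add: algebra_simps)
 then show ?thesis unfolding 1 by (simp add: ph_def cf_def)
qed

lemma cf_ph [simp]: "cf t (ph t p) = p"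
proof -
 have 1: "exp (- t) * cosh t + exp (- t) * sinh t = 1" by (rule exp_cosh_sinh)
 have "exp (- t) *R (cosh t *R x + (- exp (- t)) *R v) + exp (- t) *R (sinh t *R x + exp (- t) *R v) = (exp (- t) * cosh t + exp (- t) * sinh t) *R x"
  "(- sinh t) *R (cosh t *R x + (- exp (- t)) *R v) + cosh t *R (sinh t *R x + exp (- t) *R v) = (exp (- t) * cosh t + exp (- t) * sinh t) *R v"
  for x v :: plane by (simp_all add: algebra_simps)
 then show ?thesis unfolding 1 by (simp add: ph_def cf_def)
qed

lemma fst_ph: "fst (ph t p) = cosh t *R zc t p"
 using kap_cosh[of t] by (simp add: ph_def zc_def scaleR_diff_right mult.commute)

text \<open>A coefficient matrix of determinant 1 is written as a product of three shears;
  \<open>dl\<close> and \<open>ga\<close> are the outer coefficients once the middle one is fixed as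
  - exp (-t).\<close>

lemma ph_pres: "lborel_pres (ph t)"
proof -
 define E where "E = exp (- t)"
 define dl where "dl = (1 - cosh t) / E"
 define ga where "ga = (1 - E) / E"
 have E: "E > 0" by (simp add: E_def)
 have L: "lborel_pres (%p::phase. (fst p, snd p + k *R fst p))" for k by (rule lborel_pres_shear_snd) measurable
 have U: "lborel_pres (%p::phase. (fst p + (- E) *R snd p, snd p))" by (rule lborel_pres_shear_fst) measurable
 have 1: "1 - E * dl = cosh t" "1 - E * ga = E" using E by (simp_all add: dl_def ga_def)
 have 2: "dl + ga * cosh t = sinh t" using exp_cosh_sinh[of t] E unfolding E_def[symmetric] dl_def ga_def by (simp add: field_simps)
 have "ph t p = (x + (- E) *R (v + dl *R x), v + dl *R x + ga *R (x + (- E) *R (v + dl *R x)))" if "p = (x, v)" for p x v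
 proof -
  have "x + (- E) *R (v + dl *R x) = (1 - E * dl) *R x + (- E) *R v" by (simp add: algebra_simps)
  moreover have "v + dl *R x + ga *R ((1 - E * dl) *R x + (- E) *R v) = (dl + ga * (1 - E * dl)) *R x + (1 - E * ga) *R v" by (simp add: algebra_simps)
  ultimately show ?thesis unfolding 1 2 by (simp add: ph_def that E_def)
 qed
 then have "ph t = (%p. (%p. (fst p, snd p + ga *R fst p)) ((%p. (fst p + (- E) *R snd p, snd p)) ((%p. (fst p, snd p + dl *R fst p)) p)))"
  by (auto intro!: ext)
 then show ?thesis using lborel_pres_comp[OF L lborel_pres_comp[OF U L]] by simp
qed

lemma ph_meas [measurable]: "ph t : bmeas" by (rule lborel_pres_measurable[OF ph_pres])

lemma loclip_proj: "loclip (%t. fst :: 'a::real_normed_vector \<times> 'b::real_normed_vector => 'a)"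
  "loclip (%t. snd :: 'a::real_normed_vector \<times> 'b::real_normed_vector => 'b)"
 by (rule loclip_const_time[where C=1], use norm_fst_snd in "metis mult_1 fst_diff snd_diff")+

lemma loclip_lin:
 assumes g: "loclip g"
  and d: "!!t. (a has_real_derivative a' t) (at t)" "continuous_on UNIV a'" "!!t. (b has_real_derivative b' t) (at t)" "continuous_on UNIV b'"
   "!!t. (c has_real_derivative c' t) (at t)" "continuous_on UNIV c'" "!!t. (d has_real_derivative d' t) (at t)" "continuous_on UNIV d'"
 shows "loclip (%t p. g t (a t *R fst p + b t *R snd (p :: phase), c t *R fst p + d t *R snd p))"
 by (intro loclip_compose[OF g] loclip_Pair loclip_add bounded_bilinear.loclip[OF bounded_bilinear_scaleR] loclip_proj
   loclip_time[OF d(1,2)] loclip_time[OF d(3,4)] loclip_time[OF d(5,6)] loclip_time[OF d(7,8)])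

lemma loclip_ph: assumes "loclip g" shows "loclip (%t p. g t (ph t p))"
 unfolding ph_def
 by (rule loclip_lin[OF assms, where a'=sinh and b'="%t. exp (- t)" and c'=cosh and d'="%t. - exp (- t)"])
  (auto intro!: derivative_eq_intros continuous_intros)

lemma loclip_cf: assumes "loclip g" shows "loclip (%t p. g t (cf t p))"
 unfolding cf_def
 by (rule loclip_lin[OF assms, where a'="%t. - exp (- t)" and b'="%t. - exp (- t)" and c'="%t. - cosh t" and d'=sinh])
  (auto intro!: derivative_eq_intros continuous_intros)

text \<open>With the ratio \<open>kap t\<close> the two contributions of f to X cancel, leaving X' =
  V, while V' receives X + f / cosh t. This is where the coordinates meet the physical
  equation.\<close>

lemma ph_curve:
 assumes w: "w = kap t"
 shows "((%h. ph (t + h) (p + h *R (w *R f, f))) has_vector_derivative (snd (ph t p), fst (ph t p) + (1 / cosh t) *R f)) (at 0)"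
proof -
 obtain a c where p: "p = (a, c)" by (cases p)
 have k: "cosh t * kap t = exp (- t)" using kap_cosh[of t] by (simp add: mult.commute)
 have c: "cosh t > 0" by simp
 have k2: "sinh t * kap t + exp (- t) = 1 / cosh t"
 proof -
  have "(sinh t * kap t + exp (- t)) * cosh t = exp (- t) * cosh t + exp (- t) * sinh t" using k by (simp add: algebra_simps)
  then have "(sinh t * kap t + exp (- t)) * cosh t = 1" unfolding exp_cosh_sinh .
  then show ?thesis using c by (simp add: field_simps)
 qed
 have 1: "((%h. cosh (t + h) *R (a + h *R w *R f) + (- exp (- (t + h))) *R (c + h *R f)) has_vector_derivative
   (sinh t *R a + exp (- t) *R c) + (cosh t * w - exp (- t)) *R f) (at 0)"
  by (auto intro!: derivative_eq_intros has_vector_derivative_add has_vector_derivative_scaleR simp: algebra_simps)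
 have 2: "((%h. sinh (t + h) *R (a + h *R w *R f) + exp (- (t + h)) *R (c + h *R f)) has_vector_derivative
   (cosh t *R a + (- exp (- t)) *R c) + (sinh t * w + exp (- t)) *R f) (at 0)"
  by (auto intro!: derivative_eq_intros has_vector_derivative_add has_vector_derivative_scaleR simp: algebra_simps)
 from has_vector_derivative_Pair[OF 1 2] show ?thesis unfolding w k k2 by (simp add: ph_def p)
qed

lemma ph5_pres: "lborel_pres (%q :: real \<times> phase. (fst q, ph (fst q) (snd q)))"
proof (rule lborel_presI)
 have "continuous_on UNIV (%q :: real \<times> phase. (fst q, ph (fst q) (snd q)))" unfolding ph_def by (intro continuous_intros)
 then show m [measurable]: "(%q :: real \<times> phase. (fst q, ph (fst q) (snd q))) : bmeas" by (rule borel_measurable_continuous_onI)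
 fix A :: "(real \<times> phase) set" assume A [measurable]: "A : sets borel"
 have "(NN q. indicator A (fst q, ph (fst q) (snd q))) = (NN t. NN p. indicator A (t, ph t p))"
  by (subst nn_integral_lborel_prod(1)) simp_all
 also have "... = (NN t. NN p. indicator A (t, p))"
 proof (rule nn_integral_cong)
  fix t :: real
  have "(%p. indicator A (t, p) :: ennreal) : bmeas" by (rule measurable_compose[OF borel_measurable_Pair]) simp_all
  from lborel_pres_nn_integral[OF ph_pres this] show "(NN p. indicator A (t, ph t p)) = (NN p. indicator A (t, p))" .
 qed
 also have "... = (NN q. indicator A q)" by (subst nn_integral_lborel_prod(1)[of "indicator A"]) simp_all
 finally show "(NN q. indicator A (fst q, ph (fst q) (snd q))) = emeasure lborel A" by simp
qed

text \<open>\<open>max 0\<close> extends the function to negative times, so that it is locally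
  Lipschitz on the whole space, as \<open>rademacher_local\<close> asks.\<close>

lemma loclip_pair:
 assumes u: "loclip (u :: real => phase => real)"
 shows "EX L>=0. ALL q q'. norm q <= R --> norm q' <= R --> abs (u (max 0 (fst q)) (snd q) - u (max 0 (fst q')) (snd q')) <= L * norm (q - q')"
proof -
 obtain L where L: "L >= 0" "!!t t' p p'. t : {0..max 0 R} ==> t' : {0..max 0 R} ==> norm p <= R ==> norm p' <= R ==>
   norm (u t p - u t' p') <= L * (abs (t - t') + norm (p - p'))" by (rule loclipE[OF u, of "max 0 R" R]) blast
 show ?thesis
 proof (intro exI[of _ "2 * L"] conjI allI impI)
  fix q q' :: "real \<times> phase" assume q: "norm q <= R" "norm q' <= R"
  have f: "abs (fst x) <= norm x" "norm (snd x) <= norm x" for x :: "real \<times> phase"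
   using norm_fst_snd[of x] by simp_all
  have "abs (max 0 (fst q) - max 0 (fst q')) + norm (snd q - snd q') <= 2 * norm (q - q')"
   using f[of "q - q'"] by (simp add: max_def) linarith
  then have "L * (abs (max 0 (fst q) - max 0 (fst q')) + norm (snd q - snd q')) <= L * (2 * norm (q - q'))" using L(1) by (rule mult_left_mono)
  moreover have "abs (u (max 0 (fst q)) (snd q) - u (max 0 (fst q')) (snd q')) <= L * (abs (max 0 (fst q) - max 0 (fst q')) + norm (snd q - snd q'))"
   unfolding real_norm_def[symmetric] by (rule L(2)[simplified real_norm_def[symmetric]]) (use f[of q] f[of q'] q in "auto simp: max_def")
  ultimately show "abs (u (max 0 (fst q)) (snd q) - u (max 0 (fst q')) (snd q')) <= 2 * L * norm (q - q')" by simp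
 qed (use L in simp)
qed

lemma Kn_scale: "c > 0 ==> Kn (c *R x) = (1 / c) *R Kn x"
 by (simp add: Kn_def power_mult_distrib power2_eq_square)

lemma kernel_ph: "efield_kernel f (cosh t *R y) (ph t p) = (1 / cosh t) *R ((f (ph t p))^2 *R Kn (y - zc t p))"
 using Kn_scale[of "cosh t" "y - zc t p"] by (simp add: efield_Kn fst_ph scaleR_diff_right[symmetric])

lemma kernel_meas: "f : bmeas ==> efield_kernel f x : bmeas"
 unfolding efield_Kn by (intro borel_measurable_scaleR borel_measurable_power measurable_compose[OF _ Kn_meas] borel_measurable_diff borel_measurable_const fst_meas_plane)

lemma efield_ph:
 assumes f: "f : bmeas" and g: "!!p. g t p = f (ph t p)"
 shows "efield f (cosh t *R y) = (1 / cosh t) *R Nf g t y"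
  and "integrable lborel (%p. (g t p)^2 *R Kn (y - zc t p)) ==> integrable lborel (efield_kernel f (cosh t *R y))"
proof -
 note k = kernel_meas[OF f, of "cosh t *R y"]
 have "integral\<^sup>L lborel (efield_kernel f (cosh t *R y)) = (1 / cosh t) *R (LBINT p. (g t p)^2 *R Kn (y - zc t p))"
  using lborel_pres_integral[OF ph_pres[of t] k] by (simp only: kernel_ph integral_scaleR_right g)
 then show "efield f (cosh t *R y) = (1 / cosh t) *R Nf g t y" by (simp add: efield_def Nf_def)
 assume "integrable lborel (%p. (g t p)^2 *R Kn (y - zc t p))"
 from integrable_scaleR_right[OF this, of "1 / cosh t"] show "integrable lborel (efield_kernel f (cosh t *R y))"
  using lborel_pres_integrable[OF ph_pres[of t] k] by (simp only: kernel_ph g)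
qed

text \<open>A chain rule at a point of total differentiability: the Euler step, seen in physical
  variables, is a curve tangent to the characteristic direction. It translates between the equation
  and \<open>transported\<close>, in both directions.\<close>

lemma quotient_limit:
 assumes D: "((%(t, p). nu t p) has_derivative D) (at (t, ph t p))"
 shows "(%n. real (Suc n) * inc F (%t p. nu t (ph t p)) t p n) ---> D (1, snd (ph t p), fst (ph t p) + (1 / cosh t) *R F t (zc t p))"
proof -
 let ?d = "(1 :: real, snd (ph t p), fst (ph t p) + (1 / cosh t) *R F t (zc t p))"
 have "((%h. (t + h, ph (t + h) (p + h *R Wf F t p))) has_vector_derivative ?d) (at 0)"
 proof -
  have "((%h. t + h) has_vector_derivative 1) (at 0)"
   unfolding has_real_derivative_iff_has_vector_derivative[symmetric] by (auto intro!: derivative_eq_intros)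
  from has_vector_derivative_Pair[OF this ph_curve[OF refl, of t p "F t (zc t p)"]] show ?thesis by (simp add: Wf_def)
 qed
 then have "((%h. (t + h, ph (t + h) (p + h *R Wf F t p))) has_derivative (%h. h *R ?d)) (at 0)" by (simp add: has_vector_derivative_def)
 from has_derivative_compose[OF this, of "%(t, p). nu t p" D] D
 have "((%h. nu (t + h) (ph (t + h) (p + h *R Wf F t p))) has_derivative (%h. D (h *R ?d))) (at 0)" by simp
 then have "((%h. nu (t + h) (ph (t + h) (p + h *R Wf F t p))) has_real_derivative D ?d) (at 0)"
  by (rule has_derivative_imp_has_field_derivative) (simp add: linear_scale[OF has_derivative_linear[OF D]] del: scaleR_Pair)
 then have "((%h. (nu (t + h) (ph (t + h) (p + h *R Wf F t p)) - nu t (ph t p)) / h) \<longlongrightarrow> D ?d) (at 0)" by (simp add: DERIV_def)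
 then have "(%n. (nu (t + 1 / Suc n) (ph (t + 1 / Suc n) (p + (1 / Suc n) *R Wf F t p)) - nu t (ph t p)) / (1 / Suc n)) ---> D ?d"
  by (rule filterlim_compose) (use LIMSEQ_Suc[OF lim_1_over_n] in "auto simp: filterlim_at simp del: of_nat_Suc")
 then show ?thesis by (simp add: mult.commute del: of_nat_Suc)
qed

lemma D_split:
 fixes D :: "real \<times> phase => real"
 assumes "linear D"
 shows "D (1, v, x + lam *R w) = D (1, 0, 0) + D (0, v, 0) + D (0, 0, x) + lam * D (0, 0, w)"
proof -
 have "(1, v, x + lam *R w) = (1, 0, 0) + (0, v, 0) + (0, 0, x) + lam *R (0 :: real, 0 :: plane, w)" by simp
 then show ?thesis by (simp only: linear_add[OF assms] linear_scale[OF assms] real_scaleR_def)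
qed

context asym
begin

text \<open>The curves start from position x - v and velocity v, so their sum is x and the field is
  evaluated at x; in (a, c) they become a = x, c = v + lam t E(x).\<close>

lemma profile_eq: "profile lam E nu t q = nu t (ph t (asy t q))"
proof -
 obtain x v where q: "q = (x, v)" by (cases q)
 have e: "exp (- t) = cosh t - sinh t" by (simp add: cosh_def sinh_def field_simps)
 show ?thesis by (simp add: profile_def curve_X_def curve_V_def ph_def asy_def q e algebra_simps)
qed

lemma pdec_of_profile:
 assumes g: "!!t q. t >= 0 ==> abs (g t (asy t q)) <= A / (1 + norm (snd q)) ^ 4" and A: "A >= 0"
 shows "pdec A g"
 unfolding pdec_def
proof (intro conjI allI impI A)
 fix t p assume "(t::real) >= 0"
 from g[OF this, of "(fst p, vel t p)"] show "abs (g t p) <= A / (1 + norm (vel t p)) ^ 4" by simp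
qed

end

abbreviation solves_at where "solves_at lam nu t x v \<equiv>
 EX D. ((%(t, p). nu t p) has_derivative D) (at (t, x, v)) & D (1, 0, 0) + D (0, v, 0) + D (0, 0, x) + lam * D (0, 0, efield (nu t) x) = 0"

context asym
begin

lemma asy_cont: "continuous_on A (asy t)"
 unfolding asy_def by (intro continuous_intros continuous_on_compose2[OF E_cont[of UNIV]]) auto

lemma vel_meas [measurable]: "vel t : bmeas" unfolding vel_def[abs_def] by measurable

text \<open>Truncation at radius 1: the bounded part is controlled by the mass, the singular part by
  the velocity decay, with 4096 = 512 * 8.\<close>

lemma Nf_field:
 assumes t: "t >= 0" and dec: "pdec A g" and gi: "integrable lborel (%p. (g t p)^2)" and m: "(LBINT p. (g t p)^2) <= m"
 shows "continuous_on UNIV (Nf g t)" "norm (Nf g t y) <= m + 4096 * A^2"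
proof -
 define f where "f = (%p. (g t (unz t p))^2)"
 have gm: "(%p. (g t p)^2) : bmeas" using gi by auto
 have fi: "integrable lborel f" unfolding f_def using lborel_pres_integrable[OF unz_pres gm] gi by simp
 have fm: "(LBINT p. f p) <= m" unfolding f_def using lborel_pres_integral[OF unz_pres gm] m by simp
 have fb: "abs (f (z, c)) <= (8 * A^2) / (1 + norm (c - (lam * t) *R E z)) ^ 3" for z c
  unfolding f_def by (rule vel_density[OF t pdec_sq[OF dec t]]) simp
 have N: "Nf g t y = (1 / (2 * pi)) *R (LBINT p. f p *R Kn (y - fst p))" for y
  using lborel_pres_integral[OF unz_pres[of t], of "%p. (g t p)^2 *R Kn (y - zc t p)"] gm by (simp add: Nf_def f_def)
 show "continuous_on UNIV (Nf g t)" unfolding N[abs_def]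
  by (intro continuous_intros field_continuous[OF fi _ fb]) (auto simp: f_def)
 have ki: "integrable lborel (%p. f p *R Kr 1 (y - fst p))" by (rule integrable_bounded_mult[OF fi]) (measurable, rule Kr_bound, simp)
 have "norm (LBINT p. f p *R Kr 1 (y - fst p)) <= (LBINT p. f p)"
 proof (rule Bochner_Integration.integral_norm_bound_integral[OF ki fi])
  fix p
  show "norm (f p *R Kr 1 (y - fst p)) <= f p" using mult_left_mono[OF Kr_bound[of 1 "y - fst p"], of "f p"] by (simp add: f_def)
 qed
 moreover have "norm ((LBINT p. f p *R Kn (y - fst p)) - (LBINT p. f p *R Kr 1 (y - fst p))) <= 512 * 1 * (8 * A^2)"
  by (rule Kn_density(2)[OF fi fb]) auto
 moreover have "norm (LBINT p. f p *R Kn (y - fst p)) <= norm (LBINT p. f p *R Kr 1 (y - fst p)) + norm ((LBINT p. f p *R Kn (y - fst p)) - (LBINT p. f p *R Kr 1 (y - fst p)))"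
  using norm_triangle_sub by blast
 ultimately have "norm (LBINT p. f p *R Kn (y - fst p)) <= m + 4096 * A^2" using fm by linarith
 then show "norm (Nf g t y) <= m + 4096 * A^2" unfolding N using pi_le order_trans by blast
qed

end

section \<open>Strong solutions and transported profiles\<close>

context datum
begin

text \<open>Pulling the a.e. equation back by the measure-preserving map of space-time gives
  \<open>transported\<close>, and a.e. bounds on the profile hold everywhere by continuity.
  \<open>A\<close> and \<open>m\<close> include the constants of the datum, because
  \<open>wsol\<close> uses one pair of constants for the solution and its final state.\<close>

lemma wsol_of_strong:
 assumes st: "global_strong_solution lam nu" and bp: "bounded_profile lam E nu" and sc: "scatters_to lam E nu mu"
 defines "g \<equiv> %t p. nu t (ph t p)"
 shows "EX M A m. wsol lam E e (%t y. lam *R Nf g (max 0 t) y) g M A m mu"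
proof -
 have ndec: "abs (mu q) <= e / (1 + norm (snd q)) ^ 4" and nw: "wlip e mu" and nwm: "(NN q. ennreal (((1 + norm (snd q)) * mu q)^2)) <= ennreal (e^2)"
  and nE: "E y = (1 / (2 * pi)) *R (LBINT p. (mu p)^2 *R Kn (y - fst p))" for q y
  using na unfolding nice_axioms_def by blast+
 have nul: "loclip nu" unfolding loclip_def using st by (simp add: global_strong_solution_def)
 have gl: "loclip g" unfolding g_def by (rule loclip_ph[OF nul])
 have gm: "g t : bmeas" if "t >= 0" for t by (rule loclip_meas[OF gl that])
 obtain C where C: "!!t. t >= 0 ==> L2_norm (%(x, v). jbracket v * profile lam E nu t (x, v)) <= ereal C"
  "!!t. t >= 0 ==> Linf_norm (%(x, v). jbracket v ^ 4 * profile lam E nu t (x, v)) <= ereal C" using bp unfolding bounded_profile_def by blast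
 have pr: "profile lam E nu t q = g t (asy t q)" for t q by (simp add: profile_eq g_def)
 have C0: "C >= 0" using order_trans[OF Linf_nonneg C(2)[of 0]] by simp
 have j4: "abs (jbracket (snd q) ^ 4 * g t (asy t q)) <= C" if t: "t >= 0" for t q
 proof (rule continuous_AE_le[of "%q. abs (jbracket (snd q) ^ 4 * g t (asy t q))"])
  show "continuous_on UNIV (%q. abs (jbracket (snd q) ^ 4 * g t (asy t q)))"
   by (intro continuous_intros jbracket_cont continuous_on_compose2[OF loclip_cont[OF gl t] asy_cont]) auto
  show "AE q in lborel. abs (jbracket (snd q) ^ 4 * g t (asy t q)) <= C" using Linf_AE[OF C(2)[OF t]] by (simp add: split_def pr)
 qed
 define A where "A = 4 * C + e"
 define m where "m = 2 * C^2 + e^2"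
 have A: "A >= 0" "4 * C <= A" "e <= A" using C0 e0 by (auto simp: A_def)
 have m: "m >= 0" "e^2 <= m" "2 * C^2 <= m" by (auto simp: m_def)
 have dec: "pdec A g"
 proof (rule pdec_of_profile[OF _ A(1)])
  fix t q assume t: "(t::real) >= 0"
  have "(1 + norm (snd q)) ^ 4 * abs (g t (asy t q)) <= 4 * jbracket (snd q) ^ 4 * abs (g t (asy t q))" using jbracket_ge(3) by (intro mult_right_mono) auto
  also have "... <= A" using j4[OF t, of q] A(2) by (simp add: abs_mult)
  finally show "abs (g t (asy t q)) <= A / (1 + norm (snd q)) ^ 4" using zero_less_power[OF one_norm_pos[of "snd q"], of 4] by (simp add: pos_le_divide_eq mult.commute)
 qed
 have wm: "(NN p. ennreal (((1 + norm (vel t p)) * g t p)^2)) <= ennreal m" if t: "t >= 0" for t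
 proof -
  note [measurable] = gm[OF t]
  have mm: "(%p. ennreal (((1 + norm (vel t p)) * g t p)^2)) : bmeas" by measurable
  have L: "(%q. jbracket (snd q) * g t (asy t q)) : bmeas" "(NN q. ennreal ((jbracket (snd q) * g t (asy t q))^2)) <= ennreal (C^2)"
   using L2_D[OF C(1)[OF t]] by (simp_all add: split_def pr)
  have "(NN p. ennreal (((1 + norm (vel t p)) * g t p)^2)) = (NN q. ennreal (((1 + norm (snd q)) * g t (asy t q))^2))"
   using lborel_pres_nn_integral[OF asy_pres[of t] mm] by simp
  also have "... <= (NN q. ennreal 2 * ennreal ((jbracket (snd q) * g t (asy t q))^2))"
  proof (rule nn_integral_mono)
   fix q
   have "(1 + norm (snd q))^2 * (g t (asy t q))^2 <= 2 * (jbracket (snd q))^2 * (g t (asy t q))^2" using jbracket_ge(2) by (intro mult_right_mono) auto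
   then show "ennreal (((1 + norm (snd q)) * g t (asy t q))^2) <= ennreal 2 * ennreal ((jbracket (snd q) * g t (asy t q))^2)"
    by (subst ennreal_mult[symmetric]) (auto simp: power_mult_distrib intro!: ennreal_leI)
  qed
  also have "... = ennreal 2 * (NN q. ennreal ((jbracket (snd q) * g t (asy t q))^2))" using borel_measurable_power[OF L(1), of 2] by (intro nn_integral_cmult) simp
  also have "... <= ennreal 2 * ennreal (C^2)" using L(2) by (intro mult_left_mono) auto
  also have "... = ennreal (2 * C^2)" by (simp add: ennreal_mult)
  also have "... <= ennreal m" by (rule ennreal_leI[OF m(3)])
  finally show ?thesis .
 qed
 have mass: "(NN p. ennreal ((g t p)^2)) <= ennreal m" if "t >= 0" for t
  by (rule order_trans[OF nn_integral_mono wm[OF that]]) (intro ennreal_leI weight_ge)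
 have gi: "integrable lborel (%p. (g t p)^2)" if "t >= 0" for t by (rule integrable_sq_of_nn[OF gm[OF that] mass[OF that]])
 have gle: "(LBINT p. (g t p)^2) <= m" if "t >= 0" for t using mass[OF that] m by (simp add: nn_integral_eq_integral[OF gi[OF that]])
 define F2 where "F2 = (%t y. lam *R Nf g (max 0 t) y)"
 have nN: "norm (lam *R x) = norm x" for x :: plane using lam by simp
 have fb: "fieldbd F2 (m + 4096 * A^2)"
  unfolding fieldbd_def F2_def
 proof (intro conjI allI impI)
  fix t show "(%y. lam *R Nf g (max 0 t) y) : bmeas"
   by (intro borel_measurable_continuous_onI continuous_intros Nf_field(1)[OF _ dec gi gle]) auto
 next
  fix t y show "norm (lam *R Nf g (max 0 t) y) <= m + 4096 * A^2" unfolding nN by (intro Nf_field(2)[OF _ dec gi gle]) auto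
 qed
 have tr: "transported F2 g"
  unfolding transported_def
 proof (intro conjI gl)
  have "AE q in lborel. case q of (t, x, v) => t > 0 -->
    solves_at lam nu t x v"
   using st unfolding global_strong_solution_def by blast
  from lborel_pres_AE[OF ph5_pres this]
  show "AE q in lborel. case q of (t, p) => 0 < t --> rate_le 0 (%n. abs (inc F2 g t p n))"
  proof (rule AE_mp, intro AE_I2 impI)
   fix q :: "real \<times> phase"
   assume h: "case (fst q, ph (fst q) (snd q)) of (t, x, v) => t > 0 -->
    solves_at lam nu t x v"
   obtain t p where q: "q = (t, p)" by (cases q)
   show "case q of (t, p) => 0 < t --> rate_le 0 (%n. abs (inc F2 g t p n))"
    unfolding q prod.case
   proof (rule impI)
    assume t: "t > 0"
    then obtain D where D: "((%(t, p). nu t p) has_derivative D) (at (t, ph t p))"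
     "D (1, 0, 0) + D (0, snd (ph t p), 0) + D (0, 0, fst (ph t p)) + lam * D (0, 0, efield (nu t) (fst (ph t p))) = 0"
    proof -
     obtain x v where xv: "ph t p = (x, v)" by (cases "ph t p")
     from h t have "solves_at lam nu t x v"
      by (simp only: q xv fst_conv snd_conv prod.case)
     then show thesis using that unfolding xv by auto
    qed
    have num: "nu t : bmeas" by (rule loclip_meas[OF nul]) (use t in simp)
    have "(1 / cosh t) *R F2 t (zc t p) = lam *R efield (nu t) (fst (ph t p))"
     using t efield_ph(1)[where g=g, OF num, of t "zc t p"] by (simp add: F2_def g_def fst_ph)
    then show "rate_le 0 (%n. abs (inc F2 g t p n))"
     unfolding rate_0_iff using quotient_limit[OF D(1), of F2] D(2) by (simp add: D_split[OF has_derivative_linear[OF D(1)]] g_def del: of_nat_Suc)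
   qed
  qed
 qed
 have conv: "(%n. fin g n p) ---> mu p" for p
 proof -
  have "((%t. profile lam E nu t p) \<longlongrightarrow> mu p) at_top"
   using sc tendsto_uniform_limitI[where S="{p}"] unfolding scatters_to_def by (metis compact_insert compact_empty singletonI)
  from filterlim_compose[OF this filterlim_real_sequentially] show ?thesis by (simp add: pr)
 qed
 have "wsol lam E e F2 g (m + 4096 * A^2) A m mu"
 proof (intro wsol.intro sol.intro sol_axioms.intro wsol_axioms.intro fb tr dec mass m wm conv nE)
  show "asym lam E e" by unfold_locales
  show "mu : bmeas" by (rule borel_measurable_continuous_onI[OF wlip_cont[OF nw]])
  show "(NN p. ennreal ((mu p)^2)) <= ennreal m"
   by (rule order_trans[OF nn_integral_mono order_trans[OF nwm ennreal_leI[OF m(2)]]]) (intro ennreal_leI weight_ge)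
  show "abs (mu p) <= A / (1 + norm (snd p)) ^ 4" for p
   by (rule order_trans[OF ndec divide_right_mono[OF A(3)]]) simp
 qed
 then show ?thesis unfolding F2_def by blast
qed

text \<open>The solution is locally Lipschitz, so a total derivative exists a.e.; there
  \<open>quotient_limit\<close> identifies the expression in the equation with the limit of
  quotients along Euler steps, which vanishes because \<open>G\<close> is constant along the
  flow.\<close>

lemma strong_of_nice:
 assumes n: "nice lam E e F mu" and F: "!!t y. t >= 0 ==> F t y = lam *R Nf (GF F) t y"
 defines "nu \<equiv> %t P. GF F (max 0 t) (cf (max 0 t) P)"
 shows "global_strong_solution lam nu" "bounded_profile lam E nu" "scatters_to lam E nu mu"
proof -
 interpret n: nice lam E e F mu by (rule n)
 have G: "nu t (ph t p) = n.G t p" if "t >= 0" for t p using that by (simp add: nu_def)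
 define u where "u = (%t p. n.G t (cf t p))"
 have ul: "loclip u" unfolding u_def by (rule loclip_cf[OF n.ws.gl])
 have nuu: "nu t p = u (max 0 t) p" for t p by (simp add: nu_def u_def)
 have num: "nu t : bmeas" for t unfolding nuu[abs_def] by (rule loclip_meas[OF ul]) simp
 have nulip: "EX L>=0. ALL q q'. norm q <= R --> norm q' <= R --> abs (nu (fst q) (snd q) - nu (fst q') (snd q')) <= L * norm (q - q')" for R
  unfolding nuu by (rule loclip_pair[OF ul])
 have pr: "profile lam E nu t q = n.G t (asy t q)" if "t >= 0" for t q using that by (simp add: profile_eq G)
 show "global_strong_solution lam nu"
  unfolding global_strong_solution_def
 proof (intro conjI allI impI)
  fix K :: "(real \<times> phase) set" assume K: "compact K & K <= {0..} \<times> UNIV"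
  then obtain L where L: "L-lipschitz_on K (%(t, p). u t p)" using ul unfolding loclip_def by blast
  have "L-lipschitz_on K (%(t, p). nu t p)"
   by (rule lipschitz_on_transform[OF L]) (use K in \<open>auto simp: nuu max_def\<close>)
  then show "EX L. L-lipschitz_on K (%(t, p). nu t p)" ..
 next
  fix t :: real assume t: "t >= 0"
  note [measurable] = num
  have "(%p. (nu t p)^2) : bmeas" by measurable
  from lborel_pres_integrable[OF ph_pres[of t] this] show "integrable lborel (%p. (nu t p)^2)" using n.ws.gint[OF t] by (simp add: G[OF t])
  fix x
  have "integrable lborel (efield_kernel (nu t) (cosh t *R ((1 / cosh t) *R x)))"
   by (rule efield_ph(2)[where g=n.G and t=t, OF num G[OF t, symmetric] n.ws.N_int[OF t]])
  then show "integrable lborel (efield_kernel (nu t) x)" by simp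
 next
  have "AE q in lborel. (%q. nu (fst q) (snd q)) differentiable (at q)"
   by (rule rademacher_local) (use nulip in blast)
  then show "AE q in lborel. case q of (t, x, v) => t > 0 -->
   solves_at lam nu t x v"
  proof (rule AE_mp, intro AE_I2 impI)
   fix q :: "real \<times> phase" assume d: "(%q. nu (fst q) (snd q)) differentiable (at q)"
   obtain t x v where q: "q = (t, x, v)" by (cases q)
   show "case q of (t, x, v) => t > 0 -->
    solves_at lam nu t x v"
    unfolding q prod.case
   proof (rule impI)
    assume t: "t > 0"
    then have t0: "t >= 0" by simp
    define p where "p = cf t (x, v)"
    have xv: "ph t p = (x, v)" by (simp add: p_def)
    obtain D where D: "((%(t, p). nu t p) has_derivative D) (at (t, ph t p))" using d unfolding differentiable_def q xv split_def by blast
    have "(%n. real (Suc n) * inc F (%t p. nu t (ph t p)) t p n) ---> 0"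
     using n.H_quot[OF n.muw t, of p] t unfolding rate_0_iff by (simp add: G n.G_def add_nonneg_nonneg del: of_nat_Suc)
    from LIMSEQ_unique[OF quotient_limit[OF D] this]
    have 0: "D (1, v, x + (1 / cosh t) *R F t (zc t p)) = 0" by (simp add: xv)
    have "fst (ph t p) = x" by (simp add: xv)
    then have "(1 / cosh t) *R F t (zc t p) = lam *R efield (nu t) x"
     using efield_ph(1)[where g=n.G and t=t and y="zc t p", OF num G[OF t0, symmetric]] F[OF t0] by (simp add: fst_ph)
    then show "solves_at lam nu t x v"
     using D 0 D_split[OF has_derivative_linear[OF D]] by (intro exI[of _ D]) (simp add: xv)
   qed
  qed
 qed
 show "bounded_profile lam E nu"
  unfolding bounded_profile_def
 proof (intro exI[of _ "84 * e"] allI impI conjI)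
  fix t :: real assume t: "t >= 0"
  have Gm: "(%q. n.G t (asy t q)) : bmeas" using measurable_compose[OF asy_meas n.ws.gm[OF t]] .
  have jm: "(%q :: phase. jbracket (snd q)) : bmeas" by (intro borel_measurable_continuous_onI jbracket_cont continuous_intros)
  have jl: "jbracket v <= 1 + norm v" for v :: plane
   unfolding jbracket_def by (rule real_le_lsqrt) (auto simp: power2_eq_square algebra_simps)
  have gd: "abs (n.G t (asy t q)) <= 81 * e / (1 + norm (snd q)) ^ 4" for q
   using n.G_pdec t unfolding pdec_def by (metis vel_asy)
  show "Linf_norm (%(x, v). jbracket v ^ 4 * profile lam E nu t (x, v)) <= ereal (84 * e)"
   unfolding Linf_norm_def
  proof (rule esssup_I)
   show "(%x. ereal (abs (case x of (x, v) => jbracket v ^ 4 * profile lam E nu t (x, v)))) : borel_measurable lborel"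
    using Gm jm by (simp add: split_def pr[OF t])
   show "AE x in lborel. ereal (abs (case x of (x, v) => jbracket v ^ 4 * profile lam E nu t (x, v))) <= ereal (84 * e)"
   proof (rule AE_I2)
    fix q :: "phase"
    have "jbracket (snd q) ^ 4 * abs (n.G t (asy t q)) <= (1 + norm (snd q)) ^ 4 * (81 * e / (1 + norm (snd q)) ^ 4)"
     using gd jl[of "snd q"] jbracket_ge(4)[of "snd q"] by (intro mult_mono power_mono) auto
    also have "... = 81 * e" using one_norm_pos[of "snd q"] by simp
    finally show "ereal (abs (case q of (x, v) => jbracket v ^ 4 * profile lam E nu t (x, v))) <= ereal (84 * e)"
     using e0 jbracket_ge(4)[of "snd q"] by (simp add: split_def pr[OF t] abs_mult)
   qed
  qed
  define f where "f = (%q. jbracket (snd q) * n.G t (asy t q))"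
  have fm: "f : bmeas" unfolding f_def by (rule borel_measurable_times[OF jm Gm])
  have "(NN q. ennreal ((f q)^2)) <= (NN q. ennreal (((1 + norm (vel t (asy t q))) * n.G t (asy t q))^2))"
  proof (intro nn_integral_mono ennreal_leI)
   fix q
   have "(jbracket (snd q))^2 * (n.G t (asy t q))^2 <= (1 + norm (snd q))^2 * (n.G t (asy t q))^2"
    using jl[of "snd q"] jbracket_ge(4)[of "snd q"] by (intro mult_right_mono power_mono) auto
   then show "(f q)^2 <= ((1 + norm (vel t (asy t q))) * n.G t (asy t q))^2" by (simp add: f_def power_mult_distrib)
  qed
  also have "... = (NN p. ennreal (((1 + norm (vel t p)) * n.G t p)^2))"
  proof (rule lborel_pres_nn_integral[OF asy_pres])
   note [measurable] = n.ws.gm[OF t]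
   show "(%p. ennreal (((1 + norm (vel t p)) * n.G t p)^2)) : bmeas" by measurable
  qed
  also have "... <= ennreal (9 * e^2)" by (rule n.G_wm[OF t])
  finally have f9: "(NN q. ennreal ((f q)^2)) <= ennreal (9 * e^2)" .
  have fi: "integrable lborel (%q. (f q)^2)" by (rule integrable_sq_of_nn[OF fm f9])
  have "(LBINT q. (f q)^2) <= 9 * e^2" using f9 by (simp add: nn_integral_eq_integral[OF fi])
  also have "... <= (84 * e)^2" by (simp add: power_mult_distrib)
  finally have "sqrt (LBINT q. (f q)^2) <= 84 * e" using e0 by (intro real_le_lsqrt) auto
  moreover have "(%(x, v). jbracket v * profile lam E nu t (x, v)) = f" by (auto simp: f_def pr[OF t])
  ultimately show "L2_norm (%(x, v). jbracket v * profile lam E nu t (x, v)) <= ereal (84 * e)" using fm fi by (simp add: L2_norm_def)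
 qed
 show "scatters_to lam E nu mu"
  unfolding scatters_to_def uniform_limit_iff
 proof (intro allI impI)
  fix K :: "(phase) set" and ep :: real assume ep: "ep > 0"
  \<comment> \<open>The bound does not depend on the point, so the convergence is uniform on all of
    phase space, hence on every set \<open>K\<close>.\<close>
  have "((%t. 34 * e * e * exp (- (t / 2))) \<longlongrightarrow> 34 * e * e * 0) at_top"
   by (intro tendsto_intros filterlim_compose[OF exp_at_bot] filterlim_compose[OF filterlim_uminus_at_bot_at_top] filterlim_tendsto_pos_mult_at_top[OF tendsto_const, of "1/2", simplified] filterlim_ident)
  then have "\<forall>\<^sub>F t in at_top. 34 * e * e * exp (- (t / 2)) < ep" using ep by (intro order_tendstoD(2)) auto
  then show "\<forall>\<^sub>F t in at_top. ALL q:K. dist (profile lam E nu t q) (mu q) < ep"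
   using eventually_ge_at_top[of 0]
  proof eventually_elim
   case (elim t)
   show ?case
   proof
    fix q
    have "abs (n.G t (asy t q) - mu q) <= 34 * e * e * exp (- (t / 2))" unfolding n.G_def by (rule n.H_conv[OF n.muw elim(2)])
    then show "dist (profile lam E nu t q) (mu q) < ep" using elim by (simp add: pr dist_real_def)
   qed
  qed
 qed
qed

end

theorem theorem1p3:
  fixes lam :: real
  assumes "lam \<in> {-1, 1}"
  shows "\<exists>\<epsilon>0>0. \<forall>(\<mu>inf :: plane \<times> plane \<Rightarrow> real) Einf.
    continuous_on UNIV \<mu>inf \<and> W_inf 2 \<mu>inf \<and> Einf = efield \<mu>inf \<and> W_inf 3 Einf \<and>
    L2_norm (\<lambda>(x, v). jbracket v * \<mu>inf (x, v))
      + Linf_norm (\<lambda>(x, v). jbracket v ^ 4 * \<mu>inf (x, v))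
      + Linf_norm (\<lambda>(x, v). jbracket v * grad_norm 1 \<mu>inf (x, v))
      + Linf_norm (\<lambda>(x, v). (jbracket v)\<^sup>2 * grad_norm 2 \<mu>inf (x, v))
      + W_inf_norm 3 Einf \<le> ereal \<epsilon>0
    \<longrightarrow> (\<exists>\<mu>. (global_strong_solution lam \<mu> \<and> bounded_profile lam Einf \<mu> \<and>
              scatters_to lam Einf \<mu> \<mu>inf) \<and>
           (\<forall>\<nu>. global_strong_solution lam \<nu> \<and> bounded_profile lam Einf \<nu> \<and>
                 scatters_to lam Einf \<nu> \<mu>inf
              \<longrightarrow> (\<forall>t\<ge>0. \<forall>p. \<nu> t p = \<mu> t p)))"
proof (intro exI[of _ "1 / 10 ^ 9 / 64"] conjI allI impI)
 fix muinf :: "phase => real" and Einf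
 assume H: "continuous_on UNIV muinf & W_inf 2 muinf & Einf = efield muinf & W_inf 3 Einf &
  L2_norm (%(x, v). jbracket v * muinf (x, v)) + Linf_norm (%(x, v). jbracket v ^ 4 * muinf (x, v))
   + Linf_norm (%(x, v). jbracket v * grad_norm 1 muinf (x, v)) + Linf_norm (%(x, v). (jbracket v)^2 * grad_norm 2 muinf (x, v))
   + W_inf_norm 3 Einf <= ereal (1 / 10 ^ 9 / 64)"
 \<comment> \<open>The witness is e / 64 with e = 10^-9: the threshold on \<open>e\<close> in
   \<open>asym\<close>, divided by the loss in \<open>datum_of_norms\<close>.\<close>
 interpret d: datum lam Einf "1 / 10 ^ 9" muinf by (rule datum_of_norms[OF assms]) (use H in auto)
 obtain F where F: "nice lam Einf (1 / 10 ^ 9) F muinf" "!!t y. t >= 0 ==> F t y = lam *R Nf (d.GF F) t y"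
  using d.selfconsistent_field by blast
 show "EX mu. (global_strong_solution lam mu & bounded_profile lam Einf mu & scatters_to lam Einf mu muinf) &
  (ALL nu. global_strong_solution lam nu & bounded_profile lam Einf nu & scatters_to lam Einf nu muinf --> (ALL t>=0. ALL p. nu t p = mu t p))"
 proof (intro exI[of _ "%t P. d.GF F (max 0 t) (cf (max 0 t) P)"] conjI allI impI d.strong_of_nice[OF F])
  fix nu t p assume nu: "global_strong_solution lam nu & bounded_profile lam Einf nu & scatters_to lam Einf nu muinf" and t: "(t::real) >= 0"
  define g where "g = (%t p. nu t (ph t p))"
  obtain M A m where w: "wsol lam Einf (1 / 10 ^ 9) (%t y. lam *R Nf g (max 0 t) y) g M A m muinf"
   using d.wsol_of_strong[of nu] nu unfolding g_def by blast
  have "g t (cf t p) = d.GF F t (cf t p)" by (rule d.unique_solution[OF F w _ t]) simp_all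
  then show "nu t p = d.GF F (max 0 t) (cf (max 0 t) p)" using t by (simp add: g_def)
 qed
qed simp

end
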